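(* Let $G$ be a discrete countable amenable residually finite group, let $(L_n)_{n\ge 1}$ be a separating nested sequence of finite index normal subgroups of $G$, let $\tilde{G}=\varprojlim G/L_n$ be the corresponding profinite completion, and let $\alpha$ be the action of $G$ on $C(\tilde{G})$ induced by left multiplication of $G$ on $\tilde{G}$. Then the crossed product C*-algebra $C(\tilde{G})\rtimes_\alpha G$ (a generalized Bunce--Deddens algebra) is unital, simple, separable and nuclear.
   Context: A group $G$ is residually finite if it has a separating family of finite index normal subgroups. A separating nested sequence of finite index normal subgroups is a decreasing sequence $L_1\supseteq L_2\supseteq\cdots$ of finite index normal subgroups of $G$ that separates the points of $G$, i.e. $\bigcap_n L_n=\{e\}$. The profinite completion of $G$ with respect to $(L_n)_n$ is the inverse limit $\tilde{G}$ of the finite discrete groups $G/L_n$ under the maps $G/L_m\to G/L_n$, $xL_m\mapsto xL_n$ ($n\le m$), i.e. the closed subgroup of $\prod_{n\ge1}G/L_n$ of all sequences $(x_nL_n)_n$ with $x_mL_n=x_nL_n$ whenever $n\le m$. The group $G$ is identified with a dense subgroup of $\tilde{G}$ via $g\mapsto (gL_n)_n$, and it acts on $\tilde{G}$ by left multiplication; the induced action on $C(\tilde{G})$ is $(\alpha(g)f)(x)=f(g^{-1}x)$. The generalized Bunce--Deddens algebras are the crossed products $C(\tilde{G})\rtimes_\alpha G$ arising in this way (since $G$ is amenable, the full and reduced crossed products coincide). *)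

theory Defs
  imports
    "HOL-Analysis.Analysis"
    "HOL-Algebra.Module"
    "HOL-Algebra.Product_Groups"
begin

section \<open>C*-algebras\<close>

text \<open>The slot \<open>one\<close> inherited from rings plays no role below: algebras need not be
  unital, and \<open>cstar_unital\<close> asks for the existence of a unit.\<close>

record 'a cstar = "(complex, 'a) module" +
  adj :: "'a \<Rightarrow> 'a"
  nrm :: "'a \<Rightarrow> real"

definition nrm_cauchy :: "('a, 'm) cstar_scheme \<Rightarrow> (nat \<Rightarrow> 'a) \<Rightarrow> bool" where
  "nrm_cauchy A s \<longleftrightarrow> (\<forall>n. s n \<in> carrier A) \<and>
     (\<forall>e>0. \<exists>N. \<forall>m\<ge>N. \<forall>n\<ge>N. nrm A (s m \<ominus>\<^bsub>A\<^esub> s n) < e)"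

definition nrm_tendsto :: "('a, 'm) cstar_scheme \<Rightarrow> (nat \<Rightarrow> 'a) \<Rightarrow> 'a \<Rightarrow> bool" where
  "nrm_tendsto A s a \<longleftrightarrow> (\<lambda>n. nrm A (s n \<ominus>\<^bsub>A\<^esub> a)) \<longlonglongrightarrow> 0"

locale cstar_algebra =
  fixes A :: "('a, 'm) cstar_scheme" (structure)
  assumes is_abelian_group: "abelian_group A"
    and smult_closed: "a \<in> carrier A \<Longrightarrow> z \<odot> a \<in> carrier A"
    and smult_add_left: "a \<in> carrier A \<Longrightarrow> (z + w) \<odot> a = z \<odot> a \<oplus> w \<odot> a"
    and smult_add_right: "\<lbrakk>a \<in> carrier A; b \<in> carrier A\<rbrakk> \<Longrightarrow> z \<odot> (a \<oplus> b) = z \<odot> a \<oplus> z \<odot> b"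
    and smult_smult: "a \<in> carrier A \<Longrightarrow> (z * w) \<odot> a = z \<odot> (w \<odot> a)"
    and smult_one: "a \<in> carrier A \<Longrightarrow> 1 \<odot> a = a"
    and mult_closed: "\<lbrakk>a \<in> carrier A; b \<in> carrier A\<rbrakk> \<Longrightarrow> a \<otimes> b \<in> carrier A"
    and mult_assoc: "\<lbrakk>a \<in> carrier A; b \<in> carrier A; c \<in> carrier A\<rbrakk> \<Longrightarrow> (a \<otimes> b) \<otimes> c = a \<otimes> (b \<otimes> c)"
    and distrib_right: "\<lbrakk>a \<in> carrier A; b \<in> carrier A; c \<in> carrier A\<rbrakk> \<Longrightarrow> (a \<oplus> b) \<otimes> c = a \<otimes> c \<oplus> b \<otimes> c"
    and distrib_left: "\<lbrakk>a \<in> carrier A; b \<in> carrier A; c \<in> carrier A\<rbrakk> \<Longrightarrow> a \<otimes> (b \<oplus> c) = a \<otimes> b \<oplus> a \<otimes> c"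
    and smult_mult_left: "\<lbrakk>a \<in> carrier A; b \<in> carrier A\<rbrakk> \<Longrightarrow> (z \<odot> a) \<otimes> b = z \<odot> (a \<otimes> b)"
    and smult_mult_right: "\<lbrakk>a \<in> carrier A; b \<in> carrier A\<rbrakk> \<Longrightarrow> a \<otimes> (z \<odot> b) = z \<odot> (a \<otimes> b)"
    and adj_closed: "a \<in> carrier A \<Longrightarrow> adj A a \<in> carrier A"
    and adj_adj: "a \<in> carrier A \<Longrightarrow> adj A (adj A a) = a"
    and adj_add: "\<lbrakk>a \<in> carrier A; b \<in> carrier A\<rbrakk> \<Longrightarrow> adj A (a \<oplus> b) = adj A a \<oplus> adj A b"
    and adj_smult: "a \<in> carrier A \<Longrightarrow> adj A (z \<odot> a) = cnj z \<odot> adj A a"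
    and adj_mult: "\<lbrakk>a \<in> carrier A; b \<in> carrier A\<rbrakk> \<Longrightarrow> adj A (a \<otimes> b) = adj A b \<otimes> adj A a"
    and nrm_nonneg: "a \<in> carrier A \<Longrightarrow> 0 \<le> nrm A a"
    and nrm_eq_0: "a \<in> carrier A \<Longrightarrow> nrm A a = 0 \<longleftrightarrow> a = \<zero>"
    and nrm_smult: "a \<in> carrier A \<Longrightarrow> nrm A (z \<odot> a) = cmod z * nrm A a"
    and nrm_triangle: "\<lbrakk>a \<in> carrier A; b \<in> carrier A\<rbrakk> \<Longrightarrow> nrm A (a \<oplus> b) \<le> nrm A a + nrm A b"
    and nrm_mult: "\<lbrakk>a \<in> carrier A; b \<in> carrier A\<rbrakk> \<Longrightarrow> nrm A (a \<otimes> b) \<le> nrm A a * nrm A b"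
    and cstar_identity: "a \<in> carrier A \<Longrightarrow> nrm A (adj A a \<otimes> a) = (nrm A a)\<^sup>2"
    and complete: "nrm_cauchy A s \<Longrightarrow> \<exists>a\<in>carrier A. nrm_tendsto A s a"

definition cstar_unital :: "('a, 'm) cstar_scheme \<Rightarrow> bool" where
  "cstar_unital A \<longleftrightarrow> (\<exists>e\<in>carrier A. \<forall>a\<in>carrier A. e \<otimes>\<^bsub>A\<^esub> a = a \<and> a \<otimes>\<^bsub>A\<^esub> e = a)"

definition cstar_separable :: "('a, 'm) cstar_scheme \<Rightarrow> bool" where
  "cstar_separable A \<longleftrightarrow> (\<exists>D. countable D \<and> D \<subseteq> carrier A \<and>
     (\<forall>a\<in>carrier A. \<forall>e>0. \<exists>d\<in>D. nrm A (a \<ominus>\<^bsub>A\<^esub> d) < e))"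

definition closed_two_sided_ideal :: "('a, 'm) cstar_scheme \<Rightarrow> 'a set \<Rightarrow> bool" where
  "closed_two_sided_ideal A J \<longleftrightarrow>
     J \<subseteq> carrier A \<and> \<zero>\<^bsub>A\<^esub> \<in> J \<and>
     (\<forall>x\<in>J. \<forall>y\<in>J. x \<oplus>\<^bsub>A\<^esub> y \<in> J) \<and>
     (\<forall>z. \<forall>x\<in>J. z \<odot>\<^bsub>A\<^esub> x \<in> J) \<and>
     (\<forall>a\<in>carrier A. \<forall>x\<in>J. a \<otimes>\<^bsub>A\<^esub> x \<in> J \<and> x \<otimes>\<^bsub>A\<^esub> a \<in> J) \<and>
     (\<forall>s. \<forall>x\<in>carrier A. (\<forall>n. s n \<in> J) \<longrightarrow> nrm_tendsto A s x \<longrightarrow> x \<in> J)"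

definition cstar_simple :: "('a, 'm) cstar_scheme \<Rightarrow> bool" where
  "cstar_simple A \<longleftrightarrow> carrier A \<noteq> {\<zero>\<^bsub>A\<^esub>} \<and>
     (\<forall>J. closed_two_sided_ideal A J \<longrightarrow> J = {\<zero>\<^bsub>A\<^esub>} \<or> J = carrier A)"


section \<open>Hilbert spaces and bounded operators\<close>

text \<open>Up to unitary equivalence every complex Hilbert space is \<open>\<ell>\<^sup>2(I)\<close> for some index set \<open>I\<close>.
  Vectors are functions vanishing outside \<open>I\<close>; operators are only considered on such vectors.\<close>

definition ell2 :: "'i set \<Rightarrow> ('i \<Rightarrow> complex) set" where
  "ell2 I = {v. (\<forall>i. i \<notin> I \<longrightarrow> v i = 0) \<and> (\<lambda>i. (cmod (v i))\<^sup>2) summable_on I}"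

definition ell2_inner :: "'i set \<Rightarrow> ('i \<Rightarrow> complex) \<Rightarrow> ('i \<Rightarrow> complex) \<Rightarrow> complex" where
  "ell2_inner I v w = (\<Sum>\<^sub>\<infinity>i\<in>I. v i * cnj (w i))"

definition ell2_norm :: "'i set \<Rightarrow> ('i \<Rightarrow> complex) \<Rightarrow> real" where
  "ell2_norm I v = sqrt (\<Sum>\<^sub>\<infinity>i\<in>I. (cmod (v i))\<^sup>2)"

definition bounded_op :: "'i set \<Rightarrow> (('i \<Rightarrow> complex) \<Rightarrow> ('i \<Rightarrow> complex)) \<Rightarrow> bool" where
  "bounded_op I T \<longleftrightarrow>
     (\<forall>v\<in>ell2 I. T v \<in> ell2 I) \<and>
     (\<forall>v\<in>ell2 I. \<forall>w\<in>ell2 I. T (\<lambda>i. v i + w i) = (\<lambda>i. T v i + T w i)) \<and>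
     (\<forall>z. \<forall>v\<in>ell2 I. T (\<lambda>i. z * v i) = (\<lambda>i. z * T v i)) \<and>
     (\<exists>C. \<forall>v\<in>ell2 I. ell2_norm I (T v) \<le> C * ell2_norm I v)"

definition op_norm :: "'i set \<Rightarrow> (('i \<Rightarrow> complex) \<Rightarrow> ('i \<Rightarrow> complex)) \<Rightarrow> real" where
  "op_norm I T = Sup {ell2_norm I (T v) | v. v \<in> ell2 I \<and> ell2_norm I v \<le> 1}"


section \<open>Nuclearity\<close>

definition matrix_algebra :: "nat \<Rightarrow> (nat \<Rightarrow> nat \<Rightarrow> complex) cstar" where
  "matrix_algebra k =
    \<lparr>carrier = {M. \<forall>i j. i \<ge> k \<or> j \<ge> k \<longrightarrow> M i j = 0},
     Group.monoid.mult = (\<lambda>M N i j. \<Sum>l<k. M i l * N l j),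
     monoid.one = (\<lambda>i j. if i = j \<and> i < k then 1 else 0),
     ring.zero = (\<lambda>i j. 0),
     ring.add = (\<lambda>M N i j. M i j + N i j),
     module.smult = (\<lambda>z M i j. z * M i j),
     adj = (\<lambda>M i j. cnj (M j i)),
     nrm = (\<lambda>M. op_norm {..<k} (\<lambda>v i. \<Sum>j<k. M i j * v j))\<rparr>"

definition cstar_linear ::
  "('a, 'm) cstar_scheme \<Rightarrow> ('b, 'n) cstar_scheme \<Rightarrow> ('a \<Rightarrow> 'b) \<Rightarrow> bool" where
  "cstar_linear A B S \<longleftrightarrow>
     (\<forall>a\<in>carrier A. S a \<in> carrier B) \<and>
     (\<forall>a\<in>carrier A. \<forall>b\<in>carrier A. S (a \<oplus>\<^bsub>A\<^esub> b) = S a \<oplus>\<^bsub>B\<^esub> S b) \<and>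
     (\<forall>z. \<forall>a\<in>carrier A. S (z \<odot>\<^bsub>A\<^esub> a) = z \<odot>\<^bsub>B\<^esub> S a)"

text \<open>Positivity in the C*-algebra of \<open>n \<times> n\<close> matrices over \<open>A\<close>: the matrix \<open>M\<close> is of the form
  \<open>Y\<^sup>* Y\<close>. Only the entries with indices below \<open>n\<close> are relevant.\<close>

definition matrix_positive ::
  "('a, 'm) cstar_scheme \<Rightarrow> nat \<Rightarrow> (nat \<Rightarrow> nat \<Rightarrow> 'a) \<Rightarrow> bool" where
  "matrix_positive A n M \<longleftrightarrow>
     (\<exists>Y. (\<forall>i<n. \<forall>j<n. Y i j \<in> carrier A) \<and>
          (\<forall>i<n. \<forall>j<n. M i j = finsum A (\<lambda>l. adj A (Y l i) \<otimes>\<^bsub>A\<^esub> Y l j) {..<n}))"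

definition completely_positive ::
  "('a, 'm) cstar_scheme \<Rightarrow> ('b, 'n) cstar_scheme \<Rightarrow> ('a \<Rightarrow> 'b) \<Rightarrow> bool" where
  "completely_positive A B S \<longleftrightarrow> cstar_linear A B S \<and>
     (\<forall>n M. matrix_positive A n M \<longrightarrow> matrix_positive B n (\<lambda>i j. S (M i j)))"

definition ccp ::
  "('a, 'm) cstar_scheme \<Rightarrow> ('b, 'n) cstar_scheme \<Rightarrow> ('a \<Rightarrow> 'b) \<Rightarrow> bool" where
  "ccp A B S \<longleftrightarrow> completely_positive A B S \<and> (\<forall>a\<in>carrier A. nrm B (S a) \<le> nrm A a)"

text \<open>The identity map is a point-norm limit of contractive completely positive maps that factor
  through full matrix algebras.\<close>

definition cstar_nuclear :: "('a, 'm) cstar_scheme \<Rightarrow> bool" where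
  "cstar_nuclear A \<longleftrightarrow>
     (\<forall>F e. finite F \<longrightarrow> F \<subseteq> carrier A \<longrightarrow> e > 0 \<longrightarrow>
        (\<exists>k\<ge>1. \<exists>S T. ccp A (matrix_algebra k) S \<and> ccp (matrix_algebra k) A T \<and>
           (\<forall>a\<in>F. nrm A (T (S a) \<ominus>\<^bsub>A\<^esub> a) < e)))"


section \<open>Completion of a seminormed *-algebra\<close>

text \<open>Cauchy sequences modulo null sequences; the Hausdorff quotient is included.\<close>

definition cauchy_rel :: "('b, 'm) cstar_scheme \<Rightarrow> ((nat \<Rightarrow> 'b) \<times> (nat \<Rightarrow> 'b)) set" where
  "cauchy_rel B = {(s, t). nrm_cauchy B s \<and> nrm_cauchy B t \<and>
     (\<lambda>n. nrm B (s n \<ominus>\<^bsub>B\<^esub> t n)) \<longlonglongrightarrow> 0}"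

definition completion :: "('b, 'm) cstar_scheme \<Rightarrow> (nat \<Rightarrow> 'b) set cstar" where
  "completion B =
    \<lparr>carrier = {s. nrm_cauchy B s} // cauchy_rel B,
     Group.monoid.mult = (\<lambda>X Y. \<Union>s\<in>X. \<Union>t\<in>Y. cauchy_rel B `` {\<lambda>n. s n \<otimes>\<^bsub>B\<^esub> t n}),
     monoid.one = cauchy_rel B `` {\<lambda>n. \<one>\<^bsub>B\<^esub>},
     ring.zero = cauchy_rel B `` {\<lambda>n. \<zero>\<^bsub>B\<^esub>},
     ring.add = (\<lambda>X Y. \<Union>s\<in>X. \<Union>t\<in>Y. cauchy_rel B `` {\<lambda>n. s n \<oplus>\<^bsub>B\<^esub> t n}),
     module.smult = (\<lambda>z X. \<Union>s\<in>X. cauchy_rel B `` {\<lambda>n. z \<odot>\<^bsub>B\<^esub> s n}),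
     adj = (\<lambda>X. \<Union>s\<in>X. cauchy_rel B `` {\<lambda>n. adj B (s n)}),
     nrm = (\<lambda>X. THE r. \<forall>s\<in>X. (\<lambda>n. nrm B (s n)) \<longlonglongrightarrow> r)\<rparr>"


section \<open>Crossed products by discrete groups\<close>

definition star_representation ::
  "('a, 'm) cstar_scheme \<Rightarrow> 'i set \<Rightarrow> ('a \<Rightarrow> ('i \<Rightarrow> complex) \<Rightarrow> ('i \<Rightarrow> complex)) \<Rightarrow> bool" where
  "star_representation A I \<pi> \<longleftrightarrow>
     (\<forall>a\<in>carrier A. bounded_op I (\<pi> a)) \<and>
     (\<forall>a\<in>carrier A. \<forall>b\<in>carrier A. \<forall>v\<in>ell2 I. \<pi> (a \<oplus>\<^bsub>A\<^esub> b) v = (\<lambda>i. \<pi> a v i + \<pi> b v i)) \<and>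
     (\<forall>z. \<forall>a\<in>carrier A. \<forall>v\<in>ell2 I. \<pi> (z \<odot>\<^bsub>A\<^esub> a) v = (\<lambda>i. z * \<pi> a v i)) \<and>
     (\<forall>a\<in>carrier A. \<forall>b\<in>carrier A. \<forall>v\<in>ell2 I. \<pi> (a \<otimes>\<^bsub>A\<^esub> b) v = \<pi> a (\<pi> b v)) \<and>
     (\<forall>a\<in>carrier A. \<forall>v\<in>ell2 I. \<forall>w\<in>ell2 I.
        ell2_inner I (\<pi> (adj A a) v) w = ell2_inner I v (\<pi> a w))"

definition unitary_representation ::
  "('g, 'm) monoid_scheme \<Rightarrow> 'i set \<Rightarrow> ('g \<Rightarrow> ('i \<Rightarrow> complex) \<Rightarrow> ('i \<Rightarrow> complex)) \<Rightarrow> bool" where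
  "unitary_representation G I u \<longleftrightarrow>
     (\<forall>g\<in>carrier G. bounded_op I (u g)) \<and>
     (\<forall>v\<in>ell2 I. u \<one>\<^bsub>G\<^esub> v = v) \<and>
     (\<forall>g\<in>carrier G. \<forall>h\<in>carrier G. \<forall>v\<in>ell2 I. u (g \<otimes>\<^bsub>G\<^esub> h) v = u g (u h v)) \<and>
     (\<forall>g\<in>carrier G. \<forall>v\<in>ell2 I. \<forall>w\<in>ell2 I.
        ell2_inner I (u g v) (u g w) = ell2_inner I v w)"

definition covariant_representation ::
  "('g, 'm) monoid_scheme \<Rightarrow> ('a, 'n) cstar_scheme \<Rightarrow> ('g \<Rightarrow> 'a \<Rightarrow> 'a) \<Rightarrow> 'i set \<Rightarrow>
   ('a \<Rightarrow> ('i \<Rightarrow> complex) \<Rightarrow> ('i \<Rightarrow> complex)) \<Rightarrow>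
   ('g \<Rightarrow> ('i \<Rightarrow> complex) \<Rightarrow> ('i \<Rightarrow> complex)) \<Rightarrow> bool" where
  "covariant_representation G A \<alpha> I \<pi> u \<longleftrightarrow>
     star_representation A I \<pi> \<and> unitary_representation G I u \<and>
     (\<forall>g\<in>carrier G. \<forall>a\<in>carrier A. \<forall>v\<in>ell2 I.
        \<pi> (\<alpha> g a) v = u g (\<pi> a (u (inv\<^bsub>G\<^esub> g) v)))"

text \<open>Finitely supported functions \<open>f\<close> from \<open>G\<close> to \<open>A\<close> stand for the formal sums \<open>\<Sum>\<^sub>g f(g) g\<close>.\<close>

definition fsupp ::
  "('g, 'm) monoid_scheme \<Rightarrow> ('a, 'n) cstar_scheme \<Rightarrow> ('g \<Rightarrow> 'a) \<Rightarrow> 'g set" where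
  "fsupp G A f = {g \<in> carrier G. f g \<noteq> \<zero>\<^bsub>A\<^esub>}"

definition integrated_form ::
  "('g, 'm) monoid_scheme \<Rightarrow> ('a, 'n) cstar_scheme \<Rightarrow>
   ('a \<Rightarrow> ('i \<Rightarrow> complex) \<Rightarrow> ('i \<Rightarrow> complex)) \<Rightarrow>
   ('g \<Rightarrow> ('i \<Rightarrow> complex) \<Rightarrow> ('i \<Rightarrow> complex)) \<Rightarrow>
   ('g \<Rightarrow> 'a) \<Rightarrow> ('i \<Rightarrow> complex) \<Rightarrow> ('i \<Rightarrow> complex)" where
  "integrated_form G A \<pi> u f v = (\<lambda>i. \<Sum>g\<in>fsupp G A f. \<pi> (f g) (u g v) i)"

text \<open>The universal norm is the supremum over all covariant representations. It suffices to let
  the index set of the Hilbert space range over the subsets of the type of functions from \<open>G\<close> to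
  \<open>A\<close>: every norm is the supremum of those of cyclic subrepresentations, and
  a Hilbert space with a cyclic vector has a dense subset that is an image of the convolution
  algebra, hence an orthonormal basis of at most its cardinality.\<close>

definition universal_norm ::
  "('g, 'm) monoid_scheme \<Rightarrow> ('a, 'n) cstar_scheme \<Rightarrow> ('g \<Rightarrow> 'a \<Rightarrow> 'a) \<Rightarrow> ('g \<Rightarrow> 'a) \<Rightarrow> real" where
  "universal_norm G A \<alpha> f =
     Sup {op_norm I (integrated_form G A \<pi> u f) | (I :: ('g \<Rightarrow> 'a) set) \<pi> u.
            covariant_representation G A \<alpha> I \<pi> u}"

definition convolution_algebra ::
  "('g, 'm) monoid_scheme \<Rightarrow> ('a, 'n) cstar_scheme \<Rightarrow> ('g \<Rightarrow> 'a \<Rightarrow> 'a) \<Rightarrow> ('g \<Rightarrow> 'a) cstar" where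
  "convolution_algebra G A \<alpha> =
    \<lparr>carrier = {f. (\<forall>g\<in>carrier G. f g \<in> carrier A) \<and> (\<forall>g. g \<notin> carrier G \<longrightarrow> f g = \<zero>\<^bsub>A\<^esub>) \<and>
                   finite (fsupp G A f)},
     Group.monoid.mult = (\<lambda>f h g. if g \<in> carrier G
        then finsum A (\<lambda>s. f s \<otimes>\<^bsub>A\<^esub> \<alpha> s (h (inv\<^bsub>G\<^esub> s \<otimes>\<^bsub>G\<^esub> g))) (fsupp G A f) else \<zero>\<^bsub>A\<^esub>),
     monoid.one = (\<lambda>g. if g = \<one>\<^bsub>G\<^esub> then \<one>\<^bsub>A\<^esub> else \<zero>\<^bsub>A\<^esub>),
     ring.zero = (\<lambda>g. \<zero>\<^bsub>A\<^esub>),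
     ring.add = (\<lambda>f h g. f g \<oplus>\<^bsub>A\<^esub> h g),
     module.smult = (\<lambda>z f g. z \<odot>\<^bsub>A\<^esub> f g),
     adj = (\<lambda>f g. if g \<in> carrier G then \<alpha> g (adj A (f (inv\<^bsub>G\<^esub> g))) else \<zero>\<^bsub>A\<^esub>),
     nrm = universal_norm G A \<alpha>\<rparr>"

text \<open>The full crossed product; for amenable \<open>G\<close> it coincides with the reduced one.\<close>

definition crossed_product ::
  "('g, 'm) monoid_scheme \<Rightarrow> ('a, 'n) cstar_scheme \<Rightarrow> ('g \<Rightarrow> 'a \<Rightarrow> 'a) \<Rightarrow>
   (nat \<Rightarrow> 'g \<Rightarrow> 'a) set cstar" where
  "crossed_product G A \<alpha> = completion (convolution_algebra G A \<alpha>)"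


section \<open>Continuous functions on a compact space\<close>

text \<open>Functions are normalised to vanish outside the space, so that equality in the algebra is
  equality of functions.\<close>

definition continuous_functions :: "'x topology \<Rightarrow> ('x \<Rightarrow> complex) cstar" where
  "continuous_functions T =
    \<lparr>carrier = {f. continuous_map T euclidean f \<and> (\<forall>x. x \<notin> topspace T \<longrightarrow> f x = 0)},
     Group.monoid.mult = (\<lambda>f h x. f x * h x),
     monoid.one = (\<lambda>x. if x \<in> topspace T then 1 else 0),
     ring.zero = (\<lambda>x. 0),
     ring.add = (\<lambda>f h x. f x + h x),
     module.smult = (\<lambda>z f x. z * f x),
     adj = (\<lambda>f x. cnj (f x)),
     nrm = (\<lambda>f. SUP x\<in>topspace T. cmod (f x))\<rparr>"


section \<open>Amenability, residual finiteness and profinite completions\<close>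

text \<open>A left-invariant mean on the bounded real functions on \<open>G\<close>. The values of such a function
  outside the carrier are irrelevant: by positivity, the mean of a function that vanishes on the
  carrier is zero.\<close>

definition bounded_functions :: "('g, 'm) monoid_scheme \<Rightarrow> ('g \<Rightarrow> real) set" where
  "bounded_functions G = {f. bounded (f ` carrier G)}"

definition amenable :: "('g, 'm) monoid_scheme \<Rightarrow> bool" where
  "amenable G \<longleftrightarrow> (\<exists>\<mu> :: ('g \<Rightarrow> real) \<Rightarrow> real.
     (\<forall>f\<in>bounded_functions G. \<forall>h\<in>bounded_functions G. \<mu> (\<lambda>x. f x + h x) = \<mu> f + \<mu> h) \<and>
     (\<forall>c. \<forall>f\<in>bounded_functions G. \<mu> (\<lambda>x. c * f x) = c * \<mu> f) \<and>
     (\<forall>f\<in>bounded_functions G. (\<forall>x\<in>carrier G. 0 \<le> f x) \<longrightarrow> 0 \<le> \<mu> f) \<and>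
     \<mu> (\<lambda>x. 1) = 1 \<and>
     (\<forall>g\<in>carrier G. \<forall>f\<in>bounded_functions G. \<mu> (\<lambda>x. f (inv\<^bsub>G\<^esub> g \<otimes>\<^bsub>G\<^esub> x)) = \<mu> f))"

definition finite_index_normal :: "('g, 'm) monoid_scheme \<Rightarrow> 'g set \<Rightarrow> bool" where
  "finite_index_normal G N \<longleftrightarrow> N \<lhd> G \<and> finite (rcosets\<^bsub>G\<^esub> N)"

definition residually_finite :: "('g, 'm) monoid_scheme \<Rightarrow> bool" where
  "residually_finite G \<longleftrightarrow> (\<exists>\<F>. (\<forall>N\<in>\<F>. finite_index_normal G N) \<and>
     (\<forall>g\<in>carrier G. g \<noteq> \<one>\<^bsub>G\<^esub> \<longrightarrow> (\<exists>N\<in>\<F>. g \<notin> N)))"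

definition separating_nested_sequence :: "('g, 'm) monoid_scheme \<Rightarrow> (nat \<Rightarrow> 'g set) \<Rightarrow> bool" where
  "separating_nested_sequence G L \<longleftrightarrow>
     (\<forall>n. finite_index_normal G (L n)) \<and> (\<forall>n. L (Suc n) \<subseteq> L n) \<and> (\<Inter>n. L n) = {\<one>\<^bsub>G\<^esub>}"

definition profinite_completion ::
  "('g, 'm) monoid_scheme \<Rightarrow> (nat \<Rightarrow> 'g set) \<Rightarrow> (nat \<Rightarrow> 'g set) monoid" where
  "profinite_completion G L = (product_group UNIV (\<lambda>n. G Mod L n))
     \<lparr>carrier := {x \<in> carrier (product_group UNIV (\<lambda>n. G Mod L n)).
                   \<forall>n m. n \<le> m \<longrightarrow> x m <#>\<^bsub>G\<^esub> L n = x n}\<rparr>"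

definition profinite_topology ::
  "('g, 'm) monoid_scheme \<Rightarrow> (nat \<Rightarrow> 'g set) \<Rightarrow> (nat \<Rightarrow> 'g set) topology" where
  "profinite_topology G L = subtopology
     (product_topology (\<lambda>n. discrete_topology (carrier (G Mod L n))) UNIV)
     (carrier (profinite_completion G L))"

definition profinite_embedding ::
  "('g, 'm) monoid_scheme \<Rightarrow> (nat \<Rightarrow> 'g set) \<Rightarrow> 'g \<Rightarrow> (nat \<Rightarrow> 'g set)" where
  "profinite_embedding G L g = (\<lambda>n. g <#\<^bsub>G\<^esub> L n)"

definition translation_action ::
  "('g, 'm) monoid_scheme \<Rightarrow> (nat \<Rightarrow> 'g set) \<Rightarrow> 'g \<Rightarrow>
   ((nat \<Rightarrow> 'g set) \<Rightarrow> complex) \<Rightarrow> ((nat \<Rightarrow> 'g set) \<Rightarrow> complex)" where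
  "translation_action G L g f = (\<lambda>x. if x \<in> carrier (profinite_completion G L)
     then f (profinite_embedding G L (inv\<^bsub>G\<^esub> g) \<otimes>\<^bsub>profinite_completion G L\<^esub> x) else 0)"

definition bunce_deddens_algebra ::
  "('g, 'm) monoid_scheme \<Rightarrow> (nat \<Rightarrow> 'g set) \<Rightarrow>
   (nat \<Rightarrow> 'g \<Rightarrow> (nat \<Rightarrow> 'g set) \<Rightarrow> complex) set cstar" where
  "bunce_deddens_algebra G L =
     crossed_product G (continuous_functions (profinite_topology G L)) (translation_action G L)"

end

theory Submission
  imports Defs
begin

text \<open>Evaluation of the coefficient at \<open>e \<in> G\<close> at the point \<open>e\<close> of the completion is a positive functional
  \<open>\<phi>\<close> on the convolution algebra. The heart of the matter is that \<open>\<phi>\<close> alone determines the universal norm: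
  \<open>\<parallel>f\<parallel> \<le> C\<close> if and only if \<open>\<phi>(x\<^sup>* f\<^sup>* f x) \<le> C\<^sup>2 \<phi>(x\<^sup>* x)\<close> for all \<open>x\<close>. One direction is the regular representation
  on \<open>\<ell>\<^sup>2(G)\<close>. For the other one, let \<open>f\<close> factor through level \<open>n\<close>, let \<open>P\<close> be a Foelner set and \<open>z\<close> run through
  a transversal of \<open>L\<^sub>n\<close>: compressing \<open>f\<close> to the finite matrix blocks with entries
  \<open>\<phi>(\<delta>\<^sub>s\<^sub>z\<^sup>* f \<delta>\<^sub>t\<^sub>z)\<close>, \<open>s, t \<in> P\<close>, and averaging back in an arbitrary covariant representation is the Fourier
  multiplier \<open>g \<mapsto> |P \<inter> g P| / |P|\<close>, which is close to \<open>1\<close> on the support of \<open>f\<close>. The same two maps, extended to the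
  completion, are unital and completely positive and give nuclearity. For simplicity, if \<open>b \<ge> 0\<close> lies in an
  ideal and \<open>\<phi>(b) > 0\<close>, then \<open>p b p\<close> is close to \<open>\<phi>(b) p\<close> for the indicator \<open>p\<close> of the closure of \<open>L\<^sub>n\<close>, \<open>n\<close> large, so that
  \<open>p\<close> is in the ideal, and finitely many conjugates of \<open>p\<close> sum up to \<open>1\<close>.\<close>

section \<open>Foelner sets from an invariant mean\<close>

text \<open>No spectral theory is used. Every norm is the operator norm of left multiplication on
  the pre-Hilbert space of a positive functional, a description that is stable under passing to
  matrices and to the completion; the C*-identity, square roots and complete positivity all come
  from inequalities for that form. Evaluation at a point is preferred to the canonical trace because
  it requires no Haar measure and its GNS space is simply l^2(G). The price is that the functional
  is not faithful in general, so a nonzero element is detected only through its action on the whole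
  GNS space. The obstacle is the universal norm: its supremum ranges over representations that are
  unrelated to the functional, and amenability is what ties them to it. Since amenability is given
  as a mean while averaging needs finite sets, Foelner sets have to be extracted first. Without them
  Hall's theorem would double G by finitely many translations, which a mean forbids.\<close>

lemma hall_finite:
  assumes "finite I" and "\<And>i. i \<in> I \<Longrightarrow> finite (N i)"
    and "\<And>J. J \<subseteq> I \<Longrightarrow> card J \<le> card (\<Union>(N ` J))"
  shows "\<exists>f. (\<forall>i\<in>I. f i \<in> N i) \<and> inj_on f I"
  using assms
proof (induction "card I" arbitrary: I N rule: less_induct)
  case less
  show ?case
  proof (cases "I = {}")
    case True
    then show ?thesis by simp
  next
    case False
    then obtain i where i: "i \<in> I" by blast
    show ?thesis
    \<comment> \<open>The Halmos-Vaughan dichotomy. A proper subset J without surplus is matched by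
      induction; deleting its neighbours keeps Hall's condition for the rest, since J accounts for
      no more points than it has elements. If every proper nonempty subset has a surplus, one index
      may be matched arbitrarily and its partner deleted.\<close>
    proof (cases "\<exists>J. J \<subset> I \<and> J \<noteq> {} \<and> card (\<Union>(N ` J)) \<le> card J")
      case True
      then obtain J where J: "J \<subset> I" "J \<noteq> {}" "card (\<Union>(N ` J)) \<le> card J" by blast
      have finJ: "finite J" using J less.prems(1) finite_subset by blast
      have "card J < card I" using J less.prems(1) psubset_card_mono by blast
      from less.hyps[OF this finJ, of N] obtain f where f: "\<forall>i\<in>J. f i \<in> N i" "inj_on f J"
        using less.prems J by (metis psubset_imp_subset subset_eq)
      define N' where "N' = (\<lambda>i. N i - \<Union>(N ` J))"
      have "card (I - J) < card I"
        using J less.prems(1) by (intro psubset_card_mono) auto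
      moreover have "card H \<le> card (\<Union>(N' ` H))" if H: "H \<subseteq> I - J" for H
      proof -
        have finH: "finite H" using H less.prems(1) finite_subset by blast
        have "card (H \<union> J) = card H + card J"
          using H finH finJ by (intro card_Un_disjoint) auto
        moreover have "card (H \<union> J) \<le> card (\<Union>(N ` (H \<union> J)))"
          using less.prems(3)[of "H \<union> J"] H J by auto
        moreover have "\<Union>(N ` (H \<union> J)) = \<Union>(N' ` H) \<union> \<Union>(N ` J)"
          by (auto simp: N'_def)
        moreover have "card (\<Union>(N' ` H) \<union> \<Union>(N ` J)) \<le> card (\<Union>(N' ` H)) + card (\<Union>(N ` J))"
          by (rule card_Un_le)
        ultimately show ?thesis using J(3) by simp
      qed
      ultimately obtain h where h: "\<forall>i\<in>I - J. h i \<in> N' i" "inj_on h (I - J)"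
        using less.hyps[of "I - J" N'] less.prems by (auto simp: N'_def)
      let ?k = "\<lambda>i. if i \<in> J then f i else h i"
      have "inj_on ?k I"
      proof (rule inj_onI)
        fix x y assume xy: "x \<in> I" "y \<in> I" "?k x = ?k y"
        have *: "h z \<noteq> f w" if "z \<in> I - J" "w \<in> J" for z w
          using bspec[OF h(1) that(1)] bspec[OF f(1) that(2)] that(2) by (auto simp: N'_def)
        show "x = y"
          using xy f(2) h(2) *[of x y] *[of y x] by (auto simp: inj_on_def split: if_splits)
      qed
      moreover have "\<forall>i\<in>I. ?k i \<in> N i" using f h by (auto simp: N'_def)
      ultimately show ?thesis by (intro exI[of _ ?k] conjI)
    next
      case False
      then have strict: "card J < card (\<Union>(N ` J))" if "J \<subset> I" "J \<noteq> {}" for J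
        using that by (meson not_le)
      have "card {i} \<le> card (N i)" using less.prems(3)[of "{i}"] i by simp
      then obtain x where x: "x \<in> N i" by fastforce
      define N' where "N' = (\<lambda>j. N j - {x})"
      have "card (I - {i}) < card I" using i less.prems(1) by (meson card_Diff1_less)
      moreover have "card H \<le> card (\<Union>(N' ` H))" if H: "H \<subseteq> I - {i}" for H
      proof (cases "H = {}")
        case False
        have "card H < card (\<Union>(N ` H))" using strict[of H] H i False by blast
        moreover have "\<Union>(N' ` H) = \<Union>(N ` H) - {x}" by (auto simp: N'_def)
        moreover have "card (\<Union>(N ` H)) - 1 \<le> card (\<Union>(N ` H) - {x})"
          by (metis One_nat_def card_Diff_singleton_if diff_le_self order_refl)
        ultimately show ?thesis by simp
      qed simp
      ultimately obtain h where h: "\<forall>j\<in>I - {i}. h j \<in> N' j" "inj_on h (I - {i})"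
        using less.hyps[of "I - {i}" N'] less.prems by (auto simp: N'_def)
      have "inj_on (h(i := x)) I"
        using h by (auto simp: inj_on_def N'_def)
      moreover have "\<forall>j\<in>I. (h(i := x)) j \<in> N j" using h x by (auto simp: N'_def)
      ultimately show ?thesis by blast
    qed
  qed
qed

text \<open>Compactness. The choice functions form a product of finite discrete spaces, f i \<noteq>
  f j is a closed condition for fixed i and j, and finitely many such conditions hold together by
  the finite theorem for the indices occurring in them.\<close>

lemma hall_infinite:
  assumes fin: "\<And>i. i \<in> I \<Longrightarrow> finite (N i)"
    and hall: "\<And>J. J \<subseteq> I \<Longrightarrow> finite J \<Longrightarrow> card J \<le> card (\<Union>(N ` J))"
  shows "\<exists>f. (\<forall>i\<in>I. f i \<in> N i) \<and> inj_on f I"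
proof -
  define T where "T = product_topology (\<lambda>i. discrete_topology (N i)) I"
  have compact: "compact_space T"
    unfolding T_def using fin by (intro compact_space_product_topology[THEN iffD2] disjI2)
      (auto simp: compact_space_discrete_topology)
  have top: "topspace T = (\<Pi>\<^sub>E i\<in>I. N i)" by (simp add: T_def)
  define C where "C = (\<lambda>(i, j). {f \<in> topspace T. f i \<noteq> f j})"
  have closed: "closedin T (C (i, j))" if "i \<in> I" "j \<in> I" for i j
  proof -
    have opn: "openin T {f \<in> topspace T. f i = x}" if "i \<in> I" for i x
    proof -
      have "openin T {f \<in> topspace T. f i \<in> {x} \<inter> N i}"
        unfolding T_def
        by (rule openin_continuous_map_preimage[OF continuous_map_product_projection[OF that]]) simp
      moreover have "{f \<in> topspace T. f i \<in> {x} \<inter> N i} = {f \<in> topspace T. f i = x}"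
        using that by (auto simp: top)
      ultimately show ?thesis by simp
    qed
    have "openin T (\<Union>x. {f \<in> topspace T. f i = x} \<inter> {f \<in> topspace T. f j = x})"
      using that by (intro openin_Union) (auto intro!: openin_Int opn)
    moreover have "(\<Union>x. {f \<in> topspace T. f i = x} \<inter> {f \<in> topspace T. f j = x}) = topspace T - C (i, j)"
      by (auto simp: C_def)
    ultimately show ?thesis
      by (auto simp: closedin_def C_def)
  qed
  define P where "P = {(i, j). i \<in> I \<and> j \<in> I \<and> i \<noteq> j}"
  have fip: "topspace T \<inter> \<Inter>\<F> \<noteq> {}" if F: "finite \<F>" "\<F> \<subseteq> C ` P" for \<F>
  proof -
    obtain P' where P': "P' \<subseteq> P" "finite P'" "\<F> = C ` P'"
      using finite_subset_image[OF F] by blast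
    define J where "J = fst ` P' \<union> snd ` P'"
    have J: "J \<subseteq> I" "finite J" using P' by (auto simp: J_def P_def)
    have "\<exists>f. (\<forall>i\<in>J. f i \<in> N i) \<and> inj_on f J"
    proof (rule hall_finite[OF J(2)])
      show "finite (N i)" if "i \<in> J" for i using that J fin by blast
      show "card H \<le> card (\<Union>(N ` H))" if "H \<subseteq> J" for H
        using that J by (intro hall) (auto intro: finite_subset)
    qed
    then obtain f where f: "\<forall>i\<in>J. f i \<in> N i" "inj_on f J" by blast
    have ne: "N i \<noteq> {}" if "i \<in> I" for i
      using hall[of "{i}"] that by auto
    define h where "h = (\<lambda>i. if i \<in> J then f i else if i \<in> I then SOME x. x \<in> N i else undefined)"
    have "h \<in> topspace T"
      unfolding top
    proof (rule PiE_I)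
      show "h i \<in> N i" if "i \<in> I" for i using that f ne[OF that] by (simp add: h_def some_in_eq)
      show "h i = undefined" if "i \<notin> I" for i using that J by (auto simp: h_def)
    qed
    moreover have "h \<in> C (i, j)" if "(i, j) \<in> P'" for i j
    proof -
      have "i \<in> J" "j \<in> J" unfolding J_def using imageI[OF that, of fst] imageI[OF that, of snd] by auto
      moreover have "i \<noteq> j" using that P'(1) by (auto simp: P_def)
      ultimately show ?thesis
        using \<open>h \<in> topspace T\<close> f(2) by (simp add: C_def h_def inj_on_def) blast
    qed
    ultimately have "h \<in> topspace T \<inter> \<Inter>\<F>" unfolding P'(3) by (auto split: prod.splits)
    then show ?thesis by blast
  qed
  have "topspace T \<inter> \<Inter>(C ` P) \<noteq> {}"
  proof (cases "P = {}")
    case True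
    then show ?thesis using fip[of "{}"] by simp
  next
    case False
    have "\<Inter>(C ` P) \<noteq> {}"
    proof -
      have "\<forall>D\<in>C ` P. closedin T D" using closed by (auto simp: P_def)
      moreover have "\<forall>\<F>. finite \<F> \<and> \<F> \<subseteq> C ` P \<longrightarrow> \<Inter>\<F> \<noteq> {}" using fip by fastforce
      ultimately show ?thesis using compact[unfolded compact_space_fip] by blast
    qed
    moreover have "\<Inter>(C ` P) \<subseteq> topspace T" using False by (auto simp: C_def)
    ultimately show ?thesis by blast
  qed
  then obtain f where f: "f \<in> topspace T" "\<And>i j. (i, j) \<in> P \<Longrightarrow> f \<in> C (i, j)" by blast
  show ?thesis
  proof (intro exI conjI)
    show "\<forall>i\<in>I. f i \<in> N i" using f by (auto simp: top)
    show "inj_on f I" using f(2) by (auto simp: inj_on_def P_def C_def)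
  qed
qed

text \<open>The map f squeezes two copies of G into one, moving each point by one of finitely many
  left translations. Cut each copy b into the pieces on which f is multiplication by a fixed k: the
  pieces cover G twice, while their translates are pairwise disjoint by injectivity. Invariance of
  the mean gives 2 \<le> 1.\<close>

lemma invariant_mean_no_paradox:
  fixes G (structure)
  assumes "group G" and "amenable G" and K: "finite K" "K \<subseteq> carrier G"
    and f: "\<And>x b. x \<in> carrier G \<Longrightarrow> \<exists>k\<in>K. f (x, b) = k \<otimes> x"
    and inj: "inj_on f (carrier G \<times> (UNIV :: bool set))"
  shows False
proof -
  interpret group G by fact
  obtain \<mu> :: "('a \<Rightarrow> real) \<Rightarrow> real" where
    add: "\<And>f h. f \<in> bounded_functions G \<Longrightarrow> h \<in> bounded_functions G \<Longrightarrow> \<mu> (\<lambda>x. f x + h x) = \<mu> f + \<mu> h"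
    and scale: "\<And>c f. f \<in> bounded_functions G \<Longrightarrow> \<mu> (\<lambda>x. c * f x) = c * \<mu> f"
    and pos: "\<And>f. f \<in> bounded_functions G \<Longrightarrow> (\<forall>x\<in>carrier G. 0 \<le> f x) \<Longrightarrow> 0 \<le> \<mu> f"
    and one: "\<mu> (\<lambda>x. 1) = 1"
    and inv: "\<And>g f. g \<in> carrier G \<Longrightarrow> f \<in> bounded_functions G \<Longrightarrow> \<mu> (\<lambda>x. f (inv g \<otimes> x)) = \<mu> f"
    using assms(2) unfolding amenable_def by blast
  have bdd_intro: "f \<in> bounded_functions G" if "\<And>x. x \<in> carrier G \<Longrightarrow> \<bar>f x\<bar> \<le> C" for f :: "'a \<Rightarrow> real" and C
    unfolding bounded_functions_def bounded_iff using that by (auto intro!: exI[of _ C])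
  have bdd_add: "(\<lambda>x. f x + h x) \<in> bounded_functions G"
    if "f \<in> bounded_functions G" "h \<in> bounded_functions G" for f h
    using that unfolding bounded_functions_def
    by (auto intro!: bounded_plus_comp)
  have bdd_sum: "(\<lambda>x. \<Sum>i\<in>S. F i x) \<in> bounded_functions G"
    if "finite S" "\<And>i. i \<in> S \<Longrightarrow> F i \<in> bounded_functions G" for S :: "('a \<times> bool) set" and F
    using that
  proof (induction S)
    case empty
    show ?case by (auto intro!: bdd_intro[of _ 0])
  next
    case (insert a S)
    then show ?case using bdd_add[of "F a" "\<lambda>x. \<Sum>i\<in>S. F i x"] by simp
  qed
  have sum: "\<mu> (\<lambda>x. \<Sum>i\<in>S. F i x) = (\<Sum>i\<in>S. \<mu> (F i))"
    if "finite S" "\<And>i. i \<in> S \<Longrightarrow> F i \<in> bounded_functions G" for S :: "('a \<times> bool) set" and F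
    using that
  proof (induction S)
    case empty
    show ?case using scale[of "\<lambda>x. 1" 0] bdd_intro[of "\<lambda>x. 1" 1] by simp
  next
    case (insert a S)
    then show ?case using add[of "F a" "\<lambda>x. \<Sum>i\<in>S. F i x"] bdd_sum[of S F] by simp
  qed
  have mono: "\<mu> f \<le> \<mu> h"
    if "f \<in> bounded_functions G" "h \<in> bounded_functions G" "\<And>x. x \<in> carrier G \<Longrightarrow> f x \<le> h x" for f h
  proof -
    have m: "(\<lambda>x. (-1) * f x) \<in> bounded_functions G"
      using that(1) unfolding bounded_functions_def bounded_iff by auto
    have "0 \<le> \<mu> (\<lambda>x. h x + (-1) * f x)"
      using that bdd_add[OF that(2) m] by (intro pos) auto
    also have "\<dots> = \<mu> h - \<mu> f"
      using add[OF that(2) m] scale[OF that(1), of "-1"] by simp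
    finally show ?thesis by simp
  qed
  define A where "A = (\<lambda>(k, b). {x \<in> carrier G. f (x, b) = k \<otimes> x})"
  define ind where "ind = (\<lambda>i x. of_bool (x \<in> A i) :: real)"
  define tr where "tr = (\<lambda>(k, b) x. of_bool (inv k \<otimes> x \<in> A (k, b)) :: real)"
  let ?S = "K \<times> (UNIV :: bool set)"
  have bi: "ind i \<in> bounded_functions G" and bt: "tr i \<in> bounded_functions G" for i
    by (auto intro!: bdd_intro[of _ 1] simp: ind_def tr_def split: prod.splits)
  have finS: "finite ?S" using K by simp
  have "2 = \<mu> (\<lambda>x. 2 * 1)" using scale[of "\<lambda>x. 1" 2] one bdd_intro[of "\<lambda>x. 1" 1] by simp
  also have "\<dots> \<le> \<mu> (\<lambda>x. \<Sum>i\<in>?S. ind i x)"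
  proof (rule mono)
    fix x assume x: "x \<in> carrier G"
    have "1 \<le> (\<Sum>k\<in>K. ind (k, b) x)" for b
    proof -
      obtain k where "k \<in> K" "f (x, b) = k \<otimes> x" using f[OF x] by blast
      then have "1 \<le> ind (k, b) x" using x by (simp add: ind_def A_def)
      also have "\<dots> \<le> (\<Sum>k\<in>K. ind (k, b) x)"
        using \<open>k \<in> K\<close> K by (intro member_le_sum) (auto simp: ind_def)
      finally show ?thesis .
    qed
    from this[of True] this[of False] have "2 \<le> (\<Sum>k\<in>K. ind (k, True) x) + (\<Sum>k\<in>K. ind (k, False) x)"
      by simp
    also have "\<dots> = (\<Sum>k\<in>K. \<Sum>b\<in>UNIV. ind (k, b) x)"
      by (simp add: UNIV_bool sum.distrib)
    also have "\<dots> = (\<Sum>i\<in>?S. ind i x)" by (simp add: sum.cartesian_product)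
    finally show "2 * 1 \<le> (\<Sum>i\<in>?S. ind i x)" by simp
  qed (use bdd_intro[of "\<lambda>x. 2 * 1" 2] bdd_sum[OF finS bi] in auto)
  also have "\<dots> = (\<Sum>i\<in>?S. \<mu> (ind i))" by (intro sum finS bi)
  also have "\<dots> = (\<Sum>i\<in>?S. \<mu> (tr i))"
  proof (intro sum.cong refl)
    fix i assume "i \<in> ?S"
    then obtain k b where "i = (k, b)" "k \<in> carrier G" using K by auto
    then show "\<mu> (ind i) = \<mu> (tr i)"
      using inv[OF \<open>k \<in> carrier G\<close> bi[of i]] by (simp add: tr_def ind_def)
  qed
  also have "\<dots> = \<mu> (\<lambda>x. \<Sum>i\<in>?S. tr i x)" by (intro sum[symmetric] finS bt)
  also have "\<dots> \<le> \<mu> (\<lambda>x. 1)"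
  proof (rule mono)
    fix y assume y: "y \<in> carrier G"
    have uniq: "i = j" if ij0: "i \<in> ?S" "j \<in> ?S" "tr i y \<noteq> 0" "tr j y \<noteq> 0" for i j
    proof -
      obtain k b l c where ij: "i = (k, b)" "j = (l, c)" "k \<in> carrier G" "l \<in> carrier G"
        using ij0(1,2) K by (cases i; cases j) auto
      have "f (inv k \<otimes> y, b) = k \<otimes> (inv k \<otimes> y)" "f (inv l \<otimes> y, c) = l \<otimes> (inv l \<otimes> y)"
        using ij0(3,4) unfolding ij(1,2) by (simp_all add: tr_def A_def split: if_splits)
      then have "f (inv k \<otimes> y, b) = f (inv l \<otimes> y, c)"
        using y ij(3,4) by (simp add: m_assoc[symmetric])
      then have eq: "(inv k \<otimes> y, b) = (inv l \<otimes> y, c)"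
        using y ij(3,4) by (intro inj_onD[OF inj]) auto
      then have "inv k = inv l" using y ij(3,4) by simp
      then have "k = l" using ij(3,4) by (metis inv_inv)
      then show ?thesis using ij(1,2) eq by simp
    qed
    show "(\<Sum>i\<in>?S. tr i y) \<le> 1"
    proof (cases "\<exists>i\<in>?S. tr i y \<noteq> 0")
      case True
      then obtain i where i: "i \<in> ?S" "tr i y \<noteq> 0" by blast
      have "(\<Sum>i\<in>?S. tr i y) = (\<Sum>j\<in>{i}. tr j y)"
        using i uniq finS by (intro sum.mono_neutral_right) auto
      then show ?thesis by (simp add: tr_def split: prod.splits)
    next
      case False
      then have "(\<Sum>i\<in>?S. tr i y) = 0" by (intro sum.neutral) blast
      then show ?thesis by simp
    qed
  qed (use bdd_intro[of "\<lambda>x. 1" 1] bdd_sum[OF finS bt] in auto)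
  finally show False using one by simp
qed

text \<open>If there were no Foelner set for \<open>K\<close> and \<open>\<epsilon>\<close>, iterated multiplication by \<open>K\<close> would double
  the size of every finite set, and Hall's theorem would give a paradoxical decomposition.\<close>

lemma amenable_imp_foelner:
  fixes G (structure)
  assumes "group G" and "amenable G" and K: "finite K" "K \<subseteq> carrier G" and "\<epsilon> > 0"
  shows "\<exists>F. finite F \<and> F \<noteq> {} \<and> F \<subseteq> carrier G \<and>
    (\<forall>g\<in>K. (1 - \<epsilon>) * real (card F) \<le> real (card (F \<inter> (\<lambda>x. g \<otimes> x) ` F)))"
proof (rule ccontr)
  interpret group G by fact
  assume "\<not> ?thesis"
  then have neg: "\<exists>g\<in>K. real (card (F \<inter> (\<lambda>x. g \<otimes> x) ` F)) < (1 - \<epsilon>) * real (card F)"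
    if "finite F" "F \<noteq> {}" "F \<subseteq> carrier G" for F
    using that by (meson not_le)
  define E where "E = (\<lambda>A. \<Union>k\<in>insert \<one> K. (\<lambda>x. k \<otimes> x) ` A)"
  have E: "finite (E A)" "E A \<subseteq> carrier G" if "finite A" "A \<subseteq> carrier G" for A
    using that K by (auto simp: E_def)
  \<comment> \<open>For the bad g the sets A and g A have equal size and overlap in less than (1 -
    \<epsilon>) |A| points, so their union has more than (1 + \<epsilon>) |A|. It lies in E A
    because the identity was added to K.\<close>
  have grow: "(1 + \<epsilon>) * real (card A) \<le> real (card (E A))" if A: "finite A" "A \<subseteq> carrier G" for A
  proof (cases "A = {}")
    case False
    from neg[OF A(1) False A(2)] obtain g
      where g: "g \<in> K" "real (card (A \<inter> (\<lambda>x. g \<otimes> x) ` A)) < (1 - \<epsilon>) * real (card A)" by blast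
    have "inj_on (\<lambda>x. g \<otimes> x) A" using A g K by (auto simp: inj_on_def subset_eq)
    then have c: "card ((\<lambda>x. g \<otimes> x) ` A) = card A" by (rule card_image)
    have "real (card A) + real (card A) = real (card (A \<union> (\<lambda>x. g \<otimes> x) ` A)) + real (card (A \<inter> (\<lambda>x. g \<otimes> x) ` A))"
      using card_Un_Int[of A "(\<lambda>x. g \<otimes> x) ` A"] A c by simp
    moreover have "card (A \<union> (\<lambda>x. g \<otimes> x) ` A) \<le> card (E A)"
    proof (intro card_mono E A)
      have "A \<subseteq> (\<lambda>x. \<one> \<otimes> x) ` A" using A by (auto simp: image_iff subset_eq)
      then show "A \<union> (\<lambda>x. g \<otimes> x) ` A \<subseteq> E A" using g by (auto simp: E_def)
    qed
    ultimately show ?thesis using g(2) by (simp add: algebra_simps)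
  qed simp
  have En: "finite ((E ^^ n) A) \<and> (E ^^ n) A \<subseteq> carrier G \<and> (1 + \<epsilon>) ^ n * real (card A) \<le> real (card ((E ^^ n) A))"
    if A: "finite A" "A \<subseteq> carrier G" for A n
  proof (induction n)
    case 0
    show ?case using A by simp
  next
    case (Suc n)
    have "(1 + \<epsilon>) ^ Suc n * real (card A) = (1 + \<epsilon>) * ((1 + \<epsilon>) ^ n * real (card A))" by simp
    also have "\<dots> \<le> (1 + \<epsilon>) * real (card ((E ^^ n) A))"
      using Suc \<open>\<epsilon> > 0\<close> by (intro mult_left_mono) auto
    also have "\<dots> \<le> real (card (E ((E ^^ n) A)))" using Suc by (intro grow) auto
    finally show ?case using Suc E by simp
  qed
  have Eun: "(E ^^ n) A = (\<Union>x\<in>A. (E ^^ n) {x})" for n A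
  proof (induction n)
    case (Suc n)
    have "E ((E ^^ n) A) = E (\<Union>x\<in>A. (E ^^ n) {x})" using Suc by simp
    also have "\<dots> = (\<Union>x\<in>A. E ((E ^^ n) {x}))" by (auto simp: E_def)
    finally show ?case by simp
  qed simp
  \<comment> \<open>E multiplies on the left and so commutes with right translations. Hence the n-th
    neighbourhood of x is K' x for a finite set K' independent of x, which makes the injection
    obtained from Hall's theorem a piecewise translation.\<close>
  have Etr: "(E ^^ n) {x} = (\<lambda>k. k \<otimes> x) ` (E ^^ n) {\<one>}" if x: "x \<in> carrier G" for n x
  proof (induction n)
    case (Suc n)
    have sub: "(E ^^ n) {\<one>} \<subseteq> carrier G" using En[of "{\<one>}" n] by simp
    have "E ((E ^^ n) {x}) = E ((\<lambda>k. k \<otimes> x) ` (E ^^ n) {\<one>})" using Suc by simp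
    also have "\<dots> = (\<lambda>k. k \<otimes> x) ` E ((E ^^ n) {\<one>})"
    proof -
      have "k \<otimes> (y \<otimes> x) = k \<otimes> y \<otimes> x" if "k \<in> insert \<one> K" "y \<in> (E ^^ n) {\<one>}" for k y
        using that sub K x by (intro m_assoc[symmetric]) auto
      then show ?thesis unfolding E_def image_UN image_image by (intro SUP_cong image_cong refl)
    qed
    finally show ?case by simp
  qed (use x in simp)
  \<comment> \<open>Two copies of a finite set need twice as many neighbours; n rounds of growth
    supply them, which is Hall's condition for G \<times> bool.\<close>
  obtain n where n: "2 \<le> (1 + \<epsilon>) ^ n"
    using real_arch_pow[of "1 + \<epsilon>" 2] \<open>\<epsilon> > 0\<close> by (metis less_add_same_cancel1 less_imp_le)
  define K' where "K' = (E ^^ n) {\<one>}"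
  have K': "finite K'" "K' \<subseteq> carrier G" using En[of "{\<one>}" n] by (auto simp: K'_def)
  have "\<exists>f. (\<forall>i\<in>carrier G \<times> (UNIV :: bool set). f i \<in> (E ^^ n) {fst i}) \<and> inj_on f (carrier G \<times> (UNIV :: bool set))"
  proof (rule hall_infinite)
    show "finite ((E ^^ n) {fst i})" if "i \<in> carrier G \<times> (UNIV :: bool set)" for i
      using En[of "{fst i}" n] that by auto
    fix J assume J: "J \<subseteq> carrier G \<times> (UNIV :: bool set)" "finite J"
    have A: "finite (fst ` J)" "fst ` J \<subseteq> carrier G" using J by auto
    have "card J \<le> card (fst ` J \<times> (UNIV :: bool set))"
      using A by (intro card_mono) (auto intro: rev_image_eqI)
    also have "\<dots> = card (fst ` J) * 2" by (simp add: card_cartesian_product)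
    finally have "real (card J) \<le> 2 * real (card (fst ` J))" by linarith
    also have "\<dots> \<le> (1 + \<epsilon>) ^ n * real (card (fst ` J))"
      using n by (intro mult_right_mono) auto
    also have "\<dots> \<le> real (card ((E ^^ n) (fst ` J)))" using En[OF A] by blast
    finally show "card J \<le> card (\<Union>i\<in>J. (E ^^ n) {fst i})"
      using Eun[of n "fst ` J"] by simp
  qed
  then obtain f where f: "\<And>x b. x \<in> carrier G \<Longrightarrow> f (x, b) \<in> (E ^^ n) {x}"
    "inj_on f (carrier G \<times> (UNIV :: bool set))" by fastforce
  show False
  proof (rule invariant_mean_no_paradox[OF assms(1,2) K' _ f(2)])
    show "\<exists>k\<in>K'. f (x, b) = k \<otimes> x" if "x \<in> carrier G" for x b
      using f(1)[OF that, of b] Etr[OF that] by (auto simp: K'_def)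
  qed
qed

section \<open>*-algebras normed through a positive functional\<close>

text \<open>The algebraic half of \<open>cstar_algebra\<close>, with a unit and without a norm. It
  is available for the convolution algebra, for matrices and for completions before anything is
  known about their norms.\<close>

locale star_alg = ring A for A :: "('a, 'm) cstar_scheme" (structure) +
  assumes smult_closed [simp, intro]: "a \<in> carrier A \<Longrightarrow> z \<odot> a \<in> carrier A"
    and smult_add_left: "a \<in> carrier A \<Longrightarrow> (z + w) \<odot> a = z \<odot> a \<oplus> w \<odot> a"
    and smult_add_right: "\<lbrakk>a \<in> carrier A; b \<in> carrier A\<rbrakk> \<Longrightarrow> z \<odot> (a \<oplus> b) = z \<odot> a \<oplus> z \<odot> b"
    and smult_smult: "a \<in> carrier A \<Longrightarrow> (z * w) \<odot> a = z \<odot> (w \<odot> a)"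
    and smult_one [simp]: "a \<in> carrier A \<Longrightarrow> 1 \<odot> a = a"
    and smult_mult_left: "\<lbrakk>a \<in> carrier A; b \<in> carrier A\<rbrakk> \<Longrightarrow> (z \<odot> a) \<otimes> b = z \<odot> (a \<otimes> b)"
    and smult_mult_right: "\<lbrakk>a \<in> carrier A; b \<in> carrier A\<rbrakk> \<Longrightarrow> a \<otimes> (z \<odot> b) = z \<odot> (a \<otimes> b)"
    and adj_closed [simp, intro]: "a \<in> carrier A \<Longrightarrow> adj A a \<in> carrier A"
    and adj_adj [simp]: "a \<in> carrier A \<Longrightarrow> adj A (adj A a) = a"
    and adj_add: "\<lbrakk>a \<in> carrier A; b \<in> carrier A\<rbrakk> \<Longrightarrow> adj A (a \<oplus> b) = adj A a \<oplus> adj A b"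
    and adj_smult: "a \<in> carrier A \<Longrightarrow> adj A (z \<odot> a) = cnj z \<odot> adj A a"
    and adj_mult: "\<lbrakk>a \<in> carrier A; b \<in> carrier A\<rbrakk> \<Longrightarrow> adj A (a \<otimes> b) = adj A b \<otimes> adj A a"
begin

lemma add_eq_self_iff: "\<lbrakk>a \<in> carrier A; b \<in> carrier A\<rbrakk> \<Longrightarrow> a \<oplus> b = a \<longleftrightarrow> b = \<zero>"
  using add.l_cancel_one by blast

lemma minus_eq_zero_iff: "\<lbrakk>a \<in> carrier A; b \<in> carrier A\<rbrakk> \<Longrightarrow> a \<ominus> b = \<zero> \<longleftrightarrow> a = b"
proof -
  assume ab: "a \<in> carrier A" "b \<in> carrier A"
  then have "a = (a \<ominus> b) \<oplus> b" by algebra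
  moreover have "b \<ominus> b = \<zero>" using ab by algebra
  ultimately show ?thesis using ab by auto
qed

lemma smult_zero_left [simp]: "a \<in> carrier A \<Longrightarrow> 0 \<odot> a = \<zero>"
  using smult_add_left[of a 0 0] add_eq_self_iff[of "0 \<odot> a" "0 \<odot> a"] by simp

lemma smult_zero_right [simp]: "z \<odot> \<zero> = \<zero>"
  using smult_add_right[of \<zero> \<zero> z] add_eq_self_iff[of "z \<odot> \<zero>" "z \<odot> \<zero>"] by simp

lemma smult_neg_one: "a \<in> carrier A \<Longrightarrow> (-1) \<odot> a = \<ominus> a"
  using smult_add_left[of a "-1" 1] by (intro minus_equality[symmetric]) auto

lemma smult_minus: "\<lbrakk>a \<in> carrier A; b \<in> carrier A\<rbrakk> \<Longrightarrow> z \<odot> (a \<ominus> b) = z \<odot> a \<ominus> z \<odot> b"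
  by (simp add: a_minus_def smult_neg_one[symmetric] smult_add_right smult_smult[symmetric])

lemma minus_eq_smult: "\<lbrakk>a \<in> carrier A; b \<in> carrier A\<rbrakk> \<Longrightarrow> a \<ominus> b = a \<oplus> (-1) \<odot> b"
  by (simp add: a_minus_def smult_neg_one)

lemma adj_zero [simp]: "adj A \<zero> = \<zero>"
  using adj_smult[of \<zero> 0] by simp

lemma adj_one [simp]: "adj A \<one> = \<one>"
  using adj_mult[of \<one> "adj A \<one>"] by simp

lemma adj_minus: "\<lbrakk>a \<in> carrier A; b \<in> carrier A\<rbrakk> \<Longrightarrow> adj A (a \<ominus> b) = adj A a \<ominus> adj A b"
  by (simp add: minus_eq_smult adj_add adj_smult)

lemma finsum_in [simp]: "(\<And>i. i \<in> S \<Longrightarrow> f i \<in> carrier A) \<Longrightarrow> finsum A f S \<in> carrier A"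
  by (rule finsum_closed) auto

lemma smult_finsum:
  "\<lbrakk>finite S; \<And>i. i \<in> S \<Longrightarrow> f i \<in> carrier A\<rbrakk> \<Longrightarrow> z \<odot> finsum A f S = finsum A (\<lambda>i. z \<odot> f i) S"
  by (induction S rule: finite_induct) (simp_all add: Pi_def smult_add_right)

lemma adj_finsum:
  "\<lbrakk>finite S; \<And>i. i \<in> S \<Longrightarrow> f i \<in> carrier A\<rbrakk> \<Longrightarrow> adj A (finsum A f S) = finsum A (\<lambda>i. adj A (f i)) S"
  by (induction S rule: finite_induct) (simp_all add: Pi_def adj_add)

end

lemma (in abelian_monoid) finsum_swap:
  assumes "finite S" "finite T" and "\<And>i j. i \<in> S \<Longrightarrow> j \<in> T \<Longrightarrow> f i j \<in> carrier G"
  shows "(\<Oplus>i\<in>S. \<Oplus>j\<in>T. f i j) = (\<Oplus>j\<in>T. \<Oplus>i\<in>S. f i j)"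
  using assms(1,3)
proof (induction S rule: finite_induct)
  case empty
  then show ?case by (simp add: finsum_zero)
next
  case (insert a S)
  have "(\<Oplus>i\<in>insert a S. \<Oplus>j\<in>T. f i j) = (\<Oplus>j\<in>T. f a j) \<oplus> (\<Oplus>j\<in>T. \<Oplus>i\<in>S. f i j)"
    using insert by (subst finsum_insert) (auto intro!: finsum_closed)
  also have "\<dots> = (\<Oplus>j\<in>T. f a j \<oplus> (\<Oplus>i\<in>S. f i j))"
    using insert by (intro finsum_addf[symmetric]) (auto intro!: finsum_closed)
  also have "\<dots> = (\<Oplus>j\<in>T. \<Oplus>i\<in>insert a S. f i j)"
    using insert by (intro finsum_cong') (auto intro!: finsum_closed finsum_insert[symmetric])
  finally show ?case .
qed

text \<open>The discriminant argument behind Cauchy-Schwarz. P stands for the squared modulus of the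
  inner product and occurs twice because the test scalar is t times its conjugate. For b = 0 a
  suitable t would give the value -1 unless P = 0; otherwise t = -1 / b is the minimizer.\<close>

lemma quadratic_nonneg_imp:
  assumes "\<And>t::real. 0 \<le> a + 2 * t * P + t\<^sup>2 * P * b" and "0 \<le> P" and "0 \<le> b"
  shows "P \<le> a * b"
proof (cases "b = 0")
  case True
  show ?thesis
  proof (cases "P = 0")
    case False
    then have "0 \<le> a + 2 * (-(a + 1) / (2 * P)) * P + (-(a + 1) / (2 * P))\<^sup>2 * P * b" using assms(1) by blast
    then show ?thesis using False True by (simp add: field_simps)
  qed (use True in simp)
next
  case False
  then have "0 \<le> a + 2 * (- 1 / b) * P + (- 1 / b)\<^sup>2 * P * b" using assms(1) by blast
  also have "\<dots> = a - P / b" using False by (simp add: power2_eq_square field_simps)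
  finally show ?thesis using False assms(3) by (simp add: field_simps)
qed

locale pos_alg = star_alg A for A :: "('a, 'm) cstar_scheme" (structure) +
  fixes \<phi> :: "'a \<Rightarrow> complex"
  assumes phi_add: "\<lbrakk>a \<in> carrier A; b \<in> carrier A\<rbrakk> \<Longrightarrow> \<phi> (a \<oplus> b) = \<phi> a + \<phi> b"
    and phi_smult: "a \<in> carrier A \<Longrightarrow> \<phi> (z \<odot> a) = z * \<phi> a"
    and phi_adj: "a \<in> carrier A \<Longrightarrow> \<phi> (adj A a) = cnj (\<phi> a)"
    and phi_pos: "a \<in> carrier A \<Longrightarrow> 0 \<le> Re (\<phi> (adj A a \<otimes> a))"
begin

text \<open>The GNS form of \<phi>. It is conjugate-linear in the first argument, the opposite of
  \<open>ell2_inner\<close>.\<close>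

definition ip :: "'a \<Rightarrow> 'a \<Rightarrow> complex" where
  "ip x y = \<phi> (adj A x \<otimes> y)"

definition nn :: "'a \<Rightarrow> real" where
  "nn x = sqrt (Re (ip x x))"

section \<open>The sesquilinear form of a positive functional\<close>

lemma phi_zero [simp]: "\<phi> \<zero> = 0"
  using phi_smult[of \<zero> 0] by simp

lemma phi_minus: "\<lbrakk>a \<in> carrier A; b \<in> carrier A\<rbrakk> \<Longrightarrow> \<phi> (a \<ominus> b) = \<phi> a - \<phi> b"
  by (simp add: minus_eq_smult phi_add phi_smult)

lemma phi_finsum:
  "\<lbrakk>finite S; \<And>i. i \<in> S \<Longrightarrow> f i \<in> carrier A\<rbrakk> \<Longrightarrow> \<phi> (finsum A f S) = (\<Sum>i\<in>S. \<phi> (f i))"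
  by (induction S rule: finite_induct) (simp_all add: Pi_def phi_add)

lemma ip_add_right: "\<lbrakk>x \<in> carrier A; y \<in> carrier A; z \<in> carrier A\<rbrakk> \<Longrightarrow> ip x (y \<oplus> z) = ip x y + ip x z"
  by (simp add: ip_def r_distr phi_add)

lemma ip_add_left: "\<lbrakk>x \<in> carrier A; y \<in> carrier A; z \<in> carrier A\<rbrakk> \<Longrightarrow> ip (x \<oplus> y) z = ip x z + ip y z"
  by (simp add: ip_def adj_add l_distr phi_add)

lemma ip_smult_right: "\<lbrakk>x \<in> carrier A; y \<in> carrier A\<rbrakk> \<Longrightarrow> ip x (c \<odot> y) = c * ip x y"
  by (simp add: ip_def smult_mult_right phi_smult)

lemma ip_smult_left: "\<lbrakk>x \<in> carrier A; y \<in> carrier A\<rbrakk> \<Longrightarrow> ip (c \<odot> x) y = cnj c * ip x y"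
  by (simp add: ip_def smult_mult_left phi_smult adj_smult)

lemma ip_minus_right: "\<lbrakk>x \<in> carrier A; y \<in> carrier A; z \<in> carrier A\<rbrakk> \<Longrightarrow> ip x (y \<ominus> z) = ip x y - ip x z"
  by (simp add: minus_eq_smult ip_add_right ip_smult_right)

lemma ip_cnj: "\<lbrakk>x \<in> carrier A; y \<in> carrier A\<rbrakk> \<Longrightarrow> cnj (ip x y) = ip y x"
  by (simp add: ip_def phi_adj[symmetric] adj_mult)

lemma ip_mult_right: "\<lbrakk>a \<in> carrier A; x \<in> carrier A; y \<in> carrier A\<rbrakk> \<Longrightarrow> ip x (a \<otimes> y) = ip (adj A a \<otimes> x) y"
  by (simp add: ip_def adj_mult m_assoc)

lemma ip_finsum_right:
  "\<lbrakk>finite S; x \<in> carrier A; \<And>i. i \<in> S \<Longrightarrow> f i \<in> carrier A\<rbrakk> \<Longrightarrow> ip x (finsum A f S) = (\<Sum>i\<in>S. ip x (f i))"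
  by (induction S rule: finite_induct) (simp_all add: Pi_def ip_add_right, simp add: ip_def)

lemma ip_finsum_left:
  "\<lbrakk>finite S; x \<in> carrier A; \<And>i. i \<in> S \<Longrightarrow> f i \<in> carrier A\<rbrakk> \<Longrightarrow> ip (finsum A f S) x = (\<Sum>i\<in>S. ip (f i) x)"
  by (induction S rule: finite_induct) (simp_all add: Pi_def ip_add_left, simp add: ip_def)

lemma ip_self_nonneg: "x \<in> carrier A \<Longrightarrow> 0 \<le> Re (ip x x)"
  by (simp add: ip_def phi_pos)

lemma ip_self: "x \<in> carrier A \<Longrightarrow> ip x x = of_real ((nn x)\<^sup>2)"
  using ip_cnj[of x x] ip_self_nonneg[of x] by (simp add: nn_def complex_eq_iff)

lemma nn_sq: "x \<in> carrier A \<Longrightarrow> (nn x)\<^sup>2 = Re (ip x x)"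
  using ip_self_nonneg[of x] by (simp add: nn_def)

lemma nn_nonneg [simp]: "x \<in> carrier A \<Longrightarrow> 0 \<le> nn x"
  using ip_self_nonneg[of x] by (simp add: nn_def)

lemma gram_nonneg:
  assumes "finite Q" and y: "\<And>p. p \<in> Q \<Longrightarrow> y p \<in> carrier A"
  shows "0 \<le> Re (\<Sum>p\<in>Q. \<Sum>q\<in>Q. cnj (c p) * c q * ip (y p) (y q))"
proof -
  let ?v = "\<Oplus>q\<in>Q. c q \<odot> y q"
  have "ip ?v ?v = (\<Sum>p\<in>Q. ip (c p \<odot> y p) ?v)"
    using assms by (intro ip_finsum_left) auto
  also have "\<dots> = (\<Sum>p\<in>Q. \<Sum>q\<in>Q. ip (c p \<odot> y p) (c q \<odot> y q))"
    using assms by (intro sum.cong refl ip_finsum_right) auto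
  also have "\<dots> = (\<Sum>p\<in>Q. \<Sum>q\<in>Q. cnj (c p) * c q * ip (y p) (y q))"
    using y by (intro sum.cong refl) (simp add: ip_smult_left ip_smult_right)
  finally have "ip ?v ?v = \<dots>" .
  moreover have "0 \<le> Re (ip ?v ?v)" using y by (intro ip_self_nonneg) auto
  ultimately show ?thesis by simp
qed

text \<open>Positivity of left multiplication as an operator on the pre-Hilbert space. No
  factorization is demanded; \<open>positive_sqrt\<close> supplies one in the complete case.\<close>

definition positive :: "'a \<Rightarrow> bool" where
  "positive d \<longleftrightarrow> d \<in> carrier A \<and> adj A d = d \<and> (\<forall>x\<in>carrier A. 0 \<le> Re (ip x (d \<otimes> x)))"

lemma positive_cauchy_schwarz:
  assumes "positive d" and [simp]: "x \<in> carrier A" "y \<in> carrier A"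
  shows "(cmod (ip x (d \<otimes> y)))\<^sup>2 \<le> Re (ip x (d \<otimes> x)) * Re (ip y (d \<otimes> y))"
proof -
  have d [simp]: "d \<in> carrier A" "adj A d = d" and pos: "\<And>x. x \<in> carrier A \<Longrightarrow> 0 \<le> Re (ip x (d \<otimes> x))"
    using assms(1) by (auto simp: positive_def)
  define p where "p = ip x (d \<otimes> y)"
  have p': "ip y (d \<otimes> x) = cnj p" by (simp add: p_def ip_cnj ip_mult_right)
  show ?thesis unfolding p_def[symmetric]
  proof (rule quadratic_nonneg_imp)
    fix t :: real
    \<comment> \<open>The conjugate of p makes both cross terms equal to the real number t
      |p|^2.\<close>
    define z where "z = of_real t * cnj p"
    have "0 \<le> Re (ip (x \<oplus> z \<odot> y) (d \<otimes> (x \<oplus> z \<odot> y)))" by (rule pos) simp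
    also have "ip (x \<oplus> z \<odot> y) (d \<otimes> (x \<oplus> z \<odot> y)) =
        ip x (d \<otimes> x) + z * p + cnj z * cnj p + (cnj z * z) * ip y (d \<otimes> y)"
      by (simp add: r_distr ip_add_left ip_add_right ip_smult_left ip_smult_right smult_mult_right p' p_def[symmetric])
        (simp add: algebra_simps)
    also have "z * p = of_real t * (p * cnj p)" by (simp add: z_def)
    also have "cnj z * cnj p = of_real t * (p * cnj p)" by (simp add: z_def)
    also have "cnj z * z = of_real (t\<^sup>2) * (p * cnj p)" by (simp add: z_def power2_eq_square)
    also have "p * cnj p = of_real ((cmod p)\<^sup>2)" by (rule complex_norm_square[symmetric])
    finally show "0 \<le> Re (ip x (d \<otimes> x)) + 2 * t * (cmod p)\<^sup>2 + t\<^sup>2 * (cmod p)\<^sup>2 * Re (ip y (d \<otimes> y))"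
      by simp
  qed (use pos in auto)
qed

lemma positive_one: "positive \<one>"
  by (simp add: positive_def ip_self_nonneg)

lemma cauchy_schwarz:
  assumes [simp]: "x \<in> carrier A" "y \<in> carrier A"
  shows "cmod (ip x y) \<le> nn x * nn y"
proof -
  have "(cmod (ip x y))\<^sup>2 \<le> (nn x * nn y)\<^sup>2"
    using positive_cauchy_schwarz[OF positive_one, of x y] by (simp add: power_mult_distrib nn_sq)
  then show ?thesis by (rule power2_le_imp_le) simp
qed

lemma nn_add:
  assumes [simp]: "x \<in> carrier A" "y \<in> carrier A"
  shows "nn (x \<oplus> y) \<le> nn x + nn y"
proof (rule power2_le_imp_le)
  have "(nn (x \<oplus> y))\<^sup>2 = Re (ip x x) + Re (ip x y) + Re (cnj (ip x y)) + Re (ip y y)"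
    by (simp add: nn_sq ip_add_left ip_add_right ip_cnj)
  also have "\<dots> \<le> (nn x)\<^sup>2 + nn x * nn y + nn x * nn y + (nn y)\<^sup>2"
    using cauchy_schwarz[of x y] complex_Re_le_cmod[of "ip x y"] by (simp add: nn_sq)
  finally show "(nn (x \<oplus> y))\<^sup>2 \<le> (nn x + nn y)\<^sup>2" by (simp add: power2_eq_square algebra_simps)
qed simp

lemma nn_smult:
  assumes [simp]: "x \<in> carrier A"
  shows "nn (c \<odot> x) = cmod c * nn x"
proof -
  have "complex_of_real ((nn (c \<odot> x))\<^sup>2) = (c * cnj c) * ip x x"
    unfolding ip_self[OF smult_closed[OF assms], symmetric] by (simp add: ip_smult_left ip_smult_right)
  also have "\<dots> = of_real ((cmod c * nn x)\<^sup>2)"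
    by (simp add: ip_self complex_norm_square[symmetric] power_mult_distrib)
  finally have "(nn (c \<odot> x))\<^sup>2 = (cmod c * nn x)\<^sup>2" by (simp only: of_real_eq_iff)
  then show ?thesis by (simp add: power2_eq_iff_nonneg)
qed

lemma nn_zero [simp]: "nn \<zero> = 0"
  by (simp add: nn_def ip_def)

lemma nn_le_of_bilinear:
  assumes [simp]: "x \<in> carrier A" and "0 \<le> C" and "cmod (ip x x) \<le> C * nn x"
  shows "nn x \<le> C"
proof (cases "nn x = 0")
  case False
  have "nn x * nn x \<le> C * nn x" using assms by (simp add: ip_self power2_eq_square norm_mult)
  then show ?thesis using False nn_nonneg[of x] by (simp add: less_le)
qed (use assms in simp)

text \<open>C dominates the operator norm of left multiplication by a on the GNS space. The least
  such C is the norm throughout.\<close>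

definition bnd :: "'a \<Rightarrow> real \<Rightarrow> bool" where
  "bnd a C \<longleftrightarrow> (\<forall>x\<in>carrier A. nn (a \<otimes> x) \<le> C * nn x)"

lemma bndD: "bnd a C \<Longrightarrow> x \<in> carrier A \<Longrightarrow> nn (a \<otimes> x) \<le> C * nn x"
  by (simp add: bnd_def)

lemma bnd_mono:
  assumes "bnd a C" and "C \<le> D"
  shows "bnd a D"
  unfolding bnd_def
proof
  fix x assume "x \<in> carrier A"
  then show "nn (a \<otimes> x) \<le> D * nn x"
    using bndD[OF assms(1)] mult_right_mono[OF assms(2), of "nn x"] nn_nonneg[of x] by fastforce
qed

lemma bnd_add:
  assumes "bnd a C" "bnd b D" and [simp]: "a \<in> carrier A" "b \<in> carrier A"
  shows "bnd (a \<oplus> b) (C + D)"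
  unfolding bnd_def
proof
  fix x assume [simp]: "x \<in> carrier A"
  have "nn ((a \<oplus> b) \<otimes> x) \<le> nn (a \<otimes> x) + nn (b \<otimes> x)" by (simp add: l_distr nn_add)
  also have "\<dots> \<le> (C + D) * nn x"
    using bndD[OF assms(1), of x] bndD[OF assms(2), of x] by (simp add: algebra_simps)
  finally show "nn ((a \<oplus> b) \<otimes> x) \<le> (C + D) * nn x" .
qed

lemma bnd_smult: "\<lbrakk>bnd a C; a \<in> carrier A\<rbrakk> \<Longrightarrow> bnd (z \<odot> a) (cmod z * C)"
  unfolding bnd_def by (simp add: smult_mult_left nn_smult mult.assoc mult_left_mono)

lemma bnd_mult:
  assumes "bnd a C" "bnd b D" "0 \<le> C" and [simp]: "a \<in> carrier A" "b \<in> carrier A"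
  shows "bnd (a \<otimes> b) (C * D)"
  unfolding bnd_def
proof
  fix x assume [simp]: "x \<in> carrier A"
  have "nn (a \<otimes> b \<otimes> x) \<le> C * nn (b \<otimes> x)" using bndD[OF assms(1), of "b \<otimes> x"] by (simp add: m_assoc)
  also have "\<dots> \<le> C * (D * nn x)" using bndD[OF assms(2)] assms(3) by (intro mult_left_mono) auto
  finally show "nn (a \<otimes> b \<otimes> x) \<le> C * D * nn x" by simp
qed

text \<open>For y = a^* x the square of |y| is the modulus of the inner product of a y with x, hence
  at most C |y| |x|, and one factor |y| cancels. No completeness of the GNS space is
  involved.\<close>

lemma bnd_adj:
  assumes "bnd a C" "0 \<le> C" and [simp]: "a \<in> carrier A"
  shows "bnd (adj A a) C"
  unfolding bnd_def
proof
  fix x assume [simp]: "x \<in> carrier A"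
  let ?y = "adj A a \<otimes> x"
  have "cmod (ip ?y ?y) = cmod (ip (a \<otimes> ?y) x)" by (simp add: ip_mult_right)
  also have "\<dots> \<le> nn (a \<otimes> ?y) * nn x" by (intro cauchy_schwarz) auto
  also have "\<dots> \<le> (C * nn ?y) * nn x" using bndD[OF assms(1)] by (intro mult_right_mono) auto
  finally show "nn ?y \<le> C * nn x" using assms(2) by (intro nn_le_of_bilinear) (auto simp: mult_ac)
qed

text \<open>The half of the C*-identity that does not follow from submultiplicativity: |a x|^2 is
  the inner product of x with a^* a x.\<close>

lemma bnd_of_adj_mult:
  assumes "bnd (adj A a \<otimes> a) (C\<^sup>2)" "0 \<le> C" and [simp]: "a \<in> carrier A"
  shows "bnd a C"
  unfolding bnd_def
proof
  fix x assume [simp]: "x \<in> carrier A"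
  have "(nn (a \<otimes> x))\<^sup>2 = Re (ip x ((adj A a \<otimes> a) \<otimes> x))"
    by (simp add: nn_sq m_assoc ip_mult_right)
  also have "\<dots> \<le> nn x * nn ((adj A a \<otimes> a) \<otimes> x)"
    by (rule order_trans[OF complex_Re_le_cmod cauchy_schwarz]) auto
  also have "\<dots> \<le> nn x * (C\<^sup>2 * nn x)" using bndD[OF assms(1), of x] by (intro mult_left_mono) auto
  finally have "(nn (a \<otimes> x))\<^sup>2 \<le> (C * nn x)\<^sup>2" by (simp add: power2_eq_square mult_ac)
  then show "nn (a \<otimes> x) \<le> C * nn x" by (rule power2_le_imp_le) (use assms(2) in simp)
qed

text \<open>Cauchy-Schwarz for the form of d, applied to y = d x and x, gives |y|^4 \<le> <y, d y>
  <x, d x> \<le> |y|^2 |x|^2. This takes the place of a spectral argument for 0 \<le> d \<le>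
  1.\<close>

lemma positive_imp_bnd_one:
  assumes "positive d" and le: "\<And>x. x \<in> carrier A \<Longrightarrow> Re (ip x (d \<otimes> x)) \<le> (nn x)\<^sup>2"
  shows "bnd d 1"
  unfolding bnd_def
proof
  fix x assume [simp]: "x \<in> carrier A"
  have [simp]: "d \<in> carrier A" "adj A d = d" using assms(1) by (auto simp: positive_def)
  let ?y = "d \<otimes> x"
  have "((nn ?y)\<^sup>2)\<^sup>2 = (cmod (ip ?y (d \<otimes> x)))\<^sup>2" by (simp add: ip_self norm_power)
  also have "\<dots> \<le> Re (ip ?y (d \<otimes> ?y)) * Re (ip x (d \<otimes> x))" by (rule positive_cauchy_schwarz[OF assms(1)]) auto
  also have "\<dots> \<le> (nn ?y)\<^sup>2 * (nn x)\<^sup>2"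
    using assms(1) le by (intro mult_mono) (auto simp: positive_def)
  finally have "(nn ?y * nn ?y)\<^sup>2 \<le> (nn ?y * nn x)\<^sup>2" by (simp add: power2_eq_square mult_ac)
  then have "nn ?y * nn ?y \<le> nn ?y * nn x" by (rule power2_le_imp_le) simp
  then show "nn ?y \<le> 1 * nn x" using nn_nonneg[of ?y] nn_nonneg[of x] by (cases "nn ?y = 0") (auto simp: less_le)
qed

end

text \<open>One equivalence carries the norm axioms: triangle inequality, submultiplicativity and
  C*-identity are read off from the rules for \<open>bnd\<close>. Definiteness is left out, since
  the completion takes care of it.\<close>

locale gns_alg = pos_alg +
  assumes nrm_nonneg [simp]: "a \<in> carrier A \<Longrightarrow> 0 \<le> nrm A a"
    and nrm_le_iff: "\<lbrakk>a \<in> carrier A; 0 \<le> C\<rbrakk> \<Longrightarrow> nrm A a \<le> C \<longleftrightarrow> bnd a C"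
begin

section \<open>Norm inequalities and the C*-identity\<close>

lemma bnd_nrm: "a \<in> carrier A \<Longrightarrow> bnd a (nrm A a)"
  using nrm_le_iff[of a "nrm A a"] by simp

lemma nn_mult_le: "\<lbrakk>a \<in> carrier A; x \<in> carrier A\<rbrakk> \<Longrightarrow> nn (a \<otimes> x) \<le> nrm A a * nn x"
  using bnd_nrm bndD by blast

lemma nrm_triangle: "\<lbrakk>a \<in> carrier A; b \<in> carrier A\<rbrakk> \<Longrightarrow> nrm A (a \<oplus> b) \<le> nrm A a + nrm A b"
  by (simp add: nrm_le_iff bnd_add bnd_nrm)

lemma nrm_mult: "\<lbrakk>a \<in> carrier A; b \<in> carrier A\<rbrakk> \<Longrightarrow> nrm A (a \<otimes> b) \<le> nrm A a * nrm A b"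
  by (simp add: nrm_le_iff bnd_mult bnd_nrm)

lemma nrm_zero [simp]: "nrm A \<zero> = 0"
  using nrm_le_iff[of \<zero> 0] nrm_nonneg[OF zero_closed] by (intro antisym) (auto simp: bnd_def)

lemma nrm_smult: assumes [simp]: "a \<in> carrier A" shows "nrm A (z \<odot> a) = cmod z * nrm A a"
proof (rule antisym)
  have le: "nrm A (w \<odot> b) \<le> cmod w * nrm A b" if "b \<in> carrier A" for w b
    using that by (simp add: nrm_le_iff bnd_smult bnd_nrm)
  show "nrm A (z \<odot> a) \<le> cmod z * nrm A a" by (rule le) simp
  show "cmod z * nrm A a \<le> nrm A (z \<odot> a)"
  proof (cases "z = 0")
    case False
    then have "nrm A a \<le> cmod (inverse z) * nrm A (z \<odot> a)"
      using le[of "z \<odot> a" "inverse z"] by (simp add: smult_smult[symmetric])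
    then show ?thesis using False by (simp add: norm_divide field_simps)
  qed simp
qed

lemma nrm_adj: "a \<in> carrier A \<Longrightarrow> nrm A (adj A a) = nrm A a"
proof -
  have "nrm A (adj A b) \<le> nrm A b" if "b \<in> carrier A" for b
    using that by (simp add: nrm_le_iff bnd_adj bnd_nrm)
  from this[of a] this[of "adj A a"] show "a \<in> carrier A \<Longrightarrow> ?thesis" by fastforce
qed

lemma nrm_adj_mult: assumes [simp]: "a \<in> carrier A" shows "nrm A (adj A a \<otimes> a) = (nrm A a)\<^sup>2"
proof (rule antisym)
  show "nrm A (adj A a \<otimes> a) \<le> (nrm A a)\<^sup>2"
    using nrm_mult[of "adj A a" a] by (simp add: nrm_adj power2_eq_square)
  have "bnd a (sqrt (nrm A (adj A a \<otimes> a)))"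
    by (rule bnd_of_adj_mult) (simp_all add: bnd_nrm)
  then have "nrm A a \<le> sqrt (nrm A (adj A a \<otimes> a))" by (simp add: nrm_le_iff)
  then have "(nrm A a)\<^sup>2 \<le> (sqrt (nrm A (adj A a \<otimes> a)))\<^sup>2" by (rule power_mono) simp
  then show "(nrm A a)\<^sup>2 \<le> nrm A (adj A a \<otimes> a)" by simp
qed

lemma nrm_minus_commute: "\<lbrakk>a \<in> carrier A; b \<in> carrier A\<rbrakk> \<Longrightarrow> nrm A (a \<ominus> b) = nrm A (b \<ominus> a)"
proof -
  assume [simp]: "a \<in> carrier A" "b \<in> carrier A"
  have "a \<ominus> b = \<ominus> (b \<ominus> a)" using \<open>a \<in> carrier A\<close> \<open>b \<in> carrier A\<close> by algebra
  then have "a \<ominus> b = (-1) \<odot> (b \<ominus> a)" by (simp only: smult_neg_one minus_closed \<open>a \<in> carrier A\<close> \<open>b \<in> carrier A\<close>)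
  then show ?thesis by (simp add: nrm_smult)
qed

lemma nrm_minus_triangle:
  "\<lbrakk>a \<in> carrier A; b \<in> carrier A; c \<in> carrier A\<rbrakk> \<Longrightarrow> nrm A (a \<ominus> c) \<le> nrm A (a \<ominus> b) + nrm A (b \<ominus> c)"
proof -
  assume [simp]: "a \<in> carrier A" "b \<in> carrier A" "c \<in> carrier A"
  have "a \<ominus> c = (a \<ominus> b) \<oplus> (b \<ominus> c)"
    using \<open>a \<in> carrier A\<close> \<open>b \<in> carrier A\<close> \<open>c \<in> carrier A\<close> by algebra
  then show ?thesis by (simp add: nrm_triangle)
qed

lemma nrm_diff_le: "\<lbrakk>a \<in> carrier A; b \<in> carrier A\<rbrakk> \<Longrightarrow> \<bar>nrm A a - nrm A b\<bar> \<le> nrm A (a \<ominus> b)"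
proof -
  assume [simp]: "a \<in> carrier A" "b \<in> carrier A"
  have "a = (a \<ominus> b) \<oplus> b" "b = (b \<ominus> a) \<oplus> a"
    using \<open>a \<in> carrier A\<close> \<open>b \<in> carrier A\<close> by algebra+
  then have "nrm A a \<le> nrm A (a \<ominus> b) + nrm A b" "nrm A b \<le> nrm A (b \<ominus> a) + nrm A a"
    using nrm_triangle[of "a \<ominus> b" b] nrm_triangle[of "b \<ominus> a" a] by simp_all
  then show ?thesis using nrm_minus_commute[of a b] by simp
qed

lemma cmod_phi_le: "a \<in> carrier A \<Longrightarrow> cmod (\<phi> a) \<le> nrm A a * (nn \<one>)\<^sup>2"
  using cauchy_schwarz[of \<one> a] nn_mult_le[of a \<one>] mult_left_mono[of "nn a" "nrm A a * nn \<one>" "nn \<one>"]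
  by (simp add: ip_def power2_eq_square mult_ac)

lemma mult_diff_le:
  assumes [simp]: "a \<in> carrier A" "b \<in> carrier A" "c \<in> carrier A" "d \<in> carrier A"
  shows "nrm A (a \<otimes> b \<ominus> c \<otimes> d) \<le> nrm A (a \<ominus> c) * nrm A b + nrm A c * nrm A (b \<ominus> d)"
proof -
  have "a \<otimes> b \<ominus> c \<otimes> d = (a \<ominus> c) \<otimes> b \<oplus> c \<otimes> (b \<ominus> d)" using assms by algebra
  also have "nrm A \<dots> \<le> nrm A ((a \<ominus> c) \<otimes> b) + nrm A (c \<otimes> (b \<ominus> d))" by (intro nrm_triangle) auto
  also have "\<dots> \<le> nrm A (a \<ominus> c) * nrm A b + nrm A c * nrm A (b \<ominus> d)"
    by (intro add_mono nrm_mult) auto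
  finally show ?thesis .
qed

end

locale complete_gns_alg = gns_alg +
  assumes nrm_eq_0D: "\<lbrakk>a \<in> carrier A; nrm A a = 0\<rbrakk> \<Longrightarrow> a = \<zero>"
    and complete: "nrm_cauchy A s \<Longrightarrow> \<exists>a\<in>carrier A. nrm_tendsto A s a"
begin

lemma cstar_algebra: "cstar_algebra A"
  by unfold_locales
    (auto simp: smult_add_left smult_add_right smult_smult smult_mult_left smult_mult_right adj_add adj_smult
      adj_mult m_assoc l_distr r_distr nrm_smult nrm_triangle nrm_mult nrm_adj_mult complete dest: nrm_eq_0D)

lemma cstar_unital: "cstar_unital A"
  unfolding cstar_unital_def by (rule bexI[of _ \<one>]) auto

lemma nrm_minus_eq_0D: "\<lbrakk>a \<in> carrier A; b \<in> carrier A; nrm A (a \<ominus> b) \<le> 0\<rbrakk> \<Longrightarrow> a = b"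
  using nrm_eq_0D[OF minus_closed] minus_eq_zero_iff antisym[OF _ nrm_nonneg[OF minus_closed]] by simp

text \<open>The square root of \<open>1 - d\<close> is \<open>1 - y\<close> for the limit \<open>y\<close> of the iteration
  \<open>y \<leadsto> (d + y\<^sup>2) / 2\<close>; the increments are dominated by those of the scalar iteration for \<open>d = 1\<close>.\<close>

lemma sqrt_iteration:
  assumes [simp]: "d \<in> carrier A" and "adj A d = d" and "nrm A d \<le> 1"
  shows "\<exists>y\<in>carrier A. adj A y = y \<and> y \<oplus> y = d \<oplus> y \<otimes> y"
proof -
  define Y where "Y = rec_nat \<zero> (\<lambda>_ y. (1/2) \<odot> (d \<oplus> y \<otimes> y))"
  define t where "t = rec_nat (0::real) (\<lambda>_ x. (1 + x\<^sup>2) / 2)"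
  have Y0: "Y 0 = \<zero>" and YS: "Y (Suc k) = (1/2) \<odot> (d \<oplus> Y k \<otimes> Y k)" for k by (simp_all add: Y_def)
  have t0: "t 0 = 0" and tS: "t (Suc k) = (1 + (t k)\<^sup>2) / 2" for k by (simp_all add: t_def)
  have Yc [simp]: "Y k \<in> carrier A" for k by (induction k) (auto simp: Y0 YS)
  have Yadj: "adj A (Y k) = Y k" for k
    by (induction k) (auto simp: Y0 YS adj_add adj_smult adj_mult assms(2))
  have t01: "0 \<le> t k \<and> t k \<le> 1" for k
  proof (induction k)
    case (Suc k)
    then have "(t k)\<^sup>2 \<le> 1" by (simp add: power_le_one)
    then show ?case by (simp add: tS)
  qed (simp add: t0)
  have tmono: "t k \<le> t (Suc k)" for k
  proof -
    have "0 \<le> (1 - t k)\<^sup>2" by simp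
    then show ?thesis by (simp add: tS power2_eq_square algebra_simps)
  qed
  have Yt: "nrm A (Y k) \<le> t k" for k
  proof (induction k)
    case (Suc k)
    have "nrm A (Y (Suc k)) = 1/2 * nrm A (d \<oplus> Y k \<otimes> Y k)" by (simp add: YS nrm_smult)
    also have "nrm A (d \<oplus> Y k \<otimes> Y k) \<le> nrm A d + nrm A (Y k) * nrm A (Y k)"
      using nrm_triangle[of d "Y k \<otimes> Y k"] nrm_mult[of "Y k" "Y k"] by simp
    also have "\<dots> \<le> 1 + t k * t k" using assms(3) Suc t01[of k] by (intro add_mono mult_mono) auto
    finally show ?case by (simp add: tS power2_eq_square)
  qed (simp add: Y0 t0)
  \<comment> \<open>The scalar increment t (k+2) - t (k+1) is exactly half of (t (k+1) - t k) (t
    (k+1) + t k), so the estimate of a difference of squares by \<open>mult_diff_le\<close> is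
    matched term by term.\<close>
  have Ydiff: "nrm A (Y (Suc k) \<ominus> Y k) \<le> t (Suc k) - t k" for k
  proof (induction k)
    case 0
    show ?case using assms(3) Yt[of "Suc 0"] by (simp add: Y0 t0 a_minus_def)
  next
    case (Suc k)
    have "Y (Suc (Suc k)) \<ominus> Y (Suc k) = (1/2) \<odot> ((d \<oplus> Y (Suc k) \<otimes> Y (Suc k)) \<ominus> (d \<oplus> Y k \<otimes> Y k))"
      by (simp add: YS[of "Suc k"] YS[of k] smult_minus)
    also have "(d \<oplus> Y (Suc k) \<otimes> Y (Suc k)) \<ominus> (d \<oplus> Y k \<otimes> Y k) = Y (Suc k) \<otimes> Y (Suc k) \<ominus> Y k \<otimes> Y k"
      using assms(1) Yc[of k] Yc[of "Suc k"] by algebra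
    finally have "nrm A (Y (Suc (Suc k)) \<ominus> Y (Suc k)) = 1/2 * nrm A (Y (Suc k) \<otimes> Y (Suc k) \<ominus> Y k \<otimes> Y k)"
      by (simp add: nrm_smult)
    also have "\<dots> \<le> 1/2 * (nrm A (Y (Suc k) \<ominus> Y k) * nrm A (Y (Suc k)) + nrm A (Y k) * nrm A (Y (Suc k) \<ominus> Y k))"
      using mult_diff_le[of "Y (Suc k)" "Y (Suc k)" "Y k" "Y k"] by simp
    also have "\<dots> \<le> 1/2 * ((t (Suc k) - t k) * t (Suc k) + t k * (t (Suc k) - t k))"
      using Suc Yt t01 tmono[of k] by (intro mult_left_mono add_mono mult_mono) auto
    also have "\<dots> = t (Suc (Suc k)) - t (Suc k)"
      by (simp only: tS[of "Suc k"] tS[of k]) (simp add: power2_eq_square field_simps)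
    finally show ?case .
  qed
  have tmono': "m \<le> n \<Longrightarrow> t m \<le> t n" for m n by (rule lift_Suc_mono_le[of t]) (auto simp: tmono)
  have Ydiff': "nrm A (Y (m + k) \<ominus> Y m) \<le> t (m + k) - t m" for m k
  proof (induction k)
    case (Suc k)
    show ?case using nrm_minus_triangle[of "Y (Suc (m + k))" "Y (m + k)" "Y m"] Suc Ydiff[of "m + k"] by simp
  qed (simp add: a_minus_def r_neg)
  have "convergent t"
    by (rule Bseq_mono_convergent[OF BseqI'[of t 1]]) (use t01 tmono' in auto)
  then have cau: "Cauchy t" by (rule convergent_Cauchy)
  have "nrm_cauchy A Y"
    unfolding nrm_cauchy_def
  proof (intro conjI allI impI)
    fix e :: real assume "e > 0"
    then obtain N where N: "\<And>m n. m \<ge> N \<Longrightarrow> n \<ge> N \<Longrightarrow> \<bar>t m - t n\<bar> < e"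
      using cau unfolding Cauchy_def dist_real_def by meson
    have *: "nrm A (Y m \<ominus> Y n) < e" if "n \<ge> N" "m \<ge> n" for m n
      using Ydiff'[of n "m - n"] N[of m n] that by fastforce
    show "\<exists>N. \<forall>m\<ge>N. \<forall>n\<ge>N. nrm A (Y m \<ominus> Y n) < e"
    proof (intro exI allI impI)
      fix m n assume "m \<ge> N" "n \<ge> N"
      then show "nrm A (Y m \<ominus> Y n) < e"
        using *[of n m] *[of m n] nrm_minus_commute[of "Y m" "Y n"] by (cases "n \<le> m") auto
    qed
  qed simp
  then obtain y where [simp]: "y \<in> carrier A" and "nrm_tendsto A Y y" using complete by blast
  then have lim: "(\<lambda>k. nrm A (Y k \<ominus> y)) \<longlonglongrightarrow> 0" by (simp add: nrm_tendsto_def)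
  have "nrm A (adj A y \<ominus> y) \<le> nrm A (Y k \<ominus> y) + nrm A (Y k \<ominus> y)" for k
  proof -
    have "nrm A (adj A y \<ominus> y) \<le> nrm A (adj A y \<ominus> Y k) + nrm A (Y k \<ominus> y)" by (intro nrm_minus_triangle) auto
    also have "nrm A (adj A y \<ominus> Y k) = nrm A (adj A (y \<ominus> Y k))" by (simp add: adj_minus Yadj)
    also have "\<dots> = nrm A (Y k \<ominus> y)" by (simp add: nrm_adj nrm_minus_commute)
    finally show ?thesis .
  qed
  then have "nrm A (adj A y \<ominus> y) \<le> 0 + 0"
    by (intro LIMSEQ_le_const[OF tendsto_add[OF lim lim]]) auto
  then have "adj A y = y" by (intro nrm_minus_eq_0D) auto
  moreover have "y \<oplus> y = d \<oplus> y \<otimes> y"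
  proof -
    let ?z = "(1/2) \<odot> (d \<oplus> y \<otimes> y)"
    have "nrm A (y \<ominus> ?z) \<le> nrm A (Y (Suc k) \<ominus> y) + 1/2 * (nrm A (Y k \<ominus> y) * 1 + nrm A y * nrm A (Y k \<ominus> y))" for k
    proof -
      have "nrm A (y \<ominus> ?z) \<le> nrm A (y \<ominus> Y (Suc k)) + nrm A (Y (Suc k) \<ominus> ?z)" by (intro nrm_minus_triangle) auto
      also have "Y (Suc k) \<ominus> ?z = (1/2) \<odot> ((d \<oplus> Y k \<otimes> Y k) \<ominus> (d \<oplus> y \<otimes> y))" by (simp add: YS smult_minus)
      also have "(d \<oplus> Y k \<otimes> Y k) \<ominus> (d \<oplus> y \<otimes> y) = Y k \<otimes> Y k \<ominus> y \<otimes> y"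
        using assms(1) Yc[of k] \<open>y \<in> carrier A\<close> by algebra
      also have "nrm A ((1/2) \<odot> (Y k \<otimes> Y k \<ominus> y \<otimes> y)) = 1/2 * nrm A (Y k \<otimes> Y k \<ominus> y \<otimes> y)" by (simp add: nrm_smult)
      also have "\<dots> \<le> 1/2 * (nrm A (Y k \<ominus> y) * nrm A (Y k) + nrm A y * nrm A (Y k \<ominus> y))"
        using mult_diff_le[of "Y k" "Y k" y y] by simp
      also have "nrm A (Y k \<ominus> y) * nrm A (Y k) \<le> nrm A (Y k \<ominus> y) * 1"
        using Yt[of k] t01[of k] by (intro mult_left_mono) auto
      finally show ?thesis using nrm_minus_commute[of y "Y (Suc k)"] by simp
    qed
    moreover have "(\<lambda>k. nrm A (Y (Suc k) \<ominus> y) + 1/2 * (nrm A (Y k \<ominus> y) * 1 + nrm A y * nrm A (Y k \<ominus> y))) \<longlonglongrightarrow>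
        0 + 1/2 * (0 * 1 + nrm A y * 0)"
      by (intro tendsto_intros lim LIMSEQ_Suc)
    ultimately have "nrm A (y \<ominus> ?z) \<le> 0 + 1/2 * (0 * 1 + nrm A y * 0)" by (intro LIMSEQ_le_const) auto
    then have "y = ?z" by (intro nrm_minus_eq_0D) auto
    then have "y \<oplus> y = ?z \<oplus> ?z" by simp
    also have "\<dots> = d \<oplus> y \<otimes> y" by (simp add: smult_add_left[symmetric])
    finally show ?thesis .
  qed
  ultimately show ?thesis by (intro bexI[of _ y]) auto
qed

text \<open>The form of d = 1 - a / R lies between 0 and the square of the seminorm, so d has norm
  at most 1 and the iteration applies. Its fixed point equation 2 y = d + y^2 says (1 - y)^2 = 1 - d
  = a / R, and multiplying 1 - y by the root of R gives the root of a.\<close>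

lemma positive_sqrt:
  assumes "positive a"
  shows "\<exists>z\<in>carrier A. adj A z = z \<and> z \<otimes> z = a"
proof -
  have a [simp]: "a \<in> carrier A" "adj A a = a" and pos: "\<And>x. x \<in> carrier A \<Longrightarrow> 0 \<le> Re (ip x (a \<otimes> x))"
    using assms by (auto simp: positive_def)
  \<comment> \<open>The summand 1 keeps R positive when a has norm zero.\<close>
  define R where "R = nrm A a + 1"
  have R: "R > 0" unfolding R_def using nrm_nonneg[OF a(1)] by linarith
  define r where "r = complex_of_real (1 / R)"
  define d where "d = \<one> \<ominus> r \<odot> a"
  have [simp]: "d \<in> carrier A" by (simp add: d_def)
  have form: "ip x (d \<otimes> x) = ip x x - of_real (1 / R) * ip x (a \<otimes> x)" if [simp]: "x \<in> carrier A" for x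
  proof -
    have "d \<otimes> x = x \<ominus> r \<odot> (a \<otimes> x)"
      unfolding d_def smult_mult_left[OF a(1) that, symmetric] using that smult_closed[OF a(1), of r] by algebra
    then show ?thesis by (simp add: ip_minus_right ip_smult_right r_def)
  qed
  have "bnd d 1"
  proof (rule positive_imp_bnd_one)
    have "adj A d = d" by (simp add: d_def adj_minus adj_smult r_def)
    moreover have "0 \<le> Re (ip x (d \<otimes> x))" if [simp]: "x \<in> carrier A" for x
    proof -
      have "Re (ip x (a \<otimes> x)) \<le> nn x * nn (a \<otimes> x)"
        by (rule order_trans[OF complex_Re_le_cmod cauchy_schwarz]) auto
      also have "\<dots> \<le> nn x * (R * nn x)"
      proof (rule mult_left_mono)
        show "nn (a \<otimes> x) \<le> R * nn x"
          unfolding R_def distrib_right using nn_mult_le[OF a(1) that] nn_nonneg[OF that] by linarith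
      qed simp
      finally show ?thesis using R by (simp add: form nn_sq[symmetric] field_simps power2_eq_square)
    qed
    ultimately show "positive d" by (simp add: positive_def)
    show "Re (ip x (d \<otimes> x)) \<le> (nn x)\<^sup>2" if "x \<in> carrier A" for x
      using pos[OF that] that R by (simp add: form nn_sq)
  qed
  then have "nrm A d \<le> 1" by (simp add: nrm_le_iff)
  then obtain y where y [simp]: "y \<in> carrier A" "adj A y = y" and eq: "y \<oplus> y = d \<oplus> y \<otimes> y"
    using sqrt_iteration[of d] by (auto simp: d_def adj_minus adj_smult r_def)
  have "(\<one> \<ominus> y) \<otimes> (\<one> \<ominus> y) = \<one> \<ominus> (y \<oplus> y) \<oplus> y \<otimes> y"
    using y(1) by (simp add: a_minus_def l_distr r_distr l_minus r_minus minus_add a_ac)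
  also have "\<dots> = \<one> \<ominus> d" unfolding eq using y(1) \<open>d \<in> carrier A\<close> by algebra
  also have "\<dots> = r \<odot> a"
    unfolding d_def using smult_closed[OF a(1), of r] by algebra
  finally have sq: "(\<one> \<ominus> y) \<otimes> (\<one> \<ominus> y) = r \<odot> a" .
  let ?z = "of_real (sqrt R) \<odot> (\<one> \<ominus> y)"
  have "?z \<otimes> ?z = (of_real (sqrt R) * of_real (sqrt R)) \<odot> ((\<one> \<ominus> y) \<otimes> (\<one> \<ominus> y))"
    by (simp add: smult_mult_left smult_mult_right smult_smult)
  also have "\<dots> = (of_real (sqrt R * sqrt R) * r) \<odot> a" by (simp add: sq smult_smult del: real_sqrt_mult_self)
  also have "\<dots> = a" using R by (simp add: r_def flip: of_real_mult)
  finally show ?thesis by (intro bexI[of _ ?z]) (auto simp: adj_smult adj_minus)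
qed

end

section \<open>Matrices and completely positive maps\<close>

text \<open>The norm is a parameter: the same algebra carries the concrete operator norm of
  \<open>matrix_algebra\<close> and the abstract norm \<open>mat_nrm\<close>. Entries outside the n
  by n block vanish, so that equal matrices are equal functions.\<close>

definition mat_alg :: "nat \<Rightarrow> ('a, 'm) cstar_scheme \<Rightarrow> ((nat \<Rightarrow> nat \<Rightarrow> 'a) \<Rightarrow> real) \<Rightarrow> (nat \<Rightarrow> nat \<Rightarrow> 'a) cstar" where
  "mat_alg n A \<nu> =
    \<lparr>carrier = {M. (\<forall>i<n. \<forall>j<n. M i j \<in> carrier A) \<and> (\<forall>i j. i \<ge> n \<or> j \<ge> n \<longrightarrow> M i j = \<zero>\<^bsub>A\<^esub>)},
     Group.monoid.mult = (\<lambda>M N i j. finsum A (\<lambda>l. M i l \<otimes>\<^bsub>A\<^esub> N l j) {..<n}),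
     monoid.one = (\<lambda>i j. if i = j \<and> i < n then \<one>\<^bsub>A\<^esub> else \<zero>\<^bsub>A\<^esub>),
     ring.zero = (\<lambda>i j. \<zero>\<^bsub>A\<^esub>),
     ring.add = (\<lambda>M N i j. M i j \<oplus>\<^bsub>A\<^esub> N i j),
     module.smult = (\<lambda>z M i j. z \<odot>\<^bsub>A\<^esub> M i j),
     adj = (\<lambda>M i j. adj A (M j i)),
     nrm = \<nu>\<rparr>"

lemma mat_alg_sel [simp]:
  "Group.monoid.mult (mat_alg n A \<nu>) = (\<lambda>M N i j. finsum A (\<lambda>l. M i l \<otimes>\<^bsub>A\<^esub> N l j) {..<n})"
  "monoid.one (mat_alg n A \<nu>) = (\<lambda>i j. if i = j \<and> i < n then \<one>\<^bsub>A\<^esub> else \<zero>\<^bsub>A\<^esub>)"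
  "ring.zero (mat_alg n A \<nu>) = (\<lambda>i j. \<zero>\<^bsub>A\<^esub>)"
  "ring.add (mat_alg n A \<nu>) = (\<lambda>M N i j. M i j \<oplus>\<^bsub>A\<^esub> N i j)"
  "module.smult (mat_alg n A \<nu>) = (\<lambda>z M i j. z \<odot>\<^bsub>A\<^esub> M i j)"
  "adj (mat_alg n A \<nu>) = (\<lambda>M i j. adj A (M j i))"
  "nrm (mat_alg n A \<nu>) = \<nu>"
  by (simp_all add: mat_alg_def)

section \<open>Matrices over a *-algebra\<close>

lemma (in star_alg) mat_carrierI:
  "\<lbrakk>\<And>i j. i < n \<Longrightarrow> j < n \<Longrightarrow> M i j \<in> carrier A; \<And>i j. i \<ge> n \<or> j \<ge> n \<Longrightarrow> M i j = \<zero>\<rbrakk> \<Longrightarrow> M \<in> carrier (mat_alg n A \<nu>)"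
  by (simp add: mat_alg_def)

lemma (in star_alg) mat_carrierD:
  assumes "M \<in> carrier (mat_alg n A \<nu>)"
  shows "M i j \<in> carrier A" and "i \<ge> n \<or> j \<ge> n \<Longrightarrow> M i j = \<zero>"
  using assms by (cases "i < n \<and> j < n"; auto simp: mat_alg_def)+

lemma (in star_alg) finsum_delta_left:
  fixes n :: nat
  assumes "i < n" and "\<And>l. l < n \<Longrightarrow> f l \<in> carrier A"
  shows "(\<Oplus>l\<in>{..<n}. (if i = l \<and> i < n then \<one> else \<zero>) \<otimes> f l) = f i"
proof -
  have "(\<Oplus>l\<in>{..<n}. (if i = l \<and> i < n then \<one> else \<zero>) \<otimes> f l) = (\<Oplus>l\<in>{..<n}. if i = l then f l else \<zero>)"
    using assms by (intro finsum_cong') auto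
  also have "\<dots> = f i" using assms by (intro finsum_singleton) auto
  finally show ?thesis .
qed

lemma (in star_alg) finsum_delta_right:
  fixes n :: nat
  assumes "i < n" and "\<And>l. l < n \<Longrightarrow> f l \<in> carrier A"
  shows "(\<Oplus>l\<in>{..<n}. f l \<otimes> (if l = i \<and> l < n then \<one> else \<zero>)) = f i"
proof -
  have "(\<Oplus>l\<in>{..<n}. f l \<otimes> (if l = i \<and> l < n then \<one> else \<zero>)) = (\<Oplus>l\<in>{..<n}. if i = l then f l else \<zero>)"
    using assms by (intro finsum_cong') auto
  also have "\<dots> = f i" using assms by (intro finsum_singleton) auto
  finally show ?thesis .
qed

lemma (in star_alg) finsum_all_zero: "(\<And>l. l \<in> S \<Longrightarrow> f l = \<zero>) \<Longrightarrow> finsum A f S = \<zero>"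
proof -
  assume "\<And>l. l \<in> S \<Longrightarrow> f l = \<zero>"
  then have "finsum A f S = (\<Oplus>l\<in>S. \<zero>)" by (intro finsum_cong') auto
  then show ?thesis by (simp add: finsum_zero)
qed

lemma (in star_alg) star_alg_mat: "star_alg (mat_alg n A \<nu>)"
proof -
  let ?M = "mat_alg n A \<nu>"
  note car = mat_carrierD(1)[where n = n and \<nu> = \<nu>]
  have mult_car: "X \<otimes>\<^bsub>?M\<^esub> Y \<in> carrier ?M" if "X \<in> carrier ?M" "Y \<in> carrier ?M" for X Y
    using that by (intro mat_carrierI) (auto simp: car mat_carrierD(2) intro!: finsum_all_zero)
  have add_grp: "abelian_group ?M"
  proof (rule abelian_groupI)
    fix X assume X: "X \<in> carrier ?M"
    show "\<exists>Y\<in>carrier ?M. Y \<oplus>\<^bsub>?M\<^esub> X = \<zero>\<^bsub>?M\<^esub>"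
      using X by (intro bexI[of _ "\<lambda>i j. \<ominus> X i j"] mat_carrierI)
        (auto simp: car l_neg mat_carrierD(2))
  qed (auto intro!: mat_carrierI simp: car mat_carrierD(2) a_assoc fun_eq_iff intro: a_comm)
  have mon: "monoid ?M"
  proof (rule monoidI)
    show "\<one>\<^bsub>?M\<^esub> \<in> carrier ?M" by (rule mat_carrierI) auto
  next
    fix X assume X: "X \<in> carrier ?M"
    show "\<one>\<^bsub>?M\<^esub> \<otimes>\<^bsub>?M\<^esub> X = X"
    proof (intro ext)
      fix i j show "(\<one>\<^bsub>?M\<^esub> \<otimes>\<^bsub>?M\<^esub> X) i j = X i j"
        using X finsum_delta_left[of i n "\<lambda>l. X l j"]
        by (cases "i < n") (auto simp: car mat_carrierD(2) intro!: finsum_all_zero)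
    qed
    show "X \<otimes>\<^bsub>?M\<^esub> \<one>\<^bsub>?M\<^esub> = X"
    proof (intro ext)
      fix i j show "(X \<otimes>\<^bsub>?M\<^esub> \<one>\<^bsub>?M\<^esub>) i j = X i j"
        using X finsum_delta_right[of j n "\<lambda>l. X i l"]
        by (cases "j < n") (auto simp: car mat_carrierD(2) intro!: finsum_all_zero)
    qed
  next
    fix X Y Z assume XYZ: "X \<in> carrier ?M" "Y \<in> carrier ?M" "Z \<in> carrier ?M"
    show "X \<otimes>\<^bsub>?M\<^esub> Y \<otimes>\<^bsub>?M\<^esub> Z = X \<otimes>\<^bsub>?M\<^esub> (Y \<otimes>\<^bsub>?M\<^esub> Z)"
    proof (intro ext)
      fix i j
      have "(X \<otimes>\<^bsub>?M\<^esub> Y \<otimes>\<^bsub>?M\<^esub> Z) i j = (\<Oplus>l\<in>{..<n}. \<Oplus>k\<in>{..<n}. X i k \<otimes> Y k l \<otimes> Z l j)"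
        using XYZ by (auto simp: car intro!: finsum_cong' finsum_ldistr)
      also have "\<dots> = (\<Oplus>k\<in>{..<n}. \<Oplus>l\<in>{..<n}. X i k \<otimes> Y k l \<otimes> Z l j)"
        using XYZ by (intro finsum_swap) (auto simp: car)
      also have "\<dots> = (\<Oplus>k\<in>{..<n}. X i k \<otimes> (\<Oplus>l\<in>{..<n}. Y k l \<otimes> Z l j))"
        using XYZ by (intro finsum_cong' refl) (auto simp: car finsum_rdistr m_assoc intro!: finsum_cong')
      finally show "(X \<otimes>\<^bsub>?M\<^esub> Y \<otimes>\<^bsub>?M\<^esub> Z) i j = (X \<otimes>\<^bsub>?M\<^esub> (Y \<otimes>\<^bsub>?M\<^esub> Z)) i j" by simp
    qed
  qed (rule mult_car)
  have "ring ?M"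
  proof (rule ringI[OF add_grp mon])
    fix X Y Z assume XYZ: "X \<in> carrier ?M" "Y \<in> carrier ?M" "Z \<in> carrier ?M"
    have "(\<Oplus>l\<in>{..<n}. (X i l \<oplus> Y i l) \<otimes> Z l j) = (\<Oplus>l\<in>{..<n}. X i l \<otimes> Z l j) \<oplus> (\<Oplus>l\<in>{..<n}. Y i l \<otimes> Z l j)" for i j
      using XYZ by (subst finsum_addf[symmetric]) (auto simp: car l_distr)
    then show "(X \<oplus>\<^bsub>?M\<^esub> Y) \<otimes>\<^bsub>?M\<^esub> Z = X \<otimes>\<^bsub>?M\<^esub> Z \<oplus>\<^bsub>?M\<^esub> Y \<otimes>\<^bsub>?M\<^esub> Z" by simp
    have "(\<Oplus>l\<in>{..<n}. Z i l \<otimes> (X l j \<oplus> Y l j)) = (\<Oplus>l\<in>{..<n}. Z i l \<otimes> X l j) \<oplus> (\<Oplus>l\<in>{..<n}. Z i l \<otimes> Y l j)" for i j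
      using XYZ by (subst finsum_addf[symmetric]) (auto simp: car r_distr)
    then show "Z \<otimes>\<^bsub>?M\<^esub> (X \<oplus>\<^bsub>?M\<^esub> Y) = Z \<otimes>\<^bsub>?M\<^esub> X \<oplus>\<^bsub>?M\<^esub> Z \<otimes>\<^bsub>?M\<^esub> Y" by simp
  qed
  then show ?thesis
  proof (rule star_alg.intro, unfold_locales)
    fix X Y :: "nat \<Rightarrow> nat \<Rightarrow> 'a" and z w :: complex
    assume X: "X \<in> carrier ?M"
    show "z \<odot>\<^bsub>?M\<^esub> X \<in> carrier ?M" using X by (intro mat_carrierI) (auto simp: car mat_carrierD(2))
    show "(z + w) \<odot>\<^bsub>?M\<^esub> X = z \<odot>\<^bsub>?M\<^esub> X \<oplus>\<^bsub>?M\<^esub> w \<odot>\<^bsub>?M\<^esub> X" using X by (simp add: car smult_add_left)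
    show "(z * w) \<odot>\<^bsub>?M\<^esub> X = z \<odot>\<^bsub>?M\<^esub> (w \<odot>\<^bsub>?M\<^esub> X)" using X by (simp add: car smult_smult)
    show "1 \<odot>\<^bsub>?M\<^esub> X = X" using X by (simp add: car)
    show "adj ?M X \<in> carrier ?M" using X by (intro mat_carrierI) (auto simp: car mat_carrierD(2))
    show "adj ?M (adj ?M X) = X" using X by (simp add: car)
    show "adj ?M (z \<odot>\<^bsub>?M\<^esub> X) = cnj z \<odot>\<^bsub>?M\<^esub> adj ?M X" using X by (simp add: car adj_smult)
    assume Y: "Y \<in> carrier ?M"
    show "z \<odot>\<^bsub>?M\<^esub> (X \<oplus>\<^bsub>?M\<^esub> Y) = z \<odot>\<^bsub>?M\<^esub> X \<oplus>\<^bsub>?M\<^esub> z \<odot>\<^bsub>?M\<^esub> Y" using X Y by (simp add: car smult_add_right)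
    show "z \<odot>\<^bsub>?M\<^esub> X \<otimes>\<^bsub>?M\<^esub> Y = z \<odot>\<^bsub>?M\<^esub> (X \<otimes>\<^bsub>?M\<^esub> Y)"
      using X Y by (auto simp: fun_eq_iff car smult_mult_left smult_finsum intro!: finsum_cong')
    show "X \<otimes>\<^bsub>?M\<^esub> (z \<odot>\<^bsub>?M\<^esub> Y) = z \<odot>\<^bsub>?M\<^esub> (X \<otimes>\<^bsub>?M\<^esub> Y)"
      using X Y by (auto simp: fun_eq_iff car smult_mult_right smult_finsum intro!: finsum_cong')
    show "adj ?M (X \<oplus>\<^bsub>?M\<^esub> Y) = adj ?M X \<oplus>\<^bsub>?M\<^esub> adj ?M Y" using X Y by (simp add: car adj_add)
    show "adj ?M (X \<otimes>\<^bsub>?M\<^esub> Y) = adj ?M Y \<otimes>\<^bsub>?M\<^esub> adj ?M X"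
      using X Y by (auto simp: fun_eq_iff car adj_mult adj_finsum intro!: finsum_cong')
  qed
qed

text \<open>The unnormalized trace followed by \<phi>. Its form adds up the forms of all entries, so
  left multiplication acts on every column separately.\<close>

definition mat_phi :: "nat \<Rightarrow> ('a \<Rightarrow> complex) \<Rightarrow> (nat \<Rightarrow> nat \<Rightarrow> 'a) \<Rightarrow> complex" where
  "mat_phi n \<phi> M = (\<Sum>i<n. \<phi> (M i i))"

context pos_alg
begin

lemma mat_phi_adj_mult:
  assumes X: "X \<in> carrier (mat_alg n A \<nu>)" and Y: "Y \<in> carrier (mat_alg n A \<nu>)"
  shows "mat_phi n \<phi> (adj (mat_alg n A \<nu>) X \<otimes>\<^bsub>mat_alg n A \<nu>\<^esub> Y) = (\<Sum>c<n. \<Sum>i<n. ip (X i c) (Y i c))"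
  unfolding mat_phi_def using assms
  by (auto intro!: sum.cong simp: phi_finsum mat_carrierD ip_def)

lemma pos_alg_mat: "pos_alg (mat_alg n A \<nu>) (mat_phi n \<phi>)"
proof (intro pos_alg.intro star_alg_mat pos_alg_axioms.intro)
  fix X assume X: "X \<in> carrier (mat_alg n A \<nu>)"
  show "mat_phi n \<phi> (z \<odot>\<^bsub>mat_alg n A \<nu>\<^esub> X) = z * mat_phi n \<phi> X" for z
    using X by (simp add: mat_phi_def mat_carrierD phi_smult sum_distrib_left)
  show "mat_phi n \<phi> (adj (mat_alg n A \<nu>) X) = cnj (mat_phi n \<phi> X)"
    using X by (simp add: mat_phi_def mat_carrierD phi_adj)
  show "0 \<le> Re (mat_phi n \<phi> (adj (mat_alg n A \<nu>) X \<otimes>\<^bsub>mat_alg n A \<nu>\<^esub> X))"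
    unfolding mat_phi_adj_mult[OF X X] using X by (auto intro!: sum_nonneg ip_self_nonneg simp: mat_carrierD)
  show "mat_phi n \<phi> (X \<oplus>\<^bsub>mat_alg n A \<nu>\<^esub> Y) = mat_phi n \<phi> X + mat_phi n \<phi> Y"
    if "Y \<in> carrier (mat_alg n A \<nu>)" for Y
    using X that by (simp add: mat_phi_def mat_carrierD phi_add sum.distrib)
qed

lemma nn_finsum:
  "\<lbrakk>finite S; \<And>i. i \<in> S \<Longrightarrow> f i \<in> carrier A\<rbrakk> \<Longrightarrow> nn (finsum A f S) \<le> (\<Sum>i\<in>S. nn (f i))"
proof (induction S rule: finite_induct)
  case (insert a S)
  then have "nn (finsum A f (insert a S)) \<le> nn (f a) + nn (finsum A f S)"
    by (simp add: Pi_def nn_add)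
  then show ?case using insert by fastforce
qed simp

lemma mat_ip:
  "\<lbrakk>X \<in> carrier (mat_alg n A \<nu>); Y \<in> carrier (mat_alg n A \<nu>)\<rbrakk> \<Longrightarrow>
    pos_alg.ip (mat_alg n A \<nu>) (mat_phi n \<phi>) X Y = (\<Sum>c<n. \<Sum>i<n. ip (X i c) (Y i c))"
  using mat_phi_adj_mult[of X n \<nu> Y] by (simp add: pos_alg.ip_def[OF pos_alg_mat])

lemma mat_nn_sq:
  assumes "X \<in> carrier (mat_alg n A \<nu>)"
  shows "(pos_alg.nn (mat_alg n A \<nu>) (mat_phi n \<phi>) X)\<^sup>2 = (\<Sum>c<n. \<Sum>i<n. (nn (X i c))\<^sup>2)"
  using assms by (simp add: pos_alg.nn_sq[OF pos_alg_mat] mat_ip nn_sq mat_carrierD)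

text \<open>Bounds ignore the norm slot. This removes the circularity in defining the norm of a
  matrix algebra by bounds taken in that same algebra.\<close>

lemma mat_bnd_cong:
  "pos_alg.bnd (mat_alg n A \<nu>) (mat_phi n \<phi>) M C \<longleftrightarrow> pos_alg.bnd (mat_alg n A \<nu>') (mat_phi n \<phi>) M C"
  unfolding pos_alg.bnd_def[OF pos_alg_mat] pos_alg.nn_def[OF pos_alg_mat] pos_alg.ip_def[OF pos_alg_mat]
  by (simp add: mat_alg_def)

lemma nn_entry_le:
  assumes X: "X \<in> carrier (mat_alg n A \<nu>)" and "i < n" "c < n"
  shows "nn (X i c) \<le> pos_alg.nn (mat_alg n A \<nu>) (mat_phi n \<phi>) X"
proof (rule power2_le_imp_le)
  have "(nn (X i c))\<^sup>2 \<le> (\<Sum>i<n. (nn (X i c))\<^sup>2)" using assms by (intro member_le_sum) auto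
  also have "\<dots> \<le> (\<Sum>c<n. \<Sum>i<n. (nn (X i c))\<^sup>2)"
    using assms by (intro member_le_sum[of c "{..<n}" "\<lambda>c. \<Sum>i<n. (nn (X i c))\<^sup>2"]) (auto intro: sum_nonneg)
  finally show "(nn (X i c))\<^sup>2 \<le> (pos_alg.nn (mat_alg n A \<nu>) (mat_phi n \<phi>) X)\<^sup>2" by (simp add: mat_nn_sq[OF X])
qed (use X pos_alg.nn_nonneg[OF pos_alg_mat] in auto)

end

context gns_alg
begin

text \<open>A crude estimate: each of the n^2 entries of the product has seminorm at most b |X|,
  with b the sum of all entry norms, and summing n^2 squares yields the factor n. It serves to show
  that bounds exist and that entrywise limits are limits in norm.\<close>

lemma mat_bnd:
  assumes M: "M \<in> carrier (mat_alg n A \<nu>)"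
  shows "pos_alg.bnd (mat_alg n A \<nu>) (mat_phi n \<phi>) M (real n * (\<Sum>i<n. \<Sum>j<n. nrm A (M i j)))"
  unfolding pos_alg.bnd_def[OF pos_alg_mat]
proof
  interpret M: pos_alg "mat_alg n A \<nu>" "mat_phi n \<phi>" by (rule pos_alg_mat)
  fix X assume X: "X \<in> carrier (mat_alg n A \<nu>)"
  note [simp] = mat_carrierD(1)[OF M] mat_carrierD(1)[OF X]
  let ?N = "M.nn X" and ?b = "\<Sum>i<n. \<Sum>j<n. nrm A (M i j)"
  have b: "0 \<le> ?b" by (intro sum_nonneg) auto
  have entry: "nn (\<Oplus>j\<in>{..<n}. M i j \<otimes> X j c) \<le> ?b * ?N" if "i < n" "c < n" for i c
  proof -
    have "nn (\<Oplus>j\<in>{..<n}. M i j \<otimes> X j c) \<le> (\<Sum>j<n. nn (M i j \<otimes> X j c))" by (intro nn_finsum) auto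
    also have "\<dots> \<le> (\<Sum>j<n. nrm A (M i j) * ?N)"
    proof (rule sum_mono)
      fix j assume "j \<in> {..<n}"
      have "nn (M i j \<otimes> X j c) \<le> nrm A (M i j) * nn (X j c)" by (rule nn_mult_le) auto
      also have "\<dots> \<le> nrm A (M i j) * ?N"
        using nn_entry_le[OF X] \<open>j \<in> {..<n}\<close> that by (intro mult_left_mono) auto
      finally show "nn (M i j \<otimes> X j c) \<le> nrm A (M i j) * ?N" .
    qed
    also have "\<dots> = (\<Sum>j<n. nrm A (M i j)) * ?N" by (simp add: sum_distrib_right)
    also have "\<dots> \<le> ?b * ?N"
      using that X by (intro mult_right_mono member_le_sum[of i "{..<n}" "\<lambda>i. \<Sum>j<n. nrm A (M i j)"]) (auto intro: sum_nonneg)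
    finally show ?thesis .
  qed
  have "(M.nn (M \<otimes>\<^bsub>mat_alg n A \<nu>\<^esub> X))\<^sup>2 = (\<Sum>c<n. \<Sum>i<n. (nn (\<Oplus>j\<in>{..<n}. M i j \<otimes> X j c))\<^sup>2)"
    using mat_nn_sq[OF M.m_closed[OF M X]] by simp
  also have "\<dots> \<le> (\<Sum>c<n. \<Sum>i<n. (?b * ?N)\<^sup>2)"
    by (intro sum_mono power_mono entry) auto
  also have "\<dots> = (real n * ?b * ?N)\<^sup>2" by (simp add: power2_eq_square mult_ac)
  finally show "M.nn (M \<otimes>\<^bsub>mat_alg n A \<nu>\<^esub> X) \<le> real n * ?b * ?N"
    by (rule power2_le_imp_le) (use X b in auto)
qed

text \<open>Test on the matrix whose only nonzero entry is x at (j, 0): its seminorm is that of x,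
  and the product with M has the entry M i j x at (i, 0).\<close>

lemma mat_entry_bnd:
  assumes M: "M \<in> carrier (mat_alg n A \<nu>)" and ij: "i < n" "j < n"
    and bnd: "pos_alg.bnd (mat_alg n A \<nu>) (mat_phi n \<phi>) M C" and "0 \<le> C"
  shows "nrm A (M i j) \<le> C"
  unfolding nrm_le_iff[OF mat_carrierD(1)[OF M] \<open>0 \<le> C\<close>] bnd_def
proof
  interpret M: pos_alg "mat_alg n A \<nu>" "mat_phi n \<phi>" by (rule pos_alg_mat)
  fix x assume x [simp]: "x \<in> carrier A"
  note [simp] = mat_carrierD(1)[OF M]
  define X :: "nat \<Rightarrow> nat \<Rightarrow> 'a" where "X = (\<lambda>k c. if k = j \<and> c = 0 then x else \<zero>)"
  have X: "X \<in> carrier (mat_alg n A \<nu>)" using ij by (intro mat_carrierI) (auto simp: X_def)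
  have "(M.nn X)\<^sup>2 = (\<Sum>c<n. \<Sum>k<n. if k = j \<and> c = 0 then (nn x)\<^sup>2 else 0)"
    unfolding mat_nn_sq[OF X] by (intro sum.cong refl) (auto simp: X_def)
  also have "\<dots> = (\<Sum>c<n. if c = 0 then (nn x)\<^sup>2 else 0)"
    using ij by (intro sum.cong refl) (simp add: sum.delta)
  also have "\<dots> = (nn x)\<^sup>2" using ij by (simp add: sum.delta)
  finally have nX: "M.nn X = nn x" using X by (simp add: power2_eq_iff_nonneg)
  have "(M \<otimes>\<^bsub>mat_alg n A \<nu>\<^esub> X) i 0 = (\<Oplus>l\<in>{..<n}. if j = l then M i l \<otimes> x else \<zero>)"
    by (auto simp: X_def intro!: finsum_cong')
  also have "\<dots> = M i j \<otimes> x" using ij by (intro finsum_singleton) auto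
  finally have "nn (M i j \<otimes> x) \<le> M.nn (M \<otimes>\<^bsub>mat_alg n A \<nu>\<^esub> X)"
    using nn_entry_le[OF M.m_closed[OF M X], of i 0] ij by simp
  also have "\<dots> \<le> C * nn x" using M.bndD[OF bnd X] nX by simp
  finally show "nn (M i j \<otimes> x) \<le> C * nn x" .
qed

text \<open>The zero norm is a placeholder, harmless by \<open>mat_bnd_cong\<close>.\<close>

definition mat_nrm :: "nat \<Rightarrow> (nat \<Rightarrow> nat \<Rightarrow> 'a) \<Rightarrow> real" where
  "mat_nrm n M = Inf {C. 0 \<le> C \<and> pos_alg.bnd (mat_alg n A (\<lambda>_. 0)) (mat_phi n \<phi>) M C}"

lemma gns_alg_mat: "gns_alg (mat_alg n A (mat_nrm n)) (mat_phi n \<phi>)"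
proof (intro gns_alg.intro pos_alg_mat gns_alg_axioms.intro)
  let ?M = "mat_alg n A (mat_nrm n)"
  interpret M: pos_alg ?M "mat_phi n \<phi>" by (rule pos_alg_mat)
  fix X assume X: "X \<in> carrier ?M"
  define S where "S = {C. 0 \<le> C \<and> M.bnd X C}"
  have nrm: "nrm ?M X = Inf S"
    unfolding S_def mat_bnd_cong[where \<nu> = "mat_nrm n" and \<nu>' = "\<lambda>_. 0"] by (simp add: mat_nrm_def)
  have "real n * (\<Sum>i<n. \<Sum>j<n. nrm A (X i j)) \<in> S"
    using mat_bnd[OF X] X by (auto simp: S_def mat_carrierD(1) intro!: mult_nonneg_nonneg sum_nonneg)
  then have ne: "S \<noteq> {}" by blast
  have bdd: "bdd_below S" by (auto simp: S_def bdd_below_def)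
  show ge0: "0 \<le> nrm ?M X" unfolding nrm using ne by (intro cInf_greatest) (auto simp: S_def)
  \<comment> \<open>The set of bounds is closed, so its infimum is again a bound; the equivalence in
    \<open>gns_alg\<close> requires this.\<close>
  have attained: "M.bnd X (Inf S)"
    unfolding M.bnd_def
  proof
    fix x assume x: "x \<in> carrier ?M"
    have "M.nn (X \<otimes>\<^bsub>?M\<^esub> x) \<le> (Inf S + e) * M.nn x" if "e > 0" for e
    proof -
      obtain C where "C \<in> S" "C < Inf S + e" using cInf_lessD[OF ne, of "Inf S + e"] \<open>e > 0\<close> by auto
      then show ?thesis using M.bnd_mono[of X C "Inf S + e"] M.bndD x by (auto simp: S_def)
    qed
    then have "M.nn (X \<otimes>\<^bsub>?M\<^esub> x) \<le> Inf S * M.nn x + e * M.nn x" if "e > 0" for e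
      using that by (simp add: algebra_simps)
    moreover have "(\<lambda>k. Inf S * M.nn x + inverse (real (Suc k)) * M.nn x) \<longlonglongrightarrow> Inf S * M.nn x + 0 * M.nn x"
      by (intro tendsto_intros LIMSEQ_inverse_real_of_nat)
    ultimately have "M.nn (X \<otimes>\<^bsub>?M\<^esub> x) \<le> Inf S * M.nn x + 0 * M.nn x"
      by (intro LIMSEQ_le_const[of _ "Inf S * M.nn x + 0 * M.nn x"]) auto
    then show "M.nn (X \<otimes>\<^bsub>?M\<^esub> x) \<le> Inf S * M.nn x" by simp
  qed
  fix C :: real assume "0 \<le> C"
  show "nrm ?M X \<le> C \<longleftrightarrow> M.bnd X C"
  proof
    assume "nrm ?M X \<le> C"
    then show "M.bnd X C" using attained M.bnd_mono nrm by auto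
  next
    assume "M.bnd X C"
    then have "C \<in> S" using \<open>0 \<le> C\<close> by (simp add: S_def)
    then show "nrm ?M X \<le> C" unfolding nrm using bdd by (rule cInf_lower)
  qed
qed

end

lemma (in star_alg) mat_minus:
  assumes "X \<in> carrier (mat_alg n A \<nu>)" "Y \<in> carrier (mat_alg n A \<nu>)"
  shows "(X \<ominus>\<^bsub>mat_alg n A \<nu>\<^esub> Y) i j = X i j \<ominus> Y i j"
  using assms by (simp add: star_alg.minus_eq_smult[OF star_alg_mat] minus_eq_smult mat_carrierD)

text \<open>Convergence in norm and of all entries coincide: \<open>mat_entry_bnd\<close> hands
  Cauchy sequences down to the entries, and \<open>mat_bnd\<close> brings the limits back.\<close>

lemma (in complete_gns_alg) complete_gns_alg_mat:
  assumes "gns_alg (mat_alg n A \<nu>) (mat_phi n \<phi>)"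
  shows "complete_gns_alg (mat_alg n A \<nu>) (mat_phi n \<phi>)"
proof (intro complete_gns_alg.intro assms complete_gns_alg_axioms.intro)
  let ?M = "mat_alg n A \<nu>"
  interpret M: gns_alg ?M "mat_phi n \<phi>" by fact
  have entry: "nrm A (X i j) \<le> nrm ?M X" if "X \<in> carrier ?M" "i < n" "j < n" for X i j
    using that M.bnd_nrm[OF that(1)] M.nrm_nonneg[OF that(1)] by (intro mat_entry_bnd[of X n \<nu>]) auto
  show "X = \<zero>\<^bsub>?M\<^esub>" if X: "X \<in> carrier ?M" "nrm ?M X = 0" for X
  proof (intro ext)
    fix i j
    show "X i j = \<zero>\<^bsub>?M\<^esub> i j"
    proof (cases "i < n \<and> j < n")
      case True
      then have "nrm A (X i j) \<le> 0" using entry[OF X(1)] X(2) by fastforce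
      then have "nrm A (X i j) = 0" using nrm_nonneg[OF mat_carrierD(1)[OF X(1)]] by (rule antisym)
      then show ?thesis using nrm_eq_0D[OF mat_carrierD(1)[OF X(1)]] by simp
    qed (use mat_carrierD(2)[OF X(1)] in auto)
  qed
  fix s assume s: "nrm_cauchy ?M s"
  then have sc: "s k \<in> carrier ?M" for k by (simp add: nrm_cauchy_def)
  have "nrm_cauchy A (\<lambda>k. s k i j)" if ij: "i < n" "j < n" for i j
    unfolding nrm_cauchy_def
  proof (intro conjI allI impI)
    show "s k i j \<in> carrier A" for k using sc by (rule mat_carrierD(1))
    fix e :: real assume "e > 0"
    then obtain N where N: "\<And>m k. m \<ge> N \<Longrightarrow> k \<ge> N \<Longrightarrow> nrm ?M (s m \<ominus>\<^bsub>?M\<^esub> s k) < e"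
      using s unfolding nrm_cauchy_def by meson
    have "nrm A (s m i j \<ominus> s k i j) < e" if "m \<ge> N" "k \<ge> N" for m k
      using N[OF that] entry[OF M.minus_closed[OF sc sc] ij, of m k] by (simp add: mat_minus[OF sc sc])
    then show "\<exists>N. \<forall>m\<ge>N. \<forall>k\<ge>N. nrm A (s m i j \<ominus> s k i j) < e" by blast
  qed
  then have "\<exists>a\<in>carrier A. nrm_tendsto A (\<lambda>k. s k i j) a" if "i < n" "j < n" for i j
    using that complete by blast
  then obtain l where l: "\<And>i j. i < n \<Longrightarrow> j < n \<Longrightarrow> l i j \<in> carrier A \<and> nrm_tendsto A (\<lambda>k. s k i j) (l i j)"
    by metis
  define X where "X = (\<lambda>i j. if i < n \<and> j < n then l i j else \<zero>)"
  have X: "X \<in> carrier ?M" using l by (intro mat_carrierI) (auto simp: X_def)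
  note [simp] = mat_carrierD(1)[OF sc] mat_carrierD(1)[OF X]
  have "nrm ?M (s k \<ominus>\<^bsub>?M\<^esub> X) \<le> real n * (\<Sum>i<n. \<Sum>j<n. nrm A (s k i j \<ominus> X i j))" for k
  proof -
    have "M.bnd (s k \<ominus>\<^bsub>?M\<^esub> X) (real n * (\<Sum>i<n. \<Sum>j<n. nrm A ((s k \<ominus>\<^bsub>?M\<^esub> X) i j)))"
      by (rule mat_bnd) (intro M.minus_closed sc X)
    then show ?thesis
      using sc X by (subst M.nrm_le_iff)
        (auto simp: mat_minus[OF sc X] intro!: mult_nonneg_nonneg sum_nonneg)
  qed
  then have up: "\<forall>\<^sub>F k in sequentially. nrm ?M (s k \<ominus>\<^bsub>?M\<^esub> X) \<le> real n * (\<Sum>i<n. \<Sum>j<n. nrm A (s k i j \<ominus> X i j))"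
    by simp
  have lo: "\<forall>\<^sub>F k in sequentially. 0 \<le> nrm ?M (s k \<ominus>\<^bsub>?M\<^esub> X)"
    using M.minus_closed[OF sc X] by (intro always_eventually allI M.nrm_nonneg)
  have "(\<lambda>k. real n * (\<Sum>i<n. \<Sum>j<n. nrm A (s k i j \<ominus> X i j))) \<longlonglongrightarrow> real n * (\<Sum>i<n. \<Sum>j<n. 0)"
    using l by (intro tendsto_intros) (auto simp: X_def nrm_tendsto_def)
  then have "(\<lambda>k. real n * (\<Sum>i<n. \<Sum>j<n. nrm A (s k i j \<ominus> X i j))) \<longlonglongrightarrow> 0" by simp
  then have "(\<lambda>k. nrm ?M (s k \<ominus>\<^bsub>?M\<^esub> X)) \<longlonglongrightarrow> 0"
    by (rule tendsto_sandwich[OF lo up tendsto_const])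
  then show "\<exists>a\<in>carrier ?M. nrm_tendsto ?M s a" using X by (auto simp: nrm_tendsto_def)
qed

context complete_gns_alg
begin

text \<open>The form of the matrix algebra is a sum over columns, so positivity on columns of length
  n makes M positive there. Its self-adjoint square root serves as the factor that
  \<open>matrix_positive\<close> asks for.\<close>

lemma matrix_positiveI:
  assumes car: "\<And>i j. i < n \<Longrightarrow> j < n \<Longrightarrow> M i j \<in> carrier A"
    and herm: "\<And>i j. i < n \<Longrightarrow> j < n \<Longrightarrow> adj A (M i j) = M j i"
    and pos: "\<And>x. (\<And>i. i < n \<Longrightarrow> x i \<in> carrier A) \<Longrightarrow> 0 \<le> Re (\<Sum>i<n. \<Sum>j<n. ip (x i) (M i j \<otimes> x j))"
  shows "matrix_positive A n M"
proof -
  let ?A = "mat_alg n A (mat_nrm n)"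
  interpret M: complete_gns_alg ?A "mat_phi n \<phi>"
    by (intro complete_gns_alg_mat gns_alg_mat)
  define N where "N = (\<lambda>i j. if i < n \<and> j < n then M i j else \<zero>)"
  have N: "N \<in> carrier ?A" by (rule mat_carrierI) (auto simp: N_def car)
  have "M.positive N"
    unfolding M.positive_def
  proof (intro conjI N ballI)
    show "adj ?A N = N" using herm by (auto simp: N_def fun_eq_iff)
    fix X assume X: "X \<in> carrier ?A"
    note [simp] = mat_carrierD(1)[OF X] mat_carrierD(1)[OF N]
    have "M.ip X (N \<otimes>\<^bsub>?A\<^esub> X) = (\<Sum>c<n. \<Sum>i<n. ip (X i c) (\<Oplus>j\<in>{..<n}. N i j \<otimes> X j c))"
      using mat_ip[OF X M.m_closed[OF N X]] by simp
    also have "\<dots> = (\<Sum>c<n. \<Sum>i<n. \<Sum>j<n. ip (X i c) (N i j \<otimes> X j c))"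
      by (intro sum.cong refl ip_finsum_right) auto
    also have "\<dots> = (\<Sum>c<n. \<Sum>i<n. \<Sum>j<n. ip (X i c) (M i j \<otimes> X j c))"
      by (simp add: N_def)
    finally have ip: "M.ip X (N \<otimes>\<^bsub>?A\<^esub> X) = \<dots>" .
    show "0 \<le> Re (M.ip X (N \<otimes>\<^bsub>?A\<^esub> X))"
      unfolding ip by (subst Re_sum) (intro sum_nonneg pos, simp)
  qed
  then obtain Z where Z: "Z \<in> carrier ?A" "adj ?A Z = Z" "Z \<otimes>\<^bsub>?A\<^esub> Z = N"
    using M.positive_sqrt by blast
  then have "adj ?A Z \<otimes>\<^bsub>?A\<^esub> Z = N" by simp
  then have "N i j = (\<Oplus>l\<in>{..<n}. adj A (Z l i) \<otimes> Z l j)" for i j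
    by (simp add: fun_eq_iff)
  then show ?thesis
    unfolding matrix_positive_def N_def using mat_carrierD(1)[OF Z(1)]
    by (intro exI[of _ Z]) (metis (no_types, lifting))
qed

end

context pos_alg
begin

lemma matrix_positiveD:
  assumes "matrix_positive A n M" and ij: "i < n" "j < n"
  shows "M i j \<in> carrier A" and "adj A (M i j) = M j i"
proof -
  obtain Y where Y: "\<And>i j. i < n \<Longrightarrow> j < n \<Longrightarrow> Y i j \<in> carrier A"
    "\<And>i j. i < n \<Longrightarrow> j < n \<Longrightarrow> M i j = (\<Oplus>l\<in>{..<n}. adj A (Y l i) \<otimes> Y l j)"
    using assms(1) unfolding matrix_positive_def by blast
  show "M i j \<in> carrier A" unfolding Y(2)[OF ij] using Y(1) ij by (intro finsum_in) auto
  have "adj A (M i j) = (\<Oplus>l\<in>{..<n}. adj A (adj A (Y l i) \<otimes> Y l j))"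
    unfolding Y(2)[OF ij] using Y(1) ij by (intro adj_finsum) auto
  also have "\<dots> = (\<Oplus>l\<in>{..<n}. adj A (Y l j) \<otimes> Y l i)"
    using Y(1) ij by (intro finsum_cong') (auto simp: adj_mult)
  finally show "adj A (M i j) = M j i" using Y(2) ij by simp
qed

text \<open>With M = Y^* Y the double sum splits over the rows l of Y into squared seminorms of the
  vectors obtained by applying row l to x.\<close>

lemma matrix_positive_nonneg:
  assumes "matrix_positive A n M" and x: "\<And>i. i < n \<Longrightarrow> x i \<in> carrier A"
  shows "0 \<le> Re (\<Sum>i<n. \<Sum>j<n. ip (x i) (M i j \<otimes> x j))"
proof -
  obtain Y where Y: "\<And>i j. i < n \<Longrightarrow> j < n \<Longrightarrow> Y i j \<in> carrier A"
    "\<And>i j. i < n \<Longrightarrow> j < n \<Longrightarrow> M i j = (\<Oplus>l\<in>{..<n}. adj A (Y l i) \<otimes> Y l j)"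
    using assms(1) unfolding matrix_positive_def by blast
  have "ip (x i) (M i j \<otimes> x j) = (\<Sum>l<n. ip (Y l i \<otimes> x i) (Y l j \<otimes> x j))" if "i < n" "j < n" for i j
  proof -
    have "M i j \<otimes> x j = (\<Oplus>l\<in>{..<n}. adj A (Y l i) \<otimes> Y l j \<otimes> x j)"
      unfolding Y(2)[OF that] using that Y(1) x by (intro finsum_ldistr) auto
    then have "ip (x i) (M i j \<otimes> x j) = (\<Sum>l<n. ip (x i) (adj A (Y l i) \<otimes> Y l j \<otimes> x j))"
      using that Y(1) x by (simp only:) (intro ip_finsum_right, auto)
    also have "\<dots> = (\<Sum>l<n. ip (Y l i \<otimes> x i) (Y l j \<otimes> x j))"
      using that Y(1) x by (intro sum.cong refl) (simp add: ip_mult_right m_assoc)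
    finally show ?thesis .
  qed
  then have "(\<Sum>i<n. \<Sum>j<n. ip (x i) (M i j \<otimes> x j)) = (\<Sum>i<n. \<Sum>j<n. \<Sum>l<n. ip (Y l i \<otimes> x i) (Y l j \<otimes> x j))"
    by simp
  also have "\<dots> = (\<Sum>i<n. \<Sum>l<n. \<Sum>j<n. ip (Y l i \<otimes> x i) (Y l j \<otimes> x j))"
    by (intro sum.cong refl sum.swap)
  also have "\<dots> = (\<Sum>l<n. \<Sum>i<n. \<Sum>j<n. cnj 1 * 1 * ip (Y l i \<otimes> x i) (Y l j \<otimes> x j))"
    by (subst sum.swap) simp
  finally have eq: "(\<Sum>i<n. \<Sum>j<n. ip (x i) (M i j \<otimes> x j)) = \<dots>" .
  have gram: "0 \<le> Re (\<Sum>i<n. \<Sum>j<n. cnj 1 * 1 * ip (Y l i \<otimes> x i) (Y l j \<otimes> x j))" if "l < n" for l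
    using that Y x by (intro gram_nonneg) auto
  show ?thesis unfolding eq by (subst Re_sum) (intro sum_nonneg gram, simp)
qed

end

text \<open>Applying the map to the positive matrix with rows \<open>(1, a)\<close> and \<open>(a\<^sup>*, \<parallel>a\<parallel>\<^sup>2)\<close>.\<close>

lemma unital_completely_positive_imp_ccp:
  fixes A :: "('a, 'm) cstar_scheme" and B :: "('b, 'n) cstar_scheme"
  assumes "complete_gns_alg A \<phi>" and "gns_alg B \<psi>" and S: "completely_positive A B S"
    and one: "S \<one>\<^bsub>A\<^esub> = \<one>\<^bsub>B\<^esub>"
  shows "ccp A B S"
  unfolding ccp_def
proof (intro conjI S ballI)
  interpret A: complete_gns_alg A \<phi> by fact
  interpret B: gns_alg B \<psi> by fact
  fix a assume a [simp]: "a \<in> carrier A"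
  define c where "c = nrm A a"
  have c: "0 \<le> c" by (simp add: c_def)
  let ?c = "complex_of_real (c\<^sup>2)"
  have Slin: "\<And>x. x \<in> carrier A \<Longrightarrow> S x \<in> carrier B" "\<And>z x. x \<in> carrier A \<Longrightarrow> S (z \<odot>\<^bsub>A\<^esub> x) = z \<odot>\<^bsub>B\<^esub> S x"
    using S by (auto simp: completely_positive_def cstar_linear_def)
  define d where "d = ?c \<odot>\<^bsub>A\<^esub> \<one>\<^bsub>A\<^esub> \<ominus>\<^bsub>A\<^esub> adj A a \<otimes>\<^bsub>A\<^esub> a"
  have [simp]: "d \<in> carrier A" by (simp add: d_def)
  have "A.positive d"
    unfolding A.positive_def
  proof (intro conjI ballI)
    show "adj A d = d" by (simp add: d_def A.adj_minus A.adj_smult A.adj_mult)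
    fix x assume x [simp]: "x \<in> carrier A"
    have "d \<otimes>\<^bsub>A\<^esub> x = ?c \<odot>\<^bsub>A\<^esub> x \<ominus>\<^bsub>A\<^esub> adj A a \<otimes>\<^bsub>A\<^esub> (a \<otimes>\<^bsub>A\<^esub> x)"
      by (simp add: d_def A.minus_eq_smult A.l_distr A.smult_mult_left A.m_assoc)
    then have "A.ip x (d \<otimes>\<^bsub>A\<^esub> x) = ?c * A.ip x x - A.ip (a \<otimes>\<^bsub>A\<^esub> x) (a \<otimes>\<^bsub>A\<^esub> x)"
      by (simp add: A.ip_minus_right A.ip_smult_right A.ip_mult_right)
    then have "Re (A.ip x (d \<otimes>\<^bsub>A\<^esub> x)) = (c * A.nn x)\<^sup>2 - (A.nn (a \<otimes>\<^bsub>A\<^esub> x))\<^sup>2"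
      by (simp add: A.nn_sq power_mult_distrib)
    moreover have "(A.nn (a \<otimes>\<^bsub>A\<^esub> x))\<^sup>2 \<le> (c * A.nn x)\<^sup>2"
      using A.nn_mult_le[OF a x] by (intro power_mono) (auto simp: c_def)
    ultimately show "0 \<le> Re (A.ip x (d \<otimes>\<^bsub>A\<^esub> x))" by simp
  qed simp
  then obtain w where w: "w \<in> carrier A" "adj A w = w" "w \<otimes>\<^bsub>A\<^esub> w = d"
    using A.positive_sqrt by blast
  define M :: "nat \<Rightarrow> nat \<Rightarrow> 'a" where "M = (\<lambda>i j. if i = 0 then (if j = 0 then \<one>\<^bsub>A\<^esub> else a) else
    (if j = 0 then adj A a else ?c \<odot>\<^bsub>A\<^esub> \<one>\<^bsub>A\<^esub>))"
  \<comment> \<open>Since w^2 = d = c^2 - a^* a, the upper triangular Y with rows (1, a) and (0, w)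
    satisfies Y^* Y = M.\<close>
  define Y :: "nat \<Rightarrow> nat \<Rightarrow> 'a" where "Y = (\<lambda>i j. if i = 0 then (if j = 0 then \<one>\<^bsub>A\<^esub> else a) else
    (if j = 0 then \<zero>\<^bsub>A\<^esub> else w))"
  have Yc: "Y i j \<in> carrier A" for i j using w by (auto simp: Y_def)
  have two: "{..<2} = {0, Suc 0}" by auto
  have corner: "adj A a \<otimes>\<^bsub>A\<^esub> a \<oplus>\<^bsub>A\<^esub> d = ?c \<odot>\<^bsub>A\<^esub> \<one>\<^bsub>A\<^esub>"
  proof -
    have "x \<oplus>\<^bsub>A\<^esub> (y \<ominus>\<^bsub>A\<^esub> x) = y" if "x \<in> carrier A" "y \<in> carrier A" for x y
      using that by (simp add: a_minus_def A.a_comm[of y] A.a_assoc[symmetric] A.r_neg)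
    then show ?thesis unfolding d_def by simp
  qed
  have "M i j = finsum A (\<lambda>l. adj A (Y l i) \<otimes>\<^bsub>A\<^esub> Y l j) {..<2}" for i j
    unfolding two using w corner Yc by (simp add: Pi_def) (auto simp: M_def Y_def)
  then have "matrix_positive A 2 M"
    unfolding matrix_positive_def using Yc by (intro exI[of _ Y]) auto
  then have P: "matrix_positive B 2 (\<lambda>i j. S (M i j))"
    using S by (simp add: completely_positive_def)
  let ?s = "S a"
  have [simp]: "?s \<in> carrier B" by (simp add: Slin)
  have adjS: "S (adj A a) = adj B ?s"
    using B.matrix_positiveD(2)[OF P, of 0 1] by (simp add: M_def)
  have "B.bnd ?s c"
    unfolding B.bnd_def
  proof
    fix y assume y [simp]: "y \<in> carrier B"
    let ?v = "?s \<otimes>\<^bsub>B\<^esub> y"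
    \<comment> \<open>The test vector (-v, y) with v = S a y. As S preserves the unit, the three
      terms in |v|^2 add up to -|v|^2, which leaves |v|^2 \<le> c^2 |y|^2.\<close>
    define x :: "nat \<Rightarrow> 'b" where "x = (\<lambda>i. if i = 0 then (-1) \<odot>\<^bsub>B\<^esub> ?v else y)"
    have "0 \<le> Re (\<Sum>i<2. \<Sum>j<2. B.ip (x i) (S (M i j) \<otimes>\<^bsub>B\<^esub> x j))"
      by (rule B.matrix_positive_nonneg[OF P]) (simp add: x_def)
    also have "(\<Sum>i<2. \<Sum>j<2. B.ip (x i) (S (M i j) \<otimes>\<^bsub>B\<^esub> x j)) =
        B.ip ?v ?v - B.ip ?v ?v - B.ip ?v ?v + ?c * B.ip y y"
      by (simp add: numeral_2_eq_2 x_def M_def one adjS Slin B.ip_smult_left B.ip_smult_right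
          B.smult_mult_left B.smult_mult_right B.ip_mult_right[of "adj B ?s"] del: of_real_power)
    finally have "0 \<le> Re (- of_real ((B.nn ?v)\<^sup>2) + ?c * of_real ((B.nn y)\<^sup>2))"
      unfolding B.ip_self[OF y] B.ip_self[OF B.m_closed[OF \<open>?s \<in> carrier B\<close> y]] by simp
    then have "(B.nn ?v)\<^sup>2 \<le> (c * B.nn y)\<^sup>2"
      unfolding of_real_mult[symmetric] of_real_minus[symmetric] of_real_add[symmetric] Re_complex_of_real
      by (simp add: power_mult_distrib)
    then show "B.nn ?v \<le> c * B.nn y" by (rule power2_le_imp_le) (use c in simp)
  qed
  then show "nrm B (S a) \<le> nrm A a" using c by (simp add: B.nrm_le_iff c_def)
qed

section \<open>Completion\<close>

definition completion_class :: "('b, 'm) cstar_scheme \<Rightarrow> (nat \<Rightarrow> 'b) \<Rightarrow> (nat \<Rightarrow> 'b) set" where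
  "completion_class B s = cauchy_rel B `` {s}"

definition completion_embed :: "('b, 'm) cstar_scheme \<Rightarrow> 'b \<Rightarrow> (nat \<Rightarrow> 'b) set" where
  "completion_embed B a = completion_class B (\<lambda>_. a)"

definition completion_functional :: "('b \<Rightarrow> complex) \<Rightarrow> (nat \<Rightarrow> 'b) set \<Rightarrow> complex" where
  "completion_functional \<phi> X = (THE r. \<forall>s\<in>X. (\<lambda>n. \<phi> (s n)) \<longlonglongrightarrow> r)"

context gns_alg
begin

abbreviation "cl \<equiv> completion_class A"
abbreviation "\<iota> \<equiv> completion_embed A"
abbreviation "\<Phi> \<equiv> completion_functional \<phi>"
abbreviation "CA \<equiv> completion A"

section \<open>Cauchy sequences and their classes\<close>

lemma nrm_cauchy_closed [simp]: "nrm_cauchy A s \<Longrightarrow> s n \<in> carrier A"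
  by (simp add: nrm_cauchy_def)

lemma nrm_cauchyD: "nrm_cauchy A s \<Longrightarrow> e > 0 \<Longrightarrow> \<exists>N. \<forall>m\<ge>N. \<forall>n\<ge>N. nrm A (s m \<ominus> s n) < e"
  by (simp add: nrm_cauchy_def)

lemma Cauchy_by_nrm:
  fixes g :: "'a \<Rightarrow> 'c::real_normed_vector"
  assumes s: "nrm_cauchy A s" and lip: "\<And>a b. a \<in> carrier A \<Longrightarrow> b \<in> carrier A \<Longrightarrow> norm (g a - g b) \<le> K * nrm A (a \<ominus> b)"
  shows "Cauchy (\<lambda>n. g (s n))"
proof (rule CauchyI)
  fix e :: real assume "e > 0"
  then obtain N where N: "\<And>m n. m \<ge> N \<Longrightarrow> n \<ge> N \<Longrightarrow> nrm A (s m \<ominus> s n) < e / (\<bar>K\<bar> + 1)"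
    using nrm_cauchyD[OF s, of "e / (\<bar>K\<bar> + 1)"] by (metis divide_pos_pos abs_add_one_gt_zero add.commute)
  have "norm (g (s m) - g (s n)) < e" if "m \<ge> N" "n \<ge> N" for m n
  proof -
    have "norm (g (s m) - g (s n)) \<le> K * nrm A (s m \<ominus> s n)" using s by (intro lip) auto
    also have "\<dots> \<le> (\<bar>K\<bar> + 1) * nrm A (s m \<ominus> s n)" using s by (intro mult_right_mono) auto
    also have "\<dots> < (\<bar>K\<bar> + 1) * (e / (\<bar>K\<bar> + 1))" using N[OF that] by (intro mult_strict_left_mono) auto
    finally show ?thesis by simp
  qed
  then show "\<exists>N. \<forall>m\<ge>N. \<forall>n\<ge>N. norm (g (s m) - g (s n)) < e" by blast
qed

lemma nrm_cauchy_convergent: "nrm_cauchy A s \<Longrightarrow> convergent (\<lambda>n. nrm A (s n))"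
  using Cauchy_by_nrm[of s "nrm A" 1] nrm_diff_le by (intro Cauchy_convergent) simp

lemma phi_cauchy_convergent: "nrm_cauchy A s \<Longrightarrow> convergent (\<lambda>n. \<phi> (s n))"
  using Cauchy_by_nrm[of s \<phi> "(nn \<one>)\<^sup>2"] cmod_phi_le
  by (intro Cauchy_convergent) (simp add: phi_minus[symmetric] mult.commute)

lemma nrm_cauchy_bounded: "nrm_cauchy A s \<Longrightarrow> \<exists>K>0. \<forall>n. nrm A (s n) \<le> K"
  using convergent_imp_Bseq[OF nrm_cauchy_convergent, of s] by (auto elim!: BseqE)

lemma cauchy_rel_iff:
  "(s, t) \<in> cauchy_rel A \<longleftrightarrow> nrm_cauchy A s \<and> nrm_cauchy A t \<and> (\<lambda>n. nrm A (s n \<ominus> t n)) \<longlonglongrightarrow> 0"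
  by (simp add: cauchy_rel_def)

lemma null_by_bound:
  assumes "\<And>n. d n \<in> carrier A" and "\<And>n. nrm A (d n) \<le> f n" and "f \<longlonglongrightarrow> 0"
  shows "(\<lambda>n. nrm A (d n)) \<longlonglongrightarrow> 0"
  by (rule tendsto_sandwich[OF _ _ tendsto_const assms(3)]) (use assms in auto)

lemma equiv_cauchy_rel: "equiv {s. nrm_cauchy A s} (cauchy_rel A)"
proof (rule equivI)
  show "refl_on {s. nrm_cauchy A s} (cauchy_rel A)"
    by (auto simp: refl_on_def cauchy_rel_iff a_minus_def r_neg)
  show "cauchy_rel A \<subseteq> {s. nrm_cauchy A s} \<times> {s. nrm_cauchy A s}" by (auto simp: cauchy_rel_iff)
  show "sym (cauchy_rel A)" by (auto simp: sym_def cauchy_rel_iff nrm_minus_commute)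
  show "trans (cauchy_rel A)"
  proof (rule transI, unfold cauchy_rel_iff, intro conjI; (elim conjE)?)
    fix s t u assume c: "nrm_cauchy A s" "nrm_cauchy A t" "nrm_cauchy A u"
      and l: "(\<lambda>n. nrm A (s n \<ominus> t n)) \<longlonglongrightarrow> 0" "(\<lambda>n. nrm A (t n \<ominus> u n)) \<longlonglongrightarrow> 0"
    show "(\<lambda>n. nrm A (s n \<ominus> u n)) \<longlonglongrightarrow> 0"
      using c tendsto_add[OF l] by (intro null_by_bound[where f = "\<lambda>n. nrm A (s n \<ominus> t n) + nrm A (t n \<ominus> u n)"])
        (auto intro: nrm_minus_triangle)
  qed
qed

lemma cl_eq_iff: "\<lbrakk>nrm_cauchy A s; nrm_cauchy A t\<rbrakk> \<Longrightarrow> cl s = cl t \<longleftrightarrow> (\<lambda>n. nrm A (s n \<ominus> t n)) \<longlonglongrightarrow> 0"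
  using eq_equiv_class_iff[OF equiv_cauchy_rel, of s t] by (simp add: completion_class_def cauchy_rel_iff)

lemma carrier_completion: "carrier CA = cl ` {s. nrm_cauchy A s}"
  by (auto simp: completion_def quotient_def completion_class_def)

lemma cl_closed [simp]: "nrm_cauchy A s \<Longrightarrow> cl s \<in> carrier CA"
  by (simp add: carrier_completion)

lemma completion_cases:
  assumes "X \<in> carrier CA"
  obtains s where "nrm_cauchy A s" "X = cl s"
  using assms by (auto simp: carrier_completion)

lemma mem_cl_iff: "t \<in> cl s \<longleftrightarrow> nrm_cauchy A s \<and> nrm_cauchy A t \<and> (\<lambda>n. nrm A (s n \<ominus> t n)) \<longlonglongrightarrow> 0"
  by (simp add: completion_class_def cauchy_rel_iff)

lemma mem_cl_self: "nrm_cauchy A s \<Longrightarrow> s \<in> cl s"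
  by (simp add: mem_cl_iff a_minus_def r_neg)

lemma nrm_cauchyI:
  assumes "\<And>n. s n \<in> carrier A" and "\<And>m n. nrm A (s m \<ominus> s n) \<le> f m n" and
    "\<And>e. e > 0 \<Longrightarrow> \<exists>N. \<forall>m\<ge>N. \<forall>n\<ge>N. f m n < e"
  shows "nrm_cauchy A s"
  unfolding nrm_cauchy_def using assms by (meson le_less_trans)

lemma nrm_cauchy_const [simp]: "a \<in> carrier A \<Longrightarrow> nrm_cauchy A (\<lambda>_. a)"
  by (simp add: nrm_cauchy_def a_minus_def r_neg)

lemma nrm_cauchy_adj [simp]: "nrm_cauchy A s \<Longrightarrow> nrm_cauchy A (\<lambda>n. adj A (s n))"
  by (rule nrm_cauchyI[where f = "\<lambda>m n. nrm A (s m \<ominus> s n)"])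
    (auto simp: adj_minus[symmetric] nrm_adj dest: nrm_cauchyD)

lemma nrm_cauchy_mult [simp]:
  assumes s: "nrm_cauchy A s" and t: "nrm_cauchy A t"
  shows "nrm_cauchy A (\<lambda>n. s n \<otimes> t n)"
proof -
  obtain K L where K: "K > 0" "\<And>n. nrm A (s n) \<le> K" and L: "L > 0" "\<And>n. nrm A (t n) \<le> L"
    using nrm_cauchy_bounded[OF s] nrm_cauchy_bounded[OF t] by blast
  show ?thesis
  proof (rule nrm_cauchyI[where f = "\<lambda>m n. nrm A (s m \<ominus> s n) * L + K * nrm A (t m \<ominus> t n)"])
    show "nrm A (s m \<otimes> t m \<ominus> s n \<otimes> t n) \<le> nrm A (s m \<ominus> s n) * L + K * nrm A (t m \<ominus> t n)" for m n
      using s t K L by (intro order_trans[OF mult_diff_le] add_mono mult_mono) (auto simp: less_imp_le)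
    fix e :: real assume "e > 0"
    then have "e / (2 * L) > 0" "e / (2 * K) > 0" using K L by auto
    then obtain M N where M: "\<And>m n. m \<ge> M \<Longrightarrow> n \<ge> M \<Longrightarrow> nrm A (s m \<ominus> s n) < e / (2 * L)"
      and N: "\<And>m n. m \<ge> N \<Longrightarrow> n \<ge> N \<Longrightarrow> nrm A (t m \<ominus> t n) < e / (2 * K)"
      using nrm_cauchyD[OF s] nrm_cauchyD[OF t] by meson
    have "nrm A (s m \<ominus> s n) * L + K * nrm A (t m \<ominus> t n) < e" if "m \<ge> max M N" "n \<ge> max M N" for m n
    proof -
      have "nrm A (s m \<ominus> s n) * L < e / (2 * L) * L" using M[of m n] that L by (intro mult_strict_right_mono) auto
      moreover have "K * nrm A (t m \<ominus> t n) < K * (e / (2 * K))" using N[of m n] that K by (intro mult_strict_left_mono) auto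
      moreover have "e / (2 * L) * L = e / 2" "K * (e / (2 * K)) = e / 2" using K L by auto
      ultimately show ?thesis by linarith
    qed
    then show "\<exists>N. \<forall>m\<ge>N. \<forall>n\<ge>N. nrm A (s m \<ominus> s n) * L + K * nrm A (t m \<ominus> t n) < e" by blast
  qed (use s t in auto)
qed

lemma nrm_cauchy_add [simp]:
  assumes s: "nrm_cauchy A s" and t: "nrm_cauchy A t"
  shows "nrm_cauchy A (\<lambda>n. s n \<oplus> t n)"
proof (rule nrm_cauchyI[where f = "\<lambda>m n. nrm A (s m \<ominus> s n) + nrm A (t m \<ominus> t n)"])
  show "nrm A ((s m \<oplus> t m) \<ominus> (s n \<oplus> t n)) \<le> nrm A (s m \<ominus> s n) + nrm A (t m \<ominus> t n)" for m n
  proof -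
    have "(s m \<oplus> t m) \<ominus> (s n \<oplus> t n) = (s m \<ominus> s n) \<oplus> (t m \<ominus> t n)"
      using nrm_cauchy_closed[OF s, of m] nrm_cauchy_closed[OF s, of n] nrm_cauchy_closed[OF t, of m]
        nrm_cauchy_closed[OF t, of n] by algebra
    then show ?thesis using s t by (simp add: nrm_triangle)
  qed
  fix e :: real assume "e > 0"
  then have "e / 2 > 0" by simp
  then obtain M N where "\<And>m n. m \<ge> M \<Longrightarrow> n \<ge> M \<Longrightarrow> nrm A (s m \<ominus> s n) < e / 2"
    and "\<And>m n. m \<ge> N \<Longrightarrow> n \<ge> N \<Longrightarrow> nrm A (t m \<ominus> t n) < e / 2"
    using nrm_cauchyD[OF s] nrm_cauchyD[OF t] by meson
  then have "\<forall>m\<ge>max M N. \<forall>n\<ge>max M N. nrm A (s m \<ominus> s n) + nrm A (t m \<ominus> t n) < e"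
    by (metis add_strict_mono field_sum_of_halves max.bounded_iff)
  then show "\<exists>N. \<forall>m\<ge>N. \<forall>n\<ge>N. nrm A (s m \<ominus> s n) + nrm A (t m \<ominus> t n) < e" by blast
qed (use s t in auto)

lemma nrm_cauchy_smult [simp]:
  assumes s: "nrm_cauchy A s"
  shows "nrm_cauchy A (\<lambda>n. z \<odot> s n)"
proof -
  have "nrm_cauchy A (\<lambda>n. (z \<odot> \<one>) \<otimes> s n)" using s by (intro nrm_cauchy_mult) auto
  then show ?thesis using s by (simp add: smult_mult_left)
qed

text \<open>The operations of \<open>completion\<close> are unions over representatives.
  Independence of the representatives makes all members of the union one and the same class, and the
  union is not empty since a sequence belongs to its own class.\<close>

lemma cl_mult:
  assumes s: "nrm_cauchy A s" and t: "nrm_cauchy A t"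
  shows "cl s \<otimes>\<^bsub>CA\<^esub> cl t = cl (\<lambda>n. s n \<otimes> t n)"
proof -
  have *: "cl (\<lambda>n. s' n \<otimes> t' n) = cl (\<lambda>n. s n \<otimes> t n)" if s': "s' \<in> cl s" and t': "t' \<in> cl t" for s' t'
  proof -
    have c: "nrm_cauchy A s'" "nrm_cauchy A t'" using that by (auto simp: mem_cl_iff)
    obtain K L where K: "K > 0" "\<And>n. nrm A (s n) \<le> K" and L: "L > 0" "\<And>n. nrm A (t' n) \<le> L"
      using nrm_cauchy_bounded[OF s] nrm_cauchy_bounded[OF c(2)] by blast
    have "(\<lambda>n. nrm A (s' n \<otimes> t' n \<ominus> s n \<otimes> t n)) \<longlonglongrightarrow> 0"
    proof (rule null_by_bound[where f = "\<lambda>n. nrm A (s n \<ominus> s' n) * L + K * nrm A (t n \<ominus> t' n)"])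
      show "nrm A (s' n \<otimes> t' n \<ominus> s n \<otimes> t n) \<le> nrm A (s n \<ominus> s' n) * L + K * nrm A (t n \<ominus> t' n)" for n
        using s t c K L by (intro order_trans[OF mult_diff_le] add_mono mult_mono)
          (auto simp: less_imp_le nrm_minus_commute)
      show "(\<lambda>n. nrm A (s n \<ominus> s' n) * L + K * nrm A (t n \<ominus> t' n)) \<longlonglongrightarrow> 0"
        using s' t' by (auto simp: mem_cl_iff intro!: tendsto_eq_intros)
    qed (use s t c in auto)
    then show ?thesis using s t c by (subst cl_eq_iff) auto
  qed
  have "cl s \<otimes>\<^bsub>CA\<^esub> cl t = (\<Union>s'\<in>cl s. \<Union>t'\<in>cl t. cl (\<lambda>n. s' n \<otimes> t' n))"
    by (simp add: completion_def completion_class_def)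
  also have "\<dots> = (\<Union>s'\<in>cl s. \<Union>t'\<in>cl t. cl (\<lambda>n. s n \<otimes> t n))" using * by simp
  also have "\<dots> = cl (\<lambda>n. s n \<otimes> t n)" using mem_cl_self[OF s] mem_cl_self[OF t] by auto
  finally show ?thesis .
qed

lemma cl_add:
  assumes s: "nrm_cauchy A s" and t: "nrm_cauchy A t"
  shows "cl s \<oplus>\<^bsub>CA\<^esub> cl t = cl (\<lambda>n. s n \<oplus> t n)"
proof -
  have *: "cl (\<lambda>n. s' n \<oplus> t' n) = cl (\<lambda>n. s n \<oplus> t n)" if s': "s' \<in> cl s" and t': "t' \<in> cl t" for s' t'
  proof -
    have c: "nrm_cauchy A s'" "nrm_cauchy A t'" using that by (auto simp: mem_cl_iff)
    have "(\<lambda>n. nrm A ((s' n \<oplus> t' n) \<ominus> (s n \<oplus> t n))) \<longlonglongrightarrow> 0"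
    proof (rule null_by_bound[where f = "\<lambda>n. nrm A (s n \<ominus> s' n) + nrm A (t n \<ominus> t' n)"])
      show "nrm A ((s' n \<oplus> t' n) \<ominus> (s n \<oplus> t n)) \<le> nrm A (s n \<ominus> s' n) + nrm A (t n \<ominus> t' n)" for n
      proof -
        have "(s' n \<oplus> t' n) \<ominus> (s n \<oplus> t n) = (s' n \<ominus> s n) \<oplus> (t' n \<ominus> t n)"
          using nrm_cauchy_closed[OF s, of n] nrm_cauchy_closed[OF t, of n] nrm_cauchy_closed[OF c(1), of n]
            nrm_cauchy_closed[OF c(2), of n] by algebra
        then show ?thesis using s t c nrm_triangle[of "s' n \<ominus> s n" "t' n \<ominus> t n"] by (simp add: nrm_minus_commute)
      qed
      show "(\<lambda>n. nrm A (s n \<ominus> s' n) + nrm A (t n \<ominus> t' n)) \<longlonglongrightarrow> 0"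
        using s' t' by (auto simp: mem_cl_iff intro!: tendsto_eq_intros)
    qed (use s t c in auto)
    then show ?thesis using s t c by (subst cl_eq_iff) auto
  qed
  have "cl s \<oplus>\<^bsub>CA\<^esub> cl t = (\<Union>s'\<in>cl s. \<Union>t'\<in>cl t. cl (\<lambda>n. s' n \<oplus> t' n))"
    by (simp add: completion_def completion_class_def)
  also have "\<dots> = (\<Union>s'\<in>cl s. \<Union>t'\<in>cl t. cl (\<lambda>n. s n \<oplus> t n))" using * by simp
  also have "\<dots> = cl (\<lambda>n. s n \<oplus> t n)" using mem_cl_self[OF s] mem_cl_self[OF t] by auto
  finally show ?thesis .
qed

lemma cl_smult:
  assumes s: "nrm_cauchy A s"
  shows "z \<odot>\<^bsub>CA\<^esub> cl s = cl (\<lambda>n. z \<odot> s n)"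
proof -
  have *: "cl (\<lambda>n. z \<odot> s' n) = cl (\<lambda>n. z \<odot> s n)" if s': "s' \<in> cl s" for s'
  proof -
    have c: "nrm_cauchy A s'" using that by (auto simp: mem_cl_iff)
    have "(\<lambda>n. nrm A (z \<odot> s' n \<ominus> z \<odot> s n)) = (\<lambda>n. cmod z * nrm A (s n \<ominus> s' n))"
      using s c by (simp add: smult_minus[symmetric] nrm_smult nrm_minus_commute)
    also have "\<dots> \<longlonglongrightarrow> 0" using s' by (auto simp: mem_cl_iff intro!: tendsto_eq_intros)
    finally show ?thesis using s c by (subst cl_eq_iff) auto
  qed
  have "z \<odot>\<^bsub>CA\<^esub> cl s = (\<Union>s'\<in>cl s. cl (\<lambda>n. z \<odot> s' n))" by (simp add: completion_def completion_class_def)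
  also have "\<dots> = (\<Union>s'\<in>cl s. cl (\<lambda>n. z \<odot> s n))" using * by simp
  also have "\<dots> = cl (\<lambda>n. z \<odot> s n)" using mem_cl_self[OF s] by auto
  finally show ?thesis .
qed

lemma cl_adj:
  assumes s: "nrm_cauchy A s"
  shows "adj CA (cl s) = cl (\<lambda>n. adj A (s n))"
proof -
  have *: "cl (\<lambda>n. adj A (s' n)) = cl (\<lambda>n. adj A (s n))" if s': "s' \<in> cl s" for s'
  proof -
    have c: "nrm_cauchy A s'" using that by (auto simp: mem_cl_iff)
    have "(\<lambda>n. nrm A (adj A (s' n) \<ominus> adj A (s n))) = (\<lambda>n. nrm A (s n \<ominus> s' n))"
      using s c by (simp add: adj_minus[symmetric] nrm_adj nrm_minus_commute)
    also have "\<dots> \<longlonglongrightarrow> 0" using s' by (auto simp: mem_cl_iff)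
    finally show ?thesis using s c by (subst cl_eq_iff) auto
  qed
  have "adj CA (cl s) = (\<Union>s'\<in>cl s. cl (\<lambda>n. adj A (s' n)))" by (simp add: completion_def completion_class_def)
  also have "\<dots> = (\<Union>s'\<in>cl s. cl (\<lambda>n. adj A (s n)))" using * by simp
  also have "\<dots> = cl (\<lambda>n. adj A (s n))" using mem_cl_self[OF s] by auto
  finally show ?thesis .
qed

lemma cl_zero: "\<zero>\<^bsub>CA\<^esub> = cl (\<lambda>_. \<zero>)" and cl_one: "\<one>\<^bsub>CA\<^esub> = cl (\<lambda>_. \<one>)"
  by (simp_all add: completion_def completion_class_def)

text \<open>Serves for the norm and for \<phi> alike: both are Lipschitz in the norm, so their
  limits along equivalent Cauchy sequences agree and the definite description is justified.\<close>

lemma tendsto_on_class: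
  fixes g :: "'a \<Rightarrow> 'c::real_normed_vector"
  assumes s: "nrm_cauchy A s" and l: "(\<lambda>n. g (s n)) \<longlonglongrightarrow> r"
    and lip: "\<And>a b. a \<in> carrier A \<Longrightarrow> b \<in> carrier A \<Longrightarrow> norm (g a - g b) \<le> K * nrm A (a \<ominus> b)"
  shows "(THE r. \<forall>s\<in>cl s. (\<lambda>n. g (s n)) \<longlonglongrightarrow> r) = r"
proof (rule the_equality)
  show "\<forall>t\<in>cl s. (\<lambda>n. g (t n)) \<longlonglongrightarrow> r"
  proof
    fix t assume t: "t \<in> cl s"
    then have c: "nrm_cauchy A t" by (simp add: mem_cl_iff)
    have K: "(\<lambda>n. K * nrm A (s n \<ominus> t n)) \<longlonglongrightarrow> 0"
      using t by (auto simp: mem_cl_iff intro!: tendsto_eq_intros)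
    have "(\<lambda>n. g (s n) - g (t n)) \<longlonglongrightarrow> 0"
      by (rule Lim_null_comparison[OF _ K]) (use lip s c in auto)
    then have "(\<lambda>n. g (s n) - (g (s n) - g (t n))) \<longlonglongrightarrow> r - 0" by (intro tendsto_diff l)
    then show "(\<lambda>n. g (t n)) \<longlonglongrightarrow> r" by simp
  qed
  show "r' = r" if "\<forall>s\<in>cl s. (\<lambda>n. g (s n)) \<longlonglongrightarrow> r'" for r'
    using that mem_cl_self[OF s] l LIMSEQ_unique by blast
qed

lemma cl_nrm:
  assumes s: "nrm_cauchy A s"
  shows "(\<lambda>n. nrm A (s n)) \<longlonglongrightarrow> nrm CA (cl s)"
proof -
  obtain r where r: "(\<lambda>n. nrm A (s n)) \<longlonglongrightarrow> r" using nrm_cauchy_convergent[OF s] by (auto simp: convergent_def)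
  have "nrm CA (cl s) = r"
    using tendsto_on_class[OF s r, of 1] nrm_diff_le by (simp add: completion_def)
  then show ?thesis using r by simp
qed

lemma cl_phi:
  assumes s: "nrm_cauchy A s"
  shows "(\<lambda>n. \<phi> (s n)) \<longlonglongrightarrow> \<Phi> (cl s)"
proof -
  obtain r where r: "(\<lambda>n. \<phi> (s n)) \<longlonglongrightarrow> r" using phi_cauchy_convergent[OF s] by (auto simp: convergent_def)
  have "\<Phi> (cl s) = r"
    using tendsto_on_class[OF s r, of "(nn \<one>)\<^sup>2"] cmod_phi_le
    by (simp add: completion_functional_def phi_minus[symmetric] mult.commute)
  then show ?thesis using r by simp
qed

section \<open>The completion as a *-algebra with a positive functional\<close>

lemma star_alg_completion: "star_alg CA"
proof -
  have add_grp: "abelian_group CA"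
  proof (rule abelian_groupI)
    fix X assume "X \<in> carrier CA"
    then obtain s where s: "nrm_cauchy A s" "X = cl s" by (rule completion_cases)
    show "\<exists>Y\<in>carrier CA. Y \<oplus>\<^bsub>CA\<^esub> X = \<zero>\<^bsub>CA\<^esub>"
    proof (rule bexI[of _ "cl (\<lambda>n. (-1) \<odot> s n)"])
      show "cl (\<lambda>n. (-1) \<odot> s n) \<oplus>\<^bsub>CA\<^esub> X = \<zero>\<^bsub>CA\<^esub>"
        unfolding s(2) cl_add[OF nrm_cauchy_smult[OF s(1)] s(1)] cl_zero
        using s(1) by (simp add: smult_neg_one l_neg)
    qed (use s in simp)
  qed (auto elim!: completion_cases simp: cl_add cl_zero a_ac)
  have mon: "monoid CA"
    by (rule monoidI) (auto elim!: completion_cases simp: cl_mult cl_one m_assoc)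
  have "ring CA"
    by (rule ringI[OF add_grp mon]) (auto elim!: completion_cases simp: cl_mult cl_add l_distr r_distr)
  then show ?thesis
    by (rule star_alg.intro, unfold_locales)
      (auto elim!: completion_cases simp: cl_mult cl_add cl_smult cl_adj smult_add_left smult_add_right
        smult_smult smult_mult_left smult_mult_right adj_add adj_smult adj_mult)
qed

lemma pos_alg_completion: "pos_alg CA \<Phi>"
proof (intro pos_alg.intro star_alg_completion pos_alg_axioms.intro)
  fix X assume "X \<in> carrier CA"
  then obtain s where s: "nrm_cauchy A s" "X = cl s" by (rule completion_cases)
  show "\<Phi> (z \<odot>\<^bsub>CA\<^esub> X) = z * \<Phi> X" for z
  proof (rule LIMSEQ_unique)
    show "(\<lambda>n. \<phi> (z \<odot> s n)) \<longlonglongrightarrow> \<Phi> (z \<odot>\<^bsub>CA\<^esub> X)" using s cl_phi[of "\<lambda>n. z \<odot> s n"] by (simp add: cl_smult)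
    show "(\<lambda>n. \<phi> (z \<odot> s n)) \<longlonglongrightarrow> z * \<Phi> X" using s tendsto_mult_left[OF cl_phi[of s], of z] by (simp add: phi_smult)
  qed
  show "\<Phi> (adj CA X) = cnj (\<Phi> X)"
  proof (rule LIMSEQ_unique)
    show "(\<lambda>n. \<phi> (adj A (s n))) \<longlonglongrightarrow> \<Phi> (adj CA X)" using s cl_phi[of "\<lambda>n. adj A (s n)"] by (simp add: cl_adj)
    show "(\<lambda>n. \<phi> (adj A (s n))) \<longlonglongrightarrow> cnj (\<Phi> X)" using s tendsto_cnj[OF cl_phi[of s]] by (simp add: phi_adj)
  qed
  show "0 \<le> Re (\<Phi> (adj CA X \<otimes>\<^bsub>CA\<^esub> X))"
  proof (rule LIMSEQ_le_const)
    show "(\<lambda>n. Re (\<phi> (adj A (s n) \<otimes> s n))) \<longlonglongrightarrow> Re (\<Phi> (adj CA X \<otimes>\<^bsub>CA\<^esub> X))"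
      using s cl_phi[of "\<lambda>n. adj A (s n) \<otimes> s n"] by (intro tendsto_Re) (simp add: cl_adj cl_mult)
  qed (use s phi_pos in auto)
  fix Y assume "Y \<in> carrier CA"
  then obtain t where t: "nrm_cauchy A t" "Y = cl t" by (rule completion_cases)
  show "\<Phi> (X \<oplus>\<^bsub>CA\<^esub> Y) = \<Phi> X + \<Phi> Y"
  proof (rule LIMSEQ_unique)
    show "(\<lambda>n. \<phi> (s n \<oplus> t n)) \<longlonglongrightarrow> \<Phi> (X \<oplus>\<^bsub>CA\<^esub> Y)" using s t cl_phi[of "\<lambda>n. s n \<oplus> t n"] by (simp add: cl_add)
    show "(\<lambda>n. \<phi> (s n \<oplus> t n)) \<longlonglongrightarrow> \<Phi> X + \<Phi> Y"
      using s t tendsto_add[OF cl_phi[of s] cl_phi[of t]] by (simp add: phi_add)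
  qed
qed

lemma cl_nn:
  assumes s: "nrm_cauchy A s"
  shows "(\<lambda>n. nn (s n)) \<longlonglongrightarrow> pos_alg.nn CA \<Phi> (cl s)"
  unfolding pos_alg.nn_def[OF pos_alg_completion] pos_alg.ip_def[OF pos_alg_completion] nn_def ip_def
  using cl_phi[of "\<lambda>n. adj A (s n) \<otimes> s n"] s
  by (intro tendsto_real_sqrt tendsto_Re) (simp add: cl_adj cl_mult)

text \<open>From the norm to bounds, inequalities pass to the limit. Conversely, let X have the
  bound C and let n be late in the representing sequence: comparing a n x with a m x as m tends to
  infinity shows that a n has the bound C + e, so the limit of the norms is at most C + e.\<close>

lemma gns_alg_completion: "gns_alg CA \<Phi>"
proof (intro gns_alg.intro pos_alg_completion gns_alg_axioms.intro)
  interpret C: pos_alg CA \<Phi> by (rule pos_alg_completion)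
  fix X assume "X \<in> carrier CA"
  then obtain a where a: "nrm_cauchy A a" "X = cl a" by (rule completion_cases)
  note lim = cl_nrm[OF a(1), folded a(2)]
  show "0 \<le> nrm CA X" by (rule LIMSEQ_le_const[OF lim]) (use a in auto)
  fix C :: real assume "0 \<le> C"
  show "nrm CA X \<le> C \<longleftrightarrow> C.bnd X C"
  proof
    assume le: "nrm CA X \<le> C"
    show "C.bnd X C"
      unfolding C.bnd_def
    proof
      fix Y assume Y: "Y \<in> carrier CA"
      then obtain t where t: "nrm_cauchy A t" "Y = cl t" by (rule completion_cases)
      have "C.nn (X \<otimes>\<^bsub>CA\<^esub> Y) \<le> nrm CA X * C.nn Y"
      proof (rule LIMSEQ_le)
        show "(\<lambda>n. nn (a n \<otimes> t n)) \<longlonglongrightarrow> C.nn (X \<otimes>\<^bsub>CA\<^esub> Y)"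
          using a t cl_nn[of "\<lambda>n. a n \<otimes> t n"] by (simp add: cl_mult)
        show "(\<lambda>n. nrm A (a n) * nn (t n)) \<longlonglongrightarrow> nrm CA X * C.nn Y"
          using t cl_nn[of t] by (intro tendsto_mult lim) simp
      qed (use a t in \<open>auto intro!: exI[of _ 0] nn_mult_le\<close>)
      also have "\<dots> \<le> C * C.nn Y" using le Y by (intro mult_right_mono) auto
      finally show "C.nn (X \<otimes>\<^bsub>CA\<^esub> Y) \<le> C * C.nn Y" .
    qed
  next
    assume bnd: "C.bnd X C"
    have "nrm CA X \<le> C + e" if e: "e > 0" for e
    proof -
      obtain N where N: "\<And>m n. m \<ge> N \<Longrightarrow> n \<ge> N \<Longrightarrow> nrm A (a m \<ominus> a n) < e"
        using nrm_cauchyD[OF a(1) e] by blast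
      have "nrm A (a n) \<le> C + e" if n: "n \<ge> N" for n
      proof -
        have "bnd (a n) (C + e)"
          unfolding bnd_def
        proof
          fix x assume x [simp]: "x \<in> carrier A"
          have [simp]: "a m \<in> carrier A" for m using a by simp
          have "nn (a n \<otimes> x) \<le> nn (a m \<otimes> x) + e * nn x" if m: "m \<ge> N" for m
          proof -
            have "a n \<otimes> x = a m \<otimes> x \<oplus> (a n \<ominus> a m) \<otimes> x"
              using \<open>\<And>m. a m \<in> carrier A\<close>[of m] \<open>\<And>m. a m \<in> carrier A\<close>[of n] x by algebra
            then have "nn (a n \<otimes> x) \<le> nn (a m \<otimes> x) + nn ((a n \<ominus> a m) \<otimes> x)" by (simp add: nn_add)
            also have "nn ((a n \<ominus> a m) \<otimes> x) \<le> nrm A (a n \<ominus> a m) * nn x" by (intro nn_mult_le) auto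
            also have "\<dots> \<le> e * nn x" using N[OF n m] by (intro mult_right_mono) auto
            finally show ?thesis by simp
          qed
          moreover have "(\<lambda>m. nn (a m \<otimes> x) + e * nn x) \<longlonglongrightarrow> C.nn (X \<otimes>\<^bsub>CA\<^esub> cl (\<lambda>_. x)) + e * nn x"
            using a cl_nn[of "\<lambda>n. a n \<otimes> x"] by (intro tendsto_add tendsto_const) (simp add: cl_mult)
          ultimately have "nn (a n \<otimes> x) \<le> C.nn (X \<otimes>\<^bsub>CA\<^esub> cl (\<lambda>_. x)) + e * nn x"
            by (intro LIMSEQ_le_const) auto
          also have "\<dots> \<le> C * C.nn (cl (\<lambda>_. x)) + e * nn x" using C.bndD[OF bnd] by simp
          also have "C.nn (cl (\<lambda>_. x)) = nn x"
            using cl_nn[of "\<lambda>_. x"] by (simp add: LIMSEQ_const_iff)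
          finally show "nn (a n \<otimes> x) \<le> (C + e) * nn x" by (simp add: algebra_simps)
        qed
        then show ?thesis using nrm_le_iff[of "a n" "C + e"] a \<open>0 \<le> C\<close> e by simp
      qed
      then show ?thesis using lim by (intro LIMSEQ_le_const2) auto
    qed
    then show "nrm CA X \<le> C" by (rule field_le_epsilon)
  qed
qed

section \<open>The dense embedding\<close>

lemma embed_closed [simp]: "a \<in> carrier A \<Longrightarrow> \<iota> a \<in> carrier CA"
  by (simp add: completion_embed_def)

lemma embed_mult: "\<lbrakk>a \<in> carrier A; b \<in> carrier A\<rbrakk> \<Longrightarrow> \<iota> (a \<otimes> b) = \<iota> a \<otimes>\<^bsub>CA\<^esub> \<iota> b"
  by (simp add: completion_embed_def cl_mult)

lemma embed_add: "\<lbrakk>a \<in> carrier A; b \<in> carrier A\<rbrakk> \<Longrightarrow> \<iota> (a \<oplus> b) = \<iota> a \<oplus>\<^bsub>CA\<^esub> \<iota> b"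
  by (simp add: completion_embed_def cl_add)

lemma embed_smult: "a \<in> carrier A \<Longrightarrow> \<iota> (z \<odot> a) = z \<odot>\<^bsub>CA\<^esub> \<iota> a"
  by (simp add: completion_embed_def cl_smult)

lemma embed_adj: "a \<in> carrier A \<Longrightarrow> \<iota> (adj A a) = adj CA (\<iota> a)"
  by (simp add: completion_embed_def cl_adj)

lemma embed_zero: "\<iota> \<zero> = \<zero>\<^bsub>CA\<^esub>" and embed_one: "\<iota> \<one> = \<one>\<^bsub>CA\<^esub>"
  by (simp_all add: completion_embed_def cl_zero cl_one)

lemma embed_nrm: "a \<in> carrier A \<Longrightarrow> nrm CA (\<iota> a) = nrm A a"
  using cl_nrm[of "\<lambda>_. a"] by (simp add: completion_embed_def LIMSEQ_const_iff)

lemma embed_phi: "a \<in> carrier A \<Longrightarrow> \<Phi> (\<iota> a) = \<phi> a"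
  using cl_phi[of "\<lambda>_. a"] by (simp add: completion_embed_def LIMSEQ_const_iff)

lemma embed_minus: "\<lbrakk>a \<in> carrier A; b \<in> carrier A\<rbrakk> \<Longrightarrow> \<iota> (a \<ominus> b) = \<iota> a \<ominus>\<^bsub>CA\<^esub> \<iota> b"
  by (simp add: minus_eq_smult star_alg.minus_eq_smult[OF star_alg_completion] embed_add embed_smult)

lemma embed_finsum:
  "\<lbrakk>finite S; \<And>i. i \<in> S \<Longrightarrow> f i \<in> carrier A\<rbrakk> \<Longrightarrow> \<iota> (finsum A f S) = finsum CA (\<lambda>i. \<iota> (f i)) S"
proof (induction S rule: finite_induct)
  case empty
  interpret C: star_alg CA by (rule star_alg_completion)
  show ?case by (simp add: embed_zero)
next
  case (insert x F)
  interpret C: star_alg CA by (rule star_alg_completion)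
  show ?case using insert by (simp add: Pi_def embed_add)
qed

lemma embed_dense:
  assumes "X \<in> carrier CA" and "e > 0"
  shows "\<exists>a\<in>carrier A. nrm CA (X \<ominus>\<^bsub>CA\<^esub> \<iota> a) < e"
proof -
  interpret C: gns_alg CA \<Phi> by (rule gns_alg_completion)
  obtain s where s: "nrm_cauchy A s" "X = cl s" using assms(1) by (rule completion_cases)
  obtain N where N: "\<And>m n. m \<ge> N \<Longrightarrow> n \<ge> N \<Longrightarrow> nrm A (s m \<ominus> s n) < e / 2"
    using nrm_cauchyD[OF s(1), of "e / 2"] \<open>e > 0\<close> by auto
  have "X \<ominus>\<^bsub>CA\<^esub> \<iota> (s N) = cl (\<lambda>n. s n \<ominus> s N)"
    using s by (simp add: C.minus_eq_smult minus_eq_smult completion_embed_def cl_smult cl_add)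
  moreover have "nrm_cauchy A (\<lambda>n. s n \<ominus> s N)" using s by (simp add: minus_eq_smult)
  ultimately have "(\<lambda>n. nrm A (s n \<ominus> s N)) \<longlonglongrightarrow> nrm CA (X \<ominus>\<^bsub>CA\<^esub> \<iota> (s N))"
    using cl_nrm[of "\<lambda>n. s n \<ominus> s N"] by simp
  then have "nrm CA (X \<ominus>\<^bsub>CA\<^esub> \<iota> (s N)) \<le> e / 2"
    by (rule LIMSEQ_le_const2) (use N in \<open>auto intro!: exI[of _ N] less_imp_le\<close>)
  then show ?thesis using s \<open>e > 0\<close> by (intro bexI[of _ "s N"]) auto
qed

text \<open>A diagonal argument: X n is replaced by an element f n of the original algebra at
  distance less than 1 / (n + 1); f is a Cauchy sequence there, and its class is the limit.\<close>

lemma complete_gns_alg_completion: "complete_gns_alg CA \<Phi>"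
proof (intro complete_gns_alg.intro gns_alg_completion complete_gns_alg_axioms.intro)
  interpret C: gns_alg CA \<Phi> by (rule gns_alg_completion)
  show "X = \<zero>\<^bsub>CA\<^esub>" if X: "X \<in> carrier CA" and "nrm CA X = 0" for X
  proof -
    obtain s where s: "nrm_cauchy A s" "X = cl s" using X by (rule completion_cases)
    then have "(\<lambda>n. nrm A (s n \<ominus> \<zero>)) \<longlonglongrightarrow> 0"
      using cl_nrm[OF s(1)] that by (simp add: a_minus_def)
    then show ?thesis unfolding s cl_zero using s by (subst cl_eq_iff) auto
  qed
  fix X assume X: "nrm_cauchy CA X"
  then have Xc [simp]: "X n \<in> carrier CA" for n by (simp add: nrm_cauchy_def)
  have "\<exists>a\<in>carrier A. nrm CA (X n \<ominus>\<^bsub>CA\<^esub> \<iota> a) < inverse (real (Suc n))" for n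
    by (rule embed_dense) auto
  then obtain f where f: "\<And>n. f n \<in> carrier A"
    and fX: "\<And>n. nrm CA (X n \<ominus>\<^bsub>CA\<^esub> \<iota> (f n)) < inverse (real (Suc n))" by metis
  have fc: "nrm_cauchy A f"
  proof (rule nrm_cauchyI[OF f])
    fix m n
    have "nrm A (f m \<ominus> f n) = nrm CA (\<iota> (f m) \<ominus>\<^bsub>CA\<^esub> \<iota> (f n))" using f by (simp add: embed_nrm embed_minus flip: embed_minus)
    also have "\<dots> \<le> nrm CA (\<iota> (f m) \<ominus>\<^bsub>CA\<^esub> X m) + nrm CA (X m \<ominus>\<^bsub>CA\<^esub> \<iota> (f n))"
      using f by (intro C.nrm_minus_triangle) auto
    also have "\<dots> \<le> nrm CA (\<iota> (f m) \<ominus>\<^bsub>CA\<^esub> X m) + (nrm CA (X m \<ominus>\<^bsub>CA\<^esub> X n) + nrm CA (X n \<ominus>\<^bsub>CA\<^esub> \<iota> (f n)))"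
      using f by (intro add_left_mono C.nrm_minus_triangle) auto
    also have "nrm CA (\<iota> (f m) \<ominus>\<^bsub>CA\<^esub> X m) = nrm CA (X m \<ominus>\<^bsub>CA\<^esub> \<iota> (f m))" using f by (simp add: C.nrm_minus_commute)
    finally show "nrm A (f m \<ominus> f n) \<le> inverse (real (Suc m)) + nrm CA (X m \<ominus>\<^bsub>CA\<^esub> X n) + inverse (real (Suc n))"
      using fX[of m] fX[of n] by linarith
  next
    fix e :: real assume e: "e > 0"
    obtain K where K: "inverse (real (Suc K)) < e / 3" using e reals_Archimedean[of "e / 3"] by auto
    obtain N where N: "\<And>m n. m \<ge> N \<Longrightarrow> n \<ge> N \<Longrightarrow> nrm CA (X m \<ominus>\<^bsub>CA\<^esub> X n) < e / 3"
      using X e unfolding nrm_cauchy_def by (metis divide_pos_pos zero_less_numeral)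
    have inv: "inverse (real (Suc m)) < e / 3" if "m \<ge> K" for m
      by (rule le_less_trans[OF _ K]) (use that in \<open>simp add: field_simps\<close>)
    have "inverse (real (Suc m)) + nrm CA (X m \<ominus>\<^bsub>CA\<^esub> X n) + inverse (real (Suc n)) < e"
      if "m \<ge> max K N" "n \<ge> max K N" for m n
    proof -
      have "m \<ge> K" "n \<ge> K" "m \<ge> N" "n \<ge> N" using that by auto
      then show ?thesis using inv[of m] inv[of n] N[of m n] by linarith
    qed
    then show "\<exists>N. \<forall>m\<ge>N. \<forall>n\<ge>N. inverse (real (Suc m)) + nrm CA (X m \<ominus>\<^bsub>CA\<^esub> X n) + inverse (real (Suc n)) < e"
      by blast
  qed
  have "(\<lambda>n. nrm CA (X n \<ominus>\<^bsub>CA\<^esub> cl f)) \<longlonglongrightarrow> 0"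
  proof (rule LIMSEQ_I)
    fix e :: real assume e: "e > 0"
    obtain K where K: "inverse (real (Suc K)) < e / 2" using e reals_Archimedean[of "e / 2"] by auto
    obtain N where N: "\<And>m n. m \<ge> N \<Longrightarrow> n \<ge> N \<Longrightarrow> nrm A (f m \<ominus> f n) < e / 2"
      using nrm_cauchyD[OF fc, of "e / 2"] e by auto
    have "norm (nrm CA (X n \<ominus>\<^bsub>CA\<^esub> cl f) - 0) < e" if n: "n \<ge> max K N" for n
    proof -
      have nc: "nrm_cauchy A (\<lambda>k. f n \<ominus> f k)" using f fc by (simp add: minus_eq_smult)
      have "\<iota> (f n) \<ominus>\<^bsub>CA\<^esub> cl f = cl (\<lambda>k. f n \<ominus> f k)"
        using f fc by (simp add: C.minus_eq_smult minus_eq_smult completion_embed_def cl_smult cl_add)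
      then have "(\<lambda>k. nrm A (f n \<ominus> f k)) \<longlonglongrightarrow> nrm CA (\<iota> (f n) \<ominus>\<^bsub>CA\<^esub> cl f)"
        using cl_nrm[OF nc] by simp
      then have "nrm CA (\<iota> (f n) \<ominus>\<^bsub>CA\<^esub> cl f) \<le> e / 2"
        by (rule LIMSEQ_le_const2) (use N n in \<open>auto intro!: exI[of _ N] less_imp_le\<close>)
      moreover have "nrm CA (X n \<ominus>\<^bsub>CA\<^esub> \<iota> (f n)) < e / 2"
      proof -
        have "inverse (real (Suc n)) \<le> inverse (real (Suc K))" using n by (simp add: field_simps)
        then show ?thesis using fX[of n] K by linarith
      qed
      moreover have "nrm CA (X n \<ominus>\<^bsub>CA\<^esub> cl f) \<le> nrm CA (X n \<ominus>\<^bsub>CA\<^esub> \<iota> (f n)) + nrm CA (\<iota> (f n) \<ominus>\<^bsub>CA\<^esub> cl f)"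
        using f fc by (intro C.nrm_minus_triangle) auto
      moreover have "0 \<le> nrm CA (X n \<ominus>\<^bsub>CA\<^esub> cl f)" using fc by simp
      ultimately show ?thesis by simp
    qed
    then show "\<exists>no. \<forall>n\<ge>no. norm (nrm CA (X n \<ominus>\<^bsub>CA\<^esub> cl f) - 0) < e" by blast
  qed
  then show "\<exists>a\<in>carrier CA. nrm_tendsto CA X a"
    using fc by (intro bexI[of _ "cl f"]) (auto simp: nrm_tendsto_def)
qed

end

section \<open>Scalar matrix algebras\<close>

lemma ell2_zero [simp]: "(\<lambda>i. 0) \<in> ell2 I"
  by (simp add: ell2_def)

lemma ell2_norm_nonneg [simp]: "0 \<le> ell2_norm I v"
  by (simp add: ell2_norm_def infsum_nonneg)

lemma ell2_norm_sq: "(ell2_norm I v)\<^sup>2 = (\<Sum>\<^sub>\<infinity>i\<in>I. (cmod (v i))\<^sup>2)"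
  by (simp add: ell2_norm_def infsum_nonneg)

lemma ell2_scale: "v \<in> ell2 I \<Longrightarrow> (\<lambda>i. z * v i) \<in> ell2 I"
  by (auto simp: ell2_def norm_mult power_mult_distrib intro!: summable_on_cmult_right)

lemma ell2_norm_scale: "ell2_norm I (\<lambda>i. z * v i) = cmod z * ell2_norm I v"
  by (simp add: ell2_norm_def norm_mult power_mult_distrib infsum_cmult_right' real_sqrt_mult)

lemma op_norm_le:
  assumes "0 \<le> C" and "\<And>v. v \<in> ell2 I \<Longrightarrow> ell2_norm I (T v) \<le> C * ell2_norm I v"
  shows "op_norm I T \<le> C"
  unfolding op_norm_def
proof (rule cSup_least)
  have "ell2_norm I (\<lambda>i. 0) = 0" by (simp add: ell2_norm_def)
  then show "{ell2_norm I (T v) |v. v \<in> ell2 I \<and> ell2_norm I v \<le> 1} \<noteq> {}"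
    by (auto intro!: exI[of _ "\<lambda>i. 0"])
  fix x assume "x \<in> {ell2_norm I (T v) |v. v \<in> ell2 I \<and> ell2_norm I v \<le> 1}"
  then obtain v where v: "x = ell2_norm I (T v)" "v \<in> ell2 I" "ell2_norm I v \<le> 1" by blast
  then have "x \<le> C * ell2_norm I v" using assms by simp
  also have "\<dots> \<le> C * 1" using v assms(1) by (intro mult_left_mono)
  finally show "x \<le> C" by simp
qed

lemma op_norm_bound:
  assumes T: "bounded_op I T"
  shows "0 \<le> op_norm I T" and "v \<in> ell2 I \<Longrightarrow> ell2_norm I (T v) \<le> op_norm I T * ell2_norm I v"
proof -
  let ?S = "{ell2_norm I (T v) |v. v \<in> ell2 I \<and> ell2_norm I v \<le> 1}"
  obtain C where C: "\<And>v. v \<in> ell2 I \<Longrightarrow> ell2_norm I (T v) \<le> C * ell2_norm I v"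
    using T unfolding bounded_op_def by blast
  have bdd: "bdd_above ?S"
  proof (rule bdd_aboveI)
    fix x assume "x \<in> ?S"
    then obtain v where v: "x = ell2_norm I (T v)" "v \<in> ell2 I" "ell2_norm I v \<le> 1" by blast
    then have "x \<le> C * ell2_norm I v" using C by simp
    also have "\<dots> \<le> \<bar>C\<bar> * ell2_norm I v" by (intro mult_right_mono) auto
    also have "\<dots> \<le> \<bar>C\<bar> * 1" using v by (intro mult_left_mono) auto
    finally show "x \<le> \<bar>C\<bar>" by simp
  qed
  have le: "ell2_norm I (T v) \<le> op_norm I T" if "v \<in> ell2 I" "ell2_norm I v \<le> 1" for v
    unfolding op_norm_def using that by (intro cSup_upper bdd) blast
  have z: "ell2_norm I (\<lambda>i. 0) = 0" by (simp add: ell2_norm_def)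
  show "0 \<le> op_norm I T" by (rule order_trans[OF ell2_norm_nonneg le[of "\<lambda>i. 0"]]) (simp_all add: z)
  show "ell2_norm I (T v) \<le> op_norm I T * ell2_norm I v" if v: "v \<in> ell2 I"
  proof (cases "ell2_norm I v = 0")
    case True
    then show ?thesis using C[OF v] by simp
  next
    case False
    let ?z = "complex_of_real (inverse (ell2_norm I v))"
    have pos: "ell2_norm I v > 0" using False by (simp add: less_le)
    have "T (\<lambda>i. ?z * v i) = (\<lambda>i. ?z * T v i)" using T v unfolding bounded_op_def by blast
    then have "cmod ?z * ell2_norm I (T v) = ell2_norm I (T (\<lambda>i. ?z * v i))" by (simp only: ell2_norm_scale)
    also have "\<dots> \<le> op_norm I T"
    proof (intro le ell2_scale v)
      have "ell2_norm I (\<lambda>i. ?z * v i) = cmod ?z * ell2_norm I v" by (rule ell2_norm_scale)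
      also have "\<dots> = 1" using pos by (simp add: norm_inverse)
      finally show "ell2_norm I (\<lambda>i. ?z * v i) \<le> 1" by simp
    qed
    finally have "inverse (ell2_norm I v) * ell2_norm I (T v) \<le> op_norm I T"
      unfolding norm_of_real using pos by simp
    then show ?thesis using pos by (simp add: field_simps)
  qed
qed

lemma op_norm_le_iff:
  assumes "bounded_op I T" and "0 \<le> C"
  shows "op_norm I T \<le> C \<longleftrightarrow> (\<forall>v\<in>ell2 I. ell2_norm I (T v) \<le> C * ell2_norm I v)"
proof
  assume le: "op_norm I T \<le> C"
  show "\<forall>v\<in>ell2 I. ell2_norm I (T v) \<le> C * ell2_norm I v"
    using op_norm_bound(2)[OF assms(1)] mult_right_mono[OF le] by (meson ell2_norm_nonneg order_trans)
qed (use assms op_norm_le in blast)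

text \<open>The base of the matrix construction. With the identity as functional,
  \<open>matrix_algebra k\<close> is an instance of \<open>mat_alg\<close> and inherits
  completeness, square roots and the positivity criterion.\<close>

definition complex_cstar :: "complex cstar" where
  "complex_cstar = \<lparr>carrier = UNIV, Group.monoid.mult = (*), monoid.one = 1, ring.zero = 0, ring.add = (+),
    module.smult = (*), adj = cnj, nrm = cmod\<rparr>"

lemma complex_cstar_sel [simp]:
  "carrier complex_cstar = UNIV" "Group.monoid.mult complex_cstar = (*)" "monoid.one complex_cstar = 1"
  "ring.zero complex_cstar = 0" "ring.add complex_cstar = (+)" "module.smult complex_cstar = (*)"
  "adj complex_cstar = cnj" "nrm complex_cstar = cmod"
  by (simp_all add: complex_cstar_def)

lemma star_alg_complex: "star_alg complex_cstar"
proof -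
  have "abelian_group complex_cstar"
    by (rule abelian_groupI) (auto simp: algebra_simps intro: exI[of _ "- _"])
  moreover have "monoid complex_cstar" by (rule monoidI) auto
  ultimately have "ring complex_cstar" by (rule ringI) (auto simp: algebra_simps)
  then show ?thesis by (rule star_alg.intro, unfold_locales) (auto simp: algebra_simps)
qed

lemma pos_alg_complex: "pos_alg complex_cstar (\<lambda>z. z)"
  by (intro pos_alg.intro star_alg_complex pos_alg_axioms.intro) auto

lemma complex_nn: "pos_alg.nn complex_cstar (\<lambda>z. z) x = cmod x"
  by (simp add: pos_alg.nn_def[OF pos_alg_complex] pos_alg.ip_def[OF pos_alg_complex] cmod_def power2_eq_square)

lemma gns_alg_complex: "gns_alg complex_cstar (\<lambda>z. z)"
proof (intro gns_alg.intro pos_alg_complex gns_alg_axioms.intro)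
  fix a :: complex and C :: real
  show "0 \<le> nrm complex_cstar a" by simp
  show "nrm complex_cstar a \<le> C \<longleftrightarrow> pos_alg.bnd complex_cstar (\<lambda>z. z) a C"
    unfolding pos_alg.bnd_def[OF pos_alg_complex]
    by (auto simp: complex_nn norm_mult intro: mult_right_mono dest: spec[of _ 1])
qed

lemma complex_minus: "x \<ominus>\<^bsub>complex_cstar\<^esub> y = x - y"
  using star_alg.minus_eq_smult[OF star_alg_complex, of x y] by simp

lemma complete_gns_alg_complex: "complete_gns_alg complex_cstar (\<lambda>z. z)"
proof (intro complete_gns_alg.intro gns_alg_complex complete_gns_alg_axioms.intro)
  fix s :: "nat \<Rightarrow> complex"
  assume "nrm_cauchy complex_cstar s"
  then have "Cauchy s" unfolding nrm_cauchy_def Cauchy_def by (simp add: complex_minus dist_norm)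
  then obtain a where "s \<longlonglongrightarrow> a" using Cauchy_convergent unfolding convergent_def by blast
  then have "(\<lambda>n. cmod (s n - a)) \<longlonglongrightarrow> 0" by (simp add: tendsto_norm_zero_iff LIM_zero_iff)
  then show "\<exists>a\<in>carrier complex_cstar. nrm_tendsto complex_cstar s a"
    by (auto simp: nrm_tendsto_def complex_minus)
qed simp

lemma complex_finsum: "finite S \<Longrightarrow> finsum complex_cstar f S = sum f S"
proof (induction S rule: finite_induct)
  interpret star_alg complex_cstar by (rule star_alg_complex)
  case (insert x F)
  then show ?case by simp
next
  interpret star_alg complex_cstar by (rule star_alg_complex)
  case empty
  show ?case by simp
qed

abbreviation mat_op :: "nat \<Rightarrow> (nat \<Rightarrow> nat \<Rightarrow> complex) \<Rightarrow> (nat \<Rightarrow> complex) \<Rightarrow> nat \<Rightarrow> complex" where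
  "mat_op k M \<equiv> (\<lambda>v i. \<Sum>j<k. M i j * v j)"

lemma matrix_algebra_eq: "matrix_algebra k = mat_alg k complex_cstar (\<lambda>M. op_norm {..<k} (mat_op k M))"
  by (simp add: matrix_algebra_def mat_alg_def complex_finsum cong: if_cong)

lemma matrix_algebra_sel [simp]:
  "carrier (matrix_algebra k) = {M. \<forall>i j. i \<ge> k \<or> j \<ge> k \<longrightarrow> M i j = 0}"
  "Group.monoid.mult (matrix_algebra k) = (\<lambda>M N i j. \<Sum>l<k. M i l * N l j)"
  "monoid.one (matrix_algebra k) = (\<lambda>i j. if i = j \<and> i < k then 1 else 0)"
  "ring.zero (matrix_algebra k) = (\<lambda>i j. 0)"
  "ring.add (matrix_algebra k) = (\<lambda>M N i j. M i j + N i j)"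
  "module.smult (matrix_algebra k) = (\<lambda>z M i j. z * M i j)"
  "adj (matrix_algebra k) = (\<lambda>M i j. cnj (M j i))"
  by (simp_all add: matrix_algebra_def)

lemma ell2_lessThan: "v \<in> ell2 {..<k::nat} \<longleftrightarrow> (\<forall>i\<ge>k. v i = 0)"
  by (auto simp: ell2_def not_less intro: summable_on_finite)

lemma pos_alg_matrix_algebra: "pos_alg (matrix_algebra k) (mat_phi k (\<lambda>z. z))"
  unfolding matrix_algebra_eq by (rule pos_alg.pos_alg_mat[OF pos_alg_complex])

lemma matrix_algebra_ip:
  assumes "X \<in> carrier (matrix_algebra k)" "Y \<in> carrier (matrix_algebra k)"
  shows "pos_alg.ip (matrix_algebra k) (mat_phi k (\<lambda>z. z)) X Y = (\<Sum>c<k. \<Sum>i<k. cnj (X i c) * Y i c)"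
  using assms unfolding matrix_algebra_eq
  by (simp add: pos_alg.mat_ip[OF pos_alg_complex] pos_alg.ip_def[OF pos_alg_complex])

lemma matrix_algebra_nn_sq:
  assumes "X \<in> carrier (matrix_algebra k)"
  shows "(pos_alg.nn (matrix_algebra k) (mat_phi k (\<lambda>z. z)) X)\<^sup>2 = (\<Sum>c<k. \<Sum>i<k. (cmod (X i c))\<^sup>2)"
  using assms unfolding matrix_algebra_eq
  by (simp add: pos_alg.mat_nn_sq[OF pos_alg_complex] complex_nn)

text \<open>Left multiplication on k by k matrices consists of k copies of the operator on column
  vectors, so both have the same bounds. This identifies the given operator norm with the one coming
  from the trace.\<close>

lemma matrix_algebra_bnd_iff:
  assumes M: "M \<in> carrier (matrix_algebra k)" and C: "0 \<le> C"
  shows "pos_alg.bnd (matrix_algebra k) (mat_phi k (\<lambda>z. z)) M C \<longleftrightarrow>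
    (\<forall>v\<in>ell2 {..<k}. ell2_norm {..<k} (mat_op k M v) \<le> C * ell2_norm {..<k} v)"
proof -
  interpret M: pos_alg "matrix_algebra k" "mat_phi k (\<lambda>z. z)" by (rule pos_alg_matrix_algebra)
  have sq: "(ell2_norm {..<k} v)\<^sup>2 = (\<Sum>i<k. (cmod (v i))\<^sup>2)" for v by (simp add: ell2_norm_sq)
  show ?thesis
  proof
    assume bnd: "M.bnd M C"
    show "\<forall>v\<in>ell2 {..<k}. ell2_norm {..<k} (mat_op k M v) \<le> C * ell2_norm {..<k} v"
    proof
      fix v assume v: "v \<in> ell2 {..<k}"
      \<comment> \<open>The vector becomes column 0; for k = 0 there is no such column and X has to
        vanish.\<close>
      define X where "X = (\<lambda>i c::nat. if c = 0 \<and> k \<noteq> 0 then v i else 0)"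
      have X: "X \<in> carrier (matrix_algebra k)" using v by (auto simp: X_def ell2_lessThan)
      have nX: "(M.nn X)\<^sup>2 = (ell2_norm {..<k} v)\<^sup>2"
      proof -
        have "(M.nn X)\<^sup>2 = (\<Sum>c<k. if c = 0 then \<Sum>i<k. (cmod (v i))\<^sup>2 else 0)"
          unfolding matrix_algebra_nn_sq[OF X] by (intro sum.cong refl) (auto simp: X_def)
        then show ?thesis unfolding sq by (cases "k = 0") (simp_all add: sum.delta)
      qed
      have nMX: "(M.nn (M \<otimes>\<^bsub>matrix_algebra k\<^esub> X))\<^sup>2 = (ell2_norm {..<k} (mat_op k M v))\<^sup>2"
      proof -
        have "(M.nn (M \<otimes>\<^bsub>matrix_algebra k\<^esub> X))\<^sup>2 = (\<Sum>c<k. if c = 0 then \<Sum>i<k. (cmod (\<Sum>j<k. M i j * v j))\<^sup>2 else 0)"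
          unfolding matrix_algebra_nn_sq[OF M.m_closed[OF M X]] by (intro sum.cong refl) (auto simp: X_def)
        then show ?thesis unfolding sq by (cases "k = 0") (simp_all add: sum.delta)
      qed
      have "M.nn X = ell2_norm {..<k} v" "M.nn (M \<otimes>\<^bsub>matrix_algebra k\<^esub> X) = ell2_norm {..<k} (mat_op k M v)"
        using nX nMX M.nn_nonneg[OF X] M.nn_nonneg[OF M.m_closed[OF M X]] by (simp_all add: power2_eq_iff_nonneg)
      then show "ell2_norm {..<k} (mat_op k M v) \<le> C * ell2_norm {..<k} v"
        using M.bndD[OF bnd X] by simp
    qed
  next
    assume bnd: "\<forall>v\<in>ell2 {..<k}. ell2_norm {..<k} (mat_op k M v) \<le> C * ell2_norm {..<k} v"
    show "M.bnd M C"
      unfolding M.bnd_def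
    proof
      fix X assume X: "X \<in> carrier (matrix_algebra k)"
      have "(M.nn (M \<otimes>\<^bsub>matrix_algebra k\<^esub> X))\<^sup>2 = (\<Sum>c<k. (ell2_norm {..<k} (mat_op k M (\<lambda>i. X i c)))\<^sup>2)"
        unfolding matrix_algebra_nn_sq[OF M.m_closed[OF M X]] sq by simp
      also have "\<dots> \<le> (\<Sum>c<k. (C * ell2_norm {..<k} (\<lambda>i. X i c))\<^sup>2)"
        using X bnd by (intro sum_mono power_mono) (auto simp: ell2_lessThan)
      also have "\<dots> = (C * M.nn X)\<^sup>2"
        unfolding power_mult_distrib sq matrix_algebra_nn_sq[OF X] by (simp add: sum_distrib_left)
      finally show "M.nn (M \<otimes>\<^bsub>matrix_algebra k\<^esub> X) \<le> C * M.nn X"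
        by (rule power2_le_imp_le) (use X C in auto)
    qed
  qed
qed

lemma bounded_op_matrix:
  assumes M: "M \<in> carrier (matrix_algebra k)"
  shows "bounded_op {..<k} (mat_op k M)"
proof -
  let ?C = "real k * (\<Sum>i<k. \<Sum>j<k. cmod (M i j))"
  have "pos_alg.bnd (matrix_algebra k) (mat_phi k (\<lambda>z. z)) M ?C"
    using gns_alg.mat_bnd[OF gns_alg_complex M[unfolded matrix_algebra_eq]] by (simp add: matrix_algebra_eq)
  then have "\<forall>v\<in>ell2 {..<k}. ell2_norm {..<k} (mat_op k M v) \<le> ?C * ell2_norm {..<k} v"
    by (subst (asm) matrix_algebra_bnd_iff[OF M]) (auto intro!: mult_nonneg_nonneg sum_nonneg)
  then have "\<exists>C. \<forall>v\<in>ell2 {..<k}. ell2_norm {..<k} (mat_op k M v) \<le> C * ell2_norm {..<k} v" by blast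
  moreover have "mat_op k M (\<lambda>i. v i + w i) = (\<lambda>i. mat_op k M v i + mat_op k M w i)" for v w
    by (simp add: distrib_left sum.distrib)
  moreover have "mat_op k M (\<lambda>i. z * v i) = (\<lambda>i. z * mat_op k M v i)" for z v
    by (simp add: sum_distrib_left mult_ac)
  moreover have "mat_op k M v \<in> ell2 {..<k}" for v using M by (simp add: ell2_lessThan)
  ultimately show ?thesis unfolding bounded_op_def by blast
qed

lemma complete_gns_alg_matrix_algebra: "complete_gns_alg (matrix_algebra k) (mat_phi k (\<lambda>z. z))"
proof -
  have "gns_alg (matrix_algebra k) (mat_phi k (\<lambda>z. z))"
  proof (intro gns_alg.intro pos_alg_matrix_algebra gns_alg_axioms.intro)
    fix M and C :: real
    assume M: "M \<in> carrier (matrix_algebra k)"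
    have nrm: "nrm (matrix_algebra k) M = op_norm {..<k} (mat_op k M)" by (simp add: matrix_algebra_def)
    show "0 \<le> nrm (matrix_algebra k) M"
      unfolding nrm by (rule op_norm_bound(1)[OF bounded_op_matrix[OF M]])
    assume "0 \<le> C"
    then show "nrm (matrix_algebra k) M \<le> C \<longleftrightarrow> pos_alg.bnd (matrix_algebra k) (mat_phi k (\<lambda>z. z)) M C"
      unfolding nrm op_norm_le_iff[OF bounded_op_matrix[OF M] \<open>0 \<le> C\<close>] matrix_algebra_bnd_iff[OF M \<open>0 \<le> C\<close>] by simp
  qed
  then show ?thesis
    unfolding matrix_algebra_eq by (rule complete_gns_alg.complete_gns_alg_mat[OF complete_gns_alg_complex])
qed

section \<open>The convolution algebra of a compact dynamical system\<close>

text \<open>The convolution algebra, its representations and the universal norm need no cosets, only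
  an action on a compact space and a base point, which fixes the functional. Compactness enters
  through the boundedness of continuous functions.\<close>

locale compact_dynsys = group G for G :: "('g, 'm) monoid_scheme" (structure) +
  fixes T :: "'x topology" and act :: "'g \<Rightarrow> 'x \<Rightarrow> 'x"
    and \<alpha> :: "'g \<Rightarrow> ('x \<Rightarrow> complex) \<Rightarrow> 'x \<Rightarrow> complex" and x0 :: 'x
  assumes compact: "compact_space T" and base: "x0 \<in> topspace T"
    and act_closed [simp]: "\<lbrakk>g \<in> carrier G; x \<in> topspace T\<rbrakk> \<Longrightarrow> act g x \<in> topspace T"
    and act_one [simp]: "x \<in> topspace T \<Longrightarrow> act \<one> x = x"
    and act_mult: "\<lbrakk>g \<in> carrier G; h \<in> carrier G; x \<in> topspace T\<rbrakk> \<Longrightarrow> act (g \<otimes> h) x = act g (act h x)"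
    and act_continuous: "g \<in> carrier G \<Longrightarrow> continuous_map T T (act g)"
    and alpha: "g \<in> carrier G \<Longrightarrow> \<alpha> g f = (\<lambda>x. if x \<in> topspace T then f (act (inv g) x) else 0)"
begin

abbreviation "X \<equiv> topspace T"
abbreviation "CX \<equiv> continuous_functions T"
abbreviation "B \<equiv> convolution_algebra G CX \<alpha>"

section \<open>Continuous functions and the induced action\<close>

lemma act_inv_act [simp]: "\<lbrakk>g \<in> carrier G; x \<in> X\<rbrakk> \<Longrightarrow> act (inv g) (act g x) = x"
  and act_act_inv [simp]: "\<lbrakk>g \<in> carrier G; x \<in> X\<rbrakk> \<Longrightarrow> act g (act (inv g) x) = x"
  by (simp_all flip: act_mult)

lemma CX_sel [simp]:
  "carrier CX = {f. continuous_map T euclidean f \<and> (\<forall>x. x \<notin> X \<longrightarrow> f x = 0)}"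
  "Group.monoid.mult CX = (\<lambda>f h x. f x * h x)"
  "monoid.one CX = (\<lambda>x. if x \<in> X then 1 else 0)"
  "ring.zero CX = (\<lambda>x. 0)"
  "ring.add CX = (\<lambda>f h x. f x + h x)"
  "module.smult CX = (\<lambda>z f x. z * f x)"
  "adj CX = (\<lambda>f x. cnj (f x))"
  by (simp_all add: continuous_functions_def)

lemma continuous_map_complex_mult:
  "\<lbrakk>continuous_map T euclidean f; continuous_map T euclidean h\<rbrakk> \<Longrightarrow> continuous_map T euclidean (\<lambda>x. f x * h x :: complex)"
  by (simp add: continuous_map_atin tendsto_mult)

lemma continuous_map_complex_cnj:
  "continuous_map T euclidean f \<Longrightarrow> continuous_map T euclidean (\<lambda>x. cnj (f x))"
  by (simp add: continuous_map_atin tendsto_cnj)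

lemma continuous_map_restrict:
  "continuous_map T euclidean f \<Longrightarrow> continuous_map T euclidean (\<lambda>x. if x \<in> X then f x else (0::complex))"
  by (erule continuous_map_eq) simp

lemma CX_bounded:
  assumes "f \<in> carrier CX"
  shows "\<exists>K. \<forall>x. cmod (f x) \<le> K"
proof -
  have "compactin euclidean (f ` X)"
    using assms compact by (intro image_compactin[of T]) (auto simp: compact_space_def)
  then have "bounded (f ` X)" by (simp add: compact_imp_bounded)
  then obtain K where "\<And>x. x \<in> X \<Longrightarrow> cmod (f x) \<le> K" unfolding bounded_iff by auto
  then have "cmod (f x) \<le> max K 0" for x using assms by (cases "x \<in> X") (auto simp: le_max_iff_disj)
  then show ?thesis by blast
qed

lemma abelian_group_CX: "abelian_group CX"
proof (rule abelian_groupI)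
  fix f assume "f \<in> carrier CX"
  then show "\<exists>h\<in>carrier CX. h \<oplus>\<^bsub>CX\<^esub> f = \<zero>\<^bsub>CX\<^esub>"
    by (intro bexI[of _ "\<lambda>x. - f x"]) (auto simp: continuous_map_minus)
qed (auto simp: continuous_map_add algebra_simps)

lemma finsum_CX:
  assumes "finite S" and "\<And>s. s \<in> S \<Longrightarrow> f s \<in> carrier CX"
  shows "finsum CX f S = (\<lambda>x. \<Sum>s\<in>S. f s x)"
  using assms
proof (induction S rule: finite_induct)
  interpret abelian_group CX by (rule abelian_group_CX)
  case empty
  show ?case by simp
next
  interpret abelian_group CX by (rule abelian_group_CX)
  case (insert a S)
  then have "finsum CX f (insert a S) = f a \<oplus>\<^bsub>CX\<^esub> finsum CX f S"
    by (intro finsum_insert) auto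
  then show ?case using insert by simp
qed

lemma alpha_closed: "\<lbrakk>g \<in> carrier G; f \<in> carrier CX\<rbrakk> \<Longrightarrow> \<alpha> g f \<in> carrier CX"
  by (auto simp: alpha intro!: continuous_map_restrict continuous_map_compose[OF act_continuous, unfolded o_def])

lemma CX_mult_closed: "\<lbrakk>f \<in> carrier CX; h \<in> carrier CX\<rbrakk> \<Longrightarrow> f \<otimes>\<^bsub>CX\<^esub> h \<in> carrier CX"
  by (auto intro: continuous_map_complex_mult)

section \<open>Convolution and involution of finitely supported functions\<close>

abbreviation supp where "supp F \<equiv> fsupp G CX F"

lemma supp_eq: "supp F = {g \<in> carrier G. F g \<noteq> (\<lambda>x. 0)}"
  by (simp add: fsupp_def)

lemma supp_subset: "supp F \<subseteq> carrier G"
  by (auto simp: supp_eq)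

lemma not_supp: "\<lbrakk>g \<in> carrier G; g \<notin> supp F\<rbrakk> \<Longrightarrow> F g x = 0"
  by (simp add: supp_eq)

lemma B_carrier: "F \<in> carrier B \<longleftrightarrow>
    (\<forall>g\<in>carrier G. F g \<in> carrier CX) \<and> (\<forall>g. g \<notin> carrier G \<longrightarrow> F g = (\<lambda>x. 0)) \<and> finite (supp F)"
  by (simp add: convolution_algebra_def)

lemma B_coeff: "F \<in> carrier B \<Longrightarrow> F g \<in> carrier CX"
  by (cases "g \<in> carrier G") (simp_all add: B_carrier)

lemma B_finite: "F \<in> carrier B \<Longrightarrow> finite (supp F)"
  by (simp add: B_carrier)

lemma B_outside: "F \<in> carrier B \<Longrightarrow> g \<notin> carrier G \<Longrightarrow> F g x = 0"
  by (simp add: B_carrier)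

lemma B_outside_X: "F \<in> carrier B \<Longrightarrow> x \<notin> X \<Longrightarrow> F g x = 0"
  using B_coeff[of F g] by simp

lemma B_eqI:
  assumes "F \<in> carrier B" "H \<in> carrier B" and "\<And>g x. g \<in> carrier G \<Longrightarrow> x \<in> X \<Longrightarrow> F g x = H g x"
  shows "F = H"
proof (intro ext)
  fix g x show "F g x = H g x"
    using assms by (cases "g \<in> carrier G \<and> x \<in> X") (auto simp: B_outside B_outside_X)
qed

lemma B_sel [simp]:
  "monoid.one B = (\<lambda>g. if g = \<one> then (\<lambda>x. if x \<in> X then 1 else 0) else (\<lambda>x. 0))"
  "ring.zero B = (\<lambda>g x. 0)"
  "ring.add B = (\<lambda>F H g x. F g x + H g x)"
  "module.smult B = (\<lambda>z F g x. z * F g x)"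
  by (simp_all add: convolution_algebra_def cong: if_cong)

lemma nrm_B: "nrm B = universal_norm G CX \<alpha>"
  by (simp add: convolution_algebra_def)

lemma adj_B:
  assumes "F \<in> carrier B"
  shows "adj B F = (\<lambda>g x. if g \<in> carrier G \<and> x \<in> X then cnj (F (inv g) (act (inv g) x)) else 0)"
  by (auto simp: convolution_algebra_def alpha fun_eq_iff)

text \<open>Allowing any finite set that contains the support lets convolutions of different
  functions be compared over a common index set; the additional summands vanish.\<close>

lemma mult_B:
  assumes F: "F \<in> carrier B" and H: "H \<in> carrier B" and S: "finite S" "supp F \<subseteq> S" "S \<subseteq> carrier G"
    and g: "g \<in> carrier G"
  shows "(F \<otimes>\<^bsub>B\<^esub> H) g x = (\<Sum>s\<in>S. F s x * H (inv s \<otimes> g) (act (inv s) x))"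
proof -
  have "(F \<otimes>\<^bsub>B\<^esub> H) g = finsum CX (\<lambda>s. F s \<otimes>\<^bsub>CX\<^esub> \<alpha> s (H (inv s \<otimes> g))) (supp F)"
    using g by (simp add: convolution_algebra_def)
  also have "\<dots> = (\<lambda>x. \<Sum>s\<in>supp F. (F s \<otimes>\<^bsub>CX\<^esub> \<alpha> s (H (inv s \<otimes> g))) x)"
    using F H g supp_subset[of F]
    by (intro finsum_CX CX_mult_closed alpha_closed B_coeff B_finite) auto
  finally have "(F \<otimes>\<^bsub>B\<^esub> H) g x = (\<Sum>s\<in>supp F. F s x * \<alpha> s (H (inv s \<otimes> g)) x)" by simp
  also have "\<dots> = (\<Sum>s\<in>supp F. F s x * H (inv s \<otimes> g) (act (inv s) x))"
  proof (rule sum.cong[OF refl])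
    fix s assume "s \<in> supp F"
    then have "s \<in> carrier G" using supp_subset by blast
    then show "F s x * \<alpha> s (H (inv s \<otimes> g)) x = F s x * H (inv s \<otimes> g) (act (inv s) x)"
      using B_outside_X[OF F, of x s] by (simp add: alpha)
  qed
  also have "\<dots> = (\<Sum>s\<in>S. F s x * H (inv s \<otimes> g) (act (inv s) x))"
    using S F by (intro sum.mono_neutral_left) (auto intro!: not_supp)
  finally show ?thesis .
qed

lemma mult_B_outside: "g \<notin> carrier G \<Longrightarrow> (F \<otimes>\<^bsub>B\<^esub> H) g x = 0"
  by (simp add: convolution_algebra_def)

lemma B_closedI:
  assumes "\<And>g. g \<in> carrier G \<Longrightarrow> F g \<in> carrier CX" and "\<And>g. g \<notin> carrier G \<Longrightarrow> F g = (\<lambda>x. 0)"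
    and "finite S" and "\<And>g. g \<in> carrier G \<Longrightarrow> g \<notin> S \<Longrightarrow> F g = (\<lambda>x. 0)"
  shows "F \<in> carrier B"
proof -
  have "supp F \<subseteq> S" using assms(4) by (auto simp: supp_eq)
  then have "finite (supp F)" using assms(3) by (rule finite_subset)
  then show ?thesis unfolding B_carrier using assms(1,2) by blast
qed

lemma one_B_closed: "\<one>\<^bsub>B\<^esub> \<in> carrier B"
  by (rule B_closedI[where S = "{\<one>}"]) (auto intro: continuous_map_restrict)

lemma zero_B_closed: "\<zero>\<^bsub>B\<^esub> \<in> carrier B"
  by (rule B_closedI[where S = "{}"]) auto

lemma add_B_closed: "\<lbrakk>F \<in> carrier B; H \<in> carrier B\<rbrakk> \<Longrightarrow> F \<oplus>\<^bsub>B\<^esub> H \<in> carrier B"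
  using B_coeff[of F] B_coeff[of H]
  by (intro B_closedI[where S = "supp F \<union> supp H"]) (auto intro: continuous_map_add B_finite simp: B_outside not_supp)

lemma smult_B_closed: "F \<in> carrier B \<Longrightarrow> z \<odot>\<^bsub>B\<^esub> F \<in> carrier B"
  using B_coeff[of F]
  by (intro B_closedI[where S = "supp F"])
    (auto intro: continuous_map_complex_mult B_finite simp: B_outside not_supp)

lemma adj_B_closed:
  assumes F: "F \<in> carrier B"
  shows "adj B F \<in> carrier B"
proof (rule B_closedI[where S = "(\<lambda>g. inv g) ` supp F"])
  show "adj B F g \<in> carrier CX" if "g \<in> carrier G" for g
  proof -
    have "adj B F g = \<alpha> g (\<lambda>x. cnj (F (inv g) x))"
      using that by (auto simp: adj_B[OF F] alpha)
    then show ?thesis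
      using that B_coeff[OF F, of "inv g"] by (auto intro!: alpha_closed continuous_map_complex_cnj simp del: CX_sel(1)) (auto intro: continuous_map_complex_cnj)
  qed
  show "adj B F g = (\<lambda>x. 0)" if "g \<in> carrier G" "g \<notin> (\<lambda>g. inv g) ` supp F" for g
  proof -
    have "inv g \<notin> supp F" using that by (metis imageI inv_inv)
    then show ?thesis using that by (auto simp: adj_B[OF F] not_supp)
  qed
qed (use F in \<open>auto simp: adj_B B_finite\<close>)

lemma mult_B_nonzero:
  assumes F: "F \<in> carrier B" and H: "H \<in> carrier B" and g: "g \<in> carrier G" "(F \<otimes>\<^bsub>B\<^esub> H) g x \<noteq> 0"
  shows "g \<in> (\<lambda>(s, t). s \<otimes> t) ` (supp F \<times> supp H)"
proof -
  have "(\<Sum>s\<in>supp F. F s x * H (inv s \<otimes> g) (act (inv s) x)) \<noteq> 0"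
    using mult_B[OF F H B_finite[OF F] subset_refl supp_subset g(1), of x] g(2) by simp
  then obtain s where s: "s \<in> supp F" "H (inv s \<otimes> g) (act (inv s) x) \<noteq> 0"
    by (metis (mono_tags, lifting) mult_zero_right sum.neutral)
  then have "s \<in> carrier G" using supp_subset by blast
  then have "inv s \<otimes> g \<in> supp H" using s(2) g(1) not_supp[of "inv s \<otimes> g" H] by auto
  moreover have "g = s \<otimes> (inv s \<otimes> g)" using \<open>s \<in> carrier G\<close> g(1) by (simp add: m_assoc[symmetric])
  ultimately show ?thesis using s(1) by (intro image_eqI[of _ _ "(s, inv s \<otimes> g)"]) auto
qed

lemma mult_B_closed:
  assumes F: "F \<in> carrier B" and H: "H \<in> carrier B"
  shows "F \<otimes>\<^bsub>B\<^esub> H \<in> carrier B"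
proof (rule B_closedI[where S = "(\<lambda>(s, t). s \<otimes> t) ` (supp F \<times> supp H)"])
  interpret CX: abelian_group CX by (rule abelian_group_CX)
  show "(F \<otimes>\<^bsub>B\<^esub> H) g \<in> carrier CX" if "g \<in> carrier G" for g
  proof -
    have "(F \<otimes>\<^bsub>B\<^esub> H) g = finsum CX (\<lambda>s. F s \<otimes>\<^bsub>CX\<^esub> \<alpha> s (H (inv s \<otimes> g))) (supp F)"
      using that by (simp add: convolution_algebra_def)
    moreover have "\<dots> \<in> carrier CX"
      using F H that supp_subset[of F] by (intro CX.finsum_closed Pi_I CX_mult_closed alpha_closed B_coeff) auto
    ultimately show ?thesis by simp
  qed
  show "finite ((\<lambda>(s, t). s \<otimes> t) ` (supp F \<times> supp H))" using F H by (simp add: B_finite)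
  show "(F \<otimes>\<^bsub>B\<^esub> H) g = (\<lambda>x. 0)" if "g \<notin> carrier G" for g using that by (auto simp: mult_B_outside)
  show "(F \<otimes>\<^bsub>B\<^esub> H) g = (\<lambda>x. 0)" if "g \<in> carrier G" "g \<notin> (\<lambda>(s, t). s \<otimes> t) ` (supp F \<times> supp H)" for g
    using mult_B_nonzero[OF F H that(1)] that(2) by blast
qed

lemma mult_B_assoc:
  assumes F: "F \<in> carrier B" and H: "H \<in> carrier B" and K: "K \<in> carrier B"
  shows "F \<otimes>\<^bsub>B\<^esub> H \<otimes>\<^bsub>B\<^esub> K = F \<otimes>\<^bsub>B\<^esub> (H \<otimes>\<^bsub>B\<^esub> K)"
proof (rule B_eqI)
  fix g x assume g: "g \<in> carrier G" and x: "x \<in> X"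
  define P where "P = (\<lambda>(s, t). s \<otimes> t) ` (supp F \<times> supp H)"
  have P: "finite P" "P \<subseteq> carrier G" using F H supp_subset by (auto simp: P_def B_finite dest!: subsetD[OF supp_subset])
  have "supp (F \<otimes>\<^bsub>B\<^esub> H) \<subseteq> P"
    using mult_B_nonzero[OF F H] by (auto simp: supp_eq P_def fun_eq_iff)
  then have "(F \<otimes>\<^bsub>B\<^esub> H \<otimes>\<^bsub>B\<^esub> K) g x = (\<Sum>t\<in>P. (F \<otimes>\<^bsub>B\<^esub> H) t x * K (inv t \<otimes> g) (act (inv t) x))"
    using P g by (intro mult_B mult_B_closed F H K) auto
  also have "\<dots> = (\<Sum>t\<in>P. \<Sum>s\<in>supp F. F s x * H (inv s \<otimes> t) (act (inv s) x) * K (inv t \<otimes> g) (act (inv t) x))"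
    using P mult_B[OF F H B_finite[OF F] subset_refl supp_subset]
    by (intro sum.cong refl) (auto simp: sum_distrib_right)
  also have "\<dots> = (\<Sum>s\<in>supp F. \<Sum>t\<in>P. F s x * H (inv s \<otimes> t) (act (inv s) x) * K (inv t \<otimes> g) (act (inv t) x))"
    by (rule sum.swap)
  also have "\<dots> = (\<Sum>s\<in>supp F. F s x * (H \<otimes>\<^bsub>B\<^esub> K) (inv s \<otimes> g) (act (inv s) x))"
  proof (rule sum.cong[OF refl])
    fix s assume s: "s \<in> supp F"
    then have sG: "s \<in> carrier G" using supp_subset by blast
    let ?f = "\<lambda>t. F s x * H (inv s \<otimes> t) (act (inv s) x) * K (inv t \<otimes> g) (act (inv t) x)"
    \<comment> \<open>H is evaluated at \<open>inv s \<otimes> t\<close>, so only t = s r with r in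
      the support of H contributes, and P contains all of these. The substitution turns the sum over
      t into one over r.\<close>
    have "(\<Sum>t\<in>P. ?f t) = (\<Sum>t\<in>(\<lambda>r. s \<otimes> r) ` supp H. ?f t)"
    proof (rule sum.mono_neutral_right[OF P(1)])
      show "(\<lambda>r. s \<otimes> r) ` supp H \<subseteq> P" using s by (auto simp: P_def)
      show "\<forall>t\<in>P - (\<lambda>r. s \<otimes> r) ` supp H. ?f t = 0"
      proof
        fix t assume t: "t \<in> P - (\<lambda>r. s \<otimes> r) ` supp H"
        then have tG: "t \<in> carrier G" using P by blast
        have "t = s \<otimes> (inv s \<otimes> t)" using sG tG by (simp add: m_assoc[symmetric])
        then have "inv s \<otimes> t \<notin> supp H" using t by blast
        then show "?f t = 0" using sG tG by (simp add: not_supp)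
      qed
    qed
    also have "\<dots> = (\<Sum>r\<in>supp H. ?f (s \<otimes> r))"
      by (rule sum.reindex_cong[OF _ refl refl]) (use sG subsetD[OF supp_subset] in \<open>auto simp: inj_on_def\<close>)
    also have "\<dots> = (\<Sum>r\<in>supp H. F s x * (H r (act (inv s) x) * K (inv r \<otimes> (inv s \<otimes> g)) (act (inv r) (act (inv s) x))))"
    proof (rule sum.cong[OF refl])
      fix r assume "r \<in> supp H"
      then have rG: "r \<in> carrier G" using supp_subset by blast
      have "inv s \<otimes> (s \<otimes> r) = r" using sG rG by (simp add: m_assoc[symmetric])
      moreover have "inv (s \<otimes> r) \<otimes> g = inv r \<otimes> (inv s \<otimes> g)" using sG rG g by (simp add: inv_mult_group m_assoc)
      moreover have "act (inv (s \<otimes> r)) x = act (inv r) (act (inv s) x)" using sG rG x by (simp add: inv_mult_group act_mult)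
      ultimately show "?f (s \<otimes> r) = F s x * (H r (act (inv s) x) * K (inv r \<otimes> (inv s \<otimes> g)) (act (inv r) (act (inv s) x)))"
        by simp
    qed
    also have "\<dots> = F s x * (H \<otimes>\<^bsub>B\<^esub> K) (inv s \<otimes> g) (act (inv s) x)"
      using sG g by (subst mult_B[OF H K B_finite[OF H] subset_refl supp_subset]) (auto simp: sum_distrib_left)
    finally show "(\<Sum>t\<in>P. ?f t) = F s x * (H \<otimes>\<^bsub>B\<^esub> K) (inv s \<otimes> g) (act (inv s) x)" .
  qed
  also have "\<dots> = (F \<otimes>\<^bsub>B\<^esub> (H \<otimes>\<^bsub>B\<^esub> K)) g x"
    by (rule mult_B[OF F mult_B_closed[OF H K] B_finite[OF F] subset_refl supp_subset g, symmetric])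
  finally show "(F \<otimes>\<^bsub>B\<^esub> H \<otimes>\<^bsub>B\<^esub> K) g x = (F \<otimes>\<^bsub>B\<^esub> (H \<otimes>\<^bsub>B\<^esub> K)) g x" .
qed (intro mult_B_closed F H K)+

lemma adj_mult_B:
  assumes F: "F \<in> carrier B" and H: "H \<in> carrier B"
  shows "adj B (F \<otimes>\<^bsub>B\<^esub> H) = adj B H \<otimes>\<^bsub>B\<^esub> adj B F"
proof (rule B_eqI)
  fix g x assume g: "g \<in> carrier G" and x: "x \<in> X"
  define P where "P = (\<lambda>s. g \<otimes> s) ` supp F \<union> (\<lambda>s. inv s) ` supp H"
  have P: "finite P" "P \<subseteq> carrier G"
    using F H g subsetD[OF supp_subset] by (auto simp: P_def B_finite)
  have supp: "supp (adj B H) \<subseteq> P"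
  proof
    fix t assume "t \<in> supp (adj B H)"
    then have t: "t \<in> carrier G" "adj B H t \<noteq> (\<lambda>x. 0)" by (auto simp: supp_eq)
    then have "inv t \<in> supp H" using not_supp[of "inv t" H] by (auto simp: adj_B[OF H] fun_eq_iff split: if_splits)
    then show "t \<in> P" using t(1) unfolding P_def by (metis UnI2 imageI inv_inv)
  qed
  have "(adj B H \<otimes>\<^bsub>B\<^esub> adj B F) g x = (\<Sum>t\<in>P. adj B H t x * adj B F (inv t \<otimes> g) (act (inv t) x))"
    by (rule mult_B[OF adj_B_closed[OF H] adj_B_closed[OF F] P(1) supp P(2) g])
  also have "\<dots> = (\<Sum>t\<in>P. cnj (H (inv t) (act (inv t) x)) * cnj (F (inv g \<otimes> t) (act (inv g) x)))"
  proof (rule sum.cong[OF refl])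
    fix t assume "t \<in> P"
    then have t: "t \<in> carrier G" using P by blast
    have "inv (inv t \<otimes> g) = inv g \<otimes> t" using t g by (simp add: inv_mult_group)
    moreover have "act (inv g \<otimes> t) (act (inv t) x) = act (inv g) x" using t g x by (simp add: act_mult)
    ultimately show "adj B H t x * adj B F (inv t \<otimes> g) (act (inv t) x) =
        cnj (H (inv t) (act (inv t) x)) * cnj (F (inv g \<otimes> t) (act (inv g) x))"
      using t g x by (simp add: adj_B[OF H] adj_B[OF F])
  qed
  also have "\<dots> = (\<Sum>t\<in>(\<lambda>s. g \<otimes> s) ` supp F. cnj (H (inv t) (act (inv t) x)) * cnj (F (inv g \<otimes> t) (act (inv g) x)))"
  proof (rule sum.mono_neutral_right[OF P(1)])
    show "(\<lambda>s. g \<otimes> s) ` supp F \<subseteq> P" by (simp add: P_def)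
    show "\<forall>t\<in>P - (\<lambda>s. g \<otimes> s) ` supp F. cnj (H (inv t) (act (inv t) x)) * cnj (F (inv g \<otimes> t) (act (inv g) x)) = 0"
    proof
      fix t assume t: "t \<in> P - (\<lambda>s. g \<otimes> s) ` supp F"
      then have tG: "t \<in> carrier G" using P by blast
      have "t = g \<otimes> (inv g \<otimes> t)" using g tG by (simp add: m_assoc[symmetric])
      then have "inv g \<otimes> t \<notin> supp F" using t by blast
      then show "cnj (H (inv t) (act (inv t) x)) * cnj (F (inv g \<otimes> t) (act (inv g) x)) = 0"
        using g tG by (simp add: not_supp)
    qed
  qed
  also have "\<dots> = (\<Sum>s\<in>supp F. cnj (F s (act (inv g) x) * H (inv s \<otimes> inv g) (act (inv s) (act (inv g) x))))"
  proof (rule sum.reindex_cong[OF _ refl])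
    show "inj_on (\<lambda>s. g \<otimes> s) (supp F)" using g subsetD[OF supp_subset] by (auto simp: inj_on_def)
    fix s assume "s \<in> supp F"
    then have s: "s \<in> carrier G" using supp_subset by blast
    have "inv g \<otimes> (g \<otimes> s) = s" using g s by (simp add: m_assoc[symmetric])
    then show "cnj (H (inv (g \<otimes> s)) (act (inv (g \<otimes> s)) x)) * cnj (F (inv g \<otimes> (g \<otimes> s)) (act (inv g) x)) =
        cnj (F s (act (inv g) x) * H (inv s \<otimes> inv g) (act (inv s) (act (inv g) x)))"
      using g s x by (simp add: inv_mult_group act_mult)
  qed
  also have "\<dots> = adj B (F \<otimes>\<^bsub>B\<^esub> H) g x"
    using g x mult_B[OF F H B_finite[OF F] subset_refl supp_subset, of "inv g" "act (inv g) x"]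
    by (simp add: adj_B[OF mult_B_closed[OF F H]])
  finally show "adj B (F \<otimes>\<^bsub>B\<^esub> H) g x = (adj B H \<otimes>\<^bsub>B\<^esub> adj B F) g x" by simp
qed (intro adj_B_closed mult_B_closed F H)+

lemma star_alg_B: "star_alg B"
proof -
  note clo = one_B_closed zero_B_closed add_B_closed smult_B_closed adj_B_closed mult_B_closed
  have add_grp: "abelian_group B"
  proof (rule abelian_groupI)
    fix F assume F: "F \<in> carrier B"
    show "\<exists>H\<in>carrier B. H \<oplus>\<^bsub>B\<^esub> F = \<zero>\<^bsub>B\<^esub>"
      using smult_B_closed[OF F, of "-1"] by (intro bexI[of _ "(-1) \<odot>\<^bsub>B\<^esub> F"]) auto
  qed (auto intro: clo[simplified] simp: algebra_simps)
  have mon: "monoid B"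
  proof (rule monoidI)
    fix F assume F: "F \<in> carrier B"
    have s1: "supp \<one>\<^bsub>B\<^esub> \<subseteq> {\<one>}" by (auto simp: supp_eq split: if_splits)
    show "\<one>\<^bsub>B\<^esub> \<otimes>\<^bsub>B\<^esub> F = F"
    proof (rule B_eqI)
      fix g x assume "g \<in> carrier G" "x \<in> X"
      then show "(\<one>\<^bsub>B\<^esub> \<otimes>\<^bsub>B\<^esub> F) g x = F g x"
        by (subst mult_B[OF one_B_closed F _ s1]) auto
    qed (intro clo F)+
    show "F \<otimes>\<^bsub>B\<^esub> \<one>\<^bsub>B\<^esub> = F"
    proof (rule B_eqI)
      fix g x assume g: "g \<in> carrier G" and x: "x \<in> X"
      have "(F \<otimes>\<^bsub>B\<^esub> \<one>\<^bsub>B\<^esub>) g x = (\<Sum>s\<in>insert g (supp F). F s x * \<one>\<^bsub>B\<^esub> (inv s \<otimes> g) (act (inv s) x))"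
        using F g supp_subset by (intro mult_B one_B_closed) (auto intro: B_finite)
      also have "\<dots> = (\<Sum>s\<in>{g}. F s x * \<one>\<^bsub>B\<^esub> (inv s \<otimes> g) (act (inv s) x))"
      proof (rule sum.mono_neutral_right)
        show "\<forall>s\<in>insert g (supp F) - {g}. F s x * \<one>\<^bsub>B\<^esub> (inv s \<otimes> g) (act (inv s) x) = 0"
        proof
          fix s assume s: "s \<in> insert g (supp F) - {g}"
          then have sG: "s \<in> carrier G" using supp_subset by blast
          have "inv s \<otimes> g \<noteq> \<one>" using s sG g by (metis DiffE inv_equality inv_inv insertI1 inv_closed)
          then show "F s x * \<one>\<^bsub>B\<^esub> (inv s \<otimes> g) (act (inv s) x) = 0" by simp
        qed
      qed (use F in \<open>auto intro: B_finite\<close>)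
      also have "\<dots> = F g x" using g x by simp
      finally show "(F \<otimes>\<^bsub>B\<^esub> \<one>\<^bsub>B\<^esub>) g x = F g x" .
    qed (intro clo F)+
  qed (intro clo mult_B_assoc; assumption)+
  have ring: "ring B"
  proof (rule ringI[OF add_grp mon])
    fix F H K assume F: "F \<in> carrier B" and H: "H \<in> carrier B" and K: "K \<in> carrier B"
    show "(F \<oplus>\<^bsub>B\<^esub> H) \<otimes>\<^bsub>B\<^esub> K = F \<otimes>\<^bsub>B\<^esub> K \<oplus>\<^bsub>B\<^esub> H \<otimes>\<^bsub>B\<^esub> K"
    proof (rule B_eqI)
      fix g x assume g: "g \<in> carrier G"
      let ?S = "supp F \<union> supp H"
      have S: "finite ?S" "?S \<subseteq> carrier G" using F H supp_subset by (auto intro: B_finite)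
      have "supp (F \<oplus>\<^bsub>B\<^esub> H) \<subseteq> ?S" by (auto simp: supp_eq)
      then show "((F \<oplus>\<^bsub>B\<^esub> H) \<otimes>\<^bsub>B\<^esub> K) g x = (F \<otimes>\<^bsub>B\<^esub> K \<oplus>\<^bsub>B\<^esub> H \<otimes>\<^bsub>B\<^esub> K) g x"
        using mult_B[OF add_B_closed[OF F H] K S(1) _ S(2) g, of x] mult_B[OF F K S(1) _ S(2) g, of x]
          mult_B[OF H K S(1) _ S(2) g, of x]
        by (simp add: distrib_right sum.distrib)
    qed (intro clo F H K)+
    show "K \<otimes>\<^bsub>B\<^esub> (F \<oplus>\<^bsub>B\<^esub> H) = K \<otimes>\<^bsub>B\<^esub> F \<oplus>\<^bsub>B\<^esub> K \<otimes>\<^bsub>B\<^esub> H"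
    proof (rule B_eqI)
      fix g x assume g: "g \<in> carrier G"
      show "(K \<otimes>\<^bsub>B\<^esub> (F \<oplus>\<^bsub>B\<^esub> H)) g x = (K \<otimes>\<^bsub>B\<^esub> F \<oplus>\<^bsub>B\<^esub> K \<otimes>\<^bsub>B\<^esub> H) g x"
        using mult_B[OF K add_B_closed[OF F H] B_finite[OF K] subset_refl supp_subset g, of x]
          mult_B[OF K F B_finite[OF K] subset_refl supp_subset g, of x]
          mult_B[OF K H B_finite[OF K] subset_refl supp_subset g, of x]
        by (simp add: distrib_left sum.distrib)
    qed (intro clo F H K)+
  qed
  have left: "(z \<odot>\<^bsub>B\<^esub> F) \<otimes>\<^bsub>B\<^esub> H = z \<odot>\<^bsub>B\<^esub> (F \<otimes>\<^bsub>B\<^esub> H)"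
    and right: "F \<otimes>\<^bsub>B\<^esub> (z \<odot>\<^bsub>B\<^esub> H) = z \<odot>\<^bsub>B\<^esub> (F \<otimes>\<^bsub>B\<^esub> H)"
    if F: "F \<in> carrier B" and H: "H \<in> carrier B" for F H z
  proof -
    have "supp (z \<odot>\<^bsub>B\<^esub> F) \<subseteq> supp F" by (auto simp: supp_eq)
    note m = mult_B[OF smult_B_closed[OF F] H B_finite[OF F] this supp_subset]
      mult_B[OF F H B_finite[OF F] subset_refl supp_subset]
      mult_B[OF F smult_B_closed[OF H] B_finite[OF F] subset_refl supp_subset]
    show "(z \<odot>\<^bsub>B\<^esub> F) \<otimes>\<^bsub>B\<^esub> H = z \<odot>\<^bsub>B\<^esub> (F \<otimes>\<^bsub>B\<^esub> H)"
    proof (rule B_eqI)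
      fix g x assume g: "g \<in> carrier G"
      show "((z \<odot>\<^bsub>B\<^esub> F) \<otimes>\<^bsub>B\<^esub> H) g x = (z \<odot>\<^bsub>B\<^esub> (F \<otimes>\<^bsub>B\<^esub> H)) g x"
        unfolding m(1)[OF g] by (simp add: m(2)[OF g] sum_distrib_left mult.assoc)
    qed (intro clo F H)+
    show "F \<otimes>\<^bsub>B\<^esub> (z \<odot>\<^bsub>B\<^esub> H) = z \<odot>\<^bsub>B\<^esub> (F \<otimes>\<^bsub>B\<^esub> H)"
    proof (rule B_eqI)
      fix g x assume g: "g \<in> carrier G"
      show "(F \<otimes>\<^bsub>B\<^esub> (z \<odot>\<^bsub>B\<^esub> H)) g x = (z \<odot>\<^bsub>B\<^esub> (F \<otimes>\<^bsub>B\<^esub> H)) g x"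
        unfolding m(3)[OF g] by (simp add: m(2)[OF g] sum_distrib_left mult_ac)
    qed (intro clo F H)+
  qed
  from ring show ?thesis
  proof (rule star_alg.intro, unfold_locales)
    fix F H and z w :: complex assume F: "F \<in> carrier B"
    show "adj B (adj B F) = F"
      by (rule B_eqI[OF adj_B_closed[OF adj_B_closed[OF F]] F])
        (unfold adj_B[OF adj_B_closed[OF F]], simp add: adj_B[OF F])
    show "adj B (z \<odot>\<^bsub>B\<^esub> F) = cnj z \<odot>\<^bsub>B\<^esub> adj B F"
      by (auto simp: adj_B[OF F] adj_B[OF smult_B_closed[OF F], simplified] fun_eq_iff)
    assume H: "H \<in> carrier B"
    show "adj B (F \<oplus>\<^bsub>B\<^esub> H) = adj B F \<oplus>\<^bsub>B\<^esub> adj B H"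
      by (auto simp: adj_B[OF F] adj_B[OF H] adj_B[OF add_B_closed[OF F H], simplified] fun_eq_iff)
  qed (auto simp: left[simplified] right[simplified] algebra_simps adj_mult_B intro: clo[simplified])
qed

definition state :: "('g \<Rightarrow> 'x \<Rightarrow> complex) \<Rightarrow> complex" where
  "state F = F \<one> x0"

text \<open>Only the values F g (g x0) along the orbit enter, so the GNS space of
  \<open>state\<close> is l^2(G), with F represented by the vector of these values. Positivity of
  \<open>state\<close> becomes evident.\<close>

lemma state_adj_mult:
  assumes F: "F \<in> carrier B" and H: "H \<in> carrier B" and S: "finite S" "supp F \<subseteq> S" "S \<subseteq> carrier G"
  shows "state (adj B F \<otimes>\<^bsub>B\<^esub> H) = (\<Sum>g\<in>S. cnj (F g (act g x0)) * H g (act g x0))"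
proof -
  have supp: "supp (adj B F) \<subseteq> (\<lambda>s. inv s) ` S"
  proof
    fix t assume "t \<in> supp (adj B F)"
    then have t: "t \<in> carrier G" "adj B F t \<noteq> (\<lambda>x. 0)" by (auto simp: supp_eq)
    then have "inv t \<in> supp F" using not_supp[of "inv t" F] by (auto simp: adj_B[OF F] fun_eq_iff split: if_splits)
    then show "t \<in> (\<lambda>s. inv s) ` S" using t(1) S by (metis imageI inv_inv subsetD)
  qed
  have "state (adj B F \<otimes>\<^bsub>B\<^esub> H) = (\<Sum>t\<in>(\<lambda>s. inv s) ` S. adj B F t x0 * H (inv t \<otimes> \<one>) (act (inv t) x0))"
    unfolding state_def using S by (intro mult_B adj_B_closed F H supp) auto
  also have "\<dots> = (\<Sum>g\<in>S. cnj (F g (act g x0)) * H g (act g x0))"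
  proof (rule sum.reindex_cong[OF _ refl])
    show "inj_on (\<lambda>s. inv s) S" using S by (intro inj_onI) (metis inv_inv subsetD)
    fix g assume "g \<in> S"
    then have "g \<in> carrier G" using S by blast
    then show "adj B F (inv g) x0 * H (inv (inv g) \<otimes> \<one>) (act (inv (inv g)) x0) = cnj (F g (act g x0)) * H g (act g x0)"
      using base by (simp add: adj_B[OF F])
  qed
  finally show ?thesis .
qed

lemma pos_alg_B: "pos_alg B state"
proof (intro pos_alg.intro star_alg_B pos_alg_axioms.intro)
  fix F assume F: "F \<in> carrier B"
  show "state (adj B F) = cnj (state F)" using base by (simp add: state_def adj_B[OF F])
  show "0 \<le> Re (state (adj B F \<otimes>\<^bsub>B\<^esub> F))"
    unfolding state_adj_mult[OF F F B_finite[OF F] subset_refl supp_subset]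
    by (auto intro!: sum_nonneg)
qed (auto simp: state_def)

sublocale B: pos_alg B state
  by (rule pos_alg_B)

lemma nn_B_sq:
  assumes F: "F \<in> carrier B" and S: "finite S" "supp F \<subseteq> S" "S \<subseteq> carrier G"
  shows "(B.nn F)\<^sup>2 = (\<Sum>g\<in>S. (cmod (F g (act g x0)))\<^sup>2)"
proof -
  have "(B.nn F)\<^sup>2 = Re (\<Sum>g\<in>S. cnj (F g (act g x0)) * F g (act g x0))"
    by (simp add: B.nn_sq[OF F] B.ip_def state_adj_mult[OF F F S])
  then show ?thesis by (simp add: cmod_def power2_eq_square)
qed

lemma finsum_B:
  assumes "finite S" and "\<And>s. s \<in> S \<Longrightarrow> f s \<in> carrier B"
  shows "finsum B f S = (\<lambda>g x. \<Sum>s\<in>S. f s g x)"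
  using assms
proof (induction S rule: finite_induct)
  case (insert a S)
  then have "finsum B f (insert a S) = f a \<oplus>\<^bsub>B\<^esub> finsum B f S"
    by (intro B.finsum_insert) auto
  then show ?case using insert by simp
qed simp

definition single :: "('x \<Rightarrow> complex) \<Rightarrow> 'g \<Rightarrow> 'g \<Rightarrow> 'x \<Rightarrow> complex" where
  "single a g = (\<lambda>h. if h = g then a else (\<lambda>x. 0))"

lemma single_closed [simp]: "\<lbrakk>a \<in> carrier CX; g \<in> carrier G\<rbrakk> \<Longrightarrow> single a g \<in> carrier B"
  by (rule B_closedI[where S = "{g}"]) (auto simp: single_def)

lemma supp_single: "supp (single a g) \<subseteq> {g}"
  by (auto simp: supp_eq single_def)

lemma single_mult:
  assumes a: "a \<in> carrier CX" and b: "b \<in> carrier CX" and g: "g \<in> carrier G" and h: "h \<in> carrier G"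
  shows "single a g \<otimes>\<^bsub>B\<^esub> single b h = single (a \<otimes>\<^bsub>CX\<^esub> \<alpha> g b) (g \<otimes> h)"
proof (rule B_eqI)
  fix k x assume k: "k \<in> carrier G" and x: "x \<in> X"
  have "inv g \<otimes> k = h \<longleftrightarrow> k = g \<otimes> h" using g h k by (metis inv_closed inv_solve_left)
  then show "(single a g \<otimes>\<^bsub>B\<^esub> single b h) k x = single (a \<otimes>\<^bsub>CX\<^esub> \<alpha> g b) (g \<otimes> h) k x"
    using g k x by (subst mult_B[OF single_closed[OF a g] single_closed[OF b h] _ supp_single])
      (auto simp: single_def alpha)
qed (use assms in \<open>auto intro!: mult_B_closed single_closed CX_mult_closed alpha_closed simp del: CX_sel(1,2)\<close>)

lemma single_adj:
  assumes a: "a \<in> carrier CX" and g: "g \<in> carrier G"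
  shows "adj B (single a g) = single (\<alpha> (inv g) (\<lambda>x. cnj (a x))) (inv g)"
proof (intro ext)
  fix k x
  have "k \<in> carrier G \<Longrightarrow> inv k = g \<longleftrightarrow> k = inv g" using g by (metis inv_inv)
  then show "adj B (single a g) k x = single (\<alpha> (inv g) (\<lambda>x. cnj (a x))) (inv g) k x"
    using g unfolding adj_B[OF single_closed[OF a g]] by (auto simp: single_def alpha)
qed

end

section \<open>Covariant representations\<close>

lemma has_sum_finite_sum:
  fixes f :: "'z \<Rightarrow> 'i \<Rightarrow> 'b::topological_comm_monoid_add"
  assumes "finite Z" and "\<And>z. z \<in> Z \<Longrightarrow> (f z has_sum s z) A"
  shows "((\<lambda>i. \<Sum>z\<in>Z. f z i) has_sum (\<Sum>z\<in>Z. s z)) A"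
  using assms by (induction Z rule: finite_induct) (auto intro: has_sum_add)

lemma ell2_outside: "v \<in> ell2 I \<Longrightarrow> i \<notin> I \<Longrightarrow> v i = 0"
  by (simp add: ell2_def)

lemma ell2_norm_has_sum: "v \<in> ell2 I \<Longrightarrow> ((\<lambda>i. (cmod (v i))\<^sup>2) has_sum (ell2_norm I v)\<^sup>2) I"
  by (simp add: ell2_def ell2_norm_sq)

lemma ell2_finite_le:
  assumes "v \<in> ell2 I" "finite S" "S \<subseteq> I"
  shows "L2_set (\<lambda>i. cmod (v i)) S \<le> ell2_norm I v"
  unfolding L2_set_def ell2_norm_def
  using assms by (intro real_sqrt_le_mono finite_sum_le_infsum) (auto simp: ell2_def)

text \<open>Membership and norm estimates are reduced to finite sets of coordinates, where the
  inequalities for \<open>L2_set\<close> apply.\<close>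

lemma ell2_bounded_finite:
  assumes out: "\<And>i. i \<notin> I \<Longrightarrow> v i = 0" and "0 \<le> C"
    and le: "\<And>S. finite S \<Longrightarrow> S \<subseteq> I \<Longrightarrow> L2_set (\<lambda>i. cmod (v i)) S \<le> C"
  shows "v \<in> ell2 I" and "ell2_norm I v \<le> C"
proof -
  have le': "(\<Sum>i\<in>S. (cmod (v i))\<^sup>2) \<le> C\<^sup>2" if "finite S" "S \<subseteq> I" for S
    using le[OF that] unfolding L2_set_def by (rule sqrt_le_D)
  have "(\<lambda>i. (cmod (v i))\<^sup>2) summable_on I"
    by (rule nonneg_bdd_above_summable_on) (auto intro!: bdd_aboveI2[where M = "C\<^sup>2"] le')
  then show v: "v \<in> ell2 I" using out by (simp add: ell2_def)
  show "ell2_norm I v \<le> C"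
  proof (rule power2_le_imp_le[OF _ \<open>0 \<le> C\<close>])
    show "(ell2_norm I v)\<^sup>2 \<le> C\<^sup>2"
      unfolding ell2_norm_sq using v le' by (intro infsum_le_finite_sums) (auto simp: ell2_def)
  qed
qed

lemma
  assumes v: "v \<in> ell2 I" and w: "w \<in> ell2 I"
  shows ell2_add: "(\<lambda>i. v i + w i) \<in> ell2 I"
    and ell2_norm_add: "ell2_norm I (\<lambda>i. v i + w i) \<le> ell2_norm I v + ell2_norm I w"
proof -
  have le: "L2_set (\<lambda>i. cmod (v i + w i)) S \<le> ell2_norm I v + ell2_norm I w" if S: "finite S" "S \<subseteq> I" for S
  proof -
    have "L2_set (\<lambda>i. cmod (v i + w i)) S \<le> L2_set (\<lambda>i. cmod (v i) + cmod (w i)) S"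
      by (intro L2_set_mono norm_triangle_ineq) auto
    also have "\<dots> \<le> L2_set (\<lambda>i. cmod (v i)) S + L2_set (\<lambda>i. cmod (w i)) S" by (rule L2_set_triangle_ineq)
    also have "\<dots> \<le> ell2_norm I v + ell2_norm I w" by (intro add_mono ell2_finite_le v w S)
    finally show ?thesis .
  qed
  have out: "\<And>i. i \<notin> I \<Longrightarrow> v i + w i = 0" using v w by (simp add: ell2_outside)
  show "(\<lambda>i. v i + w i) \<in> ell2 I" by (rule ell2_bounded_finite(1)[OF out _ le]) auto
  show "ell2_norm I (\<lambda>i. v i + w i) \<le> ell2_norm I v + ell2_norm I w"
    by (rule ell2_bounded_finite(2)[OF out _ le]) auto
qed

lemma
  assumes "finite Z" and "\<And>z. z \<in> Z \<Longrightarrow> f z \<in> ell2 I"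
  shows ell2_sum: "(\<lambda>i. \<Sum>z\<in>Z. f z i) \<in> ell2 I"
    and ell2_norm_sum: "ell2_norm I (\<lambda>i. \<Sum>z\<in>Z. f z i) \<le> (\<Sum>z\<in>Z. ell2_norm I (f z))"
proof -
  have "(\<lambda>i. \<Sum>z\<in>Z. f z i) \<in> ell2 I \<and> ell2_norm I (\<lambda>i. \<Sum>z\<in>Z. f z i) \<le> (\<Sum>z\<in>Z. ell2_norm I (f z))"
    using assms
  proof (induction Z rule: finite_induct)
    case empty
    show ?case by (simp add: ell2_norm_def)
  next
    case (insert a Z)
    then show ?case
      using ell2_add[of "f a" I "\<lambda>i. \<Sum>z\<in>Z. f z i"] ell2_norm_add[of "f a" I "\<lambda>i. \<Sum>z\<in>Z. f z i"] by simp
  qed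
  then show "(\<lambda>i. \<Sum>z\<in>Z. f z i) \<in> ell2 I"
    and "ell2_norm I (\<lambda>i. \<Sum>z\<in>Z. f z i) \<le> (\<Sum>z\<in>Z. ell2_norm I (f z))" by auto
qed

lemma ell2_inner_has_sum:
  assumes "v \<in> ell2 I" "w \<in> ell2 I"
  shows "((\<lambda>i. v i * cnj (w i)) has_sum ell2_inner I v w) I"
proof -
  have "(\<lambda>i. norm (v i * cnj (w i))) summable_on I"
  proof (rule Infinite_Sum.abs_summable_on_comparison_test')
    show "(\<lambda>i. (cmod (v i))\<^sup>2 + (cmod (w i))\<^sup>2) summable_on I"
      using assms by (intro summable_on_add) (auto simp: ell2_def)
    have "0 \<le> (cmod (v i) - cmod (w i))\<^sup>2" for i by simp
    then have *: "2 * (cmod (v i) * cmod (w i)) \<le> (cmod (v i))\<^sup>2 + (cmod (w i))\<^sup>2" for i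
      by (simp add: power2_eq_square algebra_simps)
    have "cmod (v i) * cmod (w i) \<le> (cmod (v i))\<^sup>2 + (cmod (w i))\<^sup>2" for i
      using *[of i] mult_nonneg_nonneg[OF norm_ge_zero norm_ge_zero, of "v i" "w i"] by linarith
    then show "norm (v i * cnj (w i)) \<le> (cmod (v i))\<^sup>2 + (cmod (w i))\<^sup>2" for i
      by (simp add: norm_mult)
  qed
  then show ?thesis unfolding ell2_inner_def by (rule has_sum_infsum[OF Infinite_Sum.abs_summable_summable])
qed

lemma ell2_inner_add_left:
  "\<lbrakk>v \<in> ell2 I; v' \<in> ell2 I; w \<in> ell2 I\<rbrakk> \<Longrightarrow> ell2_inner I (\<lambda>i. v i + v' i) w = ell2_inner I v w + ell2_inner I v' w"
  unfolding ell2_inner_def[of I "\<lambda>i. v i + v' i"] distrib_right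
  by (intro infsumI has_sum_add ell2_inner_has_sum)

lemma ell2_inner_scale_left: "ell2_inner I (\<lambda>i. z * v i) w = z * ell2_inner I v w"
  by (simp add: ell2_inner_def mult.assoc infsum_cmult_right')

lemma ell2_inner_sum_left:
  "\<lbrakk>finite Z; \<And>z. z \<in> Z \<Longrightarrow> f z \<in> ell2 I; w \<in> ell2 I\<rbrakk> \<Longrightarrow>
    ell2_inner I (\<lambda>i. \<Sum>z\<in>Z. f z i) w = (\<Sum>z\<in>Z. ell2_inner I (f z) w)"
  unfolding ell2_inner_def[of I "\<lambda>i. \<Sum>z\<in>Z. f z i"] sum_distrib_right
  by (intro infsumI has_sum_finite_sum ell2_inner_has_sum)

lemma ell2_inner_cnj: "cnj (ell2_inner I v w) = ell2_inner I w v"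
  by (simp add: ell2_inner_def mult.commute flip: infsum_cnj)

lemma ell2_inner_self:
  assumes "v \<in> ell2 I"
  shows "ell2_inner I v v = of_real ((ell2_norm I v)\<^sup>2)"
proof -
  have "((\<lambda>i. of_real ((cmod (v i))\<^sup>2)) has_sum (of_real ((ell2_norm I v)\<^sup>2) :: complex)) I"
    by (intro has_sum_of_real ell2_norm_has_sum assms)
  then show ?thesis unfolding ell2_inner_def complex_norm_square by (rule infsumI)
qed

locale covariant_rep = compact_dynsys G T act \<alpha> x0
  for G :: "('g, 'm) monoid_scheme" (structure) and T :: "'x topology" and act \<alpha> x0 +
  fixes I :: "'i set" and \<pi> :: "('x \<Rightarrow> complex) \<Rightarrow> ('i \<Rightarrow> complex) \<Rightarrow> 'i \<Rightarrow> complex"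
    and u :: "'g \<Rightarrow> ('i \<Rightarrow> complex) \<Rightarrow> 'i \<Rightarrow> complex"
  assumes cov: "covariant_representation G CX \<alpha> I \<pi> u"
begin

section \<open>Operators of a covariant representation\<close>

lemma rep: "star_representation CX I \<pi>" and urep: "unitary_representation G I u"
  using cov by (auto simp: covariant_representation_def)

lemma pi_closed: "\<lbrakk>a \<in> carrier CX; v \<in> ell2 I\<rbrakk> \<Longrightarrow> \<pi> a v \<in> ell2 I"
  using rep unfolding star_representation_def bounded_op_def by blast

lemma pi_lin:
  assumes "a \<in> carrier CX" "v \<in> ell2 I"
  shows "w \<in> ell2 I \<Longrightarrow> \<pi> a (\<lambda>i. v i + w i) = (\<lambda>i. \<pi> a v i + \<pi> a w i)"
    and "\<pi> a (\<lambda>i. z * v i) = (\<lambda>i. z * \<pi> a v i)"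
  using rep assms unfolding star_representation_def bounded_op_def by blast+

lemma pi_add: "\<lbrakk>a \<in> carrier CX; b \<in> carrier CX; v \<in> ell2 I\<rbrakk> \<Longrightarrow> \<pi> (\<lambda>x. a x + b x) v = (\<lambda>i. \<pi> a v i + \<pi> b v i)"
  using rep unfolding star_representation_def CX_sel(5) by blast

lemma pi_smult: "\<lbrakk>a \<in> carrier CX; v \<in> ell2 I\<rbrakk> \<Longrightarrow> \<pi> (\<lambda>x. z * a x) v = (\<lambda>i. z * \<pi> a v i)"
  using rep unfolding star_representation_def CX_sel(6) by blast

lemma pi_mult: "\<lbrakk>a \<in> carrier CX; b \<in> carrier CX; v \<in> ell2 I\<rbrakk> \<Longrightarrow> \<pi> (\<lambda>x. a x * b x) v = \<pi> a (\<pi> b v)"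
  using rep unfolding star_representation_def CX_sel(2) by blast

lemma pi_adj: "\<lbrakk>a \<in> carrier CX; v \<in> ell2 I; w \<in> ell2 I\<rbrakk> \<Longrightarrow>
    ell2_inner I (\<pi> (\<lambda>x. cnj (a x)) v) w = ell2_inner I v (\<pi> a w)"
  using rep unfolding star_representation_def CX_sel(7) by blast

lemma u_closed: "\<lbrakk>g \<in> carrier G; v \<in> ell2 I\<rbrakk> \<Longrightarrow> u g v \<in> ell2 I"
  using urep unfolding unitary_representation_def bounded_op_def by blast

lemma u_lin:
  assumes "g \<in> carrier G" "v \<in> ell2 I"
  shows "w \<in> ell2 I \<Longrightarrow> u g (\<lambda>i. v i + w i) = (\<lambda>i. u g v i + u g w i)"
    and "u g (\<lambda>i. z * v i) = (\<lambda>i. z * u g v i)"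
  using urep assms unfolding unitary_representation_def bounded_op_def by blast+

lemma u_one: "v \<in> ell2 I \<Longrightarrow> u \<one> v = v"
  using urep unfolding unitary_representation_def by blast

lemma u_mult: "\<lbrakk>g \<in> carrier G; h \<in> carrier G; v \<in> ell2 I\<rbrakk> \<Longrightarrow> u (g \<otimes> h) v = u g (u h v)"
  using urep unfolding unitary_representation_def by blast

lemma u_inner: "\<lbrakk>g \<in> carrier G; v \<in> ell2 I; w \<in> ell2 I\<rbrakk> \<Longrightarrow> ell2_inner I (u g v) (u g w) = ell2_inner I v w"
  using urep unfolding unitary_representation_def by blast

lemma pi_alpha: "\<lbrakk>g \<in> carrier G; a \<in> carrier CX; v \<in> ell2 I\<rbrakk> \<Longrightarrow> \<pi> (\<alpha> g a) v = u g (\<pi> a (u (inv g) v))"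
  using cov unfolding covariant_representation_def by blast

lemma u_norm: "\<lbrakk>g \<in> carrier G; v \<in> ell2 I\<rbrakk> \<Longrightarrow> ell2_norm I (u g v) = ell2_norm I v"
  using u_inner[of g v v] by (simp add: ell2_inner_self u_closed del: of_real_power)

lemma cnj_closed: "a \<in> carrier CX \<Longrightarrow> (\<lambda>x. cnj (a x)) \<in> carrier CX"
  by (simp add: continuous_map_complex_cnj)

lemma times_closed: "\<lbrakk>a \<in> carrier CX; b \<in> carrier CX\<rbrakk> \<Longrightarrow> (\<lambda>x. a x * b x) \<in> carrier CX"
  by (simp add: continuous_map_complex_mult)

lemma zero_in_CX: "(\<lambda>x. 0) \<in> carrier CX"
  by simp

lemma pi_zero: "v \<in> ell2 I \<Longrightarrow> \<pi> (\<lambda>x. 0) v = (\<lambda>i. 0)"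
  using pi_smult[OF zero_in_CX, of v 0] by simp

lemma sum_closed: "\<lbrakk>finite Z; \<And>z. z \<in> Z \<Longrightarrow> f z \<in> carrier CX\<rbrakk> \<Longrightarrow> (\<lambda>x. \<Sum>z\<in>Z. f z x) \<in> carrier CX"
  by (induction Z rule: finite_induct) (auto simp: continuous_map_add)

lemma pi_sum:
  "\<lbrakk>finite Z; \<And>z. z \<in> Z \<Longrightarrow> f z \<in> carrier CX; v \<in> ell2 I\<rbrakk> \<Longrightarrow> \<pi> (\<lambda>x. \<Sum>z\<in>Z. f z x) v = (\<lambda>i. \<Sum>z\<in>Z. \<pi> (f z) v i)"
proof (induction Z rule: finite_induct)
  case empty
  then show ?case by (simp add: pi_zero)
next
  case (insert a Z)
  have "\<pi> (\<lambda>x. f a x + (\<Sum>z\<in>Z. f z x)) v = (\<lambda>i. \<pi> (f a) v i + \<pi> (\<lambda>x. \<Sum>z\<in>Z. f z x) v i)"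
    using insert by (intro pi_add sum_closed) auto
  then show ?case using insert by simp
qed

abbreviation "unitX \<equiv> (\<lambda>x. if x \<in> X then 1 else 0 :: complex)"

lemma unitX_closed: "unitX \<in> carrier CX"
  by (auto intro: continuous_map_restrict)

text \<open>A \<open>star_representation\<close> may be degenerate, so the unit acts as a projection
  and not necessarily as the identity.\<close>

lemma pi_unit_sq:
  assumes v: "v \<in> ell2 I"
  shows "ell2_inner I (\<pi> unitX v) v = of_real ((ell2_norm I (\<pi> unitX v))\<^sup>2)"
proof -
  have "\<pi> unitX (\<pi> unitX v) = \<pi> (\<lambda>x. unitX x * unitX x) v" by (rule pi_mult[OF unitX_closed unitX_closed v, symmetric])
  also have "(\<lambda>x. unitX x * unitX x) = unitX" by auto
  finally have idem: "\<pi> unitX (\<pi> unitX v) = \<pi> unitX v" .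
  have "(\<lambda>x. cnj (unitX x)) = unitX" by auto
  then have "ell2_inner I (\<pi> unitX (\<pi> unitX v)) v = ell2_inner I (\<pi> unitX v) (\<pi> unitX v)"
    using pi_adj[OF unitX_closed pi_closed[OF unitX_closed v] v] by simp
  then show ?thesis using ell2_inner_self[OF pi_closed[OF unitX_closed v]] idem by simp
qed

text \<open>Pythagoras for the decomposition of v into its image under the projection and the
  difference d.\<close>

lemma pi_unit_norm:
  assumes v: "v \<in> ell2 I"
  shows "ell2_norm I (\<pi> unitX v) \<le> ell2_norm I v"
proof (rule power2_le_imp_le)
  let ?p = "\<pi> unitX v"
  have p: "?p \<in> ell2 I" by (rule pi_closed[OF unitX_closed v])
  define d where "d = (\<lambda>i. v i + (-1) * ?p i)"
  have m: "(\<lambda>i. (-1) * ?p i) \<in> ell2 I" by (rule ell2_scale[OF p])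
  have d: "d \<in> ell2 I" unfolding d_def by (rule ell2_add[OF v m])
  have "ell2_inner I d w = ell2_inner I v w - ell2_inner I ?p w" if "w \<in> ell2 I" for w
    unfolding d_def ell2_inner_add_left[OF v m that] ell2_inner_scale_left by simp
  note * = this
  have dd: "ell2_inner I d d = ell2_inner I v d - ell2_inner I ?p d" by (rule *[OF d])
  have
    dv: "ell2_inner I d v = of_real ((ell2_norm I v)\<^sup>2) - of_real ((ell2_norm I ?p)\<^sup>2)" and
    dp: "ell2_inner I d ?p = ell2_inner I v ?p - of_real ((ell2_norm I ?p)\<^sup>2)"
    using *[OF v] *[OF p] v p by (simp_all add: pi_unit_sq ell2_inner_self)
  have vp: "ell2_inner I v ?p = of_real ((ell2_norm I ?p)\<^sup>2)"
    using arg_cong[OF pi_unit_sq[OF v], of cnj] by (simp add: ell2_inner_cnj)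
  have "ell2_inner I d d = cnj (ell2_inner I d v) - cnj (ell2_inner I d ?p)"
    unfolding dd by (simp add: ell2_inner_cnj)
  also have "\<dots> = of_real ((ell2_norm I v)\<^sup>2 - (ell2_norm I ?p)\<^sup>2)" unfolding dv dp vp by simp
  finally have "(ell2_norm I d)\<^sup>2 = (ell2_norm I v)\<^sup>2 - (ell2_norm I ?p)\<^sup>2"
    unfolding ell2_inner_self[OF d] of_real_eq_iff .
  then show "(ell2_norm I ?p)\<^sup>2 \<le> (ell2_norm I v)\<^sup>2" using zero_le_power2[of "ell2_norm I d"] by linarith
qed simp

text \<open>The left side is the inner product of \<pi>(sum of |a z|^2) v with v, and that function
  is the unit. In other words, v is mapped to the family of all \<pi>(a z) v without increasing the
  norm; this is an isometry when \<pi> is nondegenerate.\<close>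

lemma pi_sq_sum_le:
  assumes Z: "finite Z" and a: "\<And>z. z \<in> Z \<Longrightarrow> a z \<in> carrier CX"
    and one: "\<And>x. x \<in> X \<Longrightarrow> (\<Sum>z\<in>Z. (cmod (a z x))\<^sup>2) = 1" and v: "v \<in> ell2 I"
  shows "(\<Sum>z\<in>Z. (ell2_norm I (\<pi> (a z) v))\<^sup>2) \<le> (ell2_norm I v)\<^sup>2"
proof -
  have aa: "(\<lambda>x. cnj (a z x) * a z x) \<in> carrier CX" if "z \<in> Z" for z
    by (intro times_closed cnj_closed a that)
  have "complex_of_real (\<Sum>z\<in>Z. (ell2_norm I (\<pi> (a z) v))\<^sup>2) = (\<Sum>z\<in>Z. ell2_inner I (\<pi> (\<lambda>x. cnj (a z x) * a z x) v) v)"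
    unfolding of_real_sum
  proof (rule sum.cong[OF refl])
    fix z assume z: "z \<in> Z"
    have "ell2_inner I (\<pi> (\<lambda>x. cnj (a z x) * a z x) v) v = ell2_inner I (\<pi> (\<lambda>x. cnj (a z x)) (\<pi> (a z) v)) v"
      using pi_mult[OF cnj_closed[OF a[OF z]] a[OF z] v] by simp
    also have "\<dots> = ell2_inner I (\<pi> (a z) v) (\<pi> (a z) v)" by (rule pi_adj[OF a[OF z] pi_closed[OF a[OF z] v] v])
    also have "\<dots> = of_real ((ell2_norm I (\<pi> (a z) v))\<^sup>2)" by (rule ell2_inner_self[OF pi_closed[OF a[OF z] v]])
    finally show "of_real ((ell2_norm I (\<pi> (a z) v))\<^sup>2) = ell2_inner I (\<pi> (\<lambda>x. cnj (a z x) * a z x) v) v" by simp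
  qed
  also have "\<dots> = ell2_inner I (\<lambda>i. \<Sum>z\<in>Z. \<pi> (\<lambda>x. cnj (a z x) * a z x) v i) v"
    using Z v aa by (intro ell2_inner_sum_left[symmetric] pi_closed) auto
  also have "(\<lambda>i. \<Sum>z\<in>Z. \<pi> (\<lambda>x. cnj (a z x) * a z x) v i) = \<pi> (\<lambda>x. \<Sum>z\<in>Z. cnj (a z x) * a z x) v"
    using Z v aa by (intro pi_sum[symmetric]) auto
  also have "(\<lambda>x. \<Sum>z\<in>Z. cnj (a z x) * a z x) = unitX"
  proof
    fix x
    have "(\<Sum>z\<in>Z. cnj (a z x) * a z x) = of_real (\<Sum>z\<in>Z. (cmod (a z x))\<^sup>2)"
      unfolding of_real_sum complex_norm_square by (simp add: mult.commute)
    moreover have "a z x = 0" if "x \<notin> X" "z \<in> Z" for z using a[OF that(2)] that(1) by simp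
    ultimately show "(\<Sum>z\<in>Z. cnj (a z x) * a z x) = unitX x" using one[of x] by (cases "x \<in> X") auto
  qed
  also have "ell2_inner I (\<pi> unitX v) v = of_real ((ell2_norm I (\<pi> unitX v))\<^sup>2)" by (rule pi_unit_sq[OF v])
  finally have "(\<Sum>z\<in>Z. (ell2_norm I (\<pi> (a z) v))\<^sup>2) = (ell2_norm I (\<pi> unitX v))\<^sup>2" unfolding of_real_eq_iff .
  then show ?thesis using pi_unit_norm[OF v] by (simp add: power_mono)
qed

text \<open>Contractivity without spectral theory: b = a / K is completed by the continuous function
  c, the root of 1 - |b|^2, to a pair with |b|^2 + |c|^2 = 1, and the preceding estimate bounds both
  terms together.\<close>

lemma pi_norm_le:
  assumes a: "a \<in> carrier CX" and K: "\<And>x. cmod (a x) \<le> K" and v: "v \<in> ell2 I"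
  shows "ell2_norm I (\<pi> a v) \<le> K * ell2_norm I v"
proof (cases "K = 0")
  case True
  then have "a = (\<lambda>x. 0)" using K by (auto simp: fun_eq_iff)
  then show ?thesis using True v by (simp add: pi_zero ell2_norm_def)
next
  case False
  then have K0: "K > 0" using K[of undefined] norm_ge_zero[of "a undefined"] by linarith
  define b where "b = (\<lambda>x. complex_of_real (1 / K) * a x)"
  define c where "c = (\<lambda>x. if x \<in> X then complex_of_real (sqrt (1 - (cmod (b x))\<^sup>2)) else 0)"
  have b: "b \<in> carrier CX" using a continuous_map_complex_mult[of "\<lambda>_. complex_of_real (1 / K)" a] by (simp add: b_def)
  have b1: "(cmod (b x))\<^sup>2 \<le> 1" for x
    using K[of x] K0 by (simp add: b_def norm_mult norm_divide power_le_one)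
  have "continuous_map T euclidean (\<lambda>x. complex_of_real (sqrt (1 - (cmod (b x))\<^sup>2)))"
  proof -
    have "continuous_on UNIV (\<lambda>z::complex. complex_of_real (sqrt (1 - (cmod z)\<^sup>2)))"
      by (intro continuous_intros)
    then have "continuous_map euclidean euclidean (\<lambda>z::complex. complex_of_real (sqrt (1 - (cmod z)\<^sup>2)))"
      by (simp only: continuous_map_iff_continuous2)
    moreover have "continuous_map T euclidean b" using b by simp
    ultimately show ?thesis by (rule continuous_map_compose[unfolded o_def, rotated])
  qed
  then have c: "c \<in> carrier CX" by (auto simp: c_def intro: continuous_map_restrict)
  have "(\<Sum>z\<in>{True, False}. (ell2_norm I (\<pi> (if z then b else c) v))\<^sup>2) \<le> (ell2_norm I v)\<^sup>2"
  proof (rule pi_sq_sum_le)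
    show "(\<Sum>z\<in>{True, False}. (cmod ((if z then b else c) x))\<^sup>2) = 1" if "x \<in> X" for x
      using that b1[of x] by (simp add: c_def)
  qed (use b c v in auto)
  then have "(ell2_norm I (\<pi> b v))\<^sup>2 + (ell2_norm I (\<pi> c v))\<^sup>2 \<le> (ell2_norm I v)\<^sup>2" by simp
  then have "(ell2_norm I (\<pi> b v))\<^sup>2 \<le> (ell2_norm I v)\<^sup>2"
    using zero_le_power2[of "ell2_norm I (\<pi> c v)"] by linarith
  then have le: "ell2_norm I (\<pi> b v) \<le> ell2_norm I v" by (rule power2_le_imp_le) simp
  have "\<pi> b v = (\<lambda>i. complex_of_real (1 / K) * \<pi> a v i)" unfolding b_def by (rule pi_smult[OF a v])
  then have "ell2_norm I (\<pi> b v) = ell2_norm I (\<lambda>i. complex_of_real (1 / K) * \<pi> a v i)" by (rule arg_cong)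
  then have "ell2_norm I (\<pi> b v) = ell2_norm I (\<pi> a v) / K"
    unfolding ell2_norm_scale norm_of_real using K0 by simp
  then have "ell2_norm I (\<pi> a v) = K * ell2_norm I (\<pi> b v)" using K0 by (simp add: field_simps)
  also have "\<dots> \<le> K * ell2_norm I v" using le K0 by (intro mult_left_mono) auto
  finally show ?thesis .
qed

section \<open>The integrated form\<close>

abbreviation "R \<equiv> integrated_form G CX \<pi> u"

lemma R_superset:
  assumes F: "F \<in> carrier B" and S: "finite S" "supp F \<subseteq> S" "S \<subseteq> carrier G" and v: "v \<in> ell2 I"
  shows "R F v = (\<lambda>i. \<Sum>g\<in>S. \<pi> (F g) (u g v) i)"
proof
  fix i
  have "\<pi> (F g) (u g v) i = 0" if "g \<in> S - supp F" for g
  proof -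
    have g: "g \<in> carrier G" "g \<notin> supp F" using that S by auto
    have "F g = (\<lambda>x. 0)" using not_supp[OF g] by (simp add: fun_eq_iff)
    then show ?thesis using pi_zero[OF u_closed[OF g(1) v]] by simp
  qed
  then show "R F v i = (\<Sum>g\<in>S. \<pi> (F g) (u g v) i)"
    unfolding integrated_form_def using S by (intro sum.mono_neutral_left) auto
qed

lemma R_closed: "\<lbrakk>F \<in> carrier B; v \<in> ell2 I\<rbrakk> \<Longrightarrow> R F v \<in> ell2 I"
  unfolding integrated_form_def using subsetD[OF supp_subset]
  by (intro ell2_sum pi_closed u_closed B_finite B_coeff) auto

text \<open>The l^1 estimate. It does not depend on the representation, so it bounds the set whose
  supremum is the universal norm, and it later controls small perturbations of the
  coefficients.\<close>

lemma R_norm_le: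
  assumes F: "F \<in> carrier B" and S: "finite S" "supp F \<subseteq> S" "S \<subseteq> carrier G" and v: "v \<in> ell2 I"
    and K: "\<And>g x. g \<in> S \<Longrightarrow> cmod (F g x) \<le> K g"
  shows "ell2_norm I (R F v) \<le> (\<Sum>g\<in>S. K g) * ell2_norm I v"
proof -
  have "ell2_norm I (R F v) \<le> (\<Sum>g\<in>S. ell2_norm I (\<pi> (F g) (u g v)))"
    unfolding R_superset[OF F S v] using S F v
    by (intro ell2_norm_sum pi_closed u_closed B_coeff) auto
  also have "\<dots> \<le> (\<Sum>g\<in>S. K g * ell2_norm I v)"
  proof (rule sum_mono)
    fix g assume g: "g \<in> S"
    then have gG: "g \<in> carrier G" using S by blast
    then show "ell2_norm I (\<pi> (F g) (u g v)) \<le> K g * ell2_norm I v"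
      using pi_norm_le[OF B_coeff[OF F] K[OF g] u_closed[OF gG v]] u_norm[OF gG v] by simp
  qed
  finally show ?thesis by (simp add: sum_distrib_right)
qed

lemma B_bounded:
  assumes F: "F \<in> carrier B"
  shows "\<exists>K. \<forall>g x. cmod (F g x) \<le> K g"
  using CX_bounded[OF B_coeff[OF F]] by metis

lemma R_bounded_op: assumes F: "F \<in> carrier B" shows "bounded_op I (R F)"
proof -
  obtain K where "\<And>g x. cmod (F g x) \<le> K g" using B_bounded[OF F] by blast
  then have "\<forall>v\<in>ell2 I. ell2_norm I (R F v) \<le> (\<Sum>g\<in>supp F. K g) * ell2_norm I v"
    using R_norm_le[OF F B_finite[OF F] subset_refl supp_subset] by blast
  moreover have "R F (\<lambda>i. v i + w i) = (\<lambda>i. R F v i + R F w i)" if "v \<in> ell2 I" "w \<in> ell2 I" for v w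
  proof -
    have "\<pi> (F g) (u g (\<lambda>i. v i + w i)) = (\<lambda>i. \<pi> (F g) (u g v) i + \<pi> (F g) (u g w) i)" if "g \<in> supp F" for g
    proof -
      have "g \<in> carrier G" using that supp_subset by blast
      then show ?thesis
        using u_lin(1)[of g v w] pi_lin(1)[OF B_coeff[OF F], of "u g v" "u g w"] u_closed \<open>v \<in> ell2 I\<close> \<open>w \<in> ell2 I\<close> by simp
    qed
    then show ?thesis by (auto simp: integrated_form_def sum.distrib fun_eq_iff)
  qed
  moreover have "R F (\<lambda>i. z * v i) = (\<lambda>i. z * R F v i)" if "v \<in> ell2 I" for z v
  proof -
    have "\<pi> (F g) (u g (\<lambda>i. z * v i)) = (\<lambda>i. z * \<pi> (F g) (u g v) i)" if "g \<in> supp F" for g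
    proof -
      have "g \<in> carrier G" using that supp_subset by blast
      then show ?thesis
        using u_lin(2)[of g v z] pi_lin(2)[OF B_coeff[OF F], of "u g v"] u_closed \<open>v \<in> ell2 I\<close> by simp
    qed
    then show ?thesis by (auto simp: integrated_form_def sum_distrib_left fun_eq_iff)
  qed
  ultimately show ?thesis unfolding bounded_op_def using R_closed[OF F] by blast
qed

lemma R_add:
  assumes F: "F \<in> carrier B" and H: "H \<in> carrier B" and v: "v \<in> ell2 I"
  shows "R (F \<oplus>\<^bsub>B\<^esub> H) v = (\<lambda>i. R F v i + R H v i)"
proof -
  let ?S = "supp F \<union> supp H"
  have S: "finite ?S" "?S \<subseteq> carrier G" using F H supp_subset by (auto intro: B_finite)
  have sub: "supp (F \<oplus>\<^bsub>B\<^esub> H) \<subseteq> ?S" by (auto simp: supp_eq)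
  have "\<pi> ((F \<oplus>\<^bsub>B\<^esub> H) g) (u g v) = (\<lambda>i. \<pi> (F g) (u g v) i + \<pi> (H g) (u g v) i)" if "g \<in> ?S" for g
    using pi_add[OF B_coeff[OF F] B_coeff[OF H], of "u g v"] u_closed v that S by auto
  then show ?thesis
    unfolding R_superset[OF add_B_closed[OF F H] S(1) sub S(2) v] R_superset[OF F S(1) _ S(2) v, simplified]
      R_superset[OF H S(1) _ S(2) v, simplified]
    by (auto simp: sum.distrib fun_eq_iff)
qed

lemma R_smult:
  assumes F: "F \<in> carrier B" and v: "v \<in> ell2 I"
  shows "R (z \<odot>\<^bsub>B\<^esub> F) v = (\<lambda>i. z * R F v i)"
proof -
  have sub: "supp (z \<odot>\<^bsub>B\<^esub> F) \<subseteq> supp F" by (auto simp: supp_eq)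
  have "\<pi> ((z \<odot>\<^bsub>B\<^esub> F) g) (u g v) = (\<lambda>i. z * \<pi> (F g) (u g v) i)" if "g \<in> supp F" for g
    using pi_smult[OF B_coeff[OF F], of "u g v" z] u_closed[OF subsetD[OF supp_subset that] v] by simp
  then show ?thesis
    unfolding R_superset[OF smult_B_closed[OF F] B_finite[OF F] sub supp_subset v]
      R_superset[OF F B_finite[OF F] subset_refl supp_subset v]
    by (auto simp: sum_distrib_left fun_eq_iff)
qed

lemma R_finsum:
  "\<lbrakk>finite S; \<And>s. s \<in> S \<Longrightarrow> f s \<in> carrier B; v \<in> ell2 I\<rbrakk> \<Longrightarrow> R (finsum B f S) v = (\<lambda>i. \<Sum>s\<in>S. R (f s) v i)"
proof (induction S rule: finite_induct)
  case empty
  show ?case by (simp add: integrated_form_def fsupp_def)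
next
  case (insert a S)
  then have "finsum B f (insert a S) = f a \<oplus>\<^bsub>B\<^esub> finsum B f S" by (intro B.finsum_insert) auto
  then show ?case using insert R_add[of "f a" "finsum B f S" v] by simp
qed

lemma R_single: "\<lbrakk>a \<in> carrier CX; g \<in> carrier G; v \<in> ell2 I\<rbrakk> \<Longrightarrow> R (single a g) v = \<pi> a (u g v)"
  using R_superset[OF single_closed _ supp_single, of a g v] by (simp add: single_def)

text \<open>The element in question is the product of the adjoint of a s^(-1) with a t^(-1) in the
  convolution algebra, so its form splits into the two vectors on the right.\<close>

lemma R_form:
  assumes a: "a \<in> carrier CX" and s: "s \<in> carrier G" and t: "t \<in> carrier G"
    and v: "v \<in> ell2 I" and w: "w \<in> ell2 I"
  shows "ell2_inner I (R (single (\<alpha> s (\<lambda>x. cnj (a x) * a x)) (s \<otimes> inv t)) v) w =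
    ell2_inner I (\<pi> a (u (inv t) v)) (\<pi> a (u (inv s) w))"
proof -
  let ?y = "u (inv t) v"
  have y: "?y \<in> ell2 I" using t v by (simp add: u_closed)
  have aa: "(\<lambda>x. cnj (a x) * a x) \<in> carrier CX" by (intro times_closed cnj_closed a)
  have st: "u (inv s) (u (s \<otimes> inv t) v) = ?y"
    using s t v by (simp add: u_mult[symmetric] m_assoc[symmetric])
  have "R (single (\<alpha> s (\<lambda>x. cnj (a x) * a x)) (s \<otimes> inv t)) v = \<pi> (\<alpha> s (\<lambda>x. cnj (a x) * a x)) (u (s \<otimes> inv t) v)"
    using s t v aa by (intro R_single alpha_closed) auto
  also have "\<dots> = u s (\<pi> (\<lambda>x. cnj (a x) * a x) ?y)"
    using pi_alpha[OF s aa, of "u (s \<otimes> inv t) v"] s t v by (simp add: u_closed st)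
  also have "\<dots> = u s (\<pi> (\<lambda>x. cnj (a x)) (\<pi> a ?y))" by (simp only: pi_mult[OF cnj_closed[OF a] a y])
  finally have eq: "R (single (\<alpha> s (\<lambda>x. cnj (a x) * a x)) (s \<otimes> inv t)) v = u s (\<pi> (\<lambda>x. cnj (a x)) (\<pi> a ?y))" .
  have z: "\<pi> (\<lambda>x. cnj (a x)) (\<pi> a ?y) \<in> ell2 I" by (intro pi_closed cnj_closed a y)
  have "w = u s (u (inv s) w)" using s w by (simp add: u_mult[symmetric] u_one)
  then have "ell2_inner I (u s (\<pi> (\<lambda>x. cnj (a x)) (\<pi> a ?y))) w = ell2_inner I (\<pi> (\<lambda>x. cnj (a x)) (\<pi> a ?y)) (u (inv s) w)"
    using u_inner[OF s z u_closed[of "inv s" w]] s w by simp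
  also have "\<dots> = ell2_inner I (\<pi> a ?y) (\<pi> a (u (inv s) w))"
    using s w by (intro pi_adj a pi_closed y u_closed) auto
  finally show ?thesis using eq by simp
qed

text \<open>The operator below is \<open>V\<^sup>* (M \<otimes> 1) V\<close> for the isometry \<open>v \<mapsto> (\<pi>(a\<^sub>z) u\<^sub>t\<^sup>* v)\<^sub>z\<^sub>,\<^sub>t / \<surd>|P|\<close>; its norm is
  estimated coordinatewise in \<open>\<ell>\<^sup>2(I)\<close>.\<close>

lemma R_compression_le:
  assumes Z: "finite Z" and P: "finite P" "P \<noteq> {}" "P \<subseteq> carrier G"
    and a: "\<And>z. z \<in> Z \<Longrightarrow> a z \<in> carrier CX"
    and one: "\<And>x. x \<in> X \<Longrightarrow> (\<Sum>z\<in>Z. (cmod (a z x))\<^sup>2) = 1"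
    and M: "\<And>z \<xi> \<eta>. z \<in> Z \<Longrightarrow> cmod (\<Sum>s\<in>P. \<Sum>t\<in>P. M z s t * \<xi> t * cnj (\<eta> s)) \<le>
        C / 2 * ((\<Sum>t\<in>P. (cmod (\<xi> t))\<^sup>2) + (\<Sum>s\<in>P. (cmod (\<eta> s))\<^sup>2))"
    and C: "0 \<le> C" and v: "v \<in> ell2 I"
  defines "H \<equiv> finsum B (\<lambda>(z, s, t). (M z s t / of_nat (card P)) \<odot>\<^bsub>B\<^esub>
    single (\<alpha> s (\<lambda>x. cnj (a z x) * a z x)) (s \<otimes> inv t)) (Z \<times> P \<times> P)"
  shows "ell2_norm I (R H v) \<le> C * ell2_norm I v"
proof -
  define E where "E = (\<lambda>z s t. single (\<alpha> s (\<lambda>x. cnj (a z x) * a z x)) (s \<otimes> inv t))"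
  let ?n = "real (card P)"
  have n: "?n > 0" using P by (simp add: card_gt_0_iff)
  have PG: "s \<in> P \<Longrightarrow> s \<in> carrier G" for s using P by blast
  have E: "E z s t \<in> carrier B" if "z \<in> Z" "s \<in> P" "t \<in> P" for z s t
    unfolding E_def using that PG by (intro single_closed alpha_closed times_closed cnj_closed a) auto
  have Hc: "H \<in> carrier B"
    unfolding H_def by (intro B.finsum_in) (auto intro!: smult_B_closed E[unfolded E_def] simp del: B_sel)
  have RH: "R H v = (\<lambda>i. \<Sum>(z, s, t)\<in>Z \<times> P \<times> P. M z s t / of_nat (card P) * R (E z s t) v i)" if v: "v \<in> ell2 I" for v
  proof -
    have "R H v = (\<lambda>i. \<Sum>p\<in>Z \<times> P \<times> P. R (case p of (z, s, t) \<Rightarrow> (M z s t / of_nat (card P)) \<odot>\<^bsub>B\<^esub> E z s t) v i)"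
      unfolding H_def E_def
      using Z P v by (intro R_finsum) (auto intro!: smult_B_closed E[unfolded E_def] simp del: B_sel)
    also have "\<dots> = (\<lambda>i. \<Sum>(z, s, t)\<in>Z \<times> P \<times> P. M z s t / of_nat (card P) * R (E z s t) v i)"
      using R_smult[OF E v] by (intro ext sum.cong refl) (auto simp del: B_sel)
    finally show ?thesis .
  qed
  define V where "V = (\<lambda>v z t. \<pi> (a z) (u (inv t) v))"
  have V: "V v z t \<in> ell2 I" if "v \<in> ell2 I" "z \<in> Z" "t \<in> P" for v z t
    unfolding V_def using that PG by (intro pi_closed u_closed a) auto
  have inner: "ell2_inner I (R H v) w = (\<Sum>z\<in>Z. \<Sum>s\<in>P. \<Sum>t\<in>P. M z s t / of_nat (card P) * ell2_inner I (V v z t) (V w z s))"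
    if v: "v \<in> ell2 I" and w: "w \<in> ell2 I" for v w
  proof -
    let ?q = "\<lambda>p. case p of (z, s, t) \<Rightarrow> \<lambda>i. M z s t / of_nat (card P) * R (E z s t) v i"
    have q: "?q p \<in> ell2 I" if pZ: "p \<in> Z \<times> P \<times> P" for p
    proof -
      obtain z s t where p: "p = (z, s, t)" "z \<in> Z" "s \<in> P" "t \<in> P" using pZ by auto
      show ?thesis unfolding p(1) prod.case by (intro ell2_scale R_closed E v p)
    qed
    have "R H v = (\<lambda>i. \<Sum>p\<in>Z \<times> P \<times> P. ?q p i)"
      unfolding RH[OF v] by (intro ext sum.cong refl) (auto split: prod.splits)
    then have "ell2_inner I (R H v) w = (\<Sum>p\<in>Z \<times> P \<times> P. ell2_inner I (?q p) w)"
      using ell2_inner_sum_left[of "Z \<times> P \<times> P" ?q I w] q Z P w by simp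
    also have "\<dots> = (\<Sum>(z, s, t)\<in>Z \<times> P \<times> P. M z s t / of_nat (card P) * ell2_inner I (V v z t) (V w z s))"
    proof (rule sum.cong[OF refl])
      fix p assume "p \<in> Z \<times> P \<times> P"
      then obtain z s t where p: "p = (z, s, t)" "z \<in> Z" "s \<in> P" "t \<in> P" by auto
      have "ell2_inner I (R (E z s t) v) w = ell2_inner I (V v z t) (V w z s)"
        unfolding E_def V_def by (rule R_form[OF a[OF p(2)] PG[OF p(3)] PG[OF p(4)] v w])
      then show "ell2_inner I (case p of (z, s, t) \<Rightarrow> \<lambda>i. M z s t / of_nat (card P) * R (E z s t) v i) w =
          (case p of (z, s, t) \<Rightarrow> M z s t / of_nat (card P) * ell2_inner I (V v z t) (V w z s))"
        unfolding p(1) prod.case ell2_inner_scale_left by simp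
    qed
    finally show ?thesis by (simp add: sum.cartesian_product)
  qed
  have Vsum: "(\<Sum>z\<in>Z. \<Sum>t\<in>P. (ell2_norm I (V v z t))\<^sup>2) \<le> ?n * (ell2_norm I v)\<^sup>2" if v: "v \<in> ell2 I" for v
  proof -
    have "(\<Sum>z\<in>Z. \<Sum>t\<in>P. (ell2_norm I (V v z t))\<^sup>2) = (\<Sum>t\<in>P. \<Sum>z\<in>Z. (ell2_norm I (V v z t))\<^sup>2)" by (rule sum.swap)
    also have "\<dots> \<le> (\<Sum>t\<in>P. (ell2_norm I v)\<^sup>2)"
    proof (rule sum_mono)
      fix t assume "t \<in> P"
      then have t: "inv t \<in> carrier G" using PG by simp
      show "(\<Sum>z\<in>Z. (ell2_norm I (V v z t))\<^sup>2) \<le> (ell2_norm I v)\<^sup>2"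
        using pi_sq_sum_le[OF Z a one u_closed[OF t v]] u_norm[OF t v] by (simp add: V_def)
    qed
    finally show ?thesis by simp
  qed
  \<comment> \<open>The hypothesis on M is applied in every coordinate i, with \<xi> and \<eta> the
    coordinates of the vectors V. Its bound is half a sum of squares and not a product of norms,
    because sums of squares can be added over i and z.\<close>
  have bilin: "cmod (ell2_inner I (R H v) w) \<le> C / 2 * ((ell2_norm I v)\<^sup>2 + (ell2_norm I w)\<^sup>2)"
    if v: "v \<in> ell2 I" and w: "w \<in> ell2 I" for v w
  proof -
    define f where "f = (\<lambda>i. \<Sum>z\<in>Z. \<Sum>s\<in>P. \<Sum>t\<in>P. M z s t / of_nat (card P) * (V v z t i * cnj (V w z s i)))"
    define h where "h = (\<lambda>i. \<Sum>z\<in>Z. C / (2 * ?n) * ((\<Sum>t\<in>P. (cmod (V v z t i))\<^sup>2) + (\<Sum>s\<in>P. (cmod (V w z s i))\<^sup>2)))"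
    have f: "(f has_sum ell2_inner I (R H v) w) I"
      unfolding f_def inner[OF v w] using Z P V v w
      by (intro has_sum_finite_sum has_sum_cmult_right ell2_inner_has_sum) auto
    have h: "(h has_sum (\<Sum>z\<in>Z. C / (2 * ?n) * ((\<Sum>t\<in>P. (ell2_norm I (V v z t))\<^sup>2) + (\<Sum>s\<in>P. (ell2_norm I (V w z s))\<^sup>2)))) I"
      unfolding h_def using Z P V v w
      by (intro has_sum_finite_sum has_sum_cmult_right has_sum_add ell2_norm_has_sum) auto
    have fh: "cmod (f i) \<le> h i" for i
      unfolding f_def h_def
    proof (rule sum_norm_le)
      fix z assume z: "z \<in> Z"
      have "(\<Sum>s\<in>P. \<Sum>t\<in>P. M z s t / of_nat (card P) * (V v z t i * cnj (V w z s i))) =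
          (\<Sum>s\<in>P. \<Sum>t\<in>P. M z s t * V v z t i * cnj (V w z s i)) / of_nat (card P)"
        by (simp add: sum_divide_distrib mult.assoc)
      then have "cmod (\<Sum>s\<in>P. \<Sum>t\<in>P. M z s t / of_nat (card P) * (V v z t i * cnj (V w z s i))) =
          cmod (\<Sum>s\<in>P. \<Sum>t\<in>P. M z s t * V v z t i * cnj (V w z s i)) / ?n"
        by (simp add: norm_divide)
      also have "\<dots> \<le> C / 2 * ((\<Sum>t\<in>P. (cmod (V v z t i))\<^sup>2) + (\<Sum>s\<in>P. (cmod (V w z s i))\<^sup>2)) / ?n"
        using M[OF z, of "\<lambda>t. V v z t i" "\<lambda>s. V w z s i"] n by (intro divide_right_mono) auto
      finally show "cmod (\<Sum>s\<in>P. \<Sum>t\<in>P. M z s t / of_nat (card P) * (V v z t i * cnj (V w z s i))) \<le>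
          C / (2 * ?n) * ((\<Sum>t\<in>P. (cmod (V v z t i))\<^sup>2) + (\<Sum>s\<in>P. (cmod (V w z s i))\<^sup>2))"
        by simp
    qed
    have "cmod (ell2_inner I (R H v) w) \<le>
        (\<Sum>z\<in>Z. C / (2 * ?n) * ((\<Sum>t\<in>P. (ell2_norm I (V v z t))\<^sup>2) + (\<Sum>s\<in>P. (ell2_norm I (V w z s))\<^sup>2)))"
      by (rule norm_infsum_le[OF f h fh])
    also have "\<dots> = C / (2 * ?n) * ((\<Sum>z\<in>Z. \<Sum>t\<in>P. (ell2_norm I (V v z t))\<^sup>2) + (\<Sum>z\<in>Z. \<Sum>s\<in>P. (ell2_norm I (V w z s))\<^sup>2))"
      by (simp add: sum_distrib_left sum.distrib distrib_left)
    also have "\<dots> \<le> C / (2 * ?n) * (?n * (ell2_norm I v)\<^sup>2 + ?n * (ell2_norm I w)\<^sup>2)"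
      using C n Vsum[OF v] Vsum[OF w] by (intro mult_left_mono add_mono) auto
    also have "\<dots> = C / 2 * ((ell2_norm I v)\<^sup>2 + (ell2_norm I w)\<^sup>2)" using n by (simp add: field_simps)
    finally show ?thesis .
  qed
  let ?N = "ell2_norm I (R H v)"
  have Rv: "R H v \<in> ell2 I" by (rule R_closed[OF Hc v])
  \<comment> \<open>Testing against w = r R H v. The choice r = 1 / C balances the two squares and
    turns the additive bound into the bound by C.\<close>
  have key: "r * ?N\<^sup>2 \<le> C / 2 * ((ell2_norm I v)\<^sup>2 + r\<^sup>2 * ?N\<^sup>2)" if "r > 0" for r :: real
  proof -
    let ?w = "\<lambda>i. complex_of_real r * R H v i"
    have "ell2_inner I (R H v) ?w = cnj (ell2_inner I ?w (R H v))" by (simp add: ell2_inner_cnj)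
    also have "\<dots> = of_real (r * ?N\<^sup>2)" by (simp add: ell2_inner_scale_left ell2_inner_self[OF Rv])
    finally have "cmod (ell2_inner I (R H v) ?w) = r * ?N\<^sup>2"
      using \<open>r > 0\<close> by (simp only: norm_of_real) simp
    moreover have "ell2_norm I ?w = r * ?N" using \<open>r > 0\<close> by (simp add: ell2_norm_scale)
    ultimately show ?thesis using bilin[OF v ell2_scale[OF Rv, of "complex_of_real r"]] by (simp add: power_mult_distrib)
  qed
  show ?thesis
  proof (cases "C = 0")
    case True
    then have "?N\<^sup>2 \<le> 0" using key[of 1] by simp
    then show ?thesis using True by simp
  next
    case False
    then have C0: "C > 0" using C by simp
    have "C * (1 / C * ?N\<^sup>2) \<le> C * (C / 2 * ((ell2_norm I v)\<^sup>2 + (1 / C)\<^sup>2 * ?N\<^sup>2))"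
      using key[of "1 / C"] C0 by (intro mult_left_mono) auto
    then have "?N\<^sup>2 \<le> (C * ell2_norm I v)\<^sup>2"
      using C0 by (simp add: power_mult_distrib power2_eq_square field_simps)
    then show ?thesis by (rule power2_le_imp_le) (use C in simp)
  qed
qed

end

section \<open>The regular representation and the universal norm\<close>

context compact_dynsys
begin

text \<open>The universal norm ranges only over index sets of functions from G to the coefficient
  algebra, so l^2(G) has to be realized on a copy of G inside that type: point masses, constant in
  x.\<close>

definition idx :: "'g \<Rightarrow> 'g \<Rightarrow> 'x \<Rightarrow> complex" where
  "idx g = (\<lambda>h x. if h = g then 1 else 0)"

definition reg_set :: "('g \<Rightarrow> 'x \<Rightarrow> complex) set" where
  "reg_set = idx ` carrier G"

definition pt :: "('g \<Rightarrow> 'x \<Rightarrow> complex) \<Rightarrow> 'g" where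
  "pt i = inv_into (carrier G) idx i"

definition reg_pi :: "('x \<Rightarrow> complex) \<Rightarrow> (('g \<Rightarrow> 'x \<Rightarrow> complex) \<Rightarrow> complex) \<Rightarrow> ('g \<Rightarrow> 'x \<Rightarrow> complex) \<Rightarrow> complex" where
  "reg_pi a v = (\<lambda>i. if i \<in> reg_set then a (act (pt i) x0) * v i else 0)"

definition reg_u :: "'g \<Rightarrow> (('g \<Rightarrow> 'x \<Rightarrow> complex) \<Rightarrow> complex) \<Rightarrow> ('g \<Rightarrow> 'x \<Rightarrow> complex) \<Rightarrow> complex" where
  "reg_u h v = (\<lambda>i. if i \<in> reg_set then v (idx (inv h \<otimes> pt i)) else 0)"

text \<open>The GNS vector of F. The map preserves the seminorm and turns left multiplication into
  the regular representation.\<close>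

definition orbit_vec :: "('g \<Rightarrow> 'x \<Rightarrow> complex) \<Rightarrow> ('g \<Rightarrow> 'x \<Rightarrow> complex) \<Rightarrow> complex" where
  "orbit_vec F = (\<lambda>i. if i \<in> reg_set then F (pt i) (act (pt i) x0) else 0)"

lemma inj_idx: "inj idx"
proof (rule injI)
  fix g h assume "idx g = idx h"
  then have "idx g g undefined = idx h g undefined" by simp
  then show "g = h" by (simp add: idx_def split: if_splits)
qed

lemma idx_in [simp]: "g \<in> carrier G \<Longrightarrow> idx g \<in> reg_set"
  by (simp add: reg_set_def)

lemma pt_idx [simp]: "g \<in> carrier G \<Longrightarrow> pt (idx g) = g"
  unfolding pt_def using inj_idx by (intro inv_into_f_f) (auto intro: inj_on_subset)

lemma reg_cases: assumes "i \<in> reg_set" obtains g where "g \<in> carrier G" "i = idx g"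
  using assms by (auto simp: reg_set_def)

lemma reg_shift_bij: "h \<in> carrier G \<Longrightarrow> bij_betw (\<lambda>i. idx (inv h \<otimes> pt i)) reg_set reg_set"
  by (rule bij_betw_byWitness[where f' = "\<lambda>i. idx (h \<otimes> pt i)"])
    (auto elim!: reg_cases simp: m_assoc[symmetric])

lemma reg_pi_ell2:
  assumes a: "a \<in> carrier CX" and v: "v \<in> ell2 reg_set" and K: "\<And>x. cmod (a x) \<le> K"
  shows "reg_pi a v \<in> ell2 reg_set" and "ell2_norm reg_set (reg_pi a v) \<le> K * ell2_norm reg_set v"
proof -
  have K0: "0 \<le> K" using K[of undefined] norm_ge_zero order_trans by blast
  have le: "L2_set (\<lambda>i. cmod (reg_pi a v i)) S \<le> K * ell2_norm reg_set v" if S: "finite S" "S \<subseteq> reg_set" for S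
  proof -
    have "L2_set (\<lambda>i. cmod (reg_pi a v i)) S \<le> L2_set (\<lambda>i. K * cmod (v i)) S"
      using K K0 by (intro L2_set_mono) (auto simp: reg_pi_def norm_mult intro!: mult_right_mono)
    also have "\<dots> = K * L2_set (\<lambda>i. cmod (v i)) S" using K0 by (simp add: L2_set_right_distrib)
    also have "\<dots> \<le> K * ell2_norm reg_set v" using K0 S v by (intro mult_left_mono ell2_finite_le)
    finally show ?thesis .
  qed
  show "reg_pi a v \<in> ell2 reg_set"
    by (rule ell2_bounded_finite(1)[OF _ _ le]) (use K0 in \<open>auto simp: reg_pi_def\<close>)
  show "ell2_norm reg_set (reg_pi a v) \<le> K * ell2_norm reg_set v"
    by (rule ell2_bounded_finite(2)[OF _ _ le]) (use K0 in \<open>auto simp: reg_pi_def\<close>)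
qed

lemma reg_sum_shift:
  assumes h: "h \<in> carrier G"
  shows "infsum (\<lambda>i. f (idx (inv h \<otimes> pt i))) reg_set = infsum f reg_set"
    and "(\<lambda>i. f (idx (inv h \<otimes> pt i))) summable_on reg_set \<longleftrightarrow> f summable_on reg_set"
  using infsum_reindex_bij_betw[OF reg_shift_bij[OF h], of f] summable_on_reindex_bij_betw[OF reg_shift_bij[OF h], of f]
  by simp_all

lemma reg_u_ell2:
  assumes h: "h \<in> carrier G" and v: "v \<in> ell2 reg_set"
  shows "reg_u h v \<in> ell2 reg_set" and "ell2_norm reg_set (reg_u h v) = ell2_norm reg_set v"
proof -
  have eq: "\<And>i. i \<in> reg_set \<Longrightarrow> (cmod (reg_u h v i))\<^sup>2 = (cmod (v (idx (inv h \<otimes> pt i))))\<^sup>2"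
    by (simp add: reg_u_def)
  show "reg_u h v \<in> ell2 reg_set"
    using v reg_sum_shift(2)[OF h, of "\<lambda>i. (cmod (v i))\<^sup>2"]
    by (simp add: ell2_def summable_on_cong[OF eq]) (simp add: reg_u_def)
  show "ell2_norm reg_set (reg_u h v) = ell2_norm reg_set v"
    unfolding ell2_norm_def using reg_sum_shift(1)[OF h, of "\<lambda>i. (cmod (v i))\<^sup>2"]
    by (simp add: eq cong: infsum_cong)
qed

lemma reg_covariant: "covariant_representation G CX \<alpha> reg_set reg_pi reg_u"
  unfolding covariant_representation_def
proof (intro conjI ballI)
  show "star_representation CX reg_set reg_pi"
    unfolding star_representation_def
  proof (intro conjI ballI allI)
    fix a assume a: "a \<in> carrier CX"
    obtain K where K: "\<And>x. cmod (a x) \<le> K" using CX_bounded[OF a] by blast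
    show "bounded_op reg_set (reg_pi a)"
      unfolding bounded_op_def using reg_pi_ell2[OF a _ K]
      by (auto simp: reg_pi_def algebra_simps fun_eq_iff)
    show "ell2_inner reg_set (reg_pi (adj CX a) v) w = ell2_inner reg_set v (reg_pi a w)" for v w
      unfolding ell2_inner_def by (intro infsum_cong) (simp add: reg_pi_def)
  qed (auto simp: reg_pi_def algebra_simps fun_eq_iff)
  show "unitary_representation G reg_set reg_u"
    unfolding unitary_representation_def
  proof (intro conjI ballI)
    fix h assume h: "h \<in> carrier G"
    have "\<forall>v\<in>ell2 reg_set. ell2_norm reg_set (reg_u h v) \<le> 1 * ell2_norm reg_set v"
      using reg_u_ell2[OF h] by simp
    then have "\<exists>C. \<forall>v\<in>ell2 reg_set. ell2_norm reg_set (reg_u h v) \<le> C * ell2_norm reg_set v" by blast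
    moreover have "reg_u h (\<lambda>i. v i + w i) = (\<lambda>i. reg_u h v i + reg_u h w i)" for v w
      by (simp add: reg_u_def fun_eq_iff)
    moreover have "reg_u h (\<lambda>i. z * v i) = (\<lambda>i. z * reg_u h v i)" for z v
      by (simp add: reg_u_def fun_eq_iff)
    ultimately show "bounded_op reg_set (reg_u h)"
      unfolding bounded_op_def using reg_u_ell2(1)[OF h] by blast
    show "reg_u (h \<otimes> k) v = reg_u h (reg_u k v)" if "k \<in> carrier G" for k v
      using h that by (auto simp: reg_u_def fun_eq_iff inv_mult_group m_assoc elim!: reg_cases)
    show "ell2_inner reg_set (reg_u h v) (reg_u h w) = ell2_inner reg_set v w" for v w
      using reg_sum_shift(1)[OF h, of "\<lambda>i. v i * cnj (w i)"]
      by (simp add: ell2_inner_def reg_u_def cong: infsum_cong)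
  next
    fix v assume "v \<in> ell2 reg_set"
    then show "reg_u \<one> v = v" by (auto simp: reg_u_def fun_eq_iff ell2_def elim!: reg_cases)
  qed
  fix g a v assume g: "g \<in> carrier G"
  show "reg_pi (\<alpha> g a) v = reg_u g (reg_pi a (reg_u (inv g) v))"
  proof
    fix i
    show "reg_pi (\<alpha> g a) v i = reg_u g (reg_pi a (reg_u (inv g) v)) i"
    proof (cases "i \<in> reg_set")
      case True
      then obtain k where k: "k \<in> carrier G" "i = idx k" by (rule reg_cases)
      then show ?thesis
        using g base by (simp add: reg_pi_def reg_u_def alpha act_mult m_assoc[symmetric])
    qed (simp add: reg_pi_def reg_u_def)
  qed
qed

sublocale reg: covariant_rep G T act \<alpha> x0 reg_set reg_pi reg_u
  by unfold_locales (rule reg_covariant)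

lemma orbit_vec_ell2:
  assumes F: "F \<in> carrier B"
  shows "orbit_vec F \<in> ell2 reg_set" and "ell2_norm reg_set (orbit_vec F) = B.nn F"
proof -
  have hs: "((\<lambda>i. (cmod (orbit_vec F i))\<^sup>2) has_sum (B.nn F)\<^sup>2) reg_set"
  proof (rule has_sum_finite_neutralI)
    show "finite (idx ` supp F)" using F by (simp add: B_finite)
    show "idx ` supp F \<subseteq> reg_set" using subsetD[OF supp_subset] by auto
    show "(cmod (orbit_vec F i))\<^sup>2 = 0" if "i \<in> reg_set - idx ` supp F" for i
    proof -
      from that obtain g where g: "g \<in> carrier G" "i = idx g" using reg_cases by blast
      with that have "g \<notin> supp F" by blast
      then show ?thesis using g by (simp add: orbit_vec_def not_supp)
    qed
    have "(\<Sum>i\<in>idx ` supp F. (cmod (orbit_vec F i))\<^sup>2) = (\<Sum>g\<in>supp F. (cmod (F g (act g x0)))\<^sup>2)"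
      using subsetD[OF supp_subset]
      by (intro sum.reindex_cong[OF inj_on_subset[OF inj_idx subset_UNIV] refl]) (auto simp: orbit_vec_def)
    then show "(B.nn F)\<^sup>2 = (\<Sum>i\<in>idx ` supp F. (cmod (orbit_vec F i))\<^sup>2)"
      by (simp add: nn_B_sq[OF F B_finite[OF F] subset_refl supp_subset])
  qed
  then show "orbit_vec F \<in> ell2 reg_set" by (auto simp: ell2_def orbit_vec_def dest: has_sum_imp_summable)
  have "(ell2_norm reg_set (orbit_vec F))\<^sup>2 = (B.nn F)\<^sup>2" unfolding ell2_norm_sq using hs by (rule infsumI)
  then show "ell2_norm reg_set (orbit_vec F) = B.nn F" using F by (simp add: power2_eq_iff_nonneg)
qed

lemma reg_R_orbit_vec:
  assumes F: "F \<in> carrier B" and K: "K \<in> carrier B"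
  shows "reg.R F (orbit_vec K) = orbit_vec (F \<otimes>\<^bsub>B\<^esub> K)"
proof
  fix i
  show "reg.R F (orbit_vec K) i = orbit_vec (F \<otimes>\<^bsub>B\<^esub> K) i"
  proof (cases "i \<in> reg_set")
    case True
    then obtain k where k: "k \<in> carrier G" "i = idx k" by (rule reg_cases)
    have "reg.R F (orbit_vec K) i = (\<Sum>s\<in>supp F. F s (act k x0) * K (inv s \<otimes> k) (act (inv s) (act k x0)))"
      unfolding integrated_form_def
    proof (rule sum.cong[OF refl])
      fix s assume "s \<in> supp F"
      then have "s \<in> carrier G" using supp_subset by blast
      then show "reg_pi (F s) (reg_u s (orbit_vec K)) i = F s (act k x0) * K (inv s \<otimes> k) (act (inv s) (act k x0))"
        using k base by (simp add: reg_pi_def reg_u_def orbit_vec_def act_mult)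
    qed
    also have "\<dots> = (F \<otimes>\<^bsub>B\<^esub> K) k (act k x0)"
      by (rule mult_B[OF F K B_finite[OF F] subset_refl supp_subset k(1), symmetric])
    finally show ?thesis using k by (simp add: orbit_vec_def)
  next
    case False
    then show ?thesis by (simp add: integrated_form_def reg_pi_def orbit_vec_def)
  qed
qed

text \<open>A supremum of reals is an upper bound only when the set is bounded; the l^1 estimate
  guarantees it.\<close>

lemma universal_norm_upper:
  fixes I :: "('g \<Rightarrow> 'x \<Rightarrow> complex) set"
  assumes "covariant_representation G CX \<alpha> I \<pi> u" and F: "F \<in> carrier B"
  shows "op_norm I (integrated_form G CX \<pi> u F) \<le> universal_norm G CX \<alpha> F"
  unfolding universal_norm_def
proof (rule cSup_upper)
  obtain K where K: "\<And>g x. cmod (F g x) \<le> K g" using reg.B_bounded[OF F] by blast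
  have K0: "0 \<le> (\<Sum>g\<in>supp F. K g)" using K norm_ge_zero order_trans by (intro sum_nonneg) blast
  show "bdd_above {op_norm I (integrated_form G CX \<pi> u F) |(I :: ('g \<Rightarrow> 'x \<Rightarrow> complex) set) \<pi> u.
      covariant_representation G CX \<alpha> I \<pi> u}"
  proof (rule bdd_aboveI)
    fix r assume "r \<in> {op_norm I (integrated_form G CX \<pi> u F) |(I :: ('g \<Rightarrow> 'x \<Rightarrow> complex) set) \<pi> u.
      covariant_representation G CX \<alpha> I \<pi> u}"
    then obtain I :: "('g \<Rightarrow> 'x \<Rightarrow> complex) set" and \<pi> u where
      r: "r = op_norm I (integrated_form G CX \<pi> u F)" "covariant_representation G CX \<alpha> I \<pi> u" by blast
    interpret covariant_rep G T act \<alpha> x0 I \<pi> u by unfold_locales (rule r(2))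
    show "r \<le> (\<Sum>g\<in>supp F. K g)"
      unfolding r(1) using K by (intro op_norm_le K0 R_norm_le F B_finite subset_refl supp_subset) auto
  qed
qed (use assms in blast)

lemma universal_norm_least:
  assumes "\<And>(I :: ('g \<Rightarrow> 'x \<Rightarrow> complex) set) \<pi> u.
    covariant_representation G CX \<alpha> I \<pi> u \<Longrightarrow> op_norm I (integrated_form G CX \<pi> u F) \<le> C"
  shows "universal_norm G CX \<alpha> F \<le> C"
  unfolding universal_norm_def
  by (rule cSup_least) (use assms reg_covariant in \<open>auto 0 3\<close>)

lemma universal_norm_nonneg: "F \<in> carrier B \<Longrightarrow> 0 \<le> universal_norm G CX \<alpha> F"
  using op_norm_bound(1)[OF reg.R_bounded_op] universal_norm_upper[OF reg_covariant] order_trans by blast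

lemma bnd_universal_norm:
  assumes F: "F \<in> carrier B"
  shows "B.bnd F (universal_norm G CX \<alpha> F)"
  unfolding B.bnd_def
proof
  fix K assume K: "K \<in> carrier B"
  have "B.nn (F \<otimes>\<^bsub>B\<^esub> K) = ell2_norm reg_set (reg.R F (orbit_vec K))"
    by (simp add: reg_R_orbit_vec[OF F K] orbit_vec_ell2(2)[OF mult_B_closed[OF F K]])
  also have "\<dots> \<le> op_norm reg_set (reg.R F) * ell2_norm reg_set (orbit_vec K)"
    by (rule op_norm_bound(2)[OF reg.R_bounded_op[OF F] orbit_vec_ell2(1)[OF K]])
  also have "\<dots> \<le> universal_norm G CX \<alpha> F * ell2_norm reg_set (orbit_vec K)"
    by (intro mult_right_mono universal_norm_upper reg_covariant F) simp
  finally show "B.nn (F \<otimes>\<^bsub>B\<^esub> K) \<le> universal_norm G CX \<alpha> F * B.nn K" by (simp add: orbit_vec_ell2(2)[OF K])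
qed

lemma universal_norm_le_l1:
  assumes F: "F \<in> carrier B" and S: "finite S" "supp F \<subseteq> S" "S \<subseteq> carrier G"
    and K: "\<And>g x. g \<in> S \<Longrightarrow> cmod (F g x) \<le> K g"
  shows "universal_norm G CX \<alpha> F \<le> (\<Sum>g\<in>S. K g)"
proof (rule universal_norm_least)
  fix I :: "('g \<Rightarrow> 'x \<Rightarrow> complex) set" and \<pi> u
  assume cov: "covariant_representation G CX \<alpha> I \<pi> u"
  interpret covariant_rep G T act \<alpha> x0 I \<pi> u by unfold_locales (rule cov)
  have "0 \<le> (\<Sum>g\<in>S. K g)" using K norm_ge_zero order_trans by (intro sum_nonneg) blast
  then show "op_norm I (R F) \<le> (\<Sum>g\<in>S. K g)" using K by (intro op_norm_le R_norm_le F S) auto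
qed

section \<open>Group unitaries and matrix coefficients\<close>

lemma unitX_in_CX: "(\<lambda>x. if x \<in> X then 1 else 0) \<in> carrier CX"
  by (rule reg.unitX_closed)

definition unitary :: "'g \<Rightarrow> 'g \<Rightarrow> 'x \<Rightarrow> complex" where
  "unitary g = single (\<lambda>x. if x \<in> X then 1 else 0) g"

lemma unitary_closed [simp]: "g \<in> carrier G \<Longrightarrow> unitary g \<in> carrier B"
  unfolding unitary_def by (rule single_closed[OF unitX_in_CX])

lemma single_unitary:
  assumes a: "a \<in> carrier CX" and g: "g \<in> carrier G" and h: "h \<in> carrier G"
  shows "single a g \<otimes>\<^bsub>B\<^esub> unitary h = single a (g \<otimes> h)"
proof -
  have "a \<otimes>\<^bsub>CX\<^esub> \<alpha> g (\<lambda>x. if x \<in> X then 1 else 0) = a" using a g by (auto simp: alpha fun_eq_iff)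
  then show ?thesis unfolding unitary_def by (simp only: single_mult[OF a unitX_in_CX g h])
qed

lemma unitary_single:
  assumes a: "a \<in> carrier CX" and g: "g \<in> carrier G" and h: "h \<in> carrier G"
  shows "unitary g \<otimes>\<^bsub>B\<^esub> single a h = single (\<alpha> g a) (g \<otimes> h)"
proof -
  have "(\<lambda>x. if x \<in> X then 1 else 0) \<otimes>\<^bsub>CX\<^esub> \<alpha> g a = \<alpha> g a" using a g by (auto simp: alpha fun_eq_iff)
  then show ?thesis unfolding unitary_def by (simp only: single_mult[OF unitX_in_CX a g h])
qed

lemma unitary_adj: "g \<in> carrier G \<Longrightarrow> adj B (unitary g) = unitary (inv g)"
  unfolding unitary_def by (subst single_adj[OF unitX_in_CX]) (auto simp: alpha single_def fun_eq_iff)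

lemma unitary_mult: "\<lbrakk>g \<in> carrier G; h \<in> carrier G\<rbrakk> \<Longrightarrow> unitary g \<otimes>\<^bsub>B\<^esub> unitary h = unitary (g \<otimes> h)"
  using single_unitary[OF unitX_in_CX, of g h] by (simp add: unitary_def)

lemma ip_unitary: "\<lbrakk>g \<in> carrier G; h \<in> carrier G\<rbrakk> \<Longrightarrow> B.ip (unitary g) (unitary h) = (if g = h then 1 else 0)"
proof -
  assume g: "g \<in> carrier G" and h: "h \<in> carrier G"
  have "\<one> = inv g \<otimes> h \<longleftrightarrow> g = h" using g h by (metis inv_equality inv_inv l_inv inv_closed)
  then show ?thesis
    using g h base by (simp add: B.ip_def unitary_adj unitary_mult) (simp add: unitary_def single_def state_def)
qed

lemma nn_unitary_sum:
  assumes P: "finite P" and f: "f ` P \<subseteq> carrier G" "inj_on f P"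
  shows "(B.nn (finsum B (\<lambda>t. \<xi> t \<odot>\<^bsub>B\<^esub> unitary (f t)) P))\<^sup>2 = (\<Sum>t\<in>P. (cmod (\<xi> t))\<^sup>2)"
proof -
  let ?x = "finsum B (\<lambda>t. \<xi> t \<odot>\<^bsub>B\<^esub> unitary (f t)) P"
  have fG: "t \<in> P \<Longrightarrow> f t \<in> carrier G" for t using f by blast
  have c: "t \<in> P \<Longrightarrow> \<xi> t \<odot>\<^bsub>B\<^esub> unitary (f t) \<in> carrier B" for t using fG by (intro B.smult_closed unitary_closed) auto
  have x: "?x \<in> carrier B" using c by (rule B.finsum_in)
  have "B.ip ?x ?x = (\<Sum>s\<in>P. B.ip (\<xi> s \<odot>\<^bsub>B\<^esub> unitary (f s)) ?x)" using P x c by (intro B.ip_finsum_left) auto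
  also have "\<dots> = (\<Sum>s\<in>P. \<Sum>t\<in>P. B.ip (\<xi> s \<odot>\<^bsub>B\<^esub> unitary (f s)) (\<xi> t \<odot>\<^bsub>B\<^esub> unitary (f t)))"
    using P c by (intro sum.cong refl B.ip_finsum_right) auto
  also have "\<dots> = (\<Sum>s\<in>P. \<Sum>t\<in>P. if s = t then cnj (\<xi> s) * \<xi> s else 0)"
  proof (intro sum.cong refl)
    fix s t assume st: "s \<in> P" "t \<in> P"
    then have "f s = f t \<longleftrightarrow> s = t" using f(2) by (auto dest: inj_onD)
    then show "B.ip (\<xi> s \<odot>\<^bsub>B\<^esub> unitary (f s)) (\<xi> t \<odot>\<^bsub>B\<^esub> unitary (f t)) = (if s = t then cnj (\<xi> s) * \<xi> s else 0)"
      using st fG c by (simp add: B.ip_smult_left B.ip_smult_right ip_unitary del: B_sel)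
  qed
  also have "\<dots> = (\<Sum>s\<in>P. cnj (\<xi> s) * \<xi> s)" using P by (simp add: sum.delta')
  finally have "(B.nn ?x)\<^sup>2 = Re (\<Sum>s\<in>P. cnj (\<xi> s) * \<xi> s)" by (simp only: B.nn_sq[OF x])
  also have "\<dots> = (\<Sum>t\<in>P. (cmod (\<xi> t))\<^sup>2)" by (simp add: cmod_def power2_eq_square)
  finally show ?thesis .
qed

text \<open>The matrix of F in the regular representation with respect to the orthonormal family of
  group elements.\<close>

definition kern :: "('g \<Rightarrow> 'x \<Rightarrow> complex) \<Rightarrow> 'g \<Rightarrow> 'g \<Rightarrow> complex" where
  "kern F g h = B.ip (unitary g) (F \<otimes>\<^bsub>B\<^esub> unitary h)"

lemma kern_eq:
  assumes F: "F \<in> carrier B" and g: "g \<in> carrier G" and h: "h \<in> carrier G"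
  shows "kern F g h = F (g \<otimes> inv h) (act g x0)"
proof -
  have s: "supp (unitary g) \<subseteq> {g}" unfolding unitary_def by (rule supp_single)
  have "kern F g h = cnj (unitary g g (act g x0)) * (F \<otimes>\<^bsub>B\<^esub> unitary h) g (act g x0)"
    unfolding kern_def B.ip_def
    using state_adj_mult[OF unitary_closed[OF g] mult_B_closed[OF F unitary_closed[OF h]] _ s] g by simp
  also have "\<dots> = (F \<otimes>\<^bsub>B\<^esub> unitary h) g (act g x0)" using g base by (simp add: unitary_def single_def)
  also have "\<dots> = (\<Sum>s\<in>insert (g \<otimes> inv h) (supp F). F s (act g x0) * unitary h (inv s \<otimes> g) (act (inv s) (act g x0)))"
    using F g h supp_subset by (intro mult_B unitary_closed) (auto intro: B_finite)
  also have "\<dots> = (\<Sum>s\<in>{g \<otimes> inv h}. F s (act g x0) * unitary h (inv s \<otimes> g) (act (inv s) (act g x0)))"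
  proof (rule sum.mono_neutral_right)
    show "\<forall>s\<in>insert (g \<otimes> inv h) (supp F) - {g \<otimes> inv h}. F s (act g x0) * unitary h (inv s \<otimes> g) (act (inv s) (act g x0)) = 0"
    proof
      fix s assume s: "s \<in> insert (g \<otimes> inv h) (supp F) - {g \<otimes> inv h}"
      then have sG: "s \<in> carrier G" using supp_subset by blast
      have "inv s \<otimes> g \<noteq> h"
      proof
        assume "inv s \<otimes> g = h"
        then have "g \<otimes> inv h = s" using sG g h by (metis inv_closed inv_inv inv_solve_left inv_solve_right')
        then show False using s by blast
      qed
      then show "F s (act g x0) * unitary h (inv s \<otimes> g) (act (inv s) (act g x0)) = 0"
        by (simp add: unitary_def single_def)
    qed
  qed (use F in \<open>auto intro: B_finite\<close>)
  also have "\<dots> = F (g \<otimes> inv h) (act g x0)"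
  proof -
    have "inv (g \<otimes> inv h) \<otimes> g = h" using g h by (simp add: inv_mult_group m_assoc)
    then show ?thesis using g h base by (simp add: unitary_def single_def)
  qed
  finally show ?thesis .
qed

text \<open>The kernel restricted to finitely many group elements is a compression of left
  multiplication by F, so Cauchy-Schwarz bounds its form by C times a product of norms. The product
  is relaxed to half the sum of squares, the shape that \<open>R_compression_le\<close>
  takes.\<close>

lemma kern_form_le:
  assumes F: "F \<in> carrier B" and bnd: "B.bnd F C" and C: "0 \<le> C"
    and P: "finite P" and f: "f ` P \<subseteq> carrier G" "inj_on f P"
  shows "cmod (\<Sum>s\<in>P. \<Sum>t\<in>P. kern F (f s) (f t) * \<xi> t * cnj (\<eta> s)) \<le>
    C / 2 * ((\<Sum>t\<in>P. (cmod (\<xi> t))\<^sup>2) + (\<Sum>s\<in>P. (cmod (\<eta> s))\<^sup>2))"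
proof -
  let ?x = "finsum B (\<lambda>t. \<xi> t \<odot>\<^bsub>B\<^esub> unitary (f t)) P" and ?y = "finsum B (\<lambda>t. \<eta> t \<odot>\<^bsub>B\<^esub> unitary (f t)) P"
  have fG: "t \<in> P \<Longrightarrow> f t \<in> carrier G" for t using f by blast
  have c: "t \<in> P \<Longrightarrow> z \<odot>\<^bsub>B\<^esub> unitary (f t) \<in> carrier B" for t z using fG by (intro B.smult_closed unitary_closed) auto
  have x: "?x \<in> carrier B" and y: "?y \<in> carrier B" using c by (auto intro!: B.finsum_in simp del: B_sel)
  have Fx: "F \<otimes>\<^bsub>B\<^esub> ?x = finsum B (\<lambda>t. F \<otimes>\<^bsub>B\<^esub> (\<xi> t \<odot>\<^bsub>B\<^esub> unitary (f t))) P"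
    using P F c by (intro B.finsum_rdistr) auto
  have Fc: "t \<in> P \<Longrightarrow> F \<otimes>\<^bsub>B\<^esub> (\<xi> t \<odot>\<^bsub>B\<^esub> unitary (f t)) \<in> carrier B" for t using F c by (intro B.m_closed) auto
  have "B.ip ?y (F \<otimes>\<^bsub>B\<^esub> ?x) = (\<Sum>s\<in>P. B.ip (\<eta> s \<odot>\<^bsub>B\<^esub> unitary (f s)) (F \<otimes>\<^bsub>B\<^esub> ?x))"
    using P c F x by (intro B.ip_finsum_left) auto
  also have "\<dots> = (\<Sum>s\<in>P. \<Sum>t\<in>P. B.ip (\<eta> s \<odot>\<^bsub>B\<^esub> unitary (f s)) (F \<otimes>\<^bsub>B\<^esub> (\<xi> t \<odot>\<^bsub>B\<^esub> unitary (f t))))"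
    unfolding Fx using P c Fc by (intro sum.cong refl B.ip_finsum_right) auto
  also have "\<dots> = (\<Sum>s\<in>P. \<Sum>t\<in>P. kern F (f s) (f t) * \<xi> t * cnj (\<eta> s))"
    using F fG by (intro sum.cong refl)
      (simp add: B.smult_mult_right B.ip_smult_left B.ip_smult_right kern_def del: B_sel)
  finally have eq: "B.ip ?y (F \<otimes>\<^bsub>B\<^esub> ?x) = (\<Sum>s\<in>P. \<Sum>t\<in>P. kern F (f s) (f t) * \<xi> t * cnj (\<eta> s))" .
  have "cmod (B.ip ?y (F \<otimes>\<^bsub>B\<^esub> ?x)) \<le> B.nn ?y * B.nn (F \<otimes>\<^bsub>B\<^esub> ?x)"
    using y F x by (intro B.cauchy_schwarz B.m_closed)
  also have "\<dots> \<le> B.nn ?y * (C * B.nn ?x)" using B.bndD[OF bnd x] y by (intro mult_left_mono) auto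
  also have "\<dots> \<le> C / 2 * ((B.nn ?x)\<^sup>2 + (B.nn ?y)\<^sup>2)"
  proof -
    have "0 \<le> C / 2 * (B.nn ?x - B.nn ?y)\<^sup>2" using C by simp
    then show ?thesis by (simp add: power2_eq_square field_simps)
  qed
  finally show ?thesis unfolding eq nn_unitary_sum[OF P f] .
qed

end

section \<open>Profinite completions and compressions\<close>

locale profinite_seq = group G for G :: "('g, 'm) monoid_scheme" (structure) +
  fixes L :: "nat \<Rightarrow> 'g set"
  assumes sep: "separating_nested_sequence G L"
begin

abbreviation "T \<equiv> profinite_topology G L"

abbreviation "PX \<equiv> topspace T"

section \<open>Cosets of the finite index subgroups\<close>

lemma normal_L: "L n \<lhd> G" and finite_rcosets: "finite (rcosets (L n))" and L_Suc: "L (Suc n) \<subseteq> L n"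
  and L_Inter: "(\<Inter>n. L n) = {\<one>}"
  using sep unfolding separating_nested_sequence_def finite_index_normal_def by blast+

lemma subgroup_L: "subgroup (L n) G"
  using normal_L by (rule normal_imp_subgroup)

lemma L_subset: "L n \<subseteq> carrier G"
  using subgroup_L by (rule subgroup.subset)

lemma L_antimono: "n \<le> m \<Longrightarrow> L m \<subseteq> L n"
  by (rule lift_Suc_antimono_le[of L]) (use L_Suc in auto)

lemma one_in_L: "\<one> \<in> L n"
  using subgroup_L by (rule subgroup.one_closed)

lemma rcos_eq_lcos: "g \<in> carrier G \<Longrightarrow> L n #> g = g <# L n"
  using normal.coset_eq[OF normal_L] by blast

lemma lcos_eq_iff:
  assumes g: "g \<in> carrier G" and h: "h \<in> carrier G"
  shows "g <# L n = h <# L n \<longleftrightarrow> inv g \<otimes> h \<in> L n"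
proof
  assume eq: "g <# L n = h <# L n"
  have "h \<in> h <# L n" using h one_in_L[of n] by (auto simp: l_coset_def intro!: bexI[of _ \<one>])
  then obtain l where l: "l \<in> L n" "h = g \<otimes> l" using eq by (auto simp: l_coset_def)
  then have "inv g \<otimes> h = l" using g L_subset[of n] by (auto simp: m_assoc[symmetric])
  then show "inv g \<otimes> h \<in> L n" using l by simp
next
  assume "inv g \<otimes> h \<in> L n"
  then have "h \<in> g <# L n" using g h by (auto simp: l_coset_def m_assoc[symmetric] intro!: bexI[of _ "inv g \<otimes> h"])
  then show "g <# L n = h <# L n" using g subgroup_L by (rule l_repr_independence)
qed

lemma lcos_lcos: "\<lbrakk>g \<in> carrier G; h \<in> carrier G\<rbrakk> \<Longrightarrow> g <# (h <# L n) = (g \<otimes> h) <# L n"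
  using L_subset by (rule lcos_m_assoc)

lemma lcos_mult_L:
  assumes "n \<le> m" and g: "g \<in> carrier G"
  shows "(g <# L m) <#> L n = g <# L n"
proof -
  have "g \<otimes> l \<otimes> k \<in> g <# L n" if "l \<in> L m" "k \<in> L n" for l k
  proof -
    have "l \<in> L n" using L_antimono[OF assms(1)] that by blast
    then have "l \<otimes> k \<in> L n" using that subgroup_L by (intro subgroup.m_closed)
    moreover have "g \<otimes> l \<otimes> k = g \<otimes> (l \<otimes> k)" using g \<open>l \<in> L n\<close> that L_subset by (intro m_assoc) auto
    ultimately show ?thesis by (auto simp: l_coset_def)
  qed
  moreover have "g \<otimes> k \<in> (g <# L m) <#> L n" if "k \<in> L n" for k
  proof -
    have "g \<otimes> \<one> \<in> g <# L m" using one_in_L by (auto simp: l_coset_def)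
    moreover have "g \<otimes> k = g \<otimes> \<one> \<otimes> k" using g by simp
    ultimately show ?thesis using that unfolding set_mult_def by blast
  qed
  ultimately show ?thesis by (auto simp: l_coset_def set_mult_def)
qed

lemma rcosets_lcos: "rcosets (L n) = (\<lambda>g. g <# L n) ` carrier G"
  using rcos_eq_lcos[of _ n] by (auto simp: RCOSETS_def)

section \<open>Points of the completion and left translation\<close>

lemma topspace_T: "topspace T = carrier (profinite_completion G L)"
  by (auto simp: profinite_topology_def profinite_completion_def)

lemma PX_iff: "x \<in> PX \<longleftrightarrow> (\<forall>n. x n \<in> rcosets (L n)) \<and> (\<forall>n m. n \<le> m \<longrightarrow> x m <#> L n = x n)"
  by (auto simp: topspace_T profinite_completion_def FactGroup_def)

lemma PX_rep:
  assumes "x \<in> PX"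
  obtains g where "g \<in> carrier G" "x n = g <# L n"
  using assms unfolding PX_iff rcosets_lcos by (metis image_iff)

lemma PX_coherent: "\<lbrakk>x \<in> PX; n \<le> m; g \<in> carrier G; x m = g <# L m\<rbrakk> \<Longrightarrow> x n = g <# L n"
  using lcos_mult_L[of n m g] unfolding PX_iff by metis

lemma PX_determined: "\<lbrakk>x \<in> PX; y \<in> PX; n \<le> m; x m = y m\<rbrakk> \<Longrightarrow> x n = y n"
  unfolding PX_iff by metis

definition act :: "'g \<Rightarrow> (nat \<Rightarrow> 'g set) \<Rightarrow> nat \<Rightarrow> 'g set" where
  "act g x = (\<lambda>n. g <# x n)"

abbreviation "x0 \<equiv> profinite_embedding G L \<one>"

lemma embedding_in_PX: "g \<in> carrier G \<Longrightarrow> profinite_embedding G L g \<in> PX"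
  unfolding PX_iff profinite_embedding_def rcosets_lcos using lcos_mult_L by auto

lemma act_x0: "g \<in> carrier G \<Longrightarrow> act g x0 n = g <# L n"
  by (simp add: act_def profinite_embedding_def lcos_lcos)

lemma act_rep: "\<lbrakk>g \<in> carrier G; h \<in> carrier G; x n = h <# L n\<rbrakk> \<Longrightarrow> act g x n = (g \<otimes> h) <# L n"
  by (simp add: act_def lcos_lcos)

lemma act_in_PX:
  assumes g: "g \<in> carrier G" and x: "x \<in> PX"
  shows "act g x \<in> PX"
  unfolding PX_iff
proof (intro conjI allI impI)
  fix n m :: nat
  show "act g x n \<in> rcosets (L n)"
  proof -
    obtain h where "h \<in> carrier G" "x n = h <# L n" using x by (rule PX_rep)
    then show ?thesis using g by (auto simp: act_rep rcosets_lcos)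
  qed
  assume nm: "n \<le> m"
  obtain h where h: "h \<in> carrier G" "x m = h <# L m" using x by (rule PX_rep)
  have "x n = h <# L n" using PX_coherent[OF x nm h] .
  then show "act g x m <#> L n = act g x n" using g h nm by (simp add: act_rep lcos_mult_L)
qed

lemma act_eq_mult:
  assumes g: "g \<in> carrier G" and x: "x \<in> PX"
  shows "profinite_embedding G L g \<otimes>\<^bsub>profinite_completion G L\<^esub> x = act g x"
proof
  fix n
  obtain h where h: "h \<in> carrier G" "x n = h <# L n" using x by (rule PX_rep)
  have "(profinite_embedding G L g \<otimes>\<^bsub>profinite_completion G L\<^esub> x) n = (g <# L n) <#> (h <# L n)"
    using h by (simp add: profinite_completion_def profinite_embedding_def)
  also have "\<dots> = (g \<otimes> h) <# L n"
    using normal.rcos_sum[OF normal_L g h(1), of n] g h(1) by (simp add: rcos_eq_lcos)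
  finally show "(profinite_embedding G L g \<otimes>\<^bsub>profinite_completion G L\<^esub> x) n = act g x n"
    using act_rep[of g h x n] g h by simp
qed

lemma continuous_coord: "continuous_map T (discrete_topology (rcosets (L n))) (\<lambda>x. x n)"
proof -
  have "continuous_map (product_topology (\<lambda>n. discrete_topology (carrier (G Mod L n))) UNIV)
      (discrete_topology (rcosets (L n))) (\<lambda>x. x n)"
    using continuous_map_product_projection[of n UNIV "\<lambda>n. discrete_topology (carrier (G Mod L n))"]
    by (simp add: FactGroup_def)
  then show ?thesis unfolding profinite_topology_def by (rule continuous_map_from_subtopology)
qed

text \<open>The product is compact by Tychonoff. Incoherence of a sequence is visible in two
  coordinates m and n, so the incoherent ones form a union of open cylinders and the completion is
  closed.\<close>

lemma compact_T: "compact_space T"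
proof -
  let ?P = "product_topology (\<lambda>n. discrete_topology (carrier (G Mod L n))) UNIV"
  have car: "carrier (G Mod L n) = rcosets (L n)" for n by (simp add: FactGroup_def)
  have "compact_space ?P"
    unfolding car using finite_rcosets
    by (intro compact_space_product_topology[THEN iffD2] disjI2) (auto simp: compact_space_discrete_topology)
  moreover have "closedin ?P (carrier (profinite_completion G L))"
  proof -
    have cyl: "openin ?P {x \<in> topspace ?P. x n = c}" for n c
    proof -
      have "openin ?P {x \<in> topspace ?P. x n \<in> {c} \<inter> carrier (G Mod L n)}"
        by (rule openin_continuous_map_preimage[OF continuous_map_product_projection]) auto
      moreover have "{x \<in> topspace ?P. x n \<in> {c} \<inter> carrier (G Mod L n)} = {x \<in> topspace ?P. x n = c}" by auto
      ultimately show ?thesis by simp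
    qed
    have "openin ?P (\<Union>n. \<Union>m\<in>{n..}. \<Union>c. \<Union>d\<in>{d. c <#> L n \<noteq> d}.
        {x \<in> topspace ?P. x m = c} \<inter> {x \<in> topspace ?P. x n = d})"
      by (intro openin_Union ballI) (auto intro!: openin_Int cyl[simplified] openin_Union)
    moreover have "topspace ?P - carrier (profinite_completion G L) = (\<Union>n. \<Union>m\<in>{n..}. \<Union>c. \<Union>d\<in>{d. c <#> L n \<noteq> d}.
        {x \<in> topspace ?P. x m = c} \<inter> {x \<in> topspace ?P. x n = d})"
      by (auto simp: profinite_completion_def)
    ultimately show ?thesis
      by (auto simp: closedin_def profinite_completion_def)
  qed
  ultimately show ?thesis
    unfolding profinite_topology_def by (intro compact_space_subtopology closedin_compact_space)
qed

lemma act_continuous: assumes g: "g \<in> carrier G" shows "continuous_map T T (act g)"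
proof -
  have "continuous_map T (product_topology (\<lambda>n. discrete_topology (carrier (G Mod L n))) UNIV) (act g)"
    unfolding continuous_map_componentwise_UNIV
  proof
    fix n
    have "continuous_map T (discrete_topology (carrier (G Mod L n))) ((\<lambda>c. g <# c) \<circ> (\<lambda>x. x n))"
    proof (rule continuous_map_compose[OF continuous_coord])
      show "continuous_map (discrete_topology (rcosets (L n))) (discrete_topology (carrier (G Mod L n))) (\<lambda>c. g <# c)"
        using g by (auto simp: FactGroup_def rcosets_lcos lcos_lcos)
    qed
    then show "continuous_map T (discrete_topology (carrier (G Mod L n))) (\<lambda>x. act g x n)"
      by (simp add: act_def o_def)
  qed
  moreover have "act g ` topspace T \<subseteq> carrier (profinite_completion G L)"
    using act_in_PX[OF g] unfolding topspace_T[symmetric] by auto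
  ultimately show ?thesis
    unfolding profinite_topology_def
    by (subst continuous_map_in_subtopology) (auto simp: profinite_topology_def)
qed

sublocale compact_dynsys G T act "translation_action G L" x0
proof (intro compact_dynsys.intro compact_dynsys_axioms.intro)
    show "compact_space T" by (rule compact_T)
    show "x0 \<in> PX" by (rule embedding_in_PX) simp
    show "act \<one> x = x" if x: "x \<in> PX" for x
    proof
      fix n
      obtain h where h: "h \<in> carrier G" "x n = h <# L n" using x by (rule PX_rep)
      then show "act \<one> x n = x n" using act_rep[of \<one> h x n] by simp
    qed
    show "act (g \<otimes> h) x = act g (act h x)" if g: "g \<in> carrier G" "h \<in> carrier G" and x: "x \<in> PX" for g h x
    proof
      fix n
      obtain k where k: "k \<in> carrier G" "x n = k <# L n" using x by (rule PX_rep)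
      then show "act (g \<otimes> h) x n = act g (act h x) n" using g by (simp add: act_def lcos_lcos m_assoc)
    qed
    show "translation_action G L g f = (\<lambda>x. if x \<in> PX then f (act (inv g) x) else 0)" if "g \<in> carrier G" for g f
      using that by (auto simp: translation_action_def act_eq_mult topspace_T[symmetric] fun_eq_iff)
  qed (use act_in_PX act_continuous in \<open>auto intro: is_group\<close>)

text \<open>The characteristic function of the closure of the coset g L n, which is open and
  closed.\<close>

definition cyl :: "nat \<Rightarrow> 'g \<Rightarrow> (nat \<Rightarrow> 'g set) \<Rightarrow> complex" where
  "cyl n g = (\<lambda>x. if x \<in> X \<and> x n = g <# L n then 1 else 0)"

lemma cyl_closed [simp]: "cyl n g \<in> carrier CX"
proof -
  have "continuous_map T euclidean ((\<lambda>c. if c = g <# L n then 1 else 0 :: complex) \<circ> (\<lambda>x. x n))"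
    by (rule continuous_map_compose[OF continuous_coord]) simp
  then have "continuous_map T euclidean (cyl n g)"
    by (rule continuous_map_eq) (simp add: cyl_def)
  then show ?thesis by (simp add: cyl_def)
qed

lemma alpha_cyl:
  assumes g: "g \<in> carrier G" and h: "h \<in> carrier G"
  shows "translation_action G L h (cyl n g) = cyl n (h \<otimes> g)"
proof
  fix x
  show "translation_action G L h (cyl n g) x = cyl n (h \<otimes> g) x"
  proof (cases "x \<in> X")
    case True
    then obtain k where k: "k \<in> carrier G" "x n = k <# L n" by (rule PX_rep)
    have "act (inv h) x n = g <# L n \<longleftrightarrow> x n = (h \<otimes> g) <# L n"
      using g h k by (simp add: act_rep lcos_eq_iff inv_mult_group m_assoc)
    then show ?thesis using True g h by (simp add: alpha cyl_def)
  qed (use h in \<open>simp add: alpha cyl_def\<close>)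
qed

definition transversal :: "nat \<Rightarrow> 'g set" where
  "transversal n = (\<lambda>c. SOME g. g \<in> carrier G \<and> g <# L n = c) ` (rcosets (L n))"

lemma transversal:
  shows transversal_finite [simp]: "finite (transversal n)"
    and transversal_subset: "transversal n \<subseteq> carrier G"
    and transversal_ex1: "g \<in> carrier G \<Longrightarrow> \<exists>!z. z \<in> transversal n \<and> g <# L n = z <# L n"
proof -
  let ?r = "\<lambda>c. SOME g. g \<in> carrier G \<and> g <# L n = c"
  have r: "?r c \<in> carrier G \<and> ?r c <# L n = c" if "c \<in> rcosets (L n)" for c
    using that unfolding rcosets_lcos by (intro someI_ex[of "\<lambda>g. g \<in> carrier G \<and> g <# L n = c"]) auto
  show "finite (transversal n)" using finite_rcosets by (simp add: transversal_def)
  show "transversal n \<subseteq> carrier G" using r by (auto simp: transversal_def)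
  assume "g \<in> carrier G"
  then have "g <# L n \<in> rcosets (L n)" by (auto simp: rcosets_lcos)
  then show "\<exists>!z. z \<in> transversal n \<and> g <# L n = z <# L n"
    using r by (intro ex1I[of _ "?r (g <# L n)"]) (auto simp: transversal_def)
qed

text \<open>Left translation by s permutes the cosets, so the products s z again form a transversal,
  and x lies over exactly one of them. The same z works for all coefficient functions f, so the
  lemma evaluates any sum of multiples of these characteristic functions at x.\<close>

lemma transversal_point:
  assumes s: "s \<in> carrier G" and x: "x \<in> X"
  shows "\<exists>z\<in>transversal n. x n = (s \<otimes> z) <# L n \<and>
    (\<forall>f :: 'g \<Rightarrow> complex. (\<Sum>z\<in>transversal n. f z * cyl n (s \<otimes> z) x) = f z)"
proof -
  obtain h where h: "h \<in> carrier G" "x n = h <# L n" using x by (rule PX_rep)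
  have iff: "x n = (s \<otimes> z) <# L n \<longleftrightarrow> (inv s \<otimes> h) <# L n = z <# L n" if "z \<in> carrier G" for z
    using h s that by (simp add: lcos_eq_iff inv_mult_group m_assoc)
  obtain z where z: "z \<in> transversal n" "(inv s \<otimes> h) <# L n = z <# L n"
    and uniq: "\<And>y. y \<in> transversal n \<Longrightarrow> (inv s \<otimes> h) <# L n = y <# L n \<Longrightarrow> y = z"
    using transversal_ex1[of "inv s \<otimes> h" n] s h by blast
  show ?thesis
  proof (intro bexI[OF _ z(1)] conjI allI)
    show "x n = (s \<otimes> z) <# L n" using iff z transversal_subset by blast
    fix f :: "'g \<Rightarrow> complex"
    have "(\<Sum>y\<in>transversal n. f y * cyl n (s \<otimes> y) x) = (\<Sum>y\<in>transversal n. if y = z then f y else 0)"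
    proof (rule sum.cong[OF refl])
      fix y assume y: "y \<in> transversal n"
      then have "x n = (s \<otimes> y) <# L n \<longleftrightarrow> y = z" using iff uniq z(2) transversal_subset by blast
      then show "f y * cyl n (s \<otimes> y) x = (if y = z then f y else 0)" using x by (simp add: cyl_def)
    qed
    then show "(\<Sum>y\<in>transversal n. f y * cyl n (s \<otimes> y) x) = f z" using z by (simp add: sum.delta)
  qed
qed

lemma cyl_partition: "x \<in> X \<Longrightarrow> (\<Sum>z\<in>transversal n. (cmod (cyl n z x))\<^sup>2) = 1"
proof -
  assume x: "x \<in> X"
  obtain z where f: "\<forall>f :: 'g \<Rightarrow> complex. (\<Sum>z\<in>transversal n. f z * cyl n (\<one> \<otimes> z) x) = f z"
    using transversal_point[OF one_closed x, of n] by blast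
  note z = f[rule_format, of "\<lambda>_. 1"]
  have "complex_of_real (\<Sum>z\<in>transversal n. (cmod (cyl n z x))\<^sup>2) = (\<Sum>z\<in>transversal n. 1 * cyl n (\<one> \<otimes> z) x)"
    using subsetD[OF transversal_subset[of n]] unfolding of_real_sum by (intro sum.cong refl) (auto simp: cyl_def)
  also have "\<dots> = of_real 1" using z by simp
  finally show ?thesis unfolding of_real_eq_iff .
qed

definition level :: "nat \<Rightarrow> ('g \<Rightarrow> (nat \<Rightarrow> 'g set) \<Rightarrow> complex) \<Rightarrow> bool" where
  "level n F \<longleftrightarrow> (\<forall>g. \<forall>x\<in>X. \<forall>y\<in>X. x n = y n \<longrightarrow> F g x = F g y)"

text \<open>Uniform continuity along the tower: near each x the function varies by less than e / 2
  on a basic set given by one coordinate k x, since agreement in a coordinate forces agreement in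
  all earlier ones. Finitely many basic sets cover, and N is the largest coordinate used.\<close>

lemma uniformly_locally_constant:
  assumes f: "f \<in> carrier CX" and e: "e > 0"
  shows "\<exists>N. \<forall>n\<ge>N. \<forall>x\<in>X. \<forall>y\<in>X. x n = y n \<longrightarrow> cmod (f x - f y) < e"
proof -
  let ?P = "product_topology (\<lambda>n. discrete_topology (carrier (G Mod L n))) UNIV"
  have "\<exists>n. \<forall>y\<in>X. y n = x n \<longrightarrow> cmod (f y - f x) < e / 2" if x: "x \<in> X" for x
  proof -
    define S where "S = {y \<in> topspace T. f y \<in> ball (f x) (e / 2)}"
    have "openin T S"
      unfolding S_def using f by (intro openin_continuous_map_preimage[of T euclidean]) auto
    then obtain U where U: "openin ?P U" "S = U \<inter> carrier (profinite_completion G L)"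
      unfolding profinite_topology_def openin_subtopology by blast
    have "x \<in> S" using x e by (simp add: S_def)
    then have "x \<in> U" using U(2) by blast
    then obtain V where V: "finite {i. V i \<noteq> carrier (G Mod L i)}" "x \<in> Pi\<^sub>E UNIV V" "Pi\<^sub>E UNIV V \<subseteq> U"
      using U(1) unfolding openin_product_topology_alt by auto
    then obtain n where n: "\<And>i. V i \<noteq> carrier (G Mod L i) \<Longrightarrow> i \<le> n"
      using finite_nat_set_iff_bounded_le by auto
    have "cmod (f y - f x) < e / 2" if y: "y \<in> X" "y n = x n" for y
    proof -
      have "y i \<in> V i" for i
      proof (cases "i \<le> n")
        case True
        then have "y i = x i" using PX_determined[OF y(1) x] y(2) by blast
        then show ?thesis using V(2) by auto
      next
        case False
        then have "V i = carrier (G Mod L i)" using n by blast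
        then show ?thesis using y(1) by (auto simp: topspace_T profinite_completion_def)
      qed
      then have "y \<in> U" using V(3) by auto
      then have "y \<in> S" using U(2) y(1) by (simp add: topspace_T)
      then show ?thesis by (simp add: S_def dist_norm norm_minus_commute)
    qed
    then show ?thesis by blast
  qed
  then obtain k where k: "\<And>x y. x \<in> X \<Longrightarrow> y \<in> X \<Longrightarrow> y (k x) = x (k x) \<Longrightarrow> cmod (f y - f x) < e / 2"
    by metis
  define U where "U = (\<lambda>x. {y \<in> X. y (k x) = x (k x)})"
  have openU: "openin T (U x)" if "x \<in> X" for x
  proof -
    have "openin T {y \<in> topspace T. y (k x) \<in> {x (k x)} \<inter> rcosets (L (k x))}"
      by (rule openin_continuous_map_preimage[OF continuous_coord]) auto
    moreover have "{y \<in> topspace T. y (k x) \<in> {x (k x)} \<inter> rcosets (L (k x))} = U x"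
      using that by (auto simp: U_def PX_iff)
    ultimately show ?thesis by simp
  qed
  have "compactin T X" using compact_T by (simp add: compact_space_def)
  moreover have "X \<subseteq> \<Union>(U ` X)" by (auto simp: U_def)
  moreover have "openin T V" if "V \<in> U ` X" for V using that openU by blast
  ultimately obtain \<F> where \<F>: "finite \<F>" "\<F> \<subseteq> U ` X" "X \<subseteq> \<Union>\<F>"
    using compactinD[of T X "U ` X"] by blast
  then obtain Y where Y: "Y \<subseteq> X" "finite Y" "\<F> = U ` Y"
    using finite_subset_image[OF \<F>(1,2)] by blast
  then have cover: "X \<subseteq> \<Union>(U ` Y)" using \<F>(3) by blast
  define N where "N = Max (insert 0 (k ` Y))"
  have N: "k y \<le> N" if "y \<in> Y" for y using Y that by (simp add: N_def)
  have "cmod (f x - f y) < e" if n: "n \<ge> N" and x: "x \<in> X" and y: "y \<in> X" and eq: "x n = y n" for n x y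
  proof -
    obtain z where z: "z \<in> Y" "x \<in> U z" using cover x by blast
    then have zX: "z \<in> X" and xz: "x (k z) = z (k z)" using Y by (auto simp: U_def)
    have "k z \<le> n" using N[OF z(1)] n by simp
    then have "y (k z) = z (k z)" using PX_determined[OF x y _ eq] xz by simp
    then have "cmod (f x - f z) < e / 2" "cmod (f y - f z) < e / 2" using k zX x y xz by auto
    then show ?thesis
      using norm_triangle_ineq4[of "f x - f z" "f y - f z"] by simp
  qed
  then show ?thesis by blast
qed

text \<open>Support and supremum bound are retained because the Foelner set and its \<eta> are
  chosen from them. A threshold N in place of a single level lets several elements be approximated
  at the same level.\<close>

lemma level_approximation:
  assumes F: "F \<in> carrier B" and e: "e > 0"
  shows "\<exists>N. \<forall>n\<ge>N. \<exists>H\<in>carrier B. level n H \<and> supp H \<subseteq> supp F \<and> (\<forall>g x. cmod (F g x - H g x) \<le> e) \<and>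
    (\<forall>K. (\<forall>g x. cmod (F g x) \<le> K) \<longrightarrow> (\<forall>g x. cmod (H g x) \<le> K))"
proof -
  have "\<exists>N. \<forall>n\<ge>N. \<forall>x\<in>X. \<forall>y\<in>X. x n = y n \<longrightarrow> cmod (F g x - F g y) < e" for g
    by (rule uniformly_locally_constant[OF B_coeff[OF F] e])
  then obtain N where N: "\<And>g n x y. n \<ge> N g \<Longrightarrow> x \<in> X \<Longrightarrow> y \<in> X \<Longrightarrow> x n = y n \<Longrightarrow> cmod (F g x - F g y) < e"
    by metis
  define M where "M = Max (insert 0 (N ` supp F))"
  have M: "N g \<le> M" if "g \<in> supp F" for g using B_finite[OF F] that by (simp add: M_def)
  have "\<exists>H\<in>carrier B. level n H \<and> supp H \<subseteq> supp F \<and> (\<forall>g x. cmod (F g x - H g x) \<le> e) \<and>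
    (\<forall>K. (\<forall>g x. cmod (F g x) \<le> K) \<longrightarrow> (\<forall>g x. cmod (H g x) \<le> K))" if n: "n \<ge> M" for n
  proof -
    \<comment> \<open>F is sampled at one orbit point in each coset, which enlarges neither the
      support nor the supremum.\<close>
    define H where "H = (\<lambda>g x. \<Sum>z\<in>transversal n. F g (act z x0) * cyl n z x)"
    have zG: "z \<in> transversal n \<Longrightarrow> z \<in> carrier G" for z using transversal_subset by blast
    have H0: "H g = (\<lambda>x. 0)" if "\<And>x. F g x = 0" for g using that by (simp add: H_def)
    have Hpt: "\<exists>p\<in>X. p n = x n \<and> (\<forall>g. H g x = F g p)" if x: "x \<in> X" for x
    proof -
      obtain z where z: "z \<in> transversal n" "x n = (\<one> \<otimes> z) <# L n"
        "\<forall>f :: 'g \<Rightarrow> complex. (\<Sum>z\<in>transversal n. f z * cyl n (\<one> \<otimes> z) x) = f z"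
        using transversal_point[OF one_closed x, of n] by blast
      have "H g x = F g (act z x0)" for g
        using z(3)[rule_format, of "\<lambda>z. F g (act z x0)"] zG by (simp add: H_def)
      moreover have "act z x0 \<in> X" using zG[OF z(1)] by (intro act_in_PX embedding_in_PX) auto
      moreover have "act z x0 n = x n" using z zG by (simp add: act_x0)
      ultimately show ?thesis by blast
    qed
    have Hout: "H g x = 0" if "x \<notin> X" for g x using that by (simp add: H_def cyl_def)
    have Hc: "H \<in> carrier B"
    proof (rule B_closedI[OF _ _ B_finite[OF F]])
      show "H g \<in> carrier CX" for g
        unfolding H_def using cyl_closed[of n]
        by (intro reg.sum_closed) (auto intro!: continuous_map_complex_mult)
      show "H g = (\<lambda>x. 0)" if "g \<notin> carrier G" for g by (rule H0) (rule B_outside[OF F that])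
      show "H g = (\<lambda>x. 0)" if "g \<in> carrier G" "g \<notin> supp F" for g by (rule H0) (rule not_supp[OF that])
    qed
    have "level n H"
      unfolding level_def
    proof (intro allI ballI impI)
      fix g x y assume "x \<in> X" "y \<in> X" "x n = y n"
      then have "cyl n z x = cyl n z y" for z by (simp add: cyl_def)
      then show "H g x = H g y" by (simp add: H_def)
    qed
    moreover have sub: "supp H \<subseteq> supp F"
      using H0 not_supp[of _ F] by (auto simp: supp_eq)
    moreover have "cmod (F g x - H g x) \<le> e" for g x
    proof (cases "x \<in> X \<and> g \<in> supp F")
      case True
      then obtain p where p: "p \<in> X" "p n = x n" "H g x = F g p" using Hpt by metis
      have "N g \<le> n" using M[of g] True n by simp
      then show ?thesis using N[of g n x p] True p by (simp add: less_imp_le)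
    next
      case False
      then have "F g x = 0" using B_outside[OF F] B_outside_X[OF F] not_supp by blast
      moreover have "H g x = 0"
      proof (cases "x \<in> X")
        case x: True
        then have "g \<notin> supp H" using False sub by blast
        then show ?thesis using B_outside[OF Hc] not_supp by blast
      qed (rule Hout)
      ultimately show ?thesis using e by simp
    qed
    moreover have "cmod (H g x) \<le> K" if K: "\<forall>g x. cmod (F g x) \<le> K" for K g x
    proof (cases "x \<in> X")
      case True
      then obtain p where "H g x = F g p" using Hpt by metis
      then show ?thesis using K by simp
    next
      case False
      then show ?thesis using Hout[OF False] K norm_ge_zero order_trans by (metis norm_zero)
    qed
    ultimately show ?thesis using Hc by blast
  qed
  then show ?thesis by blast
qed

text \<open>Compressing to the matrix blocks indexed by \<open>P z\<close>, \<open>z\<close> in a transversal of \<open>L\<^sub>n\<close>, and averaging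
  back; on functions of level \<open>n\<close> this is the Fourier multiplier \<open>g \<mapsto> |P \<inter> g P| / |P|\<close>.\<close>

definition compress :: "nat \<Rightarrow> 'g set \<Rightarrow> ('g \<Rightarrow> 'g \<Rightarrow> complex) \<Rightarrow> 'g \<Rightarrow> (nat \<Rightarrow> 'g set) \<Rightarrow> complex" where
  "compress n P M = finsum B (\<lambda>(z, s, t). (M (s \<otimes> z) (t \<otimes> z) / of_nat (card P)) \<odot>\<^bsub>B\<^esub>
     single (cyl n (s \<otimes> z)) (s \<otimes> inv t)) (transversal n \<times> P \<times> P)"

lemma compress_summand_closed:
  "P \<subseteq> carrier G \<Longrightarrow> p \<in> transversal n \<times> P \<times> P \<Longrightarrow>
    (case p of (z, s, t) \<Rightarrow> (M (s \<otimes> z) (t \<otimes> z) / of_nat (card P)) \<odot>\<^bsub>B\<^esub> single (cyl n (s \<otimes> z)) (s \<otimes> inv t)) \<in> carrier B"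
  by (auto intro!: smult_B_closed single_closed cyl_closed simp del: B_sel CX_sel)

lemma compress_closed: "P \<subseteq> carrier G \<Longrightarrow> compress n P M \<in> carrier B"
  unfolding compress_def by (rule B.finsum_in) (rule compress_summand_closed)

lemma compress_apply:
  assumes P: "finite P" "P \<subseteq> carrier G" and g: "g \<in> carrier G"
  shows "compress n P M g x = (\<Sum>s\<in>P. \<Sum>t\<in>P. if t = inv g \<otimes> s then
    \<Sum>z\<in>transversal n. M (s \<otimes> z) (t \<otimes> z) / of_nat (card P) * cyl n (s \<otimes> z) x else 0)"
proof -
  have "compress n P M g x = (\<Sum>p\<in>transversal n \<times> P \<times> P. (case p of (z, s, t) \<Rightarrow>
      (M (s \<otimes> z) (t \<otimes> z) / of_nat (card P)) \<odot>\<^bsub>B\<^esub> single (cyl n (s \<otimes> z)) (s \<otimes> inv t)) g x)"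
    unfolding compress_def
    by (subst finsum_B) (intro finite_cartesian_product transversal_finite P(1) compress_summand_closed[OF P(2)] refl; assumption)+
  also have "\<dots> = (\<Sum>z\<in>transversal n. \<Sum>s\<in>P. \<Sum>t\<in>P. if t = inv g \<otimes> s then
      M (s \<otimes> z) (t \<otimes> z) / of_nat (card P) * cyl n (s \<otimes> z) x else 0)"
    unfolding sum.cartesian_product
  proof (intro sum.cong refl)
    fix p assume "p \<in> transversal n \<times> P \<times> P"
    then obtain z s t where p: "p = (z, s, t)" "s \<in> carrier G" "t \<in> carrier G" using P by auto
    have "g = s \<otimes> inv t \<longleftrightarrow> t = inv g \<otimes> s" using p g by (metis inv_closed inv_inv inv_solve_left inv_solve_right m_closed)
    then show "(case p of (z, s, t) \<Rightarrow>
        (M (s \<otimes> z) (t \<otimes> z) / of_nat (card P)) \<odot>\<^bsub>B\<^esub> single (cyl n (s \<otimes> z)) (s \<otimes> inv t)) g x =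
        (case p of (z, s, t) \<Rightarrow> if t = inv g \<otimes> s then M (s \<otimes> z) (t \<otimes> z) / of_nat (card P) * cyl n (s \<otimes> z) x else 0)"
      unfolding p(1) by (auto simp: single_def)
  qed
  also have "\<dots> = (\<Sum>s\<in>P. \<Sum>z\<in>transversal n. \<Sum>t\<in>P. if t = inv g \<otimes> s then
      M (s \<otimes> z) (t \<otimes> z) / of_nat (card P) * cyl n (s \<otimes> z) x else 0)" by (rule sum.swap)
  also have "\<dots> = (\<Sum>s\<in>P. \<Sum>t\<in>P. \<Sum>z\<in>transversal n. if t = inv g \<otimes> s then
      M (s \<otimes> z) (t \<otimes> z) / of_nat (card P) * cyl n (s \<otimes> z) x else 0)"
    by (intro sum.cong refl sum.swap)
  also have "\<dots> = (\<Sum>s\<in>P. \<Sum>t\<in>P. if t = inv g \<otimes> s then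
      \<Sum>z\<in>transversal n. M (s \<otimes> z) (t \<otimes> z) / of_nat (card P) * cyl n (s \<otimes> z) x else 0)"
    by (intro sum.cong refl) auto
  finally show ?thesis .
qed

text \<open>The entry at (s z, t z) with s t^(-1) = g is the value of F g at the orbit point of s z.
  For the z selected by x this point agrees with x in coordinate n, so level n gives F g x. It
  remains to count the s in P with g^(-1) s in P, that is, the points of P \<inter> g P.\<close>

lemma compress_kern:
  assumes F: "F \<in> carrier B" and lev: "level n F" and P: "finite P" "P \<noteq> {}" "P \<subseteq> carrier G"
    and g: "g \<in> carrier G" and x: "x \<in> X"
  shows "compress n P (kern F) g x = of_real (real (card (P \<inter> (\<lambda>y. g \<otimes> y) ` P)) / real (card P)) * F g x"
proof -
  have PG: "s \<in> P \<Longrightarrow> s \<in> carrier G" for s using P by blast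
  have inner: "(\<Sum>z\<in>transversal n. kern F (s \<otimes> z) (t \<otimes> z) / of_nat (card P) * cyl n (s \<otimes> z) x) = F g x / of_nat (card P)"
    if s: "s \<in> P" and t: "t = inv g \<otimes> s" "t \<in> P" for s t
  proof -
    obtain z where z: "z \<in> transversal n" "x n = (s \<otimes> z) <# L n"
      "\<forall>f :: 'g \<Rightarrow> complex. (\<Sum>z\<in>transversal n. f z * cyl n (s \<otimes> z) x) = f z"
      using transversal_point[OF PG[OF s] x, of n] by blast
    have zG: "z \<in> carrier G" using z(1) transversal_subset by blast
    have "(s \<otimes> z) \<otimes> inv (t \<otimes> z) = g"
    proof -
      have "z \<otimes> (inv z \<otimes> inv t) = inv t" using zG PG[OF t(2)] by (simp add: m_assoc[symmetric])
      then have "(s \<otimes> z) \<otimes> inv (t \<otimes> z) = s \<otimes> inv t"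
        using zG PG[OF s] PG[OF t(2)] by (simp add: inv_mult_group m_assoc)
      also have "\<dots> = g" unfolding t(1) using PG[OF s] g by (simp add: inv_mult_group m_assoc[symmetric])
      finally show ?thesis .
    qed
    then have "kern F (s \<otimes> z) (t \<otimes> z) = F g (act (s \<otimes> z) x0)"
      using kern_eq[OF F, of "s \<otimes> z" "t \<otimes> z"] zG PG s t by simp
    also have "\<dots> = F g x"
    proof -
      have "s \<otimes> z \<in> carrier G" using zG PG[OF s] by simp
      then have "act (s \<otimes> z) x0 \<in> X" "act (s \<otimes> z) x0 n = x n"
        using z(2) by (auto intro!: act_in_PX embedding_in_PX simp: act_x0)
      then show ?thesis using lev x unfolding level_def by blast
    qed
    finally show ?thesis using z(3)[rule_format, of "\<lambda>z. kern F (s \<otimes> z) (t \<otimes> z) / of_nat (card P)"] by simp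
  qed
  have "compress n P (kern F) g x = (\<Sum>s\<in>P. \<Sum>t\<in>P. if t = inv g \<otimes> s then F g x / of_nat (card P) else 0)"
    unfolding compress_apply[OF P(1,3) g] using inner by (intro sum.cong refl) auto
  also have "\<dots> = (\<Sum>s\<in>P. if inv g \<otimes> s \<in> P then F g x / of_nat (card P) else 0)"
    using P by (intro sum.cong refl) (simp add: sum.delta)
  also have "\<dots> = of_nat (card {s \<in> P. inv g \<otimes> s \<in> P}) * (F g x / of_nat (card P))"
    using P by (simp add: sum.If_cases Collect_conj_eq Int_commute)
  also have "{s \<in> P. inv g \<otimes> s \<in> P} = P \<inter> (\<lambda>y. g \<otimes> y) ` P"
  proof (intro equalityI subsetI)
    fix s assume "s \<in> {s \<in> P. inv g \<otimes> s \<in> P}"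
    then have "s \<in> P" "inv g \<otimes> s \<in> P" by auto
    moreover have "s = g \<otimes> (inv g \<otimes> s)" using g PG[OF \<open>s \<in> P\<close>] by (simp add: m_assoc[symmetric])
    ultimately show "s \<in> P \<inter> (\<lambda>y. g \<otimes> y) ` P" by blast
  next
    fix s assume "s \<in> P \<inter> (\<lambda>y. g \<otimes> y) ` P"
    then obtain y where "s \<in> P" "y \<in> P" "s = g \<otimes> y" by blast
    then show "s \<in> {s \<in> P. inv g \<otimes> s \<in> P}" using g PG by (simp add: m_assoc[symmetric])
  qed
  finally show ?thesis by (simp add: field_simps)
qed

text \<open>The difference is the multiplier 1 - |P \<inter> g P| / |P|, which lies between 0 and
  \<eta> on S, and nothing lives outside S; the l^1 estimate finishes.\<close>

lemma compress_kern_diff: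
  assumes F: "F \<in> carrier B" and lev: "level n F" and P: "finite P" "P \<noteq> {}" "P \<subseteq> carrier G"
    and S: "finite S" "supp F \<subseteq> S" "S \<subseteq> carrier G"
    and folner: "\<And>g. g \<in> S \<Longrightarrow> (1 - \<eta>) * real (card P) \<le> real (card (P \<inter> (\<lambda>y. g \<otimes> y) ` P))"
    and K: "\<And>g x. cmod (F g x) \<le> K" and eta: "0 \<le> \<eta>"
  shows "universal_norm G CX (translation_action G L) (F \<ominus>\<^bsub>B\<^esub> compress n P (kern F)) \<le> real (card S) * (\<eta> * K)"
proof -
  let ?C = "compress n P (kern F)" and ?D = "F \<ominus>\<^bsub>B\<^esub> compress n P (kern F)"
  have C: "?C \<in> carrier B" using P by (intro compress_closed)
  have D: "?D \<in> carrier B" using F C by (rule B.minus_closed)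
  have K0: "0 \<le> K" using K[of undefined undefined] norm_ge_zero order_trans by blast
  have cP: "real (card P) > 0" using P by (simp add: card_gt_0_iff)
  have Dapp: "?D g x = of_real (1 - real (card (P \<inter> (\<lambda>y. g \<otimes> y) ` P)) / real (card P)) * F g x"
    if "g \<in> carrier G" "x \<in> X" for g x
    using compress_kern[OF F lev P that] B.minus_eq_smult[OF F C] by (simp add: algebra_simps)
  have "supp ?D \<subseteq> S"
  proof
    fix g assume g: "g \<in> supp ?D"
    then have gG: "g \<in> carrier G" using supp_subset by blast
    obtain x where x: "?D g x \<noteq> 0" using g by (auto simp: supp_eq fun_eq_iff)
    then have "x \<in> X" using B_outside_X[OF D] by blast
    then have "F g x \<noteq> 0" using x Dapp[OF gG] by auto
    then show "g \<in> S" using gG S(2) by (auto simp: supp_eq)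
  qed
  then have "universal_norm G CX (translation_action G L) ?D \<le> (\<Sum>g\<in>S. \<eta> * K)"
  proof (rule universal_norm_le_l1[OF D S(1) _ S(3)])
    fix g x assume g: "g \<in> S"
    then have gG: "g \<in> carrier G" using S by blast
    show "cmod (?D g x) \<le> \<eta> * K"
    proof (cases "x \<in> X")
      case True
      have "card (P \<inter> (\<lambda>y. g \<otimes> y) ` P) \<le> card P" using P by (intro card_mono) auto
      then have "\<bar>1 - real (card (P \<inter> (\<lambda>y. g \<otimes> y) ` P)) / real (card P)\<bar> \<le> \<eta>"
        using folner[OF g] cP by (simp add: field_simps abs_le_iff)
      then show ?thesis
        unfolding Dapp[OF gG True] norm_mult norm_of_real using K eta by (intro mult_mono) auto
    next
      case False
      then show ?thesis using B_outside_X[OF D False] K0 eta by simp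
    qed
  qed
  then show ?thesis by simp
qed

end

section \<open>The generalized Bunce--Deddens algebra\<close>

context compact_dynsys
begin

lemma B_uniform_bound:
  assumes F: "F \<in> carrier B"
  shows "\<exists>K\<ge>0. \<forall>g x. cmod (F g x) \<le> K"
proof -
  obtain K where K: "\<And>g x. cmod (F g x) \<le> K g" using reg.B_bounded[OF F] by blast
  have K0: "0 \<le> K g" for g using K[of g undefined] norm_ge_zero order_trans by blast
  have "cmod (F g x) \<le> (\<Sum>g\<in>supp F. K g)" for g x
  proof (cases "g \<in> supp F")
    case True
    have "K g \<le> (\<Sum>g\<in>supp F. K g)" using True K0 B_finite[OF F] by (intro member_le_sum) auto
    then show ?thesis using K order_trans by blast
  next
    case False
    then have "F g x = 0" using B_outside[OF F] not_supp by blast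
    then show ?thesis using K0 by (simp add: sum_nonneg)
  qed
  then show ?thesis using K0 by (intro exI[of _ "\<Sum>g\<in>supp F. K g"]) (auto intro: sum_nonneg)
qed

text \<open>Proved directly from the representations: the norm calculus of \<open>gns_alg\<close>
  becomes available only after the comparison of norms that uses this inequality.\<close>

lemma universal_norm_add:
  assumes F: "F \<in> carrier B" and H: "H \<in> carrier B"
  shows "universal_norm G CX \<alpha> (F \<oplus>\<^bsub>B\<^esub> H) \<le> universal_norm G CX \<alpha> F + universal_norm G CX \<alpha> H"
proof (rule universal_norm_least)
  fix I :: "('g \<Rightarrow> 'x \<Rightarrow> complex) set" and \<pi> u
  assume cov: "covariant_representation G CX \<alpha> I \<pi> u"
  interpret covariant_rep G T act \<alpha> x0 I \<pi> u by unfold_locales (rule cov)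
  show "op_norm I (R (F \<oplus>\<^bsub>B\<^esub> H)) \<le> universal_norm G CX \<alpha> F + universal_norm G CX \<alpha> H"
  proof (rule op_norm_le)
    show "0 \<le> universal_norm G CX \<alpha> F + universal_norm G CX \<alpha> H" using F H by (simp add: universal_norm_nonneg)
    fix v assume v: "v \<in> ell2 I"
    have le: "ell2_norm I (R K v) \<le> universal_norm G CX \<alpha> K * ell2_norm I v" if K: "K \<in> carrier B" for K
      using op_norm_bound(2)[OF R_bounded_op[OF K] v] universal_norm_upper[OF cov K]
      by (meson ell2_norm_nonneg mult_right_mono order_trans)
    have "ell2_norm I (R (F \<oplus>\<^bsub>B\<^esub> H) v) \<le> ell2_norm I (R F v) + ell2_norm I (R H v)"
      unfolding R_add[OF F H v] by (intro ell2_norm_add R_closed F H v)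
    also have "\<dots> \<le> (universal_norm G CX \<alpha> F + universal_norm G CX \<alpha> H) * ell2_norm I v"
      using le[OF F] le[OF H] by (simp add: distrib_right)
    finally show "ell2_norm I (R (F \<oplus>\<^bsub>B\<^esub> H) v) \<le> (universal_norm G CX \<alpha> F + universal_norm G CX \<alpha> H) * ell2_norm I v" .
  qed
qed

lemma universal_norm_diff_le:
  assumes F: "F \<in> carrier B" and H: "H \<in> carrier B" and S: "finite S" "S \<subseteq> carrier G" "supp F \<subseteq> S" "supp H \<subseteq> S"
    and le: "\<And>g x. cmod (F g x - H g x) \<le> d"
  shows "universal_norm G CX \<alpha> (F \<ominus>\<^bsub>B\<^esub> H) \<le> real (card S) * d"
proof -
  have app: "(F \<ominus>\<^bsub>B\<^esub> H) g x = F g x - H g x" for g x by (simp add: B.minus_eq_smult[OF F H])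
  have "supp (F \<ominus>\<^bsub>B\<^esub> H) \<subseteq> S"
  proof
    fix g assume g: "g \<in> supp (F \<ominus>\<^bsub>B\<^esub> H)"
    then have gG: "g \<in> carrier G" using supp_subset by blast
    show "g \<in> S"
    proof (rule ccontr)
      assume "g \<notin> S"
      then have "g \<notin> supp F" "g \<notin> supp H" using S by blast+
      then have "F g x - H g x = 0" for x by (simp add: not_supp[OF gG])
      then have "(F \<ominus>\<^bsub>B\<^esub> H) g = (\<lambda>x. 0)" by (simp only: app fun_eq_iff) simp
      then show False using g by (auto simp: supp_eq)
    qed
  qed
  then have "universal_norm G CX \<alpha> (F \<ominus>\<^bsub>B\<^esub> H) \<le> (\<Sum>g\<in>S. d)"
    using le S by (intro universal_norm_le_l1 B.minus_closed F H) (auto simp only: app)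
  then show ?thesis by simp
qed

lemma kern_one: "\<lbrakk>g \<in> carrier G; h \<in> carrier G\<rbrakk> \<Longrightarrow> kern \<one>\<^bsub>B\<^esub> g h = (if g = h then 1 else 0)"
  unfolding kern_def by (simp only: B.l_one unitary_closed ip_unitary)

end

context profinite_seq
begin

text \<open>Only the entries at products s z enter, so a matrix may be truncated to these before
  averaging.\<close>

lemma compress_cong:
  assumes "finite P" "P \<subseteq> carrier G"
    and "\<And>z s t. z \<in> transversal n \<Longrightarrow> s \<in> P \<Longrightarrow> t \<in> P \<Longrightarrow> M (s \<otimes> z) (t \<otimes> z) = M' (s \<otimes> z) (t \<otimes> z)"
  shows "compress n P M = compress n P M'"
  unfolding compress_def
proof (rule B.finsum_cong'[OF refl])
  show "(\<lambda>(z, s, t). (M' (s \<otimes> z) (t \<otimes> z) / of_nat (card P)) \<odot>\<^bsub>B\<^esub> single (cyl n (s \<otimes> z)) (s \<otimes> inv t))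
      \<in> transversal n \<times> P \<times> P \<rightarrow> carrier B"
    by (rule Pi_I) (rule compress_summand_closed[OF assms(2)])
  fix p assume "p \<in> transversal n \<times> P \<times> P"
  then obtain z s t where p: "p = (z, s, t)" "z \<in> transversal n" "s \<in> P" "t \<in> P" by auto
  show "(case p of (z, s, t) \<Rightarrow> (M (s \<otimes> z) (t \<otimes> z) / of_nat (card P)) \<odot>\<^bsub>B\<^esub> single (cyl n (s \<otimes> z)) (s \<otimes> inv t)) =
      (case p of (z, s, t) \<Rightarrow> (M' (s \<otimes> z) (t \<otimes> z) / of_nat (card P)) \<odot>\<^bsub>B\<^esub> single (cyl n (s \<otimes> z)) (s \<otimes> inv t))"
    unfolding p(1) prod.case assms(3)[OF p(2-4)] ..
qed

text \<open>At the identity of G the multiplier is |P| / |P|.\<close>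

lemma compress_kern_one:
  assumes P: "finite P" "P \<noteq> {}" "P \<subseteq> carrier G"
  shows "compress n P (kern \<one>\<^bsub>B\<^esub>) = \<one>\<^bsub>B\<^esub>"
proof (rule B_eqI[OF compress_closed[OF P(3)] one_B_closed])
  fix g x assume g: "g \<in> carrier G" and x: "x \<in> X"
  have lev: "level n \<one>\<^bsub>B\<^esub>" by (simp add: level_def)
  have "(\<lambda>y. \<one> \<otimes> y) ` P = P" using subsetD[OF P(3)] by (auto simp: image_iff)
  then show "compress n P (kern \<one>\<^bsub>B\<^esub>) g x = \<one>\<^bsub>B\<^esub> g x"
    unfolding compress_kern[OF one_B_closed lev P g x] using P by (auto simp: card_gt_0_iff)
qed

text \<open>The characteristic functions are self-adjoint idempotents, so the coefficient at s z is
  the translate by s of |cyl n z|^2 and the sum has the shape treated by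
  \<open>R_compression_le\<close>. The required bound for each z is \<open>kern_form_le\<close> for
  the injection t \<mapsto> t z.\<close>

lemma universal_norm_compress_le:
  assumes H: "H \<in> carrier B" and bnd: "B.bnd H C" and C: "0 \<le> C"
    and P: "finite P" "P \<noteq> {}" "P \<subseteq> carrier G"
  shows "universal_norm G CX (translation_action G L) (compress n P (kern H)) \<le> C"
proof (rule universal_norm_least)
  fix I :: "('g \<Rightarrow> (nat \<Rightarrow> 'g set) \<Rightarrow> complex) set" and \<pi> u
  assume cov: "covariant_representation G CX (translation_action G L) I \<pi> u"
  interpret rep: covariant_rep G T act "translation_action G L" x0 I \<pi> u by unfold_locales (rule cov)
  have PG: "s \<in> P \<Longrightarrow> s \<in> carrier G" for s using P by blast
  have zG: "z \<in> transversal n \<Longrightarrow> z \<in> carrier G" for z using transversal_subset by blast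
  have eq: "compress n P (kern H) = finsum B (\<lambda>(z, s, t). (kern H (s \<otimes> z) (t \<otimes> z) / of_nat (card P)) \<odot>\<^bsub>B\<^esub>
    single (translation_action G L s (\<lambda>x. cnj (cyl n z x) * cyl n z x)) (s \<otimes> inv t)) (transversal n \<times> P \<times> P)"
    (is "_ = finsum B ?f _")
  proof -
    have cc: "(\<lambda>x. cnj (cyl n z x) * cyl n z x) = cyl n z" for z by (auto simp: cyl_def)
    have f: "?f p = (case p of (z, s, t) \<Rightarrow> (kern H (s \<otimes> z) (t \<otimes> z) / of_nat (card P)) \<odot>\<^bsub>B\<^esub>
        single (cyl n (s \<otimes> z)) (s \<otimes> inv t))" if pP: "p \<in> transversal n \<times> P \<times> P" for p
    proof -
      obtain z s t where p: "p = (z, s, t)" "z \<in> transversal n" "s \<in> P" using pP by (cases p) auto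
      show ?thesis unfolding p(1) prod.case cc alpha_cyl[OF zG[OF p(2)] PG[OF p(3)]] ..
    qed
    show ?thesis
      unfolding compress_def
    proof (rule B.finsum_cong'[OF refl _ f[symmetric]])
      show "?f \<in> transversal n \<times> P \<times> P \<rightarrow> carrier B"
      proof (rule Pi_I)
        fix p assume p: "p \<in> transversal n \<times> P \<times> P"
        show "?f p \<in> carrier B" unfolding f[OF p] by (rule compress_summand_closed[OF P(3) p])
      qed
    qed
  qed
  show "op_norm I (rep.R (compress n P (kern H))) \<le> C"
  proof (rule op_norm_le[OF C])
    fix v assume v: "v \<in> ell2 I"
    show "ell2_norm I (rep.R (compress n P (kern H)) v) \<le> C * ell2_norm I v"
      unfolding eq
    proof (rule rep.R_compression_le[OF transversal_finite P cyl_closed cyl_partition _ C v])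
      fix z and \<xi> \<eta> :: "'g \<Rightarrow> complex" assume z: "z \<in> transversal n"
      have "inj_on (\<lambda>t. t \<otimes> z) P" "(\<lambda>t. t \<otimes> z) ` P \<subseteq> carrier G"
        using zG[OF z] PG by (auto simp: inj_on_def)
      then show "cmod (\<Sum>s\<in>P. \<Sum>t\<in>P. kern H (s \<otimes> z) (t \<otimes> z) * \<xi> t * cnj (\<eta> s)) \<le>
          C / 2 * ((\<Sum>t\<in>P. (cmod (\<xi> t))\<^sup>2) + (\<Sum>s\<in>P. (cmod (\<eta> s))\<^sup>2))"
        by (intro kern_form_le H bnd C P(1))
    qed
  qed
qed

end

locale amenable_profinite_seq = profinite_seq +
  assumes amen: "amenable G"
begin

lemma foelner:
  "\<lbrakk>finite S; S \<subseteq> carrier G; \<eta> > 0\<rbrakk> \<Longrightarrow> \<exists>P. finite P \<and> P \<noteq> {} \<and> P \<subseteq> carrier G \<and>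
    (\<forall>g\<in>S. (1 - \<eta>) * real (card P) \<le> real (card (P \<inter> (\<lambda>y. g \<otimes> y) ` P)))"
  by (rule amenable_imp_foelner[OF is_group amen])

text \<open>Three errors of e / 3: from F to a nearby H of level n, from H to its compression, and
  in the bound of H, which is only C + e / 3. The compression itself obeys the bound of H in every
  covariant representation.\<close>

lemma universal_norm_le_of_bnd:
  assumes F: "F \<in> carrier B" and bnd: "B.bnd F C" and C: "0 \<le> C"
  shows "universal_norm G CX (translation_action G L) F \<le> C"
proof (rule field_le_epsilon)
  fix e :: real assume e: "e > 0"
  let ?u = "universal_norm G CX (translation_action G L)" and ?m = "real (card (supp F))"
  obtain K where K: "0 \<le> K" "\<And>g x. cmod (F g x) \<le> K" using B_uniform_bound[OF F] by blast
  \<comment> \<open>A coefficientwise error d costs at most m d in the universal norm; m + 1 in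
    place of m avoids dividing by zero for F = 0.\<close>
  define d where "d = e / (3 * (?m + 1))"
  have d: "d > 0" "?m * d \<le> e / 3"
  proof -
    show "d > 0" using e by (simp add: d_def add_nonneg_pos)
    have "?m * d = e / 3 * (?m / (?m + 1))" by (simp add: d_def)
    also have "\<dots> \<le> e / 3 * 1" using e by (intro mult_left_mono) auto
    finally show "?m * d \<le> e / 3" by simp
  qed
  from level_approximation[OF F d(1)] obtain n where n: "\<forall>m\<ge>n. \<exists>H\<in>carrier B. level m H \<and> supp H \<subseteq> supp F \<and>
    (\<forall>g x. cmod (F g x - H g x) \<le> d) \<and> (\<forall>K. (\<forall>g x. cmod (F g x) \<le> K) \<longrightarrow> (\<forall>g x. cmod (H g x) \<le> K))" ..
  from n[rule_format, OF order_refl] obtain H where H': "H \<in> carrier B" "level n H \<and> supp H \<subseteq> supp F \<and>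
    (\<forall>g x. cmod (F g x - H g x) \<le> d) \<and> (\<forall>K. (\<forall>g x. cmod (F g x) \<le> K) \<longrightarrow> (\<forall>g x. cmod (H g x) \<le> K))" ..
  then have H: "H \<in> carrier B" "level n H" "supp H \<subseteq> supp F" "\<And>g x. cmod (F g x - H g x) \<le> d"
    "\<And>g x. cmod (H g x) \<le> K"
    using K(2) by simp_all
  note S = B_finite[OF F] supp_subset[of F]
  have FH: "?u (F \<ominus>\<^bsub>B\<^esub> H) \<le> e / 3"
    using universal_norm_diff_le[OF F H(1) S subset_refl H(3,4)] d(2) by simp
  have HF: "?u (H \<ominus>\<^bsub>B\<^esub> F) \<le> e / 3"
  proof -
    have "cmod (H g x - F g x) \<le> d" for g x using H(4)[of g x] by (simp add: norm_minus_commute)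
    then show ?thesis using universal_norm_diff_le[OF H(1) F S H(3) subset_refl] d(2) by fastforce
  qed
  \<comment> \<open>The direction already known, from universal norm to bounds, is applied to H -
    F.\<close>
  have "B.bnd (F \<oplus>\<^bsub>B\<^esub> (H \<ominus>\<^bsub>B\<^esub> F)) (C + e / 3)"
    using HF by (intro B.bnd_add bnd B.bnd_mono[OF bnd_universal_norm] F B.minus_closed H(1))
  moreover have "F \<oplus>\<^bsub>B\<^esub> (H \<ominus>\<^bsub>B\<^esub> F) = H"
    unfolding B.minus_eq_smult[OF H(1) F] by (simp add: fun_eq_iff)
  ultimately have bndH: "B.bnd H (C + e / 3)" by simp
  \<comment> \<open>With \<eta> = d / (K + 1) the multiplier error m \<eta> K stays below m
    d.\<close>
  have "d / (K + 1) > 0" using d K by simp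
  from foelner[OF S this] obtain P where P': "finite P \<and> P \<noteq> {} \<and> P \<subseteq> carrier G \<and>
    (\<forall>g\<in>supp F. (1 - d / (K + 1)) * real (card P) \<le> real (card (P \<inter> (\<lambda>y. g \<otimes> y) ` P)))" ..
  note P = conjunct1[OF P'] conjunct1[OF conjunct2[OF P']] conjunct1[OF conjunct2[OF conjunct2[OF P']]]
  from P' have fol: "(1 - d / (K + 1)) * real (card P) \<le> real (card (P \<inter> (\<lambda>y. g \<otimes> y) ` P))" if "g \<in> supp F" for g
    by (elim conjE) (erule bspec[OF _ that])
  let ?C = "compress n P (kern H)"
  have Cc: "?C \<in> carrier B" by (rule compress_closed[OF P(3)])
  have HC: "?u (H \<ominus>\<^bsub>B\<^esub> ?C) \<le> e / 3"
  proof -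
    have "?u (H \<ominus>\<^bsub>B\<^esub> ?C) \<le> ?m * (d / (K + 1) * K)"
      using d K by (intro compress_kern_diff[OF H(1,2) P S(1) H(3) S(2) fol H(5)]) auto
    also have "\<dots> \<le> ?m * (d * 1)"
      using d K by (intro mult_left_mono) (auto simp: field_simps)
    finally show ?thesis using d(2) by simp
  qed
  have Cle: "?u ?C \<le> C + e / 3" using C e by (intro universal_norm_compress_le H(1) bndH P) auto
  have "F = (F \<ominus>\<^bsub>B\<^esub> H) \<oplus>\<^bsub>B\<^esub> ((H \<ominus>\<^bsub>B\<^esub> ?C) \<oplus>\<^bsub>B\<^esub> ?C)"
    unfolding B.minus_eq_smult[OF H(1) Cc] B.minus_eq_smult[OF F H(1)] by (simp add: fun_eq_iff)
  then have "?u F = ?u ((F \<ominus>\<^bsub>B\<^esub> H) \<oplus>\<^bsub>B\<^esub> ((H \<ominus>\<^bsub>B\<^esub> ?C) \<oplus>\<^bsub>B\<^esub> ?C))" by (rule arg_cong)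
  also have "\<dots> \<le> ?u (F \<ominus>\<^bsub>B\<^esub> H) + ?u ((H \<ominus>\<^bsub>B\<^esub> ?C) \<oplus>\<^bsub>B\<^esub> ?C)"
    by (intro universal_norm_add B.minus_closed B.a_closed F H(1) Cc)
  also have "\<dots> \<le> ?u (F \<ominus>\<^bsub>B\<^esub> H) + (?u (H \<ominus>\<^bsub>B\<^esub> ?C) + ?u ?C)"
    by (intro add_left_mono universal_norm_add B.minus_closed H(1) Cc)
  also have "\<dots> \<le> C + e" using FH HC Cle by simp
  finally show "?u F \<le> C + e" .
qed

text \<open>Here the convolution algebra enters the general framework: the C*-axioms, square roots
  and complete positivity become available for the crossed product.\<close>

lemma gns_alg_B: "gns_alg B state"
proof (intro gns_alg.intro pos_alg_B gns_alg_axioms.intro)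
  fix F and C :: real assume F: "F \<in> carrier B"
  show "0 \<le> nrm B F" unfolding nrm_B by (rule universal_norm_nonneg[OF F])
  assume C: "0 \<le> C"
  show "nrm B F \<le> C \<longleftrightarrow> B.bnd F C"
    unfolding nrm_B using B.bnd_mono[OF bnd_universal_norm[OF F]] universal_norm_le_of_bnd[OF F _ C] by blast
qed

sublocale B: gns_alg B state
  by (rule gns_alg_B)

sublocale A: complete_gns_alg B.CA B.\<Phi>
  by (rule B.complete_gns_alg_completion)

lemma bunce_deddens_eq: "bunce_deddens_algebra G L = B.CA"
  by (simp add: bunce_deddens_algebra_def crossed_product_def)

lemma level_approximation_nrm:
  assumes F: "F \<in> carrier B" and e: "e > 0"
  shows "\<exists>N. \<forall>n\<ge>N. \<exists>H\<in>carrier B. level n H \<and> supp H \<subseteq> supp F \<and> nrm B (F \<ominus>\<^bsub>B\<^esub> H) < e \<and>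
    (\<forall>K. (\<forall>g x. cmod (F g x) \<le> K) \<longrightarrow> (\<forall>g x. cmod (H g x) \<le> K))"
proof -
  let ?m = "real (card (supp F))"
  define d where "d = e / (2 * (?m + 1))"
  have "d > 0" using e by (simp add: d_def add_nonneg_pos)
  have md: "?m * d < e"
  proof -
    have "?m * d = e / 2 * (?m / (?m + 1))" by (simp add: d_def)
    also have "\<dots> \<le> e / 2 * 1" using e by (intro mult_left_mono) auto
    finally show ?thesis using e by simp
  qed
  have le: "nrm B (F \<ominus>\<^bsub>B\<^esub> H) < e" if "H \<in> carrier B" "supp H \<subseteq> supp F" "\<forall>g x. cmod (F g x - H g x) \<le> d" for H
    unfolding nrm_B using universal_norm_diff_le[OF F that(1) B_finite[OF F] supp_subset subset_refl that(2)] that(3) md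
    by fastforce
  from level_approximation[OF F \<open>d > 0\<close>] obtain N where N: "\<forall>n\<ge>N. \<exists>H\<in>carrier B. level n H \<and> supp H \<subseteq> supp F \<and>
    (\<forall>g x. cmod (F g x - H g x) \<le> d) \<and> (\<forall>K. (\<forall>g x. cmod (F g x) \<le> K) \<longrightarrow> (\<forall>g x. cmod (H g x) \<le> K))" ..
  show ?thesis
  proof (intro exI[of _ N] allI impI)
    fix n assume "N \<le> n"
    with N have "\<exists>H\<in>carrier B. level n H \<and> supp H \<subseteq> supp F \<and> (\<forall>g x. cmod (F g x - H g x) \<le> d) \<and>
      (\<forall>K. (\<forall>g x. cmod (F g x) \<le> K) \<longrightarrow> (\<forall>g x. cmod (H g x) \<le> K))" by simp
    then show "\<exists>H\<in>carrier B. level n H \<and> supp H \<subseteq> supp F \<and> nrm B (F \<ominus>\<^bsub>B\<^esub> H) < e \<and>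
      (\<forall>K. (\<forall>g x. cmod (F g x) \<le> K) \<longrightarrow> (\<forall>g x. cmod (H g x) \<le> K))"
      by (elim bexE conjE) (intro bexI conjI le; assumption)
  qed
qed

end

section \<open>Simplicity and separability\<close>

lemma (in compact_dynsys) mult_single_one:
  assumes F: "F \<in> carrier B" and a: "a \<in> carrier CX" and g: "g \<in> carrier G" and x: "x \<in> X"
  shows "(F \<otimes>\<^bsub>B\<^esub> single a \<one>) g x = F g x * a (act (inv g) x)"
proof -
  have "(F \<otimes>\<^bsub>B\<^esub> single a \<one>) g x = (\<Sum>s\<in>insert g (supp F). F s x * single a \<one> (inv s \<otimes> g) (act (inv s) x))"
    using F g supp_subset by (intro mult_B single_closed a one_closed) (auto intro: B_finite)
  also have "\<dots> = (\<Sum>s\<in>{g}. F s x * single a \<one> (inv s \<otimes> g) (act (inv s) x))"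
  proof (rule sum.mono_neutral_right)
    show "\<forall>s\<in>insert g (supp F) - {g}. F s x * single a \<one> (inv s \<otimes> g) (act (inv s) x) = 0"
    proof
      fix s assume s: "s \<in> insert g (supp F) - {g}"
      then have sG: "s \<in> carrier G" using supp_subset by blast
      have "inv s \<otimes> g \<noteq> \<one>" using s sG g by (metis DiffE inv_equality inv_inv insertI1 inv_closed)
      then show "F s x * single a \<one> (inv s \<otimes> g) (act (inv s) x) = 0" by (simp add: single_def)
    qed
  qed (use F in \<open>auto intro: B_finite\<close>)
  also have "\<dots> = F g x * a (act (inv g) x)" using g by (simp add: single_def)
  finally show ?thesis .
qed

lemma (in compact_dynsys) single_one_mult:
  assumes F: "F \<in> carrier B" and a: "a \<in> carrier CX" and g: "g \<in> carrier G" and x: "x \<in> X"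
  shows "(single a \<one> \<otimes>\<^bsub>B\<^esub> F) g x = a x * F g x"
  using mult_B[OF single_closed[OF a one_closed] F _ supp_single _ g, of x] g x by (simp add: single_def)

context profinite_seq
begin

text \<open>Nestedness turns the separation of single elements from the identity into simultaneous
  separation for a finite set.\<close>

lemma eventually_separated:
  assumes "finite S"
  shows "\<exists>N. \<forall>n\<ge>N. S \<inter> L n \<subseteq> {\<one>}"
proof -
  have "\<exists>n. g \<notin> L n" if "g \<noteq> \<one>" for g using L_Inter that by blast
  then obtain k where k: "\<And>g. g \<noteq> \<one> \<Longrightarrow> g \<notin> L (k g)" by metis
  have "S \<inter> L n \<subseteq> {\<one>}" if n: "n \<ge> Max (insert 0 (k ` S))" for n
  proof
    fix g assume g: "g \<in> S \<inter> L n"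
    have "k g \<le> Max (insert 0 (k ` S))" using g assms by (intro Max_ge) auto
    then have "L n \<subseteq> L (k g)" using n by (intro L_antimono) simp
    then show "g \<in> {\<one>}" using g k[of g] by blast
  qed
  then show ?thesis by blast
qed

definition corner :: "nat \<Rightarrow> 'g \<Rightarrow> (nat \<Rightarrow> 'g set) \<Rightarrow> complex" where
  "corner n = single (cyl n \<one>) \<one>"

lemma corner_closed [simp]: "corner n \<in> carrier B"
  unfolding corner_def by (rule single_closed[OF cyl_closed one_closed])

text \<open>The coefficient of the compression at g lives on points x for which both x and g^(-1) x
  lie in the closure of L n, which forces g into L n. The hypothesis on the support leaves only g =
  1, where level n makes H constant on that closure.\<close>

lemma corner_compression:
  assumes H: "H \<in> carrier B" and lev: "level n H" and sep: "supp H \<inter> L n \<subseteq> {\<one>}"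
  shows "corner n \<otimes>\<^bsub>B\<^esub> H \<otimes>\<^bsub>B\<^esub> corner n = state H \<odot>\<^bsub>B\<^esub> corner n"
proof (rule B_eqI)
  show "corner n \<otimes>\<^bsub>B\<^esub> H \<otimes>\<^bsub>B\<^esub> corner n \<in> carrier B" using H by (intro B.m_closed corner_closed)
  show "state H \<odot>\<^bsub>B\<^esub> corner n \<in> carrier B" by (intro B.smult_closed corner_closed)
  fix g x assume g: "g \<in> carrier G" and x: "x \<in> X"
  have pH: "corner n \<otimes>\<^bsub>B\<^esub> H \<in> carrier B" using H by (intro B.m_closed corner_closed)
  have eq: "(corner n \<otimes>\<^bsub>B\<^esub> H \<otimes>\<^bsub>B\<^esub> corner n) g x = cyl n \<one> x * H g x * cyl n \<one> (act (inv g) x)"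
    using mult_single_one[OF pH cyl_closed g x, of n \<one>] single_one_mult[OF H cyl_closed g x, of n \<one>]
    by (simp add: corner_def)
  show "(corner n \<otimes>\<^bsub>B\<^esub> H \<otimes>\<^bsub>B\<^esub> corner n) g x = (state H \<odot>\<^bsub>B\<^esub> corner n) g x"
  proof (cases "x n = \<one> <# L n")
    case False
    then show ?thesis unfolding eq by (simp add: corner_def single_def cyl_def)
  next
    case xn: True
    show ?thesis
    proof (cases "g = \<one>")
      case True
      have "x n = x0 n" using xn by (simp add: profinite_embedding_def)
      then have "H \<one> x = H \<one> x0" using lev x base unfolding level_def by blast
      then show ?thesis unfolding eq using True x xn by (simp add: corner_def single_def cyl_def state_def)
    next
      case False
      have "H g x = 0 \<or> cyl n \<one> (act (inv g) x) = 0"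
      proof (rule disjCI)
        assume "cyl n \<one> (act (inv g) x) \<noteq> 0"
        then have "inv g <# L n = \<one> <# L n"
          using act_rep[of "inv g" \<one> x n] g xn by (simp add: cyl_def split: if_splits)
        then have "g \<in> L n" using lcos_eq_iff[of "inv g" \<one> n] g by simp
        then have "g \<notin> supp H" using sep False by blast
        then show "H g x = 0" using g by (simp add: not_supp)
      qed
      then show ?thesis unfolding eq using False by (auto simp: corner_def single_def)
    qed
  qed
qed

lemma corner_conjugate: "z \<in> carrier G \<Longrightarrow> unitary z \<otimes>\<^bsub>B\<^esub> corner n \<otimes>\<^bsub>B\<^esub> unitary (inv z) = single (cyl n z) \<one>"
  unfolding corner_def
  by (simp add: unitary_single single_unitary alpha_cyl del: CX_sel)

lemma cyl_sum_one: "finsum B (\<lambda>z. single (cyl n z) \<one>) (transversal n) = \<one>\<^bsub>B\<^esub>"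
proof (rule B_eqI)
  have c: "single (cyl n z) \<one> \<in> carrier B" for z by (rule single_closed[OF cyl_closed one_closed])
  show "finsum B (\<lambda>z. single (cyl n z) \<one>) (transversal n) \<in> carrier B" using c by (intro B.finsum_in)
  fix g x assume g: "g \<in> carrier G" and x: "x \<in> X"
  obtain z where f: "\<forall>f :: 'g \<Rightarrow> complex. (\<Sum>z\<in>transversal n. f z * cyl n (\<one> \<otimes> z) x) = f z"
    using transversal_point[OF one_closed x, of n] by blast
  have "(\<Sum>z\<in>transversal n. cyl n z x) = (\<Sum>z\<in>transversal n. 1 * cyl n (\<one> \<otimes> z) x)"
    using subsetD[OF transversal_subset[of n]] by (intro sum.cong refl) simp
  also have "\<dots> = 1" using f[rule_format, of "\<lambda>_. 1"] by simp
  finally show "finsum B (\<lambda>z. single (cyl n z) \<one>) (transversal n) g x = \<one>\<^bsub>B\<^esub> g x"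
    using x by (simp add: finsum_B[OF transversal_finite c]) (simp add: single_def)
qed (rule one_B_closed)

end

context amenable_profinite_seq
begin

abbreviation "A \<equiv> B.CA"

abbreviation "\<iota> \<equiv> completion_embed B"

lemma nrm_single_le:
  assumes a: "a \<in> carrier CX" and g: "g \<in> carrier G" and K: "\<And>x. cmod (a x) \<le> K"
  shows "nrm B (single a g) \<le> K"
  unfolding nrm_B
  using universal_norm_le_l1[OF single_closed[OF a g] _ supp_single, of "\<lambda>_. K"] g K by (simp add: single_def)

lemma nn_one: "A.nn \<one>\<^bsub>A\<^esub> = 1"
proof -
  have "A.ip \<one>\<^bsub>A\<^esub> \<one>\<^bsub>A\<^esub> = B.\<Phi> (\<iota> \<one>\<^bsub>B\<^esub>)" unfolding A.ip_def by (simp add: B.embed_one del: B_sel)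
  also have "\<dots> = state \<one>\<^bsub>B\<^esub>" by (rule B.embed_phi[OF B.one_closed])
  also have "\<dots> = 1" using base by (simp add: state_def)
  finally show ?thesis by (simp add: A.nn_def)
qed

text \<open>A projection that is approximated up to an error \<open>d = p - c\<close> of norm less than one by an
  element \<open>c = p c p\<close> of a closed ideal lies in the ideal, since \<open>p - d\<^sup>m\<close> does for all \<open>m \<ge> 1\<close>.\<close>

lemma projection_in_ideal:
  assumes J: "closed_two_sided_ideal A J" and p: "p \<in> carrier A" "p \<otimes>\<^bsub>A\<^esub> p = p"
    and c: "c \<in> J" "c \<otimes>\<^bsub>A\<^esub> p = c" and small: "nrm A (p \<ominus>\<^bsub>A\<^esub> c) < 1"
  shows "p \<in> J"
proof -
  have JA: "J \<subseteq> carrier A" and Jadd: "\<And>x y. x \<in> J \<Longrightarrow> y \<in> J \<Longrightarrow> x \<oplus>\<^bsub>A\<^esub> y \<in> J"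
    and Jmult: "\<And>a x. a \<in> carrier A \<Longrightarrow> x \<in> J \<Longrightarrow> a \<otimes>\<^bsub>A\<^esub> x \<in> J"
    and Jlim: "\<And>s x. x \<in> carrier A \<Longrightarrow> (\<And>n. s n \<in> J) \<Longrightarrow> nrm_tendsto A s x \<Longrightarrow> x \<in> J"
    using J unfolding closed_two_sided_ideal_def by blast+
  have cA: "c \<in> carrier A" using c JA by blast
  define d where "d = p \<ominus>\<^bsub>A\<^esub> c"
  have d: "d \<in> carrier A" using p cA by (simp add: d_def)
  have dp: "d \<otimes>\<^bsub>A\<^esub> p = d" using p cA c(2) by (simp add: d_def A.minus_eq_smult A.l_distr A.smult_mult_left)
  \<comment> \<open>\<open>D m\<close> is the power of d with exponent m + 1. Starting from d and
    not from the unit keeps the property that p is a right unit for all of them.\<close>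
  define D where "D = rec_nat d (\<lambda>_ y. y \<otimes>\<^bsub>A\<^esub> d)"
  have D0: "D 0 = d" and DS: "D (Suc m) = D m \<otimes>\<^bsub>A\<^esub> d" for m by (simp_all add: D_def)
  have DA [simp]: "D m \<in> carrier A" for m by (induction m) (auto simp: D0 DS d)
  have Dp: "D m \<otimes>\<^bsub>A\<^esub> p = D m" for m by (cases m) (auto simp: D0 DS d dp p A.m_assoc)
  have in_J: "p \<ominus>\<^bsub>A\<^esub> D m \<in> J" for m
  proof (induction m)
    case 0
    have "p \<ominus>\<^bsub>A\<^esub> d = c" unfolding d_def using p(1) cA by algebra
    then show ?case using c by (simp add: D0)
  next
    case (Suc m)
    have "D m \<otimes>\<^bsub>A\<^esub> d = D m \<ominus>\<^bsub>A\<^esub> D m \<otimes>\<^bsub>A\<^esub> c"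
      using p cA Dp[of m] by (simp add: d_def A.minus_eq_smult A.r_distr A.smult_mult_right)
    then have "p \<ominus>\<^bsub>A\<^esub> D (Suc m) = (p \<ominus>\<^bsub>A\<^esub> D m) \<oplus>\<^bsub>A\<^esub> D m \<otimes>\<^bsub>A\<^esub> c"
      unfolding DS using p(1) cA DA[of m] A.m_closed[OF DA[of m] cA] by algebra
    then show ?case using Suc Jadd Jmult c by simp
  qed
  have Dn: "nrm A (D m) \<le> nrm A d ^ Suc m" for m
  proof (induction m)
    case (Suc m)
    have "nrm A (D (Suc m)) \<le> nrm A (D m) * nrm A d" unfolding DS using d by (intro A.nrm_mult) auto
    also have "\<dots> \<le> nrm A d ^ Suc m * nrm A d" using Suc d by (intro mult_right_mono) auto
    finally show ?case by (simp add: mult.commute)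
  qed (simp add: D0)
  have "(\<lambda>m. nrm A d ^ Suc m) \<longlonglongrightarrow> 0"
    using small d by (intro LIMSEQ_Suc LIMSEQ_realpow_zero) (auto simp: d_def)
  then have Dlim: "(\<lambda>m. nrm A (D m)) \<longlonglongrightarrow> 0" by (rule A.null_by_bound[OF DA Dn])
  have eq: "nrm A ((p \<ominus>\<^bsub>A\<^esub> D m) \<ominus>\<^bsub>A\<^esub> p) = nrm A (D m)" for m
  proof -
    have "(p \<ominus>\<^bsub>A\<^esub> D m) \<ominus>\<^bsub>A\<^esub> p = \<ominus>\<^bsub>A\<^esub> D m" using p(1) DA[of m] by algebra
    then have "(p \<ominus>\<^bsub>A\<^esub> D m) \<ominus>\<^bsub>A\<^esub> p = (-1) \<odot>\<^bsub>A\<^esub> D m" by (simp only: A.smult_neg_one DA)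
    then show ?thesis by (simp add: A.nrm_smult)
  qed
  show ?thesis
    by (rule Jlim[OF p(1), of "\<lambda>m. p \<ominus>\<^bsub>A\<^esub> D m", OF in_J]) (simp add: nrm_tendsto_def eq Dlim)
qed

lemma cstar_simple_A: "cstar_simple A"
  unfolding cstar_simple_def
proof (intro conjI allI impI)
  show "carrier A \<noteq> {\<zero>\<^bsub>A\<^esub>}"
  proof
    assume "carrier A = {\<zero>\<^bsub>A\<^esub>}"
    then have "\<one>\<^bsub>A\<^esub> = \<zero>\<^bsub>A\<^esub>" using A.one_closed by auto
    then show False using nn_one A.nn_zero by simp
  qed
  fix J assume J: "closed_two_sided_ideal A J"
  have JA: "J \<subseteq> carrier A" and J0: "\<zero>\<^bsub>A\<^esub> \<in> J" and Jadd: "\<And>x y. x \<in> J \<Longrightarrow> y \<in> J \<Longrightarrow> x \<oplus>\<^bsub>A\<^esub> y \<in> J"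
    and Jsmult: "\<And>z x. x \<in> J \<Longrightarrow> z \<odot>\<^bsub>A\<^esub> x \<in> J"
    and Jl: "\<And>a x. a \<in> carrier A \<Longrightarrow> x \<in> J \<Longrightarrow> a \<otimes>\<^bsub>A\<^esub> x \<in> J"
    and Jr: "\<And>a x. a \<in> carrier A \<Longrightarrow> x \<in> J \<Longrightarrow> x \<otimes>\<^bsub>A\<^esub> a \<in> J"
    using J unfolding closed_two_sided_ideal_def by blast+
  show "J = {\<zero>\<^bsub>A\<^esub>} \<or> J = carrier A"
  proof (rule disjCI)
    assume "J \<noteq> carrier A"
    show "J = {\<zero>\<^bsub>A\<^esub>}"
    proof (rule ccontr)
      assume "J \<noteq> {\<zero>\<^bsub>A\<^esub>}"
      then obtain a where a: "a \<in> J" "a \<noteq> \<zero>\<^bsub>A\<^esub>" using J0 by blast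
      then have aA: "a \<in> carrier A" using JA by blast
      \<comment> \<open>The functional may vanish on a^* a, but a nonzero a cannot annihilate the
        whole GNS space: its norm would be zero.\<close>
      have "\<exists>x\<in>carrier A. A.nn (a \<otimes>\<^bsub>A\<^esub> x) > 0"
      proof (rule ccontr)
        assume "\<not> ?thesis"
        then have "A.bnd a 0" unfolding A.bnd_def by (simp add: not_less)
        then have "nrm A a \<le> 0" using A.nrm_le_iff[OF aA] by simp
        then have "nrm A a = 0" using A.nrm_nonneg[OF aA] by (rule antisym)
        then show False using A.nrm_eq_0D[OF aA] a by blast
      qed
      then obtain x where x: "x \<in> carrier A" "A.nn (a \<otimes>\<^bsub>A\<^esub> x) > 0" by blast
      define y where "y = a \<otimes>\<^bsub>A\<^esub> x"
      define b where "b = adj A y \<otimes>\<^bsub>A\<^esub> y"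
      define r where "r = (A.nn y)\<^sup>2"
      have y: "y \<in> carrier A" using aA x by (simp add: y_def)
      have r: "r > 0" using x by (simp add: r_def y_def)
      have bJ: "b \<in> J" unfolding b_def y_def using a aA x by (intro Jl Jr) auto
      then have bA: "b \<in> carrier A" using JA by blast
      have phib: "B.\<Phi> b = of_real r" using A.ip_self[OF y] by (simp add: b_def r_def A.ip_def)
      \<comment> \<open>Two errors of r / 8 put H within r / 4 of b. This error counts twice, once
        in the scalar \<open>state H\<close> and once in p b p, so p b p is within r / 2 of r p, and
        dividing by r leaves 1 / 2 < 1.\<close>
      obtain f where f: "f \<in> carrier B" "nrm A (b \<ominus>\<^bsub>A\<^esub> \<iota> f) < r / 8"
        using B.embed_dense[OF bA, of "r / 8"] r by auto
      from level_approximation_nrm[OF f(1), of "r / 8"] r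
      obtain N where N: "\<forall>n\<ge>N. \<exists>H\<in>carrier B. level n H \<and> supp H \<subseteq> supp f \<and> nrm B (f \<ominus>\<^bsub>B\<^esub> H) < r / 8 \<and>
        (\<forall>K. (\<forall>g x. cmod (f g x) \<le> K) \<longrightarrow> (\<forall>g x. cmod (H g x) \<le> K))" by auto
      obtain N' where N': "\<forall>n\<ge>N'. supp f \<inter> L n \<subseteq> {\<one>}" using eventually_separated[OF B_finite[OF f(1)]] by blast
      \<comment> \<open>N' could be chosen before H because the support of H stays inside that of f;
        n then serves both for the approximation and for the separation.\<close>
      define n where "n = max N N'"
      obtain H where H: "H \<in> carrier B" "level n H" "supp H \<subseteq> supp f" "nrm B (f \<ominus>\<^bsub>B\<^esub> H) < r / 8"
        using N[rule_format, of n] unfolding n_def by (metis max.cobounded1)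
      have sep: "supp H \<inter> L n \<subseteq> {\<one>}" using N' H(3) unfolding n_def by (meson Int_mono max.cobounded2 order_refl subset_trans)
      define p where "p = \<iota> (corner n)"
      have pA [simp]: "p \<in> carrier A" unfolding p_def by (rule B.embed_closed[OF corner_closed])
      have "corner n \<otimes>\<^bsub>B\<^esub> corner n = corner n"
        unfolding corner_def
        by (subst single_mult[OF cyl_closed cyl_closed one_closed one_closed]) (simp only: alpha_cyl[OF one_closed one_closed] r_one[OF one_closed] inv_one, auto simp: cyl_def single_def fun_eq_iff)
      then have pp: "p \<otimes>\<^bsub>A\<^esub> p = p" unfolding p_def by (simp only: B.embed_mult[OF corner_closed corner_closed, symmetric])
      have pn: "nrm A p \<le> 1"
        unfolding p_def B.embed_nrm[OF corner_closed] unfolding corner_def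
        by (rule nrm_single_le[OF cyl_closed one_closed]) (simp add: cyl_def)
      have bH: "nrm A (b \<ominus>\<^bsub>A\<^esub> \<iota> H) < r / 4"
      proof -
        have "nrm A (b \<ominus>\<^bsub>A\<^esub> \<iota> H) \<le> nrm A (b \<ominus>\<^bsub>A\<^esub> \<iota> f) + nrm A (\<iota> f \<ominus>\<^bsub>A\<^esub> \<iota> H)"
          using bA f H by (intro A.nrm_minus_triangle B.embed_closed)
        also have "\<iota> f \<ominus>\<^bsub>A\<^esub> \<iota> H = \<iota> (f \<ominus>\<^bsub>B\<^esub> H)" by (rule B.embed_minus[OF f(1) H(1), symmetric])
        also have "nrm A \<dots> = nrm B (f \<ominus>\<^bsub>B\<^esub> H)" by (rule B.embed_nrm[OF B.minus_closed[OF f(1) H(1)]])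
        finally show ?thesis using f(2) H(4) by simp
      qed
      have iH: "\<iota> H \<in> carrier A" by (rule B.embed_closed[OF H(1)])
      have stH: "cmod (state H - of_real r) < r / 4"
      proof -
        have "B.\<Phi> (b \<ominus>\<^bsub>A\<^esub> \<iota> H) = of_real r - state H" using bA iH H by (simp add: A.phi_minus phib B.embed_phi)
        then have "cmod (state H - of_real r) = cmod (B.\<Phi> (b \<ominus>\<^bsub>A\<^esub> \<iota> H))" by (simp add: norm_minus_commute)
        also have "\<dots> \<le> nrm A (b \<ominus>\<^bsub>A\<^esub> \<iota> H)" using A.cmod_phi_le[OF A.minus_closed[OF bA iH]] nn_one by simp
        finally show ?thesis using bH by simp
      qed
      have pHp: "p \<otimes>\<^bsub>A\<^esub> \<iota> H \<otimes>\<^bsub>A\<^esub> p = state H \<odot>\<^bsub>A\<^esub> p"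
        unfolding p_def
        using corner_compression[OF H(1,2) sep] H(1)
        by (simp only: B.embed_mult[symmetric] B.embed_smult[symmetric] corner_closed B.m_closed)
      define c where "c = complex_of_real (1 / r) \<odot>\<^bsub>A\<^esub> (p \<otimes>\<^bsub>A\<^esub> b \<otimes>\<^bsub>A\<^esub> p)"
      have cJ: "c \<in> J" unfolding c_def using bJ by (intro Jsmult Jr Jl) auto
      have cp: "c \<otimes>\<^bsub>A\<^esub> p = c" using bA by (simp add: c_def A.smult_mult_left A.m_assoc pp)
      have "nrm A (p \<ominus>\<^bsub>A\<^esub> c) \<le> 1 / 2"
      proof -
        have "complex_of_real (1 / r) \<odot>\<^bsub>A\<^esub> (of_real r \<odot>\<^bsub>A\<^esub> p) = p"
          using r by (simp add: A.smult_smult[symmetric])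
        then have "p \<ominus>\<^bsub>A\<^esub> c = complex_of_real (1 / r) \<odot>\<^bsub>A\<^esub> (of_real r \<odot>\<^bsub>A\<^esub> p \<ominus>\<^bsub>A\<^esub> p \<otimes>\<^bsub>A\<^esub> b \<otimes>\<^bsub>A\<^esub> p)"
          unfolding c_def using bA by (subst A.smult_minus) auto
        then have "nrm A (p \<ominus>\<^bsub>A\<^esub> c) = 1 / r * nrm A (of_real r \<odot>\<^bsub>A\<^esub> p \<ominus>\<^bsub>A\<^esub> p \<otimes>\<^bsub>A\<^esub> b \<otimes>\<^bsub>A\<^esub> p)"
          using r bA by (simp only: A.nrm_smult A.minus_closed A.smult_closed A.m_closed pA norm_of_real) simp
        moreover have "nrm A (of_real r \<odot>\<^bsub>A\<^esub> p \<ominus>\<^bsub>A\<^esub> p \<otimes>\<^bsub>A\<^esub> b \<otimes>\<^bsub>A\<^esub> p) \<le> r / 4 + r / 4"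
        proof -
          have "nrm A (of_real r \<odot>\<^bsub>A\<^esub> p \<ominus>\<^bsub>A\<^esub> p \<otimes>\<^bsub>A\<^esub> b \<otimes>\<^bsub>A\<^esub> p) \<le>
              nrm A (of_real r \<odot>\<^bsub>A\<^esub> p \<ominus>\<^bsub>A\<^esub> state H \<odot>\<^bsub>A\<^esub> p) + nrm A (state H \<odot>\<^bsub>A\<^esub> p \<ominus>\<^bsub>A\<^esub> p \<otimes>\<^bsub>A\<^esub> b \<otimes>\<^bsub>A\<^esub> p)"
            using bA by (intro A.nrm_minus_triangle) auto
          also have "nrm A (of_real r \<odot>\<^bsub>A\<^esub> p \<ominus>\<^bsub>A\<^esub> state H \<odot>\<^bsub>A\<^esub> p) \<le> r / 4"
          proof -
            have "of_real r \<odot>\<^bsub>A\<^esub> p \<ominus>\<^bsub>A\<^esub> state H \<odot>\<^bsub>A\<^esub> p = (of_real r - state H) \<odot>\<^bsub>A\<^esub> p"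
              using A.smult_add_left[OF pA, of "of_real r" "- state H"] A.smult_smult[OF pA, of "-1" "state H"]
              by (simp add: A.minus_eq_smult)
            then have "nrm A (of_real r \<odot>\<^bsub>A\<^esub> p \<ominus>\<^bsub>A\<^esub> state H \<odot>\<^bsub>A\<^esub> p) = cmod (of_real r - state H) * nrm A p"
              by (simp add: A.nrm_smult)
            also have "\<dots> \<le> r / 4 * 1" using stH pn r by (intro mult_mono) (auto simp: norm_minus_commute)
            finally show ?thesis by simp
          qed
          also have "nrm A (state H \<odot>\<^bsub>A\<^esub> p \<ominus>\<^bsub>A\<^esub> p \<otimes>\<^bsub>A\<^esub> b \<otimes>\<^bsub>A\<^esub> p) \<le> r / 4"
          proof -
            have eq: "state H \<odot>\<^bsub>A\<^esub> p \<ominus>\<^bsub>A\<^esub> p \<otimes>\<^bsub>A\<^esub> b \<otimes>\<^bsub>A\<^esub> p = p \<otimes>\<^bsub>A\<^esub> (\<iota> H \<ominus>\<^bsub>A\<^esub> b) \<otimes>\<^bsub>A\<^esub> p"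
              unfolding pHp[symmetric] using pA iH bA
              by (simp add: A.minus_eq_smult A.l_distr A.r_distr A.smult_mult_left A.smult_mult_right)
            have "nrm A (p \<otimes>\<^bsub>A\<^esub> (\<iota> H \<ominus>\<^bsub>A\<^esub> b) \<otimes>\<^bsub>A\<^esub> p) \<le> nrm A (p \<otimes>\<^bsub>A\<^esub> (\<iota> H \<ominus>\<^bsub>A\<^esub> b)) * nrm A p"
              using iH bA by (intro A.nrm_mult) auto
            also have "\<dots> \<le> (nrm A p * nrm A (\<iota> H \<ominus>\<^bsub>A\<^esub> b)) * nrm A p"
              using iH bA by (intro mult_right_mono A.nrm_mult) auto
            also have "\<dots> \<le> (1 * (r / 4)) * 1"
              using iH bA pn bH r A.nrm_minus_commute[OF iH bA] by (intro mult_mono) auto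
            finally show ?thesis unfolding eq by simp
          qed
          finally show ?thesis by simp
        qed
        ultimately have "r * nrm A (p \<ominus>\<^bsub>A\<^esub> c) \<le> r * (1 / 2)" using r by (simp add: field_simps)
        then show ?thesis using r by (simp only: mult_le_cancel_left_pos)
      qed
      then have "p \<in> J" by (intro projection_in_ideal[OF J pA pp cJ cp]) simp
      then have conj: "\<iota> (single (cyl n z) \<one>) \<in> J" if "z \<in> transversal n" for z
      proof -
        have z: "z \<in> carrier G" using that transversal_subset by blast
        have u: "unitary z \<in> carrier B" "unitary (inv z) \<in> carrier B" using z by auto
        have "\<iota> (single (cyl n z) \<one>) = \<iota> (unitary z) \<otimes>\<^bsub>A\<^esub> p \<otimes>\<^bsub>A\<^esub> \<iota> (unitary (inv z))"
          unfolding p_def corner_conjugate[OF z, symmetric]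
          using u by (simp only: B.embed_mult corner_closed B.m_closed)
        then show ?thesis using \<open>p \<in> J\<close> u by (simp only: Jl Jr B.embed_closed)
      qed
      have Jsum: "finsum A h S \<in> J" if "finite S" "\<And>z. z \<in> S \<Longrightarrow> h z \<in> J" for h and S :: "'g set"
        using that
      proof (induction S rule: finite_induct)
        case (insert z S)
        then show ?case using JA Jadd by (subst A.finsum_insert) auto
      qed (use J0 in simp)
      have "\<one>\<^bsub>A\<^esub> = finsum A (\<lambda>z. \<iota> (single (cyl n z) \<one>)) (transversal n)"
        unfolding B.embed_one[symmetric] cyl_sum_one[of n, symmetric]
        by (intro B.embed_finsum transversal_finite single_closed cyl_closed one_closed)
      then have "\<one>\<^bsub>A\<^esub> \<in> J" using Jsum[OF transversal_finite conj] by simp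
      then have "carrier A \<subseteq> J" using Jl A.r_one by (metis subsetI)
      then show False using JA \<open>J \<noteq> carrier A\<close> by blast
    qed
  qed
qed

text \<open>The countable dense set consists of finite sums of multiples q (cyl n z) g with q in a
  countable dense set of scalars. Sums are taken over lists so that countability is
  immediate.\<close>

lemma cstar_separable_A:
  assumes "countable (carrier G)"
  shows "cstar_separable A"
proof -
  obtain Q :: "complex set" where Q: "countable Q" "\<And>V. open V \<Longrightarrow> V \<noteq> {} \<Longrightarrow> \<exists>q\<in>Q. q \<in> V"
    using countable_dense_exists by metis
  define gens where "gens = (\<lambda>(q, n, z, g). q \<odot>\<^bsub>B\<^esub> single (cyl n z) g) ` (Q \<times> (UNIV :: nat set) \<times> carrier G \<times> carrier G)"
  define sumB where "sumB = (\<lambda>l. foldr (\<lambda>a b. a \<oplus>\<^bsub>B\<^esub> b) l \<zero>\<^bsub>B\<^esub>)"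
  define D where "D = sumB ` lists gens"
  have gensB: "gens \<subseteq> carrier B"
    unfolding gens_def by (auto intro!: B.smult_closed single_closed cyl_closed simp del: B_sel CX_sel)
  have sumB_closed: "sumB l \<in> carrier B" if "l \<in> lists gens" for l
    using that
  proof (induction l)
    case Nil
    show ?case unfolding sumB_def foldr.simps id_apply by (rule B.zero_closed)
  next
    case (Cons a l)
    then have "a \<in> carrier B" "sumB l \<in> carrier B" using gensB by auto
    then show ?case using B.a_closed by (simp add: sumB_def del: B_sel)
  qed
  have DB: "D \<subseteq> carrier B" using sumB_closed by (auto simp: D_def)
  have "countable gens" unfolding gens_def using Q assms by (intro countable_image countable_SIGMA) auto
  then have cD: "countable D" unfolding D_def by (intro countable_image countable_lists)
  have D0: "\<zero>\<^bsub>B\<^esub> \<in> D" unfolding D_def by (rule image_eqI[of _ _ "[]"]) (auto simp: sumB_def)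
  have Dgen: "a \<oplus>\<^bsub>B\<^esub> d \<in> D" if "a \<in> gens" "d \<in> D" for a d
    using that unfolding D_def by (auto simp: sumB_def intro!: image_eqI[of _ _ "a # l" for l] simp del: B_sel)
  have near_sum: "\<exists>d\<in>D. nrm B (finsum B (\<lambda>i. c i \<odot>\<^bsub>B\<^esub> single (cyl n (z i)) (g i)) S \<ominus>\<^bsub>B\<^esub> d) < e"
    if "finite S" "e > 0" "\<And>i. i \<in> S \<Longrightarrow> z i \<in> carrier G \<and> g i \<in> carrier G"
    for S :: "('g \<times> 'g) set" and c :: "'g \<times> 'g \<Rightarrow> complex" and n :: nat and z g e
    using that
  proof (induction S arbitrary: e rule: finite_induct)
    case empty
    then show ?case using D0 by (intro bexI[OF _ D0]) (simp only: B.finsum_empty a_minus_def B.minus_zero B.l_zero B.zero_closed B.nrm_zero)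
  next
    case (insert i S)
    let ?t = "\<lambda>i. c i \<odot>\<^bsub>B\<^esub> single (cyl n (z i)) (g i)"
    have t: "?t j \<in> carrier B" if "j \<in> insert i S" for j
      using insert.prems that by (intro B.smult_closed single_closed cyl_closed) auto
    have zg: "z i \<in> carrier G" "g i \<in> carrier G" using insert.prems by auto
    obtain d where d: "d \<in> D" "nrm B (finsum B ?t S \<ominus>\<^bsub>B\<^esub> d) < e / 2"
      using insert.IH[of "e / 2"] insert.prems by auto
    obtain q where q: "q \<in> Q" "q \<in> ball (c i) (e / 2)"
      using Q(2)[of "ball (c i) (e / 2)"] insert.prems by auto
    define a where "a = q \<odot>\<^bsub>B\<^esub> single (cyl n (z i)) (g i)"
    have a: "a \<in> gens" unfolding a_def gens_def using q zg by (intro image_eqI[of _ _ "(q, n, z i, g i)"]) auto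
    have aB: "a \<in> carrier B" using a gensB by blast
    have dB: "d \<in> carrier B" using d DB by blast
    have sB: "finsum B ?t S \<in> carrier B" using t by (intro B.finsum_in) auto
    have single: "single (cyl n (z i)) (g i) \<in> carrier B" using zg by (intro single_closed cyl_closed)
    have ta: "?t i \<ominus>\<^bsub>B\<^esub> a = (c i - q) \<odot>\<^bsub>B\<^esub> single (cyl n (z i)) (g i)"
      unfolding a_def B.minus_eq_smult[OF B.smult_closed[OF single] B.smult_closed[OF single]]
      by (simp only: B.smult_smult[OF single, symmetric] B.smult_add_left[OF single, symmetric]) simp
    have "nrm B (?t i \<ominus>\<^bsub>B\<^esub> a) \<le> cmod (c i - q) * 1"
      unfolding ta B.nrm_smult[OF single]
      by (intro mult_left_mono nrm_single_le cyl_closed zg) (auto simp: cyl_def)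
    then have ta': "nrm B (?t i \<ominus>\<^bsub>B\<^esub> a) < e / 2" using q by (simp add: dist_norm)
    have split: "(u \<oplus>\<^bsub>B\<^esub> v) \<ominus>\<^bsub>B\<^esub> (a \<oplus>\<^bsub>B\<^esub> d) = (u \<ominus>\<^bsub>B\<^esub> a) \<oplus>\<^bsub>B\<^esub> (v \<ominus>\<^bsub>B\<^esub> d)"
      if "u \<in> carrier B" "v \<in> carrier B" for u v
      using that aB dB by algebra
    have fin: "finsum B ?t (insert i S) = ?t i \<oplus>\<^bsub>B\<^esub> finsum B ?t S"
      using insert.hyps t by (intro B.finsum_insert) auto
    have "nrm B (finsum B ?t (insert i S) \<ominus>\<^bsub>B\<^esub> (a \<oplus>\<^bsub>B\<^esub> d)) \<le>
        nrm B (?t i \<ominus>\<^bsub>B\<^esub> a) + nrm B (finsum B ?t S \<ominus>\<^bsub>B\<^esub> d)"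
      unfolding fin split[OF t[of i, OF insertI1] sB]
      by (rule B.nrm_triangle[OF B.minus_closed[OF t[of i, OF insertI1] aB] B.minus_closed[OF sB dB]])
    then show ?case using ta' d(2) Dgen[OF a d(1)] by (intro bexI[of _ "a \<oplus>\<^bsub>B\<^esub> d"]) auto
  qed
  have near_B: "\<exists>d\<in>D. nrm B (F \<ominus>\<^bsub>B\<^esub> d) < e" if F: "F \<in> carrier B" and e: "e > 0" for F e
  proof -
    from level_approximation_nrm[OF F, of "e / 2"] e
    obtain n where n: "\<forall>m\<ge>n. \<exists>H\<in>carrier B. level m H \<and> supp H \<subseteq> supp F \<and> nrm B (F \<ominus>\<^bsub>B\<^esub> H) < e / 2 \<and>
      (\<forall>K. (\<forall>g x. cmod (F g x) \<le> K) \<longrightarrow> (\<forall>g x. cmod (H g x) \<le> K))" by auto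
    from n[rule_format, OF order_refl] obtain H where H: "H \<in> carrier B" "level n H" "nrm B (F \<ominus>\<^bsub>B\<^esub> H) < e / 2" by auto
    let ?t = "\<lambda>i. H (fst i) (act (snd i) x0) \<odot>\<^bsub>B\<^esub> single (cyl n (snd i)) (fst i)"
    let ?S = "supp H \<times> transversal n"
    have S: "finite ?S" "\<And>i. i \<in> ?S \<Longrightarrow> snd i \<in> carrier G \<and> fst i \<in> carrier G"
      using B_finite[OF H(1)] subsetD[OF supp_subset[of H]] subsetD[OF transversal_subset[of n]] by auto
    have t: "?t i \<in> carrier B" if "i \<in> ?S" for i
      using S(2)[OF that] by (intro B.smult_closed single_closed cyl_closed) auto
    \<comment> \<open>A function of level n is determined on each coset by its value at the orbit
      point of the representative.\<close>
    have "H = finsum B ?t ?S"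
    proof (rule B_eqI[OF H(1) B.finsum_in[OF t]])
      fix g x assume g: "g \<in> carrier G" and x: "x \<in> X"
      obtain z where z: "z \<in> transversal n" "x n = (\<one> \<otimes> z) <# L n"
        "\<forall>f. (\<Sum>z\<in>transversal n. f z * cyl n (\<one> \<otimes> z) x) = f z"
        using transversal_point[OF one_closed x, of n] by blast
      have zG: "z \<in> carrier G" using z(1) transversal_subset by blast
      have "act z x0 \<in> X" "act z x0 n = x n" using zG z(2) by (auto intro!: act_in_PX embedding_in_PX simp: act_x0)
      then have Hz: "H g (act z x0) = H g x" for g using H(2) x unfolding level_def by blast
      have "finsum B ?t ?S g x = (\<Sum>i\<in>?S. ?t i g x)" using S(1) t by (subst finsum_B) auto
      also have "\<dots> = (\<Sum>h\<in>supp H. \<Sum>z\<in>transversal n. if g = h then H h (act z x0) * cyl n (\<one> \<otimes> z) x else 0)"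
        unfolding sum.cartesian_product using subsetD[OF transversal_subset[of n]]
        by (intro sum.cong refl) (auto simp: single_def)
      also have "\<dots> = (\<Sum>h\<in>supp H. if g = h then H h x else 0)"
      proof (intro sum.cong refl)
        fix h
        show "(\<Sum>z\<in>transversal n. if g = h then H h (act z x0) * cyl n (\<one> \<otimes> z) x else 0) = (if g = h then H h x else 0)"
          using z(3)[rule_format, of "\<lambda>z. H h (act z x0)"] Hz[of h] by simp
      qed
      also have "\<dots> = H g x" using B_finite[OF H(1)] not_supp[OF g, of H x] by (simp add: sum.delta)
      finally show "H g x = finsum B ?t ?S g x" by simp
    qed
    then obtain d where d: "d \<in> D" "nrm B (H \<ominus>\<^bsub>B\<^esub> d) < e / 2"
      using near_sum[OF S(1), of "e / 2" snd fst "\<lambda>i. H (fst i) (act (snd i) x0)" n] S(2) e by auto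
    have "nrm B (F \<ominus>\<^bsub>B\<^esub> d) \<le> nrm B (F \<ominus>\<^bsub>B\<^esub> H) + nrm B (H \<ominus>\<^bsub>B\<^esub> d)"
      using F H(1) d(1) DB by (intro B.nrm_minus_triangle) auto
    then show ?thesis using d H(3) by (intro bexI[of _ d]) auto
  qed
  show ?thesis
    unfolding cstar_separable_def
  proof (intro exI[of _ "\<iota> ` D"] conjI ballI allI impI)
    show "countable (\<iota> ` D)" using cD by (rule countable_image)
    show "\<iota> ` D \<subseteq> carrier A" using DB B.embed_closed by blast
    fix a and e :: real assume a: "a \<in> carrier A" and e: "e > 0"
    obtain F where F: "F \<in> carrier B" "nrm A (a \<ominus>\<^bsub>A\<^esub> \<iota> F) < e / 2" using B.embed_dense[OF a, of "e / 2"] e by auto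
    obtain d where d: "d \<in> D" "nrm B (F \<ominus>\<^bsub>B\<^esub> d) < e / 2" using near_B[OF F(1), of "e / 2"] e by auto
    have dB: "d \<in> carrier B" using d DB by blast
    have "nrm A (a \<ominus>\<^bsub>A\<^esub> \<iota> d) \<le> nrm A (a \<ominus>\<^bsub>A\<^esub> \<iota> F) + nrm A (\<iota> F \<ominus>\<^bsub>A\<^esub> \<iota> d)"
      using a F(1) dB by (intro A.nrm_minus_triangle B.embed_closed)
    also have "\<iota> F \<ominus>\<^bsub>A\<^esub> \<iota> d = \<iota> (F \<ominus>\<^bsub>B\<^esub> d)" by (rule B.embed_minus[OF F(1) dB, symmetric])
    also have "nrm A \<dots> = nrm B (F \<ominus>\<^bsub>B\<^esub> d)" by (rule B.embed_nrm[OF B.minus_closed[OF F(1) dB]])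
    finally have "nrm A (a \<ominus>\<^bsub>A\<^esub> \<iota> d) < e" using F(2) d(2) by simp
    then show "\<exists>d\<in>\<iota> ` D. nrm A (a \<ominus>\<^bsub>A\<^esub> d) < e" using d(1) by blast
  qed
qed

end

section \<open>Nuclearity\<close>

lemma matrix_algebra_finsum:
  assumes "finite S" and "\<And>i. i \<in> S \<Longrightarrow> f i \<in> carrier (matrix_algebra k)"
  shows "finsum (matrix_algebra k) f S a b = (\<Sum>i\<in>S. f i a b)"
proof -
  interpret M: pos_alg "matrix_algebra k" "mat_phi k (\<lambda>z. z)" by (rule pos_alg_matrix_algebra)
  show ?thesis
    using assms
  proof (induction S rule: finite_induct)
    case (insert i S)
    have "finsum (matrix_algebra k) f (insert i S) = f i \<oplus>\<^bsub>matrix_algebra k\<^esub> finsum (matrix_algebra k) f S"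
      using insert.hyps insert.prems by (intro M.finsum_insert) auto
    moreover have "finsum (matrix_algebra k) f S a b = (\<Sum>i\<in>S. f i a b)"
      using insert.prems by (intro insert.IH) auto
    ultimately show ?case using insert.hyps by simp
  qed simp
qed

text \<open>The two matrix products, over \<open>m\<close> and over \<open>k\<close>, are merged
  into one sum over pairs p. It displays M as a sum of positive rank one matrices in the joint index
  (i, a).\<close>

lemma matrix_algebra_positive_entries:
  assumes "matrix_positive (matrix_algebra k) m M"
  shows "\<exists>Y. \<forall>i<m. \<forall>j<m. \<forall>a b. M i j a b = (\<Sum>p\<in>{..<m} \<times> {..<k}. cnj (Y p i a) * Y p j b)"
proof -
  interpret M: pos_alg "matrix_algebra k" "mat_phi k (\<lambda>z. z)" by (rule pos_alg_matrix_algebra)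
  obtain Y where Y: "\<And>i j. i < m \<Longrightarrow> j < m \<Longrightarrow> Y i j \<in> carrier (matrix_algebra k)"
    "\<And>i j. i < m \<Longrightarrow> j < m \<Longrightarrow>
      M i j = finsum (matrix_algebra k) (\<lambda>l. adj (matrix_algebra k) (Y l i) \<otimes>\<^bsub>matrix_algebra k\<^esub> Y l j) {..<m}"
    using assms unfolding matrix_positive_def by blast
  have "M i j a b = (\<Sum>p\<in>{..<m} \<times> {..<k}. cnj (Y (fst p) i (snd p) a) * Y (fst p) j (snd p) b)"
    if "i < m" "j < m" for i j a b
  proof -
    have "M i j a b = (\<Sum>l<m. (adj (matrix_algebra k) (Y l i) \<otimes>\<^bsub>matrix_algebra k\<^esub> Y l j) a b)"
      unfolding Y(2)[OF that]
      by (rule matrix_algebra_finsum) (use that Y(1) in \<open>auto intro!: M.m_closed M.adj_closed simp del: matrix_algebra_sel\<close>)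
    then show ?thesis by (simp add: sum.cartesian_product case_prod_beta)
  qed
  then show ?thesis by (intro exI[of _ "\<lambda>p i a. Y (fst p) i (snd p) a"]) blast
qed

text \<open>The compression V^* a V, where V maps the i-th basis vector of C^k to e i in the GNS
  space.\<close>

definition coefficient_matrix ::
  "('a, 'm) cstar_scheme \<Rightarrow> ('a \<Rightarrow> complex) \<Rightarrow> nat \<Rightarrow> (nat \<Rightarrow> 'a) \<Rightarrow> 'a \<Rightarrow> nat \<Rightarrow> nat \<Rightarrow> complex" where
  "coefficient_matrix A \<phi> k e a =
    (\<lambda>i j. if i < k \<and> j < k then \<phi> (adj A (e i) \<otimes>\<^bsub>A\<^esub> (a \<otimes>\<^bsub>A\<^esub> e j)) else 0)"

text \<open>Each column c of the test matrices X i becomes an element y c i of the algebra, the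
  combination of the e a with the entries of that column. The form of the image then splits over c
  into forms of M itself.\<close>

lemma (in pos_alg) completely_positive_coefficient_matrix:
  assumes e: "\<And>i. i < k \<Longrightarrow> e i \<in> carrier A"
  shows "completely_positive A (matrix_algebra k) (coefficient_matrix A \<phi> k e)"
  unfolding completely_positive_def
proof (intro conjI allI impI)
  let ?S = "coefficient_matrix A \<phi> k e"
  have S: "?S a i j = (if i < k \<and> j < k then ip (e i) (a \<otimes> e j) else 0)" for a i j
    by (simp add: coefficient_matrix_def ip_def)
  have Sc: "?S a \<in> carrier (matrix_algebra k)" for a by (simp add: S)
  show "cstar_linear A (matrix_algebra k) ?S"
    unfolding cstar_linear_def using Sc e by (auto simp: S fun_eq_iff l_distr ip_add_right smult_mult_left ip_smult_right)
  interpret M: complete_gns_alg "matrix_algebra k" "mat_phi k (\<lambda>z. z)" by (rule complete_gns_alg_matrix_algebra)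
  fix n M assume M: "matrix_positive A n M"
  note Mc = matrix_positiveD(1)[OF M] and Ma = matrix_positiveD(2)[OF M]
  show "matrix_positive (matrix_algebra k) n (\<lambda>i j. ?S (M i j))"
  proof (rule M.matrix_positiveI[OF Sc])
    fix i j assume ij: "i < n" "j < n"
    have "cnj (ip (e b) (M i j \<otimes> e a)) = ip (e a) (M j i \<otimes> e b)" if "a < k" "b < k" for a b
      using that e ij by (simp add: ip_cnj Mc ip_mult_right Ma)
    then show "adj (matrix_algebra k) (?S (M i j)) = ?S (M j i)" by (auto simp: S fun_eq_iff)
  next
    fix X assume X: "\<And>i. i < n \<Longrightarrow> X i \<in> carrier (matrix_algebra k)"
    define y where "y c i = (\<Oplus>a\<in>{..<k}. X i a c \<odot> e a)" for c i
    have y: "y c i \<in> carrier A" for c i unfolding y_def using e by (intro finsum_in) auto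
    have "M.ip (X i) (?S (M i j) \<otimes>\<^bsub>matrix_algebra k\<^esub> X j) = (\<Sum>c<k. ip (y c i) (M i j \<otimes> y c j))"
      if ij: "i < n" "j < n" for i j
    proof -
      have "ip (y c i) (M i j \<otimes> y c j) = (\<Sum>a<k. \<Sum>b<k. cnj (X i a c) * (X j b c * ip (e a) (M i j \<otimes> e b)))" for c
      proof -
        have "M i j \<otimes> y c j = (\<Oplus>b\<in>{..<k}. M i j \<otimes> (X j b c \<odot> e b))"
          unfolding y_def using e Mc[OF ij] by (intro finsum_rdistr) auto
        then have "ip (y c i) (M i j \<otimes> y c j) = (\<Sum>b<k. ip (y c i) (M i j \<otimes> (X j b c \<odot> e b)))"
          using e y Mc[OF ij] by (simp only:) (intro ip_finsum_right, auto)
        also have "\<dots> = (\<Sum>b<k. \<Sum>a<k. ip (X i a c \<odot> e a) (M i j \<otimes> (X j b c \<odot> e b)))"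
          unfolding y_def[of c i] using e Mc[OF ij] by (intro sum.cong refl ip_finsum_left) auto
        also have "\<dots> = (\<Sum>b<k. \<Sum>a<k. cnj (X i a c) * (X j b c * ip (e a) (M i j \<otimes> e b)))"
          using e Mc[OF ij] by (intro sum.cong refl) (auto simp: smult_mult_right ip_smult_left ip_smult_right)
        also have "\<dots> = (\<Sum>a<k. \<Sum>b<k. cnj (X i a c) * (X j b c * ip (e a) (M i j \<otimes> e b)))" by (rule sum.swap)
        finally show ?thesis .
      qed
      moreover have "M.ip (X i) (?S (M i j) \<otimes>\<^bsub>matrix_algebra k\<^esub> X j) =
          (\<Sum>c<k. \<Sum>a<k. \<Sum>b<k. cnj (X i a c) * (X j b c * ip (e a) (M i j \<otimes> e b)))"
        unfolding matrix_algebra_ip[OF X[OF ij(1)] M.m_closed[OF Sc X[OF ij(2)]]]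
        by (simp add: S sum_distrib_left mult_ac)
      ultimately show ?thesis by simp
    qed
    then have "(\<Sum>i<n. \<Sum>j<n. M.ip (X i) (?S (M i j) \<otimes>\<^bsub>matrix_algebra k\<^esub> X j)) =
        (\<Sum>i<n. \<Sum>j<n. \<Sum>c<k. ip (y c i) (M i j \<otimes> y c j))" by (intro sum.cong refl) auto
    also have "\<dots> = (\<Sum>i<n. \<Sum>c<k. \<Sum>j<n. ip (y c i) (M i j \<otimes> y c j))" by (intro sum.cong refl sum.swap)
    also have "\<dots> = (\<Sum>c<k. \<Sum>i<n. \<Sum>j<n. ip (y c i) (M i j \<otimes> y c j))" by (rule sum.swap)
    finally have eq: "(\<Sum>i<n. \<Sum>j<n. M.ip (X i) (?S (M i j) \<otimes>\<^bsub>matrix_algebra k\<^esub> X j)) =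
        (\<Sum>c<k. \<Sum>i<n. \<Sum>j<n. ip (y c i) (M i j \<otimes> y c j))" .
    show "0 \<le> Re (\<Sum>i<n. \<Sum>j<n. M.ip (X i) (?S (M i j) \<otimes>\<^bsub>matrix_algebra k\<^esub> X j))"
      unfolding eq Re_sum[of _ "{..<k}"] by (intro sum_nonneg matrix_positive_nonneg[OF M] y)
  qed
qed

text \<open>For each z this is V z^* M V z with rows picked by r. Writing M as a sum of rank one
  matrices turns the form into Gram sums of the vectors V z s x i, and the square root criterion
  \<open>matrix_positiveI\<close> converts this into matrix positivity.\<close>

lemma (in complete_gns_alg) completely_positive_matrix_sum:
  fixes V :: "'z \<Rightarrow> 's \<Rightarrow> 'a" and r :: "'z \<Rightarrow> 's \<Rightarrow> nat" and m :: nat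
  assumes fin: "finite R" "finite P" and V: "\<And>z s. z \<in> R \<Longrightarrow> s \<in> P \<Longrightarrow> V z s \<in> carrier A"
  shows "completely_positive (matrix_algebra k) A (\<lambda>M. \<Oplus>p\<in>R \<times> P \<times> P.
    (M (r (fst p) (fst (snd p))) (r (fst p) (snd (snd p))) / of_nat m) \<odot>
      (adj A (V (fst p) (fst (snd p))) \<otimes> V (fst p) (snd (snd p))))"
    (is "completely_positive _ _ ?T")
  unfolding completely_positive_def
proof (intro conjI allI impI)
  let ?Q = "R \<times> P \<times> P"
  define c where "c M p = M (r (fst p) (fst (snd p))) (r (fst p) (snd (snd p))) / of_nat m"
    for M :: "nat \<Rightarrow> nat \<Rightarrow> complex" and p
  define v where "v p = adj A (V (fst p) (fst (snd p))) \<otimes> V (fst p) (snd (snd p))" for p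
  have T: "?T M = (\<Oplus>p\<in>?Q. c M p \<odot> v p)" for M by (simp add: c_def v_def)
  have Q: "finite ?Q" using fin by simp
  have v: "v p \<in> carrier A" if "p \<in> ?Q" for p using that V by (auto simp: v_def)
  have Tc: "?T M \<in> carrier A" for M unfolding T using v by (intro finsum_in smult_closed)
  show "cstar_linear (matrix_algebra k) A ?T"
    unfolding cstar_linear_def
  proof (intro conjI ballI allI Tc)
    fix M N :: "nat \<Rightarrow> nat \<Rightarrow> complex" and z
    have "?T (M \<oplus>\<^bsub>matrix_algebra k\<^esub> N) = (\<Oplus>p\<in>?Q. c M p \<odot> v p \<oplus> c N p \<odot> v p)"
      unfolding T
    proof (intro finsum_cong' refl)
      fix p assume p: "p \<in> ?Q"
      have "c (M \<oplus>\<^bsub>matrix_algebra k\<^esub> N) p = c M p + c N p" by (simp add: c_def add_divide_distrib)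
      then show "c (M \<oplus>\<^bsub>matrix_algebra k\<^esub> N) p \<odot> v p = c M p \<odot> v p \<oplus> c N p \<odot> v p"
        using smult_add_left[OF v[OF p]] by simp
    qed (use v in auto)
    also have "\<dots> = ?T M \<oplus> ?T N" unfolding T using v by (intro finsum_addf) auto
    finally show "?T (M \<oplus>\<^bsub>matrix_algebra k\<^esub> N) = ?T M \<oplus> ?T N" .
    have "?T (z \<odot>\<^bsub>matrix_algebra k\<^esub> M) = (\<Oplus>p\<in>?Q. z \<odot> (c M p \<odot> v p))"
      unfolding T
    proof (intro finsum_cong' refl)
      fix p assume p: "p \<in> ?Q"
      have "c (z \<odot>\<^bsub>matrix_algebra k\<^esub> M) p = z * c M p" by (simp add: c_def)
      then show "c (z \<odot>\<^bsub>matrix_algebra k\<^esub> M) p \<odot> v p = z \<odot> (c M p \<odot> v p)"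
        using smult_smult[OF v[OF p]] by simp
    qed (use v in auto)
    also have "\<dots> = z \<odot> ?T M" unfolding T using v by (intro smult_finsum[symmetric] Q) auto
    finally show "?T (z \<odot>\<^bsub>matrix_algebra k\<^esub> M) = z \<odot> ?T M" .
  qed
  interpret Mk: pos_alg "matrix_algebra k" "mat_phi k (\<lambda>z. z)" by (rule pos_alg_matrix_algebra)
  fix n M assume M: "matrix_positive (matrix_algebra k) n M"
  obtain Y where Y: "\<And>i j a b. i < n \<Longrightarrow> j < n \<Longrightarrow> M i j a b = (\<Sum>q\<in>{..<n} \<times> {..<k}. cnj (Y q i a) * Y q j b)"
    using matrix_algebra_positive_entries[OF M] by blast
  let ?W = "{..<n} \<times> {..<k}"
  show "matrix_positive A n (\<lambda>i j. ?T (M i j))"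
  proof (rule matrix_positiveI[OF Tc])
    fix i j assume ij: "i < n" "j < n"
    \<comment> \<open>Taking adjoints exchanges s and t, a bijection of the index set that fits the
      hermitian symmetry of M.\<close>
    let ?h = "\<lambda>p. (fst p, snd (snd p), fst (snd p))"
    have "adj A (?T (M i j)) = (\<Oplus>p\<in>?Q. adj A (c (M i j) p \<odot> v p))"
      unfolding T using v by (intro adj_finsum Q) auto
    also have "\<dots> = (\<Oplus>p\<in>?Q. c (M j i) (?h p) \<odot> v (?h p))"
    proof (intro finsum_cong' refl)
      fix p assume p: "p \<in> ?Q"
      have "cnj (c (M i j) p) = c (M j i) (?h p)" by (simp add: c_def Y ij mult.commute)
      moreover have "adj A (v p) = v (?h p)" using p V by (auto simp: v_def adj_mult)
      ultimately show "adj A (c (M i j) p \<odot> v p) = c (M j i) (?h p) \<odot> v (?h p)" using v[OF p] by (simp add: adj_smult)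
    qed (use v in auto)
    also have "\<dots> = (\<Oplus>p\<in>?h ` ?Q. c (M j i) p \<odot> v p)"
      using v by (intro finsum_reindex[symmetric]) (auto simp: inj_on_def)
    also have "?h ` ?Q = ?Q" by (auto simp: image_iff)
    finally show "adj A (?T (M i j)) = ?T (M j i)" unfolding T .
  next
    fix x assume x: "\<And>i. i < n \<Longrightarrow> x i \<in> carrier A"
    define h where "h z q i s j t = cnj (Y q i (r z s)) * Y q j (r z t) * ip (V z s \<otimes> x i) (V z t \<otimes> x j)" for z q i s j t
    have nest: "(\<Sum>p\<in>?Q. f (fst p) (fst (snd p)) (snd (snd p))) = (\<Sum>z\<in>R. \<Sum>s\<in>P. \<Sum>t\<in>P. f z s t)"
      for f :: "'z \<Rightarrow> 's \<Rightarrow> 's \<Rightarrow> complex"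
      by (simp add: sum.cartesian_product case_prod_beta)
    have pairs: "(\<Sum>p\<in>{..<n} \<times> P. f (fst p) (snd p)) = (\<Sum>i<n. \<Sum>s\<in>P. f i s)" for f :: "nat \<Rightarrow> 's \<Rightarrow> complex"
      by (simp add: sum.cartesian_product case_prod_beta)
    have ipT: "ip (x i) (?T (M i j) \<otimes> x j) = (\<Sum>z\<in>R. \<Sum>s\<in>P. \<Sum>t\<in>P. \<Sum>q\<in>?W. h z q i s j t / of_nat m)"
      if ij: "i < n" "j < n" for i j
    proof -
      have "?T (M i j) \<otimes> x j = (\<Oplus>p\<in>?Q. c (M i j) p \<odot> v p \<otimes> x j)"
        unfolding T using v x ij Q by (intro finsum_ldistr) auto
      then have "ip (x i) (?T (M i j) \<otimes> x j) = (\<Sum>p\<in>?Q. ip (x i) (c (M i j) p \<odot> v p \<otimes> x j))"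
        using v x ij Q by (simp only:) (intro ip_finsum_right, auto)
      also have "\<dots> = (\<Sum>p\<in>?Q. \<Sum>q\<in>?W. h (fst p) q i (fst (snd p)) j (snd (snd p)) / of_nat m)"
      proof (intro sum.cong refl)
        fix p assume p: "p \<in> ?Q"
        then have Vp: "V (fst p) (fst (snd p)) \<in> carrier A" "V (fst p) (snd (snd p)) \<in> carrier A" using V by auto
        have "ip (x i) (c (M i j) p \<odot> v p \<otimes> x j) = c (M i j) p * ip (x i) (v p \<otimes> x j)"
          using v[OF p] x ij by (simp add: smult_mult_left ip_smult_right)
        also have "ip (x i) (v p \<otimes> x j) = ip (V (fst p) (fst (snd p)) \<otimes> x i) (V (fst p) (snd (snd p)) \<otimes> x j)"
          unfolding v_def using Vp x ij by (simp add: m_assoc ip_mult_right)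
        finally show "ip (x i) (c (M i j) p \<odot> v p \<otimes> x j) =
            (\<Sum>q\<in>?W. h (fst p) q i (fst (snd p)) j (snd (snd p)) / of_nat m)"
          by (simp add: c_def Y ij h_def sum_distrib_right sum_divide_distrib)
      qed
      also have "\<dots> = (\<Sum>z\<in>R. \<Sum>s\<in>P. \<Sum>t\<in>P. \<Sum>q\<in>?W. h z q i s j t / of_nat m)"
        using nest[of "\<lambda>z s t. \<Sum>q\<in>?W. h z q i s j t / of_nat m"] by simp
      finally show ?thesis .
    qed
    have hp: "(\<Sum>p\<in>{..<n} \<times> P. \<Sum>p'\<in>{..<n} \<times> P. h z q (fst p) (snd p) (fst p') (snd p')) =
        (\<Sum>i<n. \<Sum>s\<in>P. \<Sum>j<n. \<Sum>t\<in>P. h z q i s j t)" for z q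
    proof -
      have "(\<Sum>p\<in>{..<n} \<times> P. \<Sum>p'\<in>{..<n} \<times> P. h z q (fst p) (snd p) (fst p') (snd p')) =
          (\<Sum>p\<in>{..<n} \<times> P. \<Sum>j<n. \<Sum>t\<in>P. h z q (fst p) (snd p) j t)"
        by (rule sum.cong[OF refl], rule pairs)
      also have "\<dots> = (\<Sum>i<n. \<Sum>s\<in>P. \<Sum>j<n. \<Sum>t\<in>P. h z q i s j t)"
        by (rule pairs[of "\<lambda>i s. \<Sum>j<n. \<Sum>t\<in>P. h z q i s j t"])
      finally show ?thesis .
    qed
    \<comment> \<open>With z and q outermost, the inner sums run over the pairs (i, s) and (j, t)
      and form a Gram sum with weights Y q i (r z s).\<close>
    have swap: "(\<Sum>i<n. \<Sum>j<n. \<Sum>z\<in>R. \<Sum>s\<in>P. \<Sum>t\<in>P. \<Sum>q\<in>?W. h z q i s j t / of_nat m) =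
        (\<Sum>z\<in>R. \<Sum>q\<in>?W. \<Sum>i<n. \<Sum>s\<in>P. \<Sum>j<n. \<Sum>t\<in>P. h z q i s j t / of_nat m)"
      unfolding sum.cartesian_product
      by (rule sum.reindex_bij_witness[of _ "\<lambda>(z, q, i, s, j, t). (i, j, z, s, t, q)" "\<lambda>(i, j, z, s, t, q). (z, q, i, s, j, t)"]) auto
    have "(\<Sum>i<n. \<Sum>j<n. ip (x i) (?T (M i j) \<otimes> x j)) =
        (\<Sum>i<n. \<Sum>j<n. \<Sum>z\<in>R. \<Sum>s\<in>P. \<Sum>t\<in>P. \<Sum>q\<in>?W. h z q i s j t / of_nat m)"
      by (intro sum.cong refl ipT) auto
    also note swap
    also have "(\<Sum>z\<in>R. \<Sum>q\<in>?W. \<Sum>i<n. \<Sum>s\<in>P. \<Sum>j<n. \<Sum>t\<in>P. h z q i s j t / of_nat m) =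
        (\<Sum>z\<in>R. \<Sum>q\<in>?W. (\<Sum>p\<in>{..<n} \<times> P. \<Sum>p'\<in>{..<n} \<times> P. h z q (fst p) (snd p) (fst p') (snd p')) / of_nat m)"
      by (simp only: hp sum_divide_distrib)
    finally have eq: "(\<Sum>i<n. \<Sum>j<n. ip (x i) (?T (M i j) \<otimes> x j)) =
        (\<Sum>z\<in>R. \<Sum>q\<in>?W. (\<Sum>p\<in>{..<n} \<times> P. \<Sum>p'\<in>{..<n} \<times> P. h z q (fst p) (snd p) (fst p') (snd p')) / of_nat m)" .
    show "0 \<le> Re (\<Sum>i<n. \<Sum>j<n. ip (x i) (?T (M i j) \<otimes> x j))"
      unfolding eq Re_sum[of _ R] Re_sum[of _ ?W]
    proof (intro sum_nonneg)
      fix z q assume z: "z \<in> R"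
      have "0 \<le> Re (\<Sum>p\<in>{..<n} \<times> P. \<Sum>p'\<in>{..<n} \<times> P. h z q (fst p) (snd p) (fst p') (snd p'))"
        unfolding h_def using z V x fin
        by (intro gram_nonneg[of _ "\<lambda>p. V z (snd p) \<otimes> x (fst p)" "\<lambda>p. Y q (fst p) (r z (snd p))"]) auto
      then show "0 \<le> Re ((\<Sum>p\<in>{..<n} \<times> P. \<Sum>p'\<in>{..<n} \<times> P. h z q (fst p) (snd p) (fst p') (snd p')) / of_nat m)"
        by (simp add: Re_divide_of_nat)
    qed
  qed
qed

lemma cstar_linear_minus:
  assumes "star_alg A" "star_alg B" "cstar_linear A B S" "a \<in> carrier A" "b \<in> carrier A"
  shows "S (a \<ominus>\<^bsub>A\<^esub> b) = S a \<ominus>\<^bsub>B\<^esub> S b"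
proof -
  have lin: "S x \<in> carrier B" "S (z \<odot>\<^bsub>A\<^esub> x) = z \<odot>\<^bsub>B\<^esub> S x" if "x \<in> carrier A" for x z
    using assms(3) that unfolding cstar_linear_def by blast+
  have add: "S (x \<oplus>\<^bsub>A\<^esub> y) = S x \<oplus>\<^bsub>B\<^esub> S y" if "x \<in> carrier A" "y \<in> carrier A" for x y
    using assms(3) that unfolding cstar_linear_def by blast
  interpret A: star_alg A by fact
  interpret B: star_alg B by fact
  show ?thesis
    using assms(4,5) by (simp add: A.minus_eq_smult B.minus_eq_smult lin add)
qed

context amenable_profinite_seq
begin

text \<open>All blocks are read off a single matrix whose rows are numbered by
  \<open>ix\<close>.\<close>

definition averaging :: "nat \<Rightarrow> 'a set \<Rightarrow> ('a \<Rightarrow> nat) \<Rightarrow> (nat \<Rightarrow> nat \<Rightarrow> complex) \<Rightarrow>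
    (nat \<Rightarrow> 'a \<Rightarrow> (nat \<Rightarrow> 'a set) \<Rightarrow> complex) set" where
  "averaging n P ix M = \<iota> (compress n P (\<lambda>x y. M (ix x) (ix y)))"

text \<open>With V z s the product of cyl n z with s^(-1), the adjoint of V z s times V z t is cyl n
  (s z) times s t^(-1), so the average has the form treated by
  \<open>completely_positive_matrix_sum\<close>.\<close>

lemma completely_positive_averaging:
  assumes P: "finite P" "P \<subseteq> carrier G"
  shows "completely_positive (matrix_algebra k) A (averaging n P ix)"
proof -
  define V where "V z s = \<iota> (single (cyl n z) (inv s))" for z s
  let ?R = "transversal n"
  have zG: "z \<in> carrier G" if "z \<in> ?R" for z using that transversal_subset by blast
  have sG: "s \<in> carrier G" if "s \<in> P" for s using that P by blast
  have VV: "adj A (V z s) \<otimes>\<^bsub>A\<^esub> V z t = \<iota> (single (cyl n (s \<otimes> z)) (s \<otimes> inv t))"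
    if z: "z \<in> carrier G" and s: "s \<in> carrier G" and t: "t \<in> carrier G" for z s t
  proof -
    have cc: "(\<lambda>x. cnj (cyl n z x)) = cyl n z" for z by (auto simp: cyl_def)
    have c: "single (cyl n z) (inv s) \<in> carrier B" "single (cyl n z) (inv t) \<in> carrier B"
      by (intro single_closed cyl_closed inv_closed z s t)+
    have a: "adj B (single (cyl n z) (inv s)) = single (cyl n (s \<otimes> z)) s"
      unfolding single_adj[OF cyl_closed inv_closed[OF s]] inv_inv[OF s] cc alpha_cyl[OF z s] ..
    have "adj B (single (cyl n z) (inv s)) \<otimes>\<^bsub>B\<^esub> single (cyl n z) (inv t) =
        single (cyl n (s \<otimes> z) \<otimes>\<^bsub>CX\<^esub> translation_action G L s (cyl n z)) (s \<otimes> inv t)"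
      unfolding a using z s t by (intro single_mult cyl_closed inv_closed m_closed)
    also have "cyl n (s \<otimes> z) \<otimes>\<^bsub>CX\<^esub> translation_action G L s (cyl n z) = cyl n (s \<otimes> z)"
      unfolding alpha_cyl[OF z s] by (auto simp: cyl_def fun_eq_iff)
    finally show ?thesis
      unfolding V_def B.embed_adj[OF c(1), symmetric] B.embed_mult[OF B.adj_closed[OF c(1)] c(2), symmetric] by simp
  qed
  have V: "V z s \<in> carrier A" if "z \<in> ?R" "s \<in> P" for z s
    unfolding V_def using zG[OF that(1)] sG[OF that(2)] by (intro B.embed_closed single_closed cyl_closed inv_closed)
  have "averaging n P ix M = finsum A (\<lambda>p. (M (ix (fst (snd p) \<otimes> fst p)) (ix (snd (snd p) \<otimes> fst p)) / of_nat (card P)) \<odot>\<^bsub>A\<^esub>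
      (adj A (V (fst p) (fst (snd p))) \<otimes>\<^bsub>A\<^esub> V (fst p) (snd (snd p)))) (?R \<times> P \<times> P)" for M
  proof -
    let ?f = "\<lambda>(z, s, t). (M (ix (s \<otimes> z)) (ix (t \<otimes> z)) / of_nat (card P)) \<odot>\<^bsub>B\<^esub>
      single (cyl n (s \<otimes> z)) (s \<otimes> inv t)"
    have fc: "?f p \<in> carrier B" if "p \<in> ?R \<times> P \<times> P" for p by (rule compress_summand_closed[OF P(2) that])
    have "averaging n P ix M = finsum A (\<lambda>p. \<iota> (?f p)) (?R \<times> P \<times> P)"
      unfolding averaging_def compress_def
      by (intro B.embed_finsum fc finite_cartesian_product transversal_finite P(1))
    also have "\<dots> = finsum A (\<lambda>p. (M (ix (fst (snd p) \<otimes> fst p)) (ix (snd (snd p) \<otimes> fst p)) / of_nat (card P)) \<odot>\<^bsub>A\<^esub>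
      (adj A (V (fst p) (fst (snd p))) \<otimes>\<^bsub>A\<^esub> V (fst p) (snd (snd p)))) (?R \<times> P \<times> P)"
    proof (rule A.finsum_cong'[OF refl])
      fix p assume "p \<in> ?R \<times> P \<times> P"
      then obtain z s t where p: "p = (z, s, t)" "z \<in> ?R" "s \<in> P" "t \<in> P" by (cases p) auto
      note G = zG[OF p(2)] sG[OF p(3)] sG[OF p(4)]
      have "single (cyl n (s \<otimes> z)) (s \<otimes> inv t) \<in> carrier B"
        using G by (intro single_closed cyl_closed m_closed inv_closed)
      then show "\<iota> (?f p) = (M (ix (fst (snd p) \<otimes> fst p)) (ix (snd (snd p) \<otimes> fst p)) / of_nat (card P)) \<odot>\<^bsub>A\<^esub>
          (adj A (V (fst p) (fst (snd p))) \<otimes>\<^bsub>A\<^esub> V (fst p) (snd (snd p)))"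
        unfolding p(1) prod.case fst_conv snd_conv VV[OF G] by (rule B.embed_smult)
    qed (intro Pi_I A.smult_closed A.m_closed A.adj_closed V; force)
    finally show ?thesis .
  qed
  then have "averaging n P ix = (\<lambda>M. finsum A (\<lambda>p. (M (ix (fst (snd p) \<otimes> fst p)) (ix (snd (snd p) \<otimes> fst p)) / of_nat (card P)) \<odot>\<^bsub>A\<^esub>
      (adj A (V (fst p) (fst (snd p))) \<otimes>\<^bsub>A\<^esub> V (fst p) (snd (snd p)))) (?R \<times> P \<times> P))"
    by (rule ext)
  then show ?thesis
    using A.completely_positive_matrix_sum[OF transversal_finite P(1) V, where r = "\<lambda>z s. ix (s \<otimes> z)" and m = "card P" and k = k]
    by (simp only:)
qed

lemma coefficient_matrix_embed:
  assumes H: "H \<in> carrier B" and en: "\<And>i. i < k \<Longrightarrow> en i \<in> carrier G"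
  shows "coefficient_matrix A B.\<Phi> k (\<lambda>i. \<iota> (unitary (en i))) (\<iota> H) =
    (\<lambda>i j. if i < k \<and> j < k then kern H (en i) (en j) else 0)"
proof -
  have "B.\<Phi> (adj A (\<iota> (unitary g)) \<otimes>\<^bsub>A\<^esub> (\<iota> H \<otimes>\<^bsub>A\<^esub> \<iota> (unitary h))) = kern H g h"
    if "g \<in> carrier G" "h \<in> carrier G" for g h
    using H unitary_closed[OF that(1)] unitary_closed[OF that(2)]
    by (simp only: B.embed_adj[symmetric] B.embed_mult[symmetric] B.m_closed B.adj_closed B.embed_phi kern_def B.ip_def)
  then show ?thesis using en by (simp add: coefficient_matrix_def fun_eq_iff)
qed

text \<open>One level n, one support S and one bound K for the whole finite set, so that a single
  Foelner set and a single pair of maps serve all of its elements.\<close>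

lemma simultaneous_approximation:
  assumes fin: "finite \<F>" and \<F>: "\<F> \<subseteq> carrier A" and e: "e > 0"
  shows "\<exists>n S K. finite S \<and> S \<subseteq> carrier G \<and> 0 \<le> K \<and> (\<forall>a\<in>\<F>. \<exists>H\<in>carrier B. level n H \<and> supp H \<subseteq> S \<and>
    (\<forall>g x. cmod (H g x) \<le> K) \<and> nrm A (a \<ominus>\<^bsub>A\<^esub> \<iota> H) < e)"
proof -
  have "\<forall>a\<in>\<F>. \<exists>F. F \<in> carrier B \<and> nrm A (a \<ominus>\<^bsub>A\<^esub> \<iota> F) < e / 2"
    using B.embed_dense[of _ "e / 2"] \<F> e by auto
  from bchoice[OF this] obtain F where F: "\<And>a. a \<in> \<F> \<Longrightarrow> F a \<in> carrier B"
    "\<And>a. a \<in> \<F> \<Longrightarrow> nrm A (a \<ominus>\<^bsub>A\<^esub> \<iota> (F a)) < e / 2" by auto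
  have "\<forall>a\<in>\<F>. \<exists>K. 0 \<le> K \<and> (\<forall>g x. cmod (F a g x) \<le> K)" using B_uniform_bound[OF F(1)] by blast
  from bchoice[OF this] obtain K where K: "\<And>a. a \<in> \<F> \<Longrightarrow> 0 \<le> K a" "\<And>a g x. a \<in> \<F> \<Longrightarrow> cmod (F a g x) \<le> K a" by auto
  have "\<forall>a\<in>\<F>. \<exists>N. \<forall>n\<ge>N. \<exists>H\<in>carrier B. level n H \<and> supp H \<subseteq> supp (F a) \<and> nrm B (F a \<ominus>\<^bsub>B\<^esub> H) < e / 2 \<and>
    (\<forall>K. (\<forall>g x. cmod (F a g x) \<le> K) \<longrightarrow> (\<forall>g x. cmod (H g x) \<le> K))"
    using level_approximation_nrm[OF F(1), of _ "e / 2"] e by simp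
  from bchoice[OF this] obtain N where N: "\<forall>a\<in>\<F>. \<forall>n\<ge>N a. \<exists>H\<in>carrier B. level n H \<and> supp H \<subseteq> supp (F a) \<and>
    nrm B (F a \<ominus>\<^bsub>B\<^esub> H) < e / 2 \<and> (\<forall>K. (\<forall>g x. cmod (F a g x) \<le> K) \<longrightarrow> (\<forall>g x. cmod (H g x) \<le> K))" ..
  \<comment> \<open>The sum is a convenient common upper bound, also for the empty family.\<close>
  define n where "n = (\<Sum>a\<in>\<F>. N a)"
  define S where "S = (\<Union>a\<in>\<F>. supp (F a))"
  show ?thesis
  proof (intro exI[of _ n] exI[of _ S] exI[of _ "\<Sum>a\<in>\<F>. K a"] conjI ballI)
    show "finite S" unfolding S_def using fin F(1) B_finite by (intro finite_UN_I) auto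
    show "S \<subseteq> carrier G" unfolding S_def using supp_subset by blast
    show "0 \<le> (\<Sum>a\<in>\<F>. K a)" using K(1) by (rule sum_nonneg)
    fix a assume a: "a \<in> \<F>"
    have "N a \<le> n" unfolding n_def using fin a by (intro member_le_sum) auto
    with N a have "\<exists>H\<in>carrier B. level n H \<and> supp H \<subseteq> supp (F a) \<and>
      nrm B (F a \<ominus>\<^bsub>B\<^esub> H) < e / 2 \<and> (\<forall>K. (\<forall>g x. cmod (F a g x) \<le> K) \<longrightarrow> (\<forall>g x. cmod (H g x) \<le> K))" by simp
    then obtain H where H: "H \<in> carrier B" "level n H" "supp H \<subseteq> supp (F a)" "nrm B (F a \<ominus>\<^bsub>B\<^esub> H) < e / 2"
      "\<And>g x. cmod (H g x) \<le> K a" using K(2)[OF a] by blast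
    have "K a \<le> (\<Sum>a\<in>\<F>. K a)" using fin a K(1) by (intro member_le_sum) auto
    then have HK: "cmod (H g x) \<le> (\<Sum>a\<in>\<F>. K a)" for g x using H(5) order_trans by blast
    have HS: "supp H \<subseteq> S" using H(3) a unfolding S_def by blast
    have aA: "a \<in> carrier A" using a \<F> by blast
    have "nrm A (a \<ominus>\<^bsub>A\<^esub> \<iota> H) \<le> nrm A (a \<ominus>\<^bsub>A\<^esub> \<iota> (F a)) + nrm A (\<iota> (F a) \<ominus>\<^bsub>A\<^esub> \<iota> H)"
      using aA F(1)[OF a] H(1) by (intro A.nrm_minus_triangle B.embed_closed)
    moreover have "nrm A (\<iota> (F a) \<ominus>\<^bsub>A\<^esub> \<iota> H) = nrm B (F a \<ominus>\<^bsub>B\<^esub> H)"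
      unfolding B.embed_minus[OF F(1)[OF a] H(1), symmetric] by (rule B.embed_nrm[OF B.minus_closed[OF F(1)[OF a] H(1)]])
    ultimately have "nrm A (a \<ominus>\<^bsub>A\<^esub> \<iota> H) < e" using F(2)[OF a] H(4) by simp
    then show "\<exists>H\<in>carrier B. level n H \<and> supp H \<subseteq> S \<and>
        (\<forall>g x. cmod (H g x) \<le> (\<Sum>a\<in>\<F>. K a)) \<and> nrm A (a \<ominus>\<^bsub>A\<^esub> \<iota> H) < e"
      using H(1,2) HS HK by blast
  qed
qed

lemma cstar_nuclear_A: "cstar_nuclear A"
  unfolding cstar_nuclear_def
proof (intro allI impI)
  fix \<F> and e :: real
  assume \<F>: "finite \<F>" "\<F> \<subseteq> carrier A" and e: "e > 0"
  have "e / 3 > 0" using e by simp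
  from simultaneous_approximation[OF \<F> this]
  obtain n S K where S: "finite S" "S \<subseteq> carrier G" and K: "0 \<le> K"
    and app: "\<forall>a\<in>\<F>. \<exists>H\<in>carrier B. level n H \<and> supp H \<subseteq> S \<and> (\<forall>g x. cmod (H g x) \<le> K) \<and> nrm A (a \<ominus>\<^bsub>A\<^esub> \<iota> H) < e / 3"
    by (elim exE conjE) (rule that)
  \<comment> \<open>Chosen so that the multiplier error |S| \<eta> K is at most e / 3; the summands
    1 avoid division by zero.\<close>
  define \<eta> where "\<eta> = e / (3 * (real (card S) + 1) * (K + 1))"
  have \<eta>: "\<eta> > 0" using e K by (simp add: \<eta>_def add_nonneg_pos)
  have \<eta>': "real (card S) * (\<eta> * K) \<le> e / 3"
  proof -
    have "real (card S) * (\<eta> * K) = e / 3 * ((real (card S) / (real (card S) + 1)) * (K / (K + 1)))"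
      using K by (simp add: \<eta>_def algebra_simps)
    also have "\<dots> \<le> e / 3 * (1 * 1)" using e K by (intro mult_left_mono mult_mono) auto
    finally show ?thesis by simp
  qed
  from foelner[OF S \<eta>] obtain P where P': "finite P \<and> P \<noteq> {} \<and> P \<subseteq> carrier G \<and>
    (\<forall>g\<in>S. (1 - \<eta>) * real (card P) \<le> real (card (P \<inter> (\<lambda>y. g \<otimes> y) ` P)))" ..
  note P = conjunct1[OF P'] conjunct1[OF conjunct2[OF P']] conjunct1[OF conjunct2[OF conjunct2[OF P']]]
  from P' have fol: "(1 - \<eta>) * real (card P) \<le> real (card (P \<inter> (\<lambda>y. g \<otimes> y) ` P))" if "g \<in> S" for g
    by (elim conjE) (erule bspec[OF _ that])
  \<comment> \<open>\<open>cstar_nuclear\<close> asks for one full matrix algebra, and the blocks P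
    z may overlap for different z. So one matrix is indexed by all products s z, and
    \<open>averaging\<close> uses only its entries with a common z.\<close>
  define E where "E = (\<lambda>(s, z). s \<otimes> z) ` (P \<times> transversal n)"
  have E: "finite E" "E \<subseteq> carrier G"
    using P transversal_finite transversal_subset unfolding E_def by (auto intro!: m_closed)
  have inE: "s \<otimes> z \<in> E" if "s \<in> P" "z \<in> transversal n" for s z using that unfolding E_def by force
  obtain z0 where z0: "z0 \<in> transversal n" using transversal_point[OF one_closed base, of n] by blast
  define k where "k = card E"
  have k: "k \<ge> 1"
  proof -
    have "E \<noteq> {}" using P(2) z0 inE by blast
    then show ?thesis using E(1) by (simp add: k_def Suc_le_eq card_gt_0_iff)
  qed
  obtain en where en: "bij_betw en {0..<k} E" using ex_bij_betw_nat_finite[OF E(1)] unfolding k_def by blast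
  have enG: "en i \<in> carrier G" if "i < k" for i using bij_betw_apply[OF en, of i] that E(2) by auto
  define ix where "ix = inv_into {0..<k} en"
  have ix: "ix g < k" "en (ix g) = g" if "g \<in> E" for g
    using that en inv_into_into[of g en "{0..<k}"] f_inv_into_f[of g en "{0..<k}"]
    unfolding ix_def bij_betw_def by auto
  have ixen: "i = ix (en i)" if "i < k" for i
    using that en inv_into_f_f[of en "{0..<k}" i] unfolding ix_def bij_betw_def by simp
  let ?S = "coefficient_matrix A B.\<Phi> k (\<lambda>i. \<iota> (unitary (en i)))" and ?T = "averaging n P ix"
  interpret M: complete_gns_alg "matrix_algebra k" "mat_phi k (\<lambda>z. z)" by (rule complete_gns_alg_matrix_algebra)
  have Scp: "completely_positive A (matrix_algebra k) ?S"
    by (intro A.completely_positive_coefficient_matrix B.embed_closed unitary_closed enG)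
  have Tcp: "completely_positive (matrix_algebra k) A ?T" by (rule completely_positive_averaging[OF P(1,3)])
  have TS: "?T (?S (\<iota> H)) = \<iota> (compress n P (kern H))" if H: "H \<in> carrier B" for H
  proof -
    have "?S (\<iota> H) = (\<lambda>i j. if i < k \<and> j < k then kern H (en i) (en j) else 0)"
      by (rule coefficient_matrix_embed[OF H enG])
    then show ?thesis
      unfolding averaging_def using P by (intro arg_cong[where f = \<iota>] compress_cong) (simp_all add: ix inE)
  qed
  \<comment> \<open>Distinct group elements are orthonormal. Unitality of both maps is what upgrades
    complete positivity to contractivity.\<close>
  have S1: "?S \<one>\<^bsub>A\<^esub> = \<one>\<^bsub>matrix_algebra k\<^esub>"
  proof -
    have "?S \<one>\<^bsub>A\<^esub> = (\<lambda>i j. if i < k \<and> j < k then kern \<one>\<^bsub>B\<^esub> (en i) (en j) else 0)"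
      unfolding B.embed_one[symmetric] by (rule coefficient_matrix_embed[OF one_B_closed enG])
    also have "\<dots> = (\<lambda>i j. if i = j \<and> i < k then 1 else 0)"
      using ixen enG by (auto simp: fun_eq_iff kern_one simp del: B_sel) metis+
    finally show ?thesis by simp
  qed
  have T1: "?T \<one>\<^bsub>matrix_algebra k\<^esub> = \<one>\<^bsub>A\<^esub>"
    unfolding S1[symmetric] B.embed_one[symmetric] TS[OF one_B_closed] compress_kern_one[OF P] ..
  have Sccp: "ccp A (matrix_algebra k) ?S"
    by (rule unital_completely_positive_imp_ccp[OF A.complete_gns_alg_axioms M.gns_alg_axioms Scp S1])
  have Tccp: "ccp (matrix_algebra k) A ?T"
    by (rule unital_completely_positive_imp_ccp[OF _ _ Tcp]) (rule M.complete_gns_alg_axioms A.gns_alg_axioms T1)+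
  have lin: "cstar_linear A (matrix_algebra k) ?S" "cstar_linear (matrix_algebra k) A ?T"
    using Scp Tcp unfolding completely_positive_def by blast+
  have Sc: "?S a \<in> carrier (matrix_algebra k)" if "a \<in> carrier A" for a
    using lin(1) that unfolding cstar_linear_def by blast
  have Tc: "?T M \<in> carrier A" if "M \<in> carrier (matrix_algebra k)" for M
    using lin(2) that unfolding cstar_linear_def by blast
  have contr: "nrm A (?T (?S a)) \<le> nrm A a" if "a \<in> carrier A" for a
    using Sccp Tccp Sc[OF that] that unfolding ccp_def by (meson order_trans)
  \<comment> \<open>Three errors of e / 3: the maps are contractive on a - H, the multiplier moves H
    by at most e / 3, and H is close to a.\<close>
  have "nrm A (?T (?S a) \<ominus>\<^bsub>A\<^esub> a) < e" if a: "a \<in> \<F>" for a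
  proof -
    have aA: "a \<in> carrier A" using a \<F> by blast
    from app a have "\<exists>H\<in>carrier B. level n H \<and> supp H \<subseteq> S \<and> (\<forall>g x. cmod (H g x) \<le> K) \<and> nrm A (a \<ominus>\<^bsub>A\<^esub> \<iota> H) < e / 3" ..
    then obtain H where H: "H \<in> carrier B" "level n H" "supp H \<subseteq> S" "\<And>g x. cmod (H g x) \<le> K"
      "nrm A (a \<ominus>\<^bsub>A\<^esub> \<iota> H) < e / 3" by blast
    let ?C = "compress n P (kern H)"
    have C: "?C \<in> carrier B" by (rule compress_closed[OF P(3)])
    note iH = B.embed_closed[OF H(1)] and iC = B.embed_closed[OF C]
    have "?T (?S a) \<ominus>\<^bsub>A\<^esub> \<iota> ?C = ?T (?S (a \<ominus>\<^bsub>A\<^esub> \<iota> H))"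
      unfolding TS[OF H(1), symmetric] cstar_linear_minus[OF A.star_alg_axioms M.star_alg_axioms lin(1) aA iH]
        cstar_linear_minus[OF M.star_alg_axioms A.star_alg_axioms lin(2) Sc[OF aA] Sc[OF iH]] ..
    then have 1: "nrm A (?T (?S a) \<ominus>\<^bsub>A\<^esub> \<iota> ?C) < e / 3"
      using contr[OF A.minus_closed[OF aA iH]] H(5) by simp
    have "nrm B (H \<ominus>\<^bsub>B\<^esub> ?C) \<le> real (card S) * (\<eta> * K)"
      unfolding nrm_B using \<eta> by (intro compress_kern_diff[OF H(1,2) P S(1) H(3) S(2) fol H(4)]) auto
    then have 2: "nrm A (\<iota> ?C \<ominus>\<^bsub>A\<^esub> \<iota> H) \<le> e / 3"
      unfolding A.nrm_minus_commute[OF iC iH] B.embed_minus[OF H(1) C, symmetric] B.embed_nrm[OF B.minus_closed[OF H(1) C]]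
      using \<eta>' by linarith
    have 3: "nrm A (\<iota> H \<ominus>\<^bsub>A\<^esub> a) < e / 3" using H(5) unfolding A.nrm_minus_commute[OF iH aA] .
    have "nrm A (?T (?S a) \<ominus>\<^bsub>A\<^esub> a) \<le> nrm A (?T (?S a) \<ominus>\<^bsub>A\<^esub> \<iota> ?C) + nrm A (\<iota> ?C \<ominus>\<^bsub>A\<^esub> a)"
      by (rule A.nrm_minus_triangle[OF Tc[OF Sc[OF aA]] iC aA])
    moreover have "nrm A (\<iota> ?C \<ominus>\<^bsub>A\<^esub> a) \<le> nrm A (\<iota> ?C \<ominus>\<^bsub>A\<^esub> \<iota> H) + nrm A (\<iota> H \<ominus>\<^bsub>A\<^esub> a)"
      by (rule A.nrm_minus_triangle[OF iC iH aA])
    ultimately show ?thesis using 1 2 3 by linarith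
  qed
  then show "\<exists>k\<ge>1. \<exists>S T. ccp A (matrix_algebra k) S \<and> ccp (matrix_algebra k) A T \<and>
      (\<forall>a\<in>\<F>. nrm A (T (S a) \<ominus>\<^bsub>A\<^esub> a) < e)"
    using k Sccp Tccp by (intro exI[of _ k] conjI exI[of _ ?S] exI[of _ ?T] ballI)
qed

end

theorem corollary7:
  fixes G :: "('g, 'm) monoid_scheme" and L :: "nat \<Rightarrow> 'g set"
  assumes "group G" and "countable (carrier G)" and "amenable G" and "residually_finite G"
    and "separating_nested_sequence G L"
  shows "cstar_algebra (bunce_deddens_algebra G L) \<and>
    cstar_unital (bunce_deddens_algebra G L) \<and>
    cstar_simple (bunce_deddens_algebra G L) \<and>
    cstar_separable (bunce_deddens_algebra G L) \<and>
    cstar_nuclear (bunce_deddens_algebra G L)"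
proof -
  interpret amenable_profinite_seq G L
    using assms by (intro amenable_profinite_seq.intro amenable_profinite_seq_axioms.intro profinite_seq.intro profinite_seq_axioms.intro)
  show ?thesis
    unfolding bunce_deddens_eq
    using A.cstar_algebra A.cstar_unital cstar_simple_A cstar_separable_A[OF assms(2)] cstar_nuclear_A by blast
qed

end
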